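(* Let $n\ge 1$, let $A$ be a non-degenerate hermitian $n\times n$ matrix, $r(z)=\mathrm{Re}\,z_0-{}^t\bar z_\alpha A z_\alpha$ for $z=(z_0,z_\alpha)\in\mathbb{C}\times\mathbb{C}^n$, and $Q=\{r=0\}$. Let $p=(p_0,0,\ldots,0)\in\mathbb{C}^{n+1}$ with $p\notin Q$, and let $h^0$ be a stationary disc glued to $Q$ and centered at $p$. Then for every $\rho$ sufficiently near $r$ in the $\mathcal{C}^3$-topology, the set of all non-constant stationary discs glued to the hypersurface $\{\rho=0\}$ forms, near $h^0$, a $(4n+3)$-real-parameter family. That is, there are a neighborhood $V$ of $r$ in the $\mathcal{C}^3$-topology and a neighborhood $W$ of $h^0$ in $\mathcal{C}^\alpha(\partial\Delta)^{n+1}$ such that for each $\rho\in V$ there are an open neighborhood $U$ of $0$ in $\mathbb{R}^{4n+3}$ and an injective $\mathcal{C}^1$ map from $U$ to $\mathcal{C}^\alpha(\partial\Delta)^{n+1}$, all of whose values are boundary values of non-constant stationary discs glued to $\{\rho=0\}$, and whose image contains all such discs lying in $W$. Moreover, if one considers only those discs $h$ of this family which are centered at $p$, the maps $h\mapsto h(1)$ and $h\mapsto h'(0)$ are local diffeomorphisms onto their images.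
   Context: $\Delta$ is the open unit disc in $\mathbb{C}$. A holomorphic disc in $\mathbb{C}^{n+1}$ is a map $h=(h_0,h_\alpha):\overline\Delta\to\mathbb{C}\times\mathbb{C}^n$, continuous on $\overline\Delta$ and holomorphic on $\Delta$; it is centered at $h(0)$, and it is glued to a hypersurface $M$ if $h(\partial\Delta)\subset M$. If $M=\{\rho=0\}$ with $d\rho\neq 0$ on $M$, a holomorphic disc $h$ glued to $M$ is stationary if there is a continuous function $c:\partial\Delta\to\mathbb{R}\setminus\{0\}$ such that $\zeta\mapsto \zeta\, c(\zeta)\,\partial\rho_{h(\zeta)}$ (where $\partial\rho=(\partial\rho/\partial z_0,\ldots,\partial\rho/\partial z_n)$) extends from $\partial\Delta$ to a map continuous on $\overline\Delta$ and holomorphic on $\Delta$. Equivalently, $h$ has a meromorphic lift $(h,h^* )$ to the cotangent bundle with at most a simple pole, located at $0$, such that $h^*(\zeta)$ is a non-zero element of the conormal fibre $N^*_{h(\zeta)}M=\{\phi\in T^*_{h(\zeta)}\mathbb{C}^{n+1}\ (\text{of type }(1,0)) : \mathrm{Re}\,\phi|_{T_{h(\zeta)}M}=0\}$ for $\zeta\in\partial\Delta$. The functions $r,\rho$ are real-valued of class $\mathcal{C}^3$ on a fixed open ball of $\mathbb{C}^{n+1}$ centered at $0$ and containing $h^0(\overline\Delta)$. Fix $0<\alpha<1$; $\mathcal{C}^\alpha(\partial\Delta)$ is the Banach space of complex-valued $\alpha$-Hölder functions on $\partial\Delta$, and discs are identified with their boundary values. "Local diffeomorphism" is understood in the $\mathcal{C}^1$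 sense, sets of discs carrying the structure induced from $\mathcal{C}^\alpha(\partial\Delta)^{n+1}$. *)

theory Defs
  imports "HOL-Complex_Analysis.Complex_Analysis" "HOL-Library.Function_Algebras"
begin

subsection \<open>Functions of class \<open>C\<^sup>k\<close> and the \<open>C\<^sup>k\<close>-topology\<close>

text \<open>
  For an open set in a finite-dimensional space, all iterated directional derivatives existing
  (as total derivatives) and being continuous is the usual notion of class \<open>C\<^sup>k\<close>.
\<close>

primrec Ck_on ::
    "nat \<Rightarrow> ('a::real_normed_vector \<Rightarrow> 'b::real_normed_vector) \<Rightarrow> 'a set \<Rightarrow> bool" where
  "Ck_on 0 f S \<longleftrightarrow> continuous_on S f"
| "Ck_on (Suc k) f S \<longleftrightarrow>
     (\<forall>x\<in>S. f differentiable (at x)) \<and> (\<forall>v. Ck_on k (\<lambda>x. frechet_derivative f (at x) v) S)"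

primrec iter_deriv ::
    "('a::real_normed_vector \<Rightarrow> 'b::real_normed_vector) \<Rightarrow> 'a list \<Rightarrow> 'a \<Rightarrow> 'b" where
  "iter_deriv f [] = f"
| "iter_deriv f (v # vs) = (\<lambda>x. frechet_derivative (iter_deriv f vs) (at x) v)"

text \<open>
  The sets \<open>Ck_ball k S f \<epsilon>\<close>, for \<open>\<epsilon> > 0\<close>, form a neighbourhood base of \<open>f\<close> for the topology of
  uniform convergence on \<open>S\<close> of all partial derivatives of order at most \<open>k\<close>.
\<close>

definition Ck_ball ::
    "nat \<Rightarrow> 'a::euclidean_space set \<Rightarrow> ('a \<Rightarrow> 'b::real_normed_vector) \<Rightarrow> real \<Rightarrow> ('a \<Rightarrow> 'b) set" where
  "Ck_ball k S f \<epsilon> = {g. Ck_on k g S \<and>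
     (\<forall>vs. set vs \<subseteq> Basis \<and> length vs \<le> k \<longrightarrow>
        (\<forall>x\<in>S. norm (iter_deriv g vs x - iter_deriv f vs x) < \<epsilon>))}"

subsection \<open>Hoelder functions on the unit circle\<close>

instantiation "fun" :: (type, real_vector) real_vector
begin

definition scaleR_fun :: "real \<Rightarrow> ('a \<Rightarrow> 'b) \<Rightarrow> 'a \<Rightarrow> 'b" where
  "scaleR_fun a f = (\<lambda>x. a *\<^sub>R f x)"

instance
  by standard (auto simp: scaleR_fun_def plus_fun_def fun_eq_iff algebra_simps)

end

text \<open>
  A function on the unit circle is represented by any function on the complex plane with these
  values on the circle. Thus \<open>holder_norm \<alpha>\<close> is only a seminorm: two functions represent
  the same element of the Hoelder space iff their difference has \<open>holder_norm\<close> zero.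
\<close>

definition holder_space :: "real \<Rightarrow> (complex \<Rightarrow> 'b::real_normed_vector) set" where
  "holder_space \<alpha> = {f. \<exists>C. \<forall>\<zeta>\<in>sphere 0 1. \<forall>\<eta>\<in>sphere 0 1.
     norm (f \<zeta> - f \<eta>) \<le> C * dist \<zeta> \<eta> powr \<alpha>}"

definition holder_norm :: "real \<Rightarrow> (complex \<Rightarrow> 'b::real_normed_vector) \<Rightarrow> real" where
  "holder_norm \<alpha> f =
     (SUP \<zeta>\<in>sphere 0 1. norm (f \<zeta>)) +
     (SUP (\<zeta>, \<eta>)\<in>{(\<zeta>, \<eta>). \<zeta> \<in> sphere 0 1 \<and> \<eta> \<in> sphere 0 1 \<and> \<zeta> \<noteq> \<eta>}.
        norm (f \<zeta> - f \<eta>) / dist \<zeta> \<eta> powr \<alpha>)"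

definition holder_ball ::
    "real \<Rightarrow> (complex \<Rightarrow> 'b::real_normed_vector) \<Rightarrow> real \<Rightarrow> (complex \<Rightarrow> 'b) set" where
  "holder_ball \<alpha> f \<delta> = {g \<in> holder_space \<alpha>. holder_norm \<alpha> (g - f) < \<delta>}"

subsection \<open>\<open>C\<^sup>1\<close> maps and local diffeomorphisms\<close>

text \<open>
  \<open>C1_map X nX \<Omega> Y nY f\<close>: the map \<open>f\<close> from the set \<open>\<Omega>\<close>, open in the linear subspace \<open>X\<close> with
  (semi)norm \<open>nX\<close>, to the linear subspace \<open>Y\<close> with (semi)norm \<open>nY\<close>, is Frechet differentiable, with
  derivative depending continuously on the point for the operator norm.
\<close>

definition C1_map ::
    "'a::real_vector set \<Rightarrow> ('a \<Rightarrow> real) \<Rightarrow> 'a set \<Rightarrow> 'b::real_vector set \<Rightarrow> ('b \<Rightarrow> real) \<Rightarrow>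
     ('a \<Rightarrow> 'b) \<Rightarrow> bool" where
  "C1_map X nX \<Omega> Y nY f \<longleftrightarrow>
     f ` \<Omega> \<subseteq> Y \<and>
     (\<exists>D. \<forall>x\<in>\<Omega>.
        linear (D x) \<and> D x ` X \<subseteq> Y \<and> (\<exists>K. \<forall>u\<in>X. nY (D x u) \<le> K * nX u) \<and>
        (\<forall>e>0. \<exists>d>0. \<forall>y\<in>\<Omega>. nX (y - x) < d \<longrightarrow>
           nY (f y - f x - D x (y - x)) \<le> e * nX (y - x)) \<and>
        (\<forall>e>0. \<exists>d>0. \<forall>y\<in>\<Omega>. nX (y - x) < d \<longrightarrow>
           (\<forall>u\<in>X. nY (D y u - D x u) \<le> e * nX u)))"

text \<open>
  \<open>S\<close> is an arbitrary subset of \<open>X\<close>, with the structure induced from \<open>X\<close>, and \<open>\<phi> ` S\<close> has the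
  structure induced from the Euclidean space: a map defined on a subset is \<open>C\<^sup>1\<close> if it
  extends locally to a \<open>C\<^sup>1\<close> map on an open subset of the ambient space. Every point of \<open>S\<close> has a
  relatively open neighbourhood \<open>N\<close> in \<open>S\<close> which \<open>\<phi>\<close> maps onto a relatively open subset of \<open>\<phi> ` S\<close>,
  \<open>C\<^sup>1\<close> with \<open>C\<^sup>1\<close> inverse. The condition \<open>nX (\<Psi> (\<phi> g) - g) = 0\<close> says that \<open>\<Psi> (\<phi> g)\<close> and \<open>g\<close> are equal
  as elements of the normed space given by the seminorm \<open>nX\<close>.
\<close>

definition local_diffeo_onto_image ::
    "'a::real_vector set \<Rightarrow> ('a \<Rightarrow> real) \<Rightarrow> 'a set \<Rightarrow> ('a \<Rightarrow> 'b::euclidean_space) \<Rightarrow> bool" where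
  "local_diffeo_onto_image X nX S \<phi> \<longleftrightarrow>
     (\<forall>g0\<in>S. \<exists>e>0. \<exists>N. N = {g \<in> S. nX (g - g0) < e} \<and>
        openin (top_of_set (\<phi> ` S)) (\<phi> ` N) \<and>
        (\<exists>\<Phi>. C1_map X nX {g \<in> X. nX (g - g0) < e} UNIV norm \<Phi> \<and> (\<forall>g\<in>N. \<Phi> g = \<phi> g)) \<and>
        (\<exists>T \<Psi>. open T \<and> \<phi> ` N \<subseteq> T \<and> C1_map UNIV norm T X nX \<Psi> \<and>
               (\<forall>g\<in>N. nX (\<Psi> (\<phi> g) - g) = 0)))"

subsection \<open>Stationary discs\<close>

text \<open>
  Points of \<open>\<complex>\<^sup>n\<^sup>+\<^sup>1\<close> are pairs \<open>(z\<^sub>0, z\<^sub>\<alpha>)\<close>; the product norm is the Euclidean norm.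
\<close>

type_synonym 'n cpoint = "complex \<times> (complex ^ 'n)"

definition hermitian_matrix :: "complex ^ 'n ^ 'n \<Rightarrow> bool" where
  "hermitian_matrix A \<longleftrightarrow> (\<forall>i j. A $ i $ j = cnj (A $ j $ i))"

text \<open>For hermitian \<open>A\<close> the double sum is real.\<close>

definition quadric_fun :: "complex ^ 'n ^ 'n \<Rightarrow> 'n::finite cpoint \<Rightarrow> real" where
  "quadric_fun A z =
     Re (fst z) - Re (\<Sum>i\<in>UNIV. \<Sum>j\<in>UNIV. cnj (snd z $ i) * A $ i $ j * snd z $ j)"

text \<open>\<open>\<partial>\<rho>/\<partial>z\<^sub>j = (\<partial>\<rho>/\<partial>x\<^sub>j - \<i> \<partial>\<rho>/\<partial>y\<^sub>j) / 2\<close>\<close>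

definition del :: "('n::finite cpoint \<Rightarrow> real) \<Rightarrow> 'n cpoint \<Rightarrow> 'n cpoint" where
  "del \<rho> z =
     (let D = (\<lambda>v. complex_of_real (frechet_derivative \<rho> (at z) v))
      in ((D (1, 0) - \<i> * D (\<i>, 0)) / 2,
          \<chi> j. (D (0, axis j 1) - \<i> * D (0, axis j \<i>)) / 2))"

definition holomorphic_disc :: "(complex \<Rightarrow> 'n::finite cpoint) \<Rightarrow> bool" where
  "holomorphic_disc h \<longleftrightarrow>
     continuous_on (cball 0 1) h \<and>
     (\<lambda>\<zeta>. fst (h \<zeta>)) holomorphic_on ball 0 1 \<and>
     (\<forall>j. (\<lambda>\<zeta>. snd (h \<zeta>) $ j) holomorphic_on ball 0 1)"

definition disc_deriv :: "(complex \<Rightarrow> 'n::finite cpoint) \<Rightarrow> complex \<Rightarrow> 'n cpoint" where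
  "disc_deriv h \<zeta> = (deriv (\<lambda>\<xi>. fst (h \<xi>)) \<zeta>, \<chi> j. deriv (\<lambda>\<xi>. snd (h \<xi>) $ j) \<zeta>)"

text \<open>\<open>B\<close> is the open set on which the defining function \<open>\<rho>\<close> is considered.\<close>

definition zero_hypersurface :: "'n::finite cpoint set \<Rightarrow> ('n cpoint \<Rightarrow> real) \<Rightarrow> 'n cpoint set" where
  "zero_hypersurface B \<rho> = {z \<in> B. \<rho> z = 0}"

definition stationary_disc ::
    "'n::finite cpoint set \<Rightarrow> ('n cpoint \<Rightarrow> real) \<Rightarrow> (complex \<Rightarrow> 'n cpoint) \<Rightarrow> bool" where
  "stationary_disc B \<rho> h \<longleftrightarrow>
     (\<forall>z\<in>zero_hypersurface B \<rho>. frechet_derivative \<rho> (at z) \<noteq> (\<lambda>_. 0)) \<and>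
     holomorphic_disc h \<and>
     h ` sphere 0 1 \<subseteq> zero_hypersurface B \<rho> \<and>
     (\<exists>c :: complex \<Rightarrow> real. continuous_on (sphere 0 1) c \<and> (\<forall>\<zeta>\<in>sphere 0 1. c \<zeta> \<noteq> 0) \<and>
        (\<exists>g. holomorphic_disc g \<and>
           (\<forall>\<zeta>\<in>sphere 0 1.
              g \<zeta> = (\<zeta> * of_real (c \<zeta>) * fst (del \<rho> (h \<zeta>)),
                     (\<zeta> * of_real (c \<zeta>)) *s snd (del \<rho> (h \<zeta>))))))"

definition nonconstant_stationary_discs ::
    "'n::finite cpoint set \<Rightarrow> ('n cpoint \<Rightarrow> real) \<Rightarrow> (complex \<Rightarrow> 'n cpoint) set" where
  "nonconstant_stationary_discs B \<rho> =
     {h. stationary_disc B \<rho> h \<and> \<not> h constant_on cball 0 1}"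

end

theory Submission
 imports Defs
begin

text \<open>
 Dividing the stationarity condition by the factor \<open>del \<rho>\<close> has in the direction \<open>z\<^sub>0\<close>, and splitting Hoelder
 functions on the circle into boundary values of holomorphic and antiholomorphic functions (Privalov's theorem),
 one finds that the stationary discs near \<open>h\<^sub>0\<close> are exactly the solutions of a fixed point equation
 \<open>h = \<Lambda> t + L (P\<^sub>\<rho> \<circ> h) + L (q \<circ> h)\<close>. Here \<open>\<Lambda> t\<close> is the explicit disc
 \<open>(\<i> y, v + w \<xi> / (1 - a \<xi>))\<close> with the \<open>4 n + 3\<close> real parameters \<open>t = (a, v, w, y)\<close>, the linear operator \<open>L\<close>
 recovers a holomorphic disc from the real part of its first and the holomorphic part of its other components,
 \<open>q\<close> is the quadratic part of the model, and \<open>P\<^sub>\<rho>\<close> is small when \<open>\<rho>\<close> is near the quadric. As \<open>q\<close> only depends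
 on \<open>z\<^sub>\<alpha>\<close>, the substitution \<open>h = k + L (q \<circ> k)\<close> turns this into the contraction \<open>k = \<Lambda> t + \<Theta> k\<close>,
 whose solution is continuously differentiable in \<open>t\<close>. For the quadric the centre, \<open>h 1\<close> and \<open>h' 0\<close> are explicit and
 determine \<open>a\<close> and \<open>w\<close> with a Lipschitz bound, and this bound survives a small perturbation.
\<close>

text \<open>The multiplier \<open>c\<close> is eliminated as follows. Near the quadric
  \<open>2 * fst (del \<rho> h)\<close> is a positive function times the exponential of a
  holomorphic one; dividing by that exponential leaves a holomorphic function which is real on the
  circle after division by \<zeta>, hence a quadratic polynomial without zeros there, and its root
  inside the disc is the conjugate of the parameter \<open>a\<close>.

  Three derivatives of \<rho> are what the method consumes: the equation contains first derivatives,
  and composition with a map is C1 on Hoelder functions if the map is C2.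

  The condition that the centre lies off the quadric means \<open>Re p\<^sub>0 \<noteq> 0\<close>,
  which forces \<open>w \<noteq> 0\<close>; for \<open>w = 0\<close> the parameter \<open>a\<close>
  would be invisible.

  The centred discs of a perturbed hypersurface are not shown to form a manifold. The centre fixes
  \<open>v\<close> and \<open>y\<close> exactly and leaves one real equation for
  \<open>(a, w)\<close>; it suffices that centre and functional together are bounded below in
  \<open>(a, w)\<close>.

  As discs are identified with their boundary values, the Hoelder norm is a seminorm on functions of
  the plane. Fixed points are unique up to null functions only, and every statement about interior
  points passes through a Cauchy transform.\<close>

notation holder_space ("\<H>") and holder_norm ("\<N>") and frechet_derivative ("\<D>")

subsection \<open>Differential calculus in seminormed spaces\<close>

definition seminormed :: "'a::real_vector set \<Rightarrow> ('a \<Rightarrow> real) \<Rightarrow> bool" where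
 "seminormed X N \<longleftrightarrow> subspace X \<and> (\<forall>x\<in>X. 0 \<le> N x) \<and>
   (\<forall>x\<in>X. \<forall>y\<in>X. N (x + y) \<le> N x + N y) \<and> (\<forall>c. \<forall>x\<in>X. N (c *\<^sub>R x) = \<bar>c\<bar> * N x)"

text \<open>Only sequences with geometrically decaying increments are asked to converge, as the
  iterates of a contraction with factor 1/2 have them. Every Cauchy sequence has such a subsequence,
  so this is ordinary completeness; the limit is determined up to null vectors.\<close>

definition seminorm_complete :: "'a::real_vector set \<Rightarrow> ('a \<Rightarrow> real) \<Rightarrow> bool" where
 "seminorm_complete X N \<longleftrightarrow> (\<forall>s C. (\<forall>n. s n \<in> X \<and> N (s (Suc n) - s n) \<le> C / 2 ^ n) \<longrightarrow>
   (\<exists>x\<in>X. (\<lambda>n. N (s n - x)) \<longlonglongrightarrow> 0))"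

lemma seminormedD:
 assumes "seminormed X N"
 shows "subspace X" "\<And>x. x \<in> X \<Longrightarrow> 0 \<le> N x" "\<And>x y. x \<in> X \<Longrightarrow> y \<in> X \<Longrightarrow> N (x + y) \<le> N x + N y"
  "\<And>c x. x \<in> X \<Longrightarrow> N (c *\<^sub>R x) = \<bar>c\<bar> * N x"
  "\<And>x y. x \<in> X \<Longrightarrow> y \<in> X \<Longrightarrow> x + y \<in> X" "\<And>x y. x \<in> X \<Longrightarrow> y \<in> X \<Longrightarrow> x - y \<in> X"
  "\<And>c x. x \<in> X \<Longrightarrow> c *\<^sub>R x \<in> X" "0 \<in> X"
 using assms by (auto simp: seminormed_def subspace_add subspace_diff subspace_scale subspace_0)

lemma seminormed_zero: "seminormed X N \<Longrightarrow> N 0 = 0"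
 using seminormedD(4)[of X N 0 0] seminormedD(8)[of X N] by simp

lemma seminormed_minus: "seminormed X N \<Longrightarrow> x \<in> X \<Longrightarrow> N (- x) = N x"
 using seminormedD(4)[of X N x "-1"] by simp

lemma seminormed_minus_commute:
 assumes "seminormed X N" "x \<in> X" "y \<in> X" shows "N (x - y) = N (y - x)"
 using seminormed_minus[OF assms(1) seminormedD(6)[OF assms]] by simp

lemma seminormed_diff_le:
 assumes "seminormed X N" "x \<in> X" "y \<in> X" shows "N (x - y) \<le> N x + N y"
proof -
 have "- y \<in> X" using seminormedD(6)[OF assms(1) seminormedD(8)[OF assms(1)] assms(3)] by simp
 then show ?thesis
  using seminormedD(3)[OF assms(1,2), of "- y"] seminormed_minus[OF assms(1,3)] by simp
qed

lemma seminormed_triangle: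
 assumes "seminormed X N" "x \<in> X" "y \<in> X" "z \<in> X" shows "N (x - z) \<le> N (x - y) + N (y - z)"
 using seminormedD(3)[OF assms(1) seminormedD(6)[OF assms(1,2,3)] seminormedD(6)[OF assms(1,3,4)]]
 by simp

lemma seminormed_sum:
 assumes "seminormed X N" "finite I" "\<And>i. i \<in> I \<Longrightarrow> f i \<in> X"
 shows "sum f I \<in> X \<and> N (sum f I) \<le> (\<Sum>i\<in>I. N (f i))"
 using assms(2,3)
proof (induction I rule: finite_induct)
 case empty
 then show ?case using seminormed_zero[OF assms(1)] seminormedD(8)[OF assms(1)] by simp
next
 case (insert i I)
 then have "sum f I \<in> X" "N (sum f I) \<le> (\<Sum>i\<in>I. N (f i))" "f i \<in> X" by auto
 then show ?case using insert seminormedD(3)[OF assms(1), of "f i" "sum f I"]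
   seminormedD(5)[OF assms(1), of "f i" "sum f I"] by simp
qed

lemma seminormed_norm: "seminormed (UNIV :: 'a::real_normed_vector set) norm"
 by (auto simp: seminormed_def norm_triangle_ineq)

lemma seminorm_complete_norm: "seminorm_complete (UNIV :: 'a::banach set) norm"
 unfolding seminorm_complete_def
proof (intro allI impI)
 fix s :: "nat \<Rightarrow> 'a" and C
 assume a: "\<forall>n. s n \<in> UNIV \<and> norm (s (Suc n) - s n) \<le> C / 2 ^ n"
 have "summable (\<lambda>n. s (Suc n) - s n)"
 proof (rule summable_comparison_test)
  show "\<exists>N. \<forall>n\<ge>N. norm (s (Suc n) - s n) \<le> C * (1/2) ^ n"
   using a by (auto simp: power_divide)
 qed (auto intro: summable_mult)
 then have "convergent (\<lambda>n. \<Sum>i<n. s (Suc i) - s i)" by (simp add: summable_iff_convergent)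
 then obtain l where "(\<lambda>n. s n - s 0) \<longlonglongrightarrow> l" unfolding sum_lessThan_telescope convergent_def by auto
 then have "(\<lambda>n. s n - s 0 - l) \<longlonglongrightarrow> 0" using tendsto_diff[OF _ tendsto_const[of l]] by force
 then have "(\<lambda>n. norm (s n - (s 0 + l))) \<longlonglongrightarrow> 0"
  by (simp add: tendsto_norm_zero_iff diff_diff_eq)
 then show "\<exists>x\<in>UNIV. (\<lambda>n. norm (s n - x)) \<longlonglongrightarrow> 0" by auto
qed

text \<open>The contraction is only defined on a ball, and a fixed point is a fixed point up to \<open>N\<close>-null vectors.\<close>

lemma contraction_fixed_point:
 assumes sn: "seminormed X N" and co: "seminorm_complete X N"
  and c: "c \<in> X" and T: "\<And>x. x \<in> X \<Longrightarrow> N (x - c) < r \<Longrightarrow> T x \<in> X"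
  and lip: "\<And>x y. x \<in> X \<Longrightarrow> y \<in> X \<Longrightarrow> N (x - c) < r \<Longrightarrow> N (y - c) < r \<Longrightarrow>
   N (T x - T y) \<le> N (x - y) / 2"
  and small: "N (T c - c) < r / 2" and r: "0 < r"
 shows "\<exists>x\<in>X. N (x - c) < r \<and> N (x - T x) = 0"
proof -
 note D = seminormedD[OF sn] and tri = seminormed_triangle[OF sn] and comm = seminormed_minus_commute[OF sn]
 define d where "d = N (T c - c)"
 have Nc: "N (c - c) = 0" using seminormed_zero[OF sn] by simp
 have Tc: "T c \<in> X" using T[OF c] Nc r by simp
 have d: "0 \<le> d" using D(2)[OF D(6)[OF Tc c]] by (simp add: d_def)
 have d2: "2 * d < r" using small by (simp add: d_def)
 define s where "s n = (T ^^ n) c" for n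
 have s0: "s 0 = c" and sS: "s (Suc n) = T (s n)" for n by (auto simp: s_def)
 \<comment> \<open>\<open>2 * d - 2 * d / 2 ^ n\<close> is the partial sum of the series d + d/2 +
   d/4 + ..., so all iterates stay within \<open>2 * d < r\<close> of the centre and the iteration
   never leaves the ball on which \<open>T\<close> contracts.\<close>
 have P: "s n \<in> X \<and> N (s n - c) \<le> 2 * d - 2 * d / 2 ^ n \<and> s (Suc n) \<in> X \<and> N (s (Suc n) - s n) \<le> d / 2 ^ n"
  for n
 proof (induction n)
  case 0
  then show ?case using c Tc Nc by (simp add: s0 sS d_def)
 next
  case (Suc n)
  have p: "0 \<le> 2 * d / 2 ^ m" for m using d by simp
  have half: "2 * d / 2 ^ Suc n = d / 2 ^ n" "2 * d / 2 ^ n = d / 2 ^ n + d / 2 ^ n" by auto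
  have 1: "N (s (Suc n) - c) \<le> 2 * d - 2 * d / 2 ^ Suc n"
   using tri[of "s (Suc n)" "s n" c] Suc c half by linarith
  have lt: "N (s (Suc n) - c) < r" "N (s n - c) < r"
   using 1 Suc p[of n] p[of "Suc n"] d2 by linarith+
  have 2: "s (Suc (Suc n)) \<in> X" using T[of "s (Suc n)"] Suc lt sS by simp
  have "N (s (Suc (Suc n)) - s (Suc n)) \<le> N (s (Suc n) - s n) / 2"
   using lip[of "s (Suc n)" "s n"] Suc lt by (simp add: sS)
  also have "\<dots> \<le> d / 2 ^ Suc n" using Suc by (simp add: field_simps)
  finally show ?case using 1 2 Suc by blast
 qed
 have p: "0 \<le> 2 * d / 2 ^ m" for m using d by simp
 have slt: "N (s n - c) < r" for n using P[of n] p[of n] d2 by linarith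
 obtain x where x: "x \<in> X" and lim: "(\<lambda>n. N (s n - x)) \<longlonglongrightarrow> 0"
  using co P unfolding seminorm_complete_def by blast
 have "N (x - c) \<le> N (s n - x) + 2 * d" for n
  using tri[of x "s n" c] comm[of x "s n"] x c P[of n] p[of n] by fastforce
 then have "N (x - c) \<le> 0 + 2 * d"
  by (intro LIMSEQ_le_const[OF tendsto_add[OF lim tendsto_const]]) auto
 then have xr: "N (x - c) < r" using d2 by simp
 have Tx: "T x \<in> X" using T x xr by blast
 have "N (x - T x) \<le> N (s (Suc n) - x) + N (s n - x) / 2" for n
  using tri[of x "s (Suc n)" "T x"] comm[of x "s (Suc n)"] lip[of "s n" x] x Tx xr slt[of n] P[of n]
  by (fastforce simp: sS)
 then have "N (x - T x) \<le> 0 + 0 / 2"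
  by (intro LIMSEQ_le_const[OF tendsto_add[OF LIMSEQ_Suc[OF lim] tendsto_divide[OF lim tendsto_const]]]) auto
 then have "N (x - T x) = 0" using D(2)[OF D(6)[OF x Tx]] by simp
 then show ?thesis using x xr by blast
qed

text \<open>\<open>C1_map\<close> wants derivatives that are linear on the whole type, whereas
  operators on Hoelder functions are additive on the subspace only. Composing with a linear
  projection onto \<open>X\<close> repairs this without changing the operator on
  \<open>X\<close>.\<close>

lemma linear_on_extend:
 fixes T :: "'a::real_vector \<Rightarrow> 'b::real_vector"
 assumes X: "subspace X" and add: "\<And>x y. x \<in> X \<Longrightarrow> y \<in> X \<Longrightarrow> T (x + y) = T x + T y"
  and scale: "\<And>c x. x \<in> X \<Longrightarrow> T (c *\<^sub>R x) = c *\<^sub>R T x"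
 shows "\<exists>T'. linear T' \<and> (\<forall>x\<in>X. T' x = T x)"
proof -
 obtain g :: "'a \<Rightarrow> 'a" where g: "g ` UNIV \<subseteq> X" "linear g" "\<forall>v\<in>X. g (id v) = v"
  using real_vector.linear_exists_left_inverse_on[OF real_vector.linear_id X] by (auto simp: linear_def real_scaleR_def)
 have gX: "g x \<in> X" for x using g by auto
 have "linear (T \<circ> g)"
  by (rule linearI) (auto simp: linear_add[OF g(2)] linear_scale[OF g(2)] add gX scale)
 then show ?thesis using g by (auto intro!: exI[of _ "T \<circ> g"])
qed

section \<open>Continuously differentiable maps between seminormed spaces\<close>

definition C1_derivative ::
  "'a::real_vector set \<Rightarrow> ('a \<Rightarrow> real) \<Rightarrow> 'a set \<Rightarrow> 'b::real_vector set \<Rightarrow> ('b \<Rightarrow> real) \<Rightarrow>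
   ('a \<Rightarrow> 'b) \<Rightarrow> ('a \<Rightarrow> 'a \<Rightarrow> 'b) \<Rightarrow> bool" where
 "C1_derivative X nX \<Omega> Y nY f D \<longleftrightarrow> f ` \<Omega> \<subseteq> Y \<and> (\<forall>x\<in>\<Omega>.
   linear (D x) \<and> D x ` X \<subseteq> Y \<and> (\<exists>K. \<forall>u\<in>X. nY (D x u) \<le> K * nX u) \<and>
   (\<forall>e>0. \<exists>d>0. \<forall>y\<in>\<Omega>. nX (y - x) < d \<longrightarrow> nY (f y - f x - D x (y - x)) \<le> e * nX (y - x)) \<and>
   (\<forall>e>0. \<exists>d>0. \<forall>y\<in>\<Omega>. nX (y - x) < d \<longrightarrow> (\<forall>u\<in>X. nY (D y u - D x u) \<le> e * nX u)))"

lemma C1_map_iff: "C1_map X nX \<Omega> Y nY f \<longleftrightarrow> (\<exists>D. C1_derivative X nX \<Omega> Y nY f D)"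
 by (simp only: C1_map_def C1_derivative_def ex_simps)

lemma C1_derivativeD:
 assumes "C1_derivative X nX \<Omega> Y nY f D"
 shows "\<And>x. x \<in> \<Omega> \<Longrightarrow> f x \<in> Y" "\<And>x. x \<in> \<Omega> \<Longrightarrow> linear (D x)"
  "\<And>x u. x \<in> \<Omega> \<Longrightarrow> u \<in> X \<Longrightarrow> D x u \<in> Y"
  "\<And>x. x \<in> \<Omega> \<Longrightarrow> \<exists>K. \<forall>u\<in>X. nY (D x u) \<le> K * nX u"
  "\<And>x e. x \<in> \<Omega> \<Longrightarrow> e > 0 \<Longrightarrow> \<exists>d>0. \<forall>y\<in>\<Omega>. nX (y - x) < d \<longrightarrow> nY (f y - f x - D x (y - x)) \<le> e * nX (y - x)"
  "\<And>x e. x \<in> \<Omega> \<Longrightarrow> e > 0 \<Longrightarrow> \<exists>d>0. \<forall>y\<in>\<Omega>. nX (y - x) < d \<longrightarrow> (\<forall>u\<in>X. nY (D y u - D x u) \<le> e * nX u)"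
 using assms unfolding C1_derivative_def by (simp_all add: image_subset_iff)

lemma C1_mapI:
 assumes "\<And>x. x \<in> \<Omega> \<Longrightarrow> f x \<in> Y" "\<And>x. x \<in> \<Omega> \<Longrightarrow> linear (D x)"
  "\<And>x u. x \<in> \<Omega> \<Longrightarrow> u \<in> X \<Longrightarrow> D x u \<in> Y"
  "\<And>x. x \<in> \<Omega> \<Longrightarrow> \<exists>K. \<forall>u\<in>X. nY (D x u) \<le> K * nX u"
  "\<And>x e. x \<in> \<Omega> \<Longrightarrow> e > 0 \<Longrightarrow> \<exists>d>0. \<forall>y\<in>\<Omega>. nX (y - x) < d \<longrightarrow> nY (f y - f x - D x (y - x)) \<le> e * nX (y - x)"
  "\<And>x e. x \<in> \<Omega> \<Longrightarrow> e > 0 \<Longrightarrow> \<exists>d>0. \<forall>y\<in>\<Omega>. nX (y - x) < d \<longrightarrow> (\<forall>u\<in>X. nY (D y u - D x u) \<le> e * nX u)"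
 shows "C1_map X nX \<Omega> Y nY f"
 unfolding C1_map_iff C1_derivative_def
 by (intro exI[of _ D] conjI ballI allI impI image_subsetI) (simp_all add: assms)

lemma C1_map_const:
 assumes "seminormed X nX" "seminormed Y nY" "\<Omega> \<subseteq> X" "c \<in> Y"
 shows "C1_map X nX \<Omega> Y nY (\<lambda>_. c)"
proof -
 note DX = seminormedD[OF assms(1)] and DY = seminormedD[OF assms(2)] and z = seminormed_zero[OF assms(2)]
 show ?thesis unfolding C1_map_def
 proof (intro conjI exI[of _ "\<lambda>_ _. 0"] ballI)
  fix x assume x: "x \<in> \<Omega>"
  show "linear (\<lambda>_. 0 :: 'b)" by (rule linearI) auto
  show "\<exists>K. \<forall>u\<in>X. nY 0 \<le> K * nX u" using z by (intro exI[of _ 0]) simp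
  show "\<forall>e>0. \<exists>d>0. \<forall>y\<in>\<Omega>. nX (y - x) < d \<longrightarrow> nY (c - c - 0) \<le> e * nX (y - x)"
   using z DX(2)[OF DX(6)] x assms(3) by (auto simp: subset_eq intro!: exI[of _ 1] mult_nonneg_nonneg)
  show "\<forall>e>0. \<exists>d>0. \<forall>y\<in>\<Omega>. nX (y - x) < d \<longrightarrow> (\<forall>u\<in>X. nY (0 - 0) \<le> e * nX u)"
   using z DX(2) by (auto intro!: exI[of _ 1])
 qed (use assms(4) DY(8) in auto)
qed

text \<open>One statement for three uses: constant \<open>f\<close> gives affine maps, zero
  \<open>f\<close> linear ones, and \<open>T\<close> the identity gives the perturbed identities
  needed for local inverses. The derivative of the first summand is the linear extension of
  \<open>T\<close>, the same at every point.\<close>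

lemma C1_map_linear_add:
 assumes sX: "seminormed X nX" and sY: "seminormed Y nY" and Om: "\<Omega> \<subseteq> X" and f: "C1_map X nX \<Omega> Y nY f"
  and add: "\<And>x y. x \<in> X \<Longrightarrow> y \<in> X \<Longrightarrow> T (x + y) = T x + T y"
  and scale: "\<And>c x. x \<in> X \<Longrightarrow> T (c *\<^sub>R x) = c *\<^sub>R T x"
  and TX: "\<And>x. x \<in> X \<Longrightarrow> T x \<in> Y" and bd: "\<And>x. x \<in> X \<Longrightarrow> nY (T x) \<le> K * nX x"
 shows "C1_map X nX \<Omega> Y nY (\<lambda>x. T x + f x)"
proof -
 note DX = seminormedD[OF sX] and DY = seminormedD[OF sY]
 obtain T' where T': "linear T'" "\<forall>x\<in>X. T' x = T x" using linear_on_extend[of X T] DX(1) add scale by blast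
 obtain D where "C1_derivative X nX \<Omega> Y nY f D" using f unfolding C1_map_iff by (rule exE)
 note D = C1_derivativeD[OF this]
 show ?thesis
 proof (rule C1_mapI[of _ _ _ "\<lambda>x u. T' u + D x u"])
  fix x assume x: "x \<in> \<Omega>"
  show "T x + f x \<in> Y" using TX D(1)[OF x] DY(5) x Om by blast
  show "linear (\<lambda>u. T' u + D x u)" using T'(1) D(2)[OF x] by (rule linear_compose_add)
  show "T' u + D x u \<in> Y" if "u \<in> X" for u using TX[OF that] D(3)[OF x that] DY(5) T'(2) that by simp
  obtain K' where K': "\<forall>u\<in>X. nY (D x u) \<le> K' * nX u" using D(4)[OF x] by blast
  have "nY (T' u + D x u) \<le> (K + K') * nX u" if u: "u \<in> X" for u
   using DY(3)[OF TX[OF u] D(3)[OF x u]] bd[OF u] K'[rule_format, OF u] T'(2) u by (simp add: distrib_right)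
  then show "\<exists>K. \<forall>u\<in>X. nY (T' u + D x u) \<le> K * nX u" by blast
  fix e :: real assume e: "e > 0"
  have eq: "T y + f y - (T x + f x) - (T' (y - x) + D x (y - x)) = f y - f x - D x (y - x)" if "y \<in> \<Omega>" for y
  proof -
   have "T y = T' y" "T x = T' x" using T'(2) Om x that by auto
   then show ?thesis by (simp add: linear_diff[OF T'(1)])
  qed
  obtain d where d: "d > 0" "\<forall>y\<in>\<Omega>. nX (y - x) < d \<longrightarrow> nY (f y - f x - D x (y - x)) \<le> e * nX (y - x)"
   using D(5)[OF x e] by blast
  show "\<exists>d>0. \<forall>y\<in>\<Omega>. nX (y - x) < d \<longrightarrow>
    nY (T y + f y - (T x + f x) - (T' (y - x) + D x (y - x))) \<le> e * nX (y - x)"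
   by (intro exI[of _ d] conjI d(1) ballI impI, subst eq) (use d(2) in auto)
  show "\<exists>d>0. \<forall>y\<in>\<Omega>. nX (y - x) < d \<longrightarrow> (\<forall>u\<in>X. nY (T' u + D y u - (T' u + D x u)) \<le> e * nX u)"
   using D(6)[OF x e] by simp
 qed
qed

lemma C1_map_linear_on:
 assumes sX: "seminormed X nX" and sY: "seminormed Y nY" and Om: "\<Omega> \<subseteq> X"
  and add: "\<And>x y. x \<in> X \<Longrightarrow> y \<in> X \<Longrightarrow> T (x + y) = T x + T y"
  and scale: "\<And>c x. x \<in> X \<Longrightarrow> T (c *\<^sub>R x) = c *\<^sub>R T x"
  and TX: "\<And>x. x \<in> X \<Longrightarrow> T x \<in> Y" and bd: "\<And>x. x \<in> X \<Longrightarrow> nY (T x) \<le> K * nX x"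
 shows "C1_map X nX \<Omega> Y nY T"
proof -
 have "C1_map X nX \<Omega> Y nY (\<lambda>x. T x + 0)"
  by (rule C1_map_linear_add[OF sX sY Om C1_map_const[OF sX sY Om seminormedD(8)[OF sY]] add scale TX bd])
 then show ?thesis by simp
qed

lemma C1_map_linear_bound:
 assumes "seminormed X nX" "\<exists>K. \<forall>u\<in>X. nY (D u) \<le> K * nX u"
 shows "\<exists>K>0. \<forall>u\<in>X. nY (D u) \<le> K * nX u"
proof -
 obtain K where K: "\<forall>u\<in>X. nY (D u) \<le> K * nX u" using assms(2) by blast
 have "nY (D u) \<le> (\<bar>K\<bar> + 1) * nX u" if u: "u \<in> X" for u
  using K[rule_format, OF u] mult_right_mono[of K "\<bar>K\<bar> + 1" "nX u"] seminormedD(2)[OF assms(1) u] by linarith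
 then show ?thesis by (intro exI[of _ "\<bar>K\<bar> + 1"]) auto
qed

lemma C1_map_locally_Lipschitz:
 assumes sX: "seminormed X nX" and sY: "seminormed Y nY" and Om: "\<Omega> \<subseteq> X"
  and f: "C1_map X nX \<Omega> Y nY f" and x: "x \<in> \<Omega>"
 shows "\<exists>C>0. \<exists>d>0. \<forall>y\<in>\<Omega>. nX (y - x) < d \<longrightarrow> nY (f y - f x) \<le> C * nX (y - x)"
proof -
 note DX = seminormedD[OF sX] and DY = seminormedD[OF sY]
 obtain D0 where "C1_derivative X nX \<Omega> Y nY f D0" using f unfolding C1_map_iff by (rule exE)
 note D0 = C1_derivativeD[OF this]
 define D where "D = D0 x"
 note D = D0(1) D0(2)[OF x, folded D_def] D0(3)[OF x, folded D_def] D0(4)[OF x, folded D_def] D0(5)[OF x, folded D_def]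
 obtain K where K: "K > 0" "\<forall>u\<in>X. nY (D u) \<le> K * nX u" using C1_map_linear_bound[of X nX nY D, OF sX D(4)] by blast
 obtain d where d: "d > 0" "\<forall>y\<in>\<Omega>. nX (y - x) < d \<longrightarrow> nY (f y - f x - D (y - x)) \<le> 1 * nX (y - x)"
  using D(5)[of 1] by auto
 have "nY (f y - f x) \<le> (K + 1) * nX (y - x)" if y: "y \<in> \<Omega>" "nX (y - x) < d" for y
 proof -
  have u: "y - x \<in> X" using Om x y DX(6) by blast
  have "nY (f y - f x) = nY ((f y - f x - D (y - x)) + D (y - x))" by simp
  also have "\<dots> \<le> nY (f y - f x - D (y - x)) + nY (D (y - x))"
   using D(1,3) u y x DY(6) by (intro DY(3)) auto
  also have "\<dots> \<le> 1 * nX (y - x) + K * nX (y - x)"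
   using d y K u by (intro add_mono) auto
  finally show ?thesis by (simp add: algebra_simps)
 qed
 then show ?thesis using K d by (intro exI[of _ "K + 1"] conjI exI[of _ d]) auto
qed

lemma C1_map_compose:
 assumes sX: "seminormed X nX" and sY: "seminormed Y nY" and sZ: "seminormed Z nZ"
  and Om: "\<Omega> \<subseteq> X" and Om': "\<Omega>' \<subseteq> Y"
  and f: "C1_map X nX \<Omega> Y nY f" and g: "C1_map Y nY \<Omega>' Z nZ g" and fO: "\<And>x. x \<in> \<Omega> \<Longrightarrow> f x \<in> \<Omega>'"
 shows "C1_map X nX \<Omega> Z nZ (\<lambda>x. g (f x))"
proof -
 note DX = seminormedD[OF sX] and DY = seminormedD[OF sY] and DZ = seminormedD[OF sZ]
 obtain Df where "C1_derivative X nX \<Omega> Y nY f Df" using f unfolding C1_map_iff by (rule exE)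
 note Df = C1_derivativeD[OF this]
 obtain Dg where "C1_derivative Y nY \<Omega>' Z nZ g Dg" using g unfolding C1_map_iff by (rule exE)
 note Dg = C1_derivativeD[OF this]
 show ?thesis unfolding C1_map_def
 proof (intro conjI exI[of _ "\<lambda>x u. Dg (f x) (Df x u)"] ballI allI impI)
  show "(\<lambda>x. g (f x)) ` \<Omega> \<subseteq> Z" using Dg(1) fO by auto
  fix x assume x: "x \<in> \<Omega>"
  then have fx: "f x \<in> \<Omega>'" by (rule fO)
  have xX: "x \<in> X" using x Om by blast
  show "linear (\<lambda>u. Dg (f x) (Df x u))"
   using linear_compose[OF Df(2)[OF x] Dg(2)[OF fx]] by (simp add: o_def)
  show "(\<lambda>u. Dg (f x) (Df x u)) ` X \<subseteq> Z" using Df(3)[OF x] Dg(3)[OF fx] by auto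
  obtain K where K: "K > 0" "\<forall>u\<in>X. nY (Df x u) \<le> K * nX u" using C1_map_linear_bound[of X nX nY "Df x", OF sX Df(4)[OF x]] by blast
  obtain K' where K': "K' > 0" "\<forall>u\<in>Y. nZ (Dg (f x) u) \<le> K' * nY u"
   using C1_map_linear_bound[of Y nY nZ "Dg (f x)", OF sY Dg(4)[OF fx]] by blast
  have Dfy: "Df y u \<in> Y" if "y \<in> \<Omega>" "u \<in> X" for y u using Df(3) that by auto
  have Dgy: "Dg y u \<in> Z" if "y \<in> \<Omega>'" "u \<in> Y" for y u using Dg(3) that by auto
  have fY: "f y \<in> Y" if "y \<in> \<Omega>" for y using Df(1) that by auto
  have gZ: "g y \<in> Z" if "y \<in> \<Omega>'" for y using Dg(1) that by auto
  show "\<exists>K. \<forall>u\<in>X. nZ (Dg (f x) (Df x u)) \<le> K * nX u"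
  proof (intro exI[of _ "K' * K"] ballI)
   fix u assume u: "u \<in> X"
   have "nZ (Dg (f x) (Df x u)) \<le> K' * nY (Df x u)" using K'(2) Dfy[OF x u] by blast
   also have "\<dots> \<le> K' * (K * nX u)" using K K' u by (intro mult_left_mono) auto
   finally show "nZ (Dg (f x) (Df x u)) \<le> K' * K * nX u" by simp
  qed
  obtain C d0 where C: "C > 0" "d0 > 0" "\<forall>y\<in>\<Omega>. nX (y - x) < d0 \<longrightarrow> nY (f y - f x) \<le> C * nX (y - x)"
   using C1_map_locally_Lipschitz[OF sX sY Om f x] by blast
  have near: "\<exists>d'>0. \<forall>y\<in>\<Omega>. nX (y - x) < d' \<longrightarrow> nY (f y - f x) < d \<and> nY (f y - f x) \<le> C * nX (y - x)"
   if d: "d > 0" for d :: real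
  proof (intro exI[of _ "min d0 (d / C)"] conjI ballI impI)
   show "0 < min d0 (d / C)" using C d by simp
   fix y assume y: "y \<in> \<Omega>" "nX (y - x) < min d0 (d / C)"
   then show c: "nY (f y - f x) \<le> C * nX (y - x)" using C by simp
   have "C * nX (y - x) < d" using y C by (simp add: pos_less_divide_eq mult.commute)
   then show "nY (f y - f x) < d" using c by simp
  qed
  fix e :: real assume e: "e > 0"
  show "\<exists>d>0. \<forall>y\<in>\<Omega>. nX (y - x) < d \<longrightarrow>
    nZ (g (f y) - g (f x) - Dg (f x) (Df x (y - x))) \<le> e * nX (y - x)"
  proof -
   obtain d1 where d1: "d1 > 0" "\<forall>y\<in>\<Omega>'. nY (y - f x) < d1 \<longrightarrow>
     nZ (g y - g (f x) - Dg (f x) (y - f x)) \<le> (e / (2 * C)) * nY (y - f x)"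
    using Dg(5)[OF fx, of "e / (2 * C)"] e C by auto
   obtain d2 where d2: "d2 > 0" "\<forall>y\<in>\<Omega>. nX (y - x) < d2 \<longrightarrow>
     nY (f y - f x - Df x (y - x)) \<le> (e / (2 * K')) * nX (y - x)"
    using Df(5)[OF x, of "e / (2 * K')"] e K' by auto
   obtain d3 where d3: "d3 > 0" "\<forall>y\<in>\<Omega>. nX (y - x) < d3 \<longrightarrow> nY (f y - f x) < d1 \<and> nY (f y - f x) \<le> C * nX (y - x)"
    using near[OF d1(1)] by blast
   show ?thesis
   proof (intro exI[of _ "min d2 d3"] conjI ballI impI)
    show "0 < min d2 d3" using d2 d3 by simp
    fix y assume y: "y \<in> \<Omega>" "nX (y - x) < min d2 d3"
    have u: "y - x \<in> X" using Om y xX DX(6) by blast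
    have fu: "f y - f x \<in> Y" using fY y x DY(6) by blast
    have w: "f y - f x - Df x (y - x) \<in> Y" using fu Dfy[OF x u] DY(6) by blast
    have eq: "g (f y) - g (f x) - Dg (f x) (Df x (y - x)) =
      (g (f y) - g (f x) - Dg (f x) (f y - f x)) + Dg (f x) (f y - f x - Df x (y - x))"
     using linear_diff[OF Dg(2)[OF fx], of "f y - f x" "Df x (y - x)"] by simp
    have "nZ (g (f y) - g (f x) - Dg (f x) (Df x (y - x))) \<le>
      nZ (g (f y) - g (f x) - Dg (f x) (f y - f x)) + nZ (Dg (f x) (f y - f x - Df x (y - x)))"
     unfolding eq using gZ fO y fx Dgy fu w DZ(6) by (intro DZ(3)) auto
    also have "\<dots> \<le> (e / (2 * C)) * nY (f y - f x) + K' * nY (f y - f x - Df x (y - x))"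
     using d1(2) d3(2) y fO K'(2) w by (intro add_mono) auto
    also have "\<dots> \<le> (e / (2 * C)) * (C * nX (y - x)) + K' * ((e / (2 * K')) * nX (y - x))"
     using d3(2) d2(2) y e C(1) K'(1) by (intro add_mono mult_left_mono) auto
    also have "\<dots> = e * nX (y - x)" using C(1) K'(1) by simp
    finally show "nZ (g (f y) - g (f x) - Dg (f x) (Df x (y - x))) \<le> e * nX (y - x)" .
   qed
  qed
  show "\<exists>d>0. \<forall>y\<in>\<Omega>. nX (y - x) < d \<longrightarrow>
    (\<forall>u\<in>X. nZ (Dg (f y) (Df y u) - Dg (f x) (Df x u)) \<le> e * nX u)"
  proof -
   obtain d1 where d1: "d1 > 0" "\<forall>y\<in>\<Omega>'. nY (y - f x) < d1 \<longrightarrow>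
     (\<forall>u\<in>Y. nZ (Dg y u - Dg (f x) u) \<le> (e / (2 * (K + 1))) * nY u)"
    using Dg(6)[OF fx, of "e / (2 * (K + 1))"] e K by auto
   \<comment> \<open>The bound 1 keeps \<open>Df y\<close> below \<open>K + 1\<close> near
     \<open>x\<close>; the bound \<open>e / (2 * K')\<close> makes the contribution of
     \<open>Df y - Df x\<close> at most half of the error.\<close>
   obtain d2 where d2: "d2 > 0" "\<forall>y\<in>\<Omega>. nX (y - x) < d2 \<longrightarrow>
     (\<forall>u\<in>X. nY (Df y u - Df x u) \<le> (min 1 (e / (2 * K'))) * nX u)"
    using Df(6)[OF x, of "min 1 (e / (2 * K'))"] e K' by auto
   obtain d3 where d3: "d3 > 0" "\<forall>y\<in>\<Omega>. nX (y - x) < d3 \<longrightarrow> nY (f y - f x) < d1 \<and> nY (f y - f x) \<le> C * nX (y - x)"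
    using near[OF d1(1)] by blast
   show ?thesis
   proof (intro exI[of _ "min d2 d3"] conjI ballI impI)
    show "0 < min d2 d3" using d2 d3 by simp
    fix y u assume y: "y \<in> \<Omega>" "nX (y - x) < min d2 d3" and u: "u \<in> X"
    have fy: "f y \<in> \<Omega>'" using fO y by blast
    have nu: "0 \<le> nX u" using DX(2) u by blast
    have a: "nY (Df y u - Df x u) \<le> min 1 (e / (2 * K')) * nX u" using d2 y u by auto
    also have "\<dots> \<le> 1 * nX u" using nu by (intro mult_right_mono) auto
    finally have a1: "nY (Df y u - Df x u) \<le> nX u" by simp
    have a2: "nY (Df y u - Df x u) \<le> (e / (2 * K')) * nX u"
     using a mult_right_mono[OF min.cobounded2 nu, of 1 "e / (2 * K')"] by linarith
    have "nY (Df y u) = nY ((Df y u - Df x u) + Df x u)" by simp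
    also have "\<dots> \<le> nY (Df y u - Df x u) + nY (Df x u)"
     using Dfy x y u DY(6) by (intro DY(3)) auto
    also have "\<dots> \<le> nX u + K * nX u" using a1 K u by (intro add_mono) auto
    finally have b: "nY (Df y u) \<le> (K + 1) * nX u" by (simp add: algebra_simps)
    have w: "Df y u - Df x u \<in> Y" using Dfy x y u DY(6) by blast
    have eq: "Dg (f y) (Df y u) - Dg (f x) (Df x u) =
      (Dg (f y) (Df y u) - Dg (f x) (Df y u)) + Dg (f x) (Df y u - Df x u)"
     using linear_diff[OF Dg(2)[OF fx], of "Df y u" "Df x u"] by simp
    have "nZ (Dg (f y) (Df y u) - Dg (f x) (Df x u)) \<le>
      nZ (Dg (f y) (Df y u) - Dg (f x) (Df y u)) + nZ (Dg (f x) (Df y u - Df x u))"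
     unfolding eq using Dgy fx fy Dfy y u w DZ(6) by (intro DZ(3)) auto
    also have "\<dots> \<le> (e / (2 * (K + 1))) * nY (Df y u) + K' * nY (Df y u - Df x u)"
     using d1(2) d3(2) y fy Dfy u K'(2) w by (intro add_mono) auto
    also have "\<dots> \<le> (e / (2 * (K + 1))) * ((K + 1) * nX u) + K' * ((e / (2 * K')) * nX u)"
     using b a2 e K K' by (intro add_mono mult_left_mono) auto
    also have "\<dots> = e * nX u" using K(1) K'(1) by (simp add: field_simps)
    finally show "nZ (Dg (f y) (Df y u) - Dg (f x) (Df x u)) \<le> e * nX u" .
   qed
  qed
 qed
qed

lemma C1_map_subset:
 assumes f: "C1_map X nX \<Omega> Y nY f" and sub: "\<Omega>' \<subseteq> \<Omega>"
 shows "C1_map X nX \<Omega>' Y nY f"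
proof -
 obtain D where "C1_derivative X nX \<Omega> Y nY f D" using f unfolding C1_map_iff by (rule exE)
 note D = C1_derivativeD[OF this]
 show ?thesis
 proof (rule C1_mapI[of _ _ _ D])
  fix x e assume x: "x \<in> \<Omega>'" and e: "(e :: real) > 0"
  have x': "x \<in> \<Omega>" using x sub by blast
  show "\<exists>d>0. \<forall>y\<in>\<Omega>'. nX (y - x) < d \<longrightarrow> nY (f y - f x - D x (y - x)) \<le> e * nX (y - x)"
   using D(5)[OF x' e] sub by (meson subsetD)
  show "\<exists>d>0. \<forall>y\<in>\<Omega>'. nX (y - x) < d \<longrightarrow> (\<forall>u\<in>X. nY (D y u - D x u) \<le> e * nX u)"
   using D(6)[OF x' e] sub by (meson subsetD)
 qed (use D(1-4) sub in \<open>auto simp: subset_eq\<close>)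
qed

text \<open>Changing values by null vectors changes no seminorm of a difference, so the same
  derivative works. This allows passing between representatives that agree on the circle but differ
  elsewhere.\<close>

lemma C1_map_null_cong:
 assumes sY: "seminormed Y nY" and f: "C1_map X nX \<Omega> Y nY f"
  and g: "\<And>x. x \<in> \<Omega> \<Longrightarrow> g x \<in> Y \<and> nY (g x - f x) = 0"
  and uX: "\<And>x y. x \<in> \<Omega> \<Longrightarrow> y \<in> \<Omega> \<Longrightarrow> y - x \<in> X"
 shows "C1_map X nX \<Omega> Y nY g"
proof -
 note DY = seminormedD[OF sY]
 obtain D where "C1_derivative X nX \<Omega> Y nY f D" using f unfolding C1_map_iff by (rule exE)
 note D = C1_derivativeD[OF this]
 have le: "nY (g y - g x - D x (y - x)) \<le> nY (f y - f x - D x (y - x))" if xy: "x \<in> \<Omega>" "y \<in> \<Omega>" for x y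
 proof -
  have f: "f x \<in> Y" "f y \<in> Y" "D x (y - x) \<in> Y" using D(1) D(3)[OF xy(1) uX[OF xy]] xy by auto
  have g': "g x \<in> Y" "g y \<in> Y" "nY (g x - f x) = 0" "nY (g y - f y) = 0" using g xy by auto
  have "g y - g x - D x (y - x) = (f y - f x - D x (y - x)) + ((g y - f y) - (g x - f x))" by simp
  then have "nY (g y - g x - D x (y - x)) \<le> nY (f y - f x - D x (y - x)) + nY ((g y - f y) - (g x - f x))"
   using DY(3)[of "f y - f x - D x (y - x)" "(g y - f y) - (g x - f x)"] f g' DY(6) by simp
  moreover have "nY ((g y - f y) - (g x - f x)) \<le> 0"
   using seminormed_diff_le[OF sY, of "g y - f y" "g x - f x"] f g' DY(6) by simp
  ultimately show ?thesis by simp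
 qed
 show ?thesis
 proof (rule C1_mapI[of _ _ _ D])
  fix x e assume x: "x \<in> \<Omega>" and e: "(e :: real) > 0"
  show "\<exists>d>0. \<forall>y\<in>\<Omega>. nX (y - x) < d \<longrightarrow> nY (g y - g x - D x (y - x)) \<le> e * nX (y - x)"
   using D(5)[OF x e] le[OF x] by (meson order_trans)
 qed (use D g in auto)
qed

text \<open>A difference quotient of \<open>f\<close> in direction \<open>u\<close> with small step
  has seminorm at most half that of \<open>u\<close>, and the derivative differs from it by an
  arbitrarily small amount.\<close>

lemma C1_map_derivative_le_half:
 assumes sX: "seminormed X N" and Om: "\<Omega> \<subseteq> X"
  and op: "\<exists>d>0. \<forall>y\<in>X. N (y - x) < d \<longrightarrow> y \<in> \<Omega>"
  and lip: "\<And>x y. x \<in> \<Omega> \<Longrightarrow> y \<in> \<Omega> \<Longrightarrow> N (f x - f y) \<le> N (x - y) / 2"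
  and fX: "f ` \<Omega> \<subseteq> X" and D: "linear D" "D ` X \<subseteq> X"
  and der: "\<And>e. e > 0 \<Longrightarrow> \<exists>d>0. \<forall>y\<in>\<Omega>. N (y - x) < d \<longrightarrow> N (f y - f x - D (y - x)) \<le> e * N (y - x)"
  and x: "x \<in> \<Omega>" and u: "u \<in> X"
 shows "N (D u) \<le> N u / 2"
proof (rule field_le_epsilon)
 note DX = seminormedD[OF sX]
 have xX: "x \<in> X" using x Om by blast
 have Nu: "0 \<le> N u" using DX(2) u by blast
 fix e :: real assume e: "e > 0"
 define e' where "e' = e / (N u + 1)"
 have e': "e' > 0" and e'u: "e' * N u \<le> e" using e Nu by (auto simp: e'_def field_simps)
 obtain d1 where d1: "d1 > 0" "\<forall>y\<in>X. N (y - x) < d1 \<longrightarrow> y \<in> \<Omega>" using op by blast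
 obtain d2 where d2: "d2 > 0" "\<forall>y\<in>\<Omega>. N (y - x) < d2 \<longrightarrow> N (f y - f x - D (y - x)) \<le> e' * N (y - x)"
  using der[OF e'] by blast
 \<comment> \<open>The step is so short that \<open>x + h *\<^sub>R u\<close> lies in \<Omega> and
   in the range of the derivative estimate; the added 1 covers null vectors
   \<open>u\<close>.\<close>
 define h where "h = min d1 d2 / (2 * (N u + 1))"
 have h: "h > 0" using d1 d2 Nu by (simp add: h_def)
 have hN: "h * N u < min d1 d2"
 proof -
  have "h * N u \<le> h * (N u + 1)" using h by simp
  also have "\<dots> = min d1 d2 / 2" using Nu by (simp add: h_def field_simps)
  also have "\<dots> < min d1 d2" using min_less_iff_conj[of 0 d1 d2] d1(1) d2(1) by linarith
  finally show ?thesis .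
 qed
 define y where "y = x + h *\<^sub>R u"
 have yx: "y - x = h *\<^sub>R u" by (simp add: y_def)
 have yX: "y \<in> X" using DX(5,7) xX u y_def by blast
 have Nyx: "N (y - x) = h * N u" using DX(4)[OF u, of h] h by (simp add: yx)
 have y: "y \<in> \<Omega>" using d1 hN Nyx yX by auto
 have DX': "D v \<in> X" if "v \<in> X" for v using D(2) that by auto
 have m: "f y \<in> X" "f x \<in> X" "D (y - x) \<in> X" using fX x y DX' DX(6)[OF yX xX] by auto
 have "h * N (D u) = N (D (y - x))" using DX(4)[OF DX'[OF u], of h] h by (simp add: yx linear_scale[OF D(1)])
 also have "\<dots> = N ((f y - f x) - (f y - f x - D (y - x)))" by simp
 also have "\<dots> \<le> N (f y - f x) + N (f y - f x - D (y - x))"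
  using m DX(6) by (intro seminormed_diff_le[OF sX]) auto
 also have "\<dots> \<le> (h * N u) / 2 + e' * (h * N u)"
  using lip[OF y x] d2 y hN Nyx by (intro add_mono) auto
 finally have "h * N (D u) \<le> h * (N u / 2 + e' * N u)" by (simp add: algebra_simps)
 then have "N (D u) \<le> N u / 2 + e' * N u" using h by simp
 then show "N (D u) \<le> N u / 2 + e" using e'u by simp
qed

text \<open>Differentiating \<open>k = \<Lambda> t + \<Theta> k\<close> formally gives the linear
  equation Z = D\<Lambda> u + D\<Theta> Z, again a contraction because the derivative of \<Theta>
  has norm at most 1/2. No inverse function theorem in the seminormed space is involved. In the
  locale below the lemma differentiates the family of discs; in the criterion for local
  diffeomorphisms it differentiates a local inverse in a Euclidean space.\<close>

lemma C1_map_fixed_point: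
 fixes \<Lambda> :: "'e::euclidean_space \<Rightarrow> 'a::real_vector"
 assumes sX: "seminormed X N" and co: "seminorm_complete X N"
  and L: "C1_map UNIV norm U X N \<Lambda>" and Th: "C1_map X N \<Omega> X N \<Theta>" and Om: "\<Omega> \<subseteq> X"
  and op: "\<And>x. x \<in> \<Omega> \<Longrightarrow> \<exists>d>0. \<forall>y\<in>X. N (y - x) < d \<longrightarrow> y \<in> \<Omega>"
  and lip: "\<And>x y. x \<in> \<Omega> \<Longrightarrow> y \<in> \<Omega> \<Longrightarrow> N (\<Theta> x - \<Theta> y) \<le> N (x - y) / 2"
  and k: "\<And>t. t \<in> U \<Longrightarrow> k t \<in> \<Omega> \<and> N (k t - (\<Lambda> t + \<Theta> (k t))) = 0"
 shows "C1_map UNIV norm U X N k"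
proof -
 note DX = seminormedD[OF sX] and z0 = seminormed_zero[OF sX]
 obtain DL where "C1_derivative UNIV norm U X N \<Lambda> DL" using L unfolding C1_map_iff by (rule exE)
 note DL = C1_derivativeD[OF this]
 note DL = DL(1,2) DL(3)[OF _ UNIV_I] DL(5,6)
 obtain DT where "C1_derivative X N \<Omega> X N \<Theta> DT" using Th unfolding C1_map_iff by (rule exE)
 note DT = C1_derivativeD[OF this]
 note DTX = DT(3)
 have DTim: "DT x ` X \<subseteq> X" if "x \<in> \<Omega>" for x using DTX[OF that] by auto
 have Thim: "\<Theta> ` \<Omega> \<subseteq> X" using DT(1) by auto
 note DT = Thim DT(2) DTim DT(5,6)
 have half: "N (DT x u) \<le> N u / 2" if x: "x \<in> \<Omega>" and u: "u \<in> X" for x u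
  by (rule C1_map_derivative_le_half[OF sX Om op[OF x] lip DT(1) DT(2)[OF x] DT(3)[OF x] DT(4)[OF x] x u])
 have solve: "\<exists>z\<in>X. N (z - (b + DT x z)) = 0" if x: "x \<in> \<Omega>" and b: "b \<in> X" for x b
 proof -
  have "\<exists>z\<in>X. N (z - 0) < 2 * N b + 1 \<and> N (z - (b + DT x z)) = 0"
  proof (rule contraction_fixed_point[OF sX co])
   show "0 \<in> X" by (rule DX(8))
   show "b + DT x z \<in> X" if "z \<in> X" for z using DX(5) b DTX[OF x that] by blast
   show "N (b + DT x z - (b + DT x y)) \<le> N (z - y) / 2" if "z \<in> X" "y \<in> X" for z y
    using half[OF x DX(6)[OF that]] linear_diff[OF DT(2)[OF x], of z y] by simp
   show "N (b + DT x 0 - 0) < (2 * N b + 1) / 2" using linear_0[OF DT(2)[OF x]] by simp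
   show "0 < 2 * N b + 1" using DX(2)[OF b] by simp
  qed
  then show ?thesis by blast
 qed
 have kO: "k t \<in> \<Omega>" and kX: "k t \<in> X" and LX: "\<Lambda> t \<in> X" and ThX: "\<Theta> (k t) \<in> X" if "t \<in> U" for t
  using k[OF that] Om DL(1)[OF that] DT(1) by auto
 \<comment> \<open>The linear equation determines Z up to null vectors only, and an arbitrary choice
   for every direction would not be linear. So the choice is made on the finite basis of the
   parameter space and extended linearly.\<close>
 define kb where "kb t b = (SOME z. z \<in> X \<and> N (z - (DL t b + DT (k t) z)) = 0)" for t b
 have kb: "kb t b \<in> X" "N (kb t b - (DL t b + DT (k t) (kb t b))) = 0" if t: "t \<in> U" for t b
 proof -
  have "\<exists>z. z \<in> X \<and> N (z - (DL t b + DT (k t) z)) = 0" using solve[OF kO[OF t] DL(3)[OF t, of b]] by blast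
  from someI_ex[OF this] show "kb t b \<in> X" "N (kb t b - (DL t b + DT (k t) (kb t b))) = 0"
   by (auto simp: kb_def)
 qed
 define Dk where "Dk t u = (\<Sum>b\<in>Basis. (u \<bullet> b) *\<^sub>R kb t b)" for t u
 have sumle: "(\<Sum>b\<in>Basis. (u \<bullet> b) *\<^sub>R f b) \<in> X \<and>
   N (\<Sum>b\<in>Basis. (u \<bullet> b) *\<^sub>R f b) \<le> norm u * (\<Sum>b\<in>Basis. N (f b))"
  if f: "\<And>b. f b \<in> X" for u :: 'e and f
 proof -
  have 1: "(\<Sum>b\<in>Basis. (u \<bullet> b) *\<^sub>R f b) \<in> X \<and>
   N (\<Sum>b\<in>Basis. (u \<bullet> b) *\<^sub>R f b) \<le> (\<Sum>b\<in>Basis. N ((u \<bullet> b) *\<^sub>R f b))"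
   using f DX(7) by (intro seminormed_sum[OF sX]) auto
  have "(\<Sum>b\<in>Basis. N ((u \<bullet> b) *\<^sub>R f b)) \<le> (\<Sum>b\<in>Basis. norm u * N (f b))"
   using DX(2,4) f by (intro sum_mono) (auto intro!: mult_right_mono Basis_le_norm)
  then show ?thesis using 1 by (simp add: sum_distrib_left)
 qed
 have DkX: "Dk t u \<in> X" if "t \<in> U" for t u using sumle[of "kb t"] kb(1)[OF that] by (simp add: Dk_def)
 have linDk: "linear (Dk t)" for t
  by (rule linearI) (simp_all add: Dk_def inner_add_left scaleR_add_left sum.distrib scaleR_sum_right)
 have eqn: "N (Dk t u - (DL t u + DT (k t) (Dk t u))) = 0" if t: "t \<in> U" for t u
 proof -
  have "DL t u = DL t (\<Sum>b\<in>Basis. (u \<bullet> b) *\<^sub>R b)" by (simp add: euclidean_representation)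
  also have "\<dots> = (\<Sum>b\<in>Basis. (u \<bullet> b) *\<^sub>R DL t b)"
   by (simp add: linear_sum[OF DL(2)[OF t]] linear_scale[OF DL(2)[OF t]])
  finally have e: "Dk t u - (DL t u + DT (k t) (Dk t u)) =
    (\<Sum>b\<in>Basis. (u \<bullet> b) *\<^sub>R (kb t b - (DL t b + DT (k t) (kb t b))))"
   by (simp add: Dk_def linear_sum[OF DT(2)[OF kO[OF t]]] linear_scale[OF DT(2)[OF kO[OF t]]]
     sum_subtractf sum.distrib scaleR_diff_right scaleR_add_right)
  have mem: "kb t b - (DL t b + DT (k t) (kb t b)) \<in> X" for b
   using kb(1)[OF t] DL(3)[OF t] DTX[OF kO[OF t] kb(1)[OF t]] DX(5,6) by blast
  then have "N (Dk t u - (DL t u + DT (k t) (Dk t u))) \<le> 0"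
   using sumle[of "\<lambda>b. kb t b - (DL t b + DT (k t) (kb t b))" u] kb(2)[OF t] e by simp
  moreover have "Dk t u - (DL t u + DT (k t) (Dk t u)) \<in> X"
   using DkX[OF t] DL(3)[OF t] DTX[OF kO[OF t] DkX[OF t]] DX(5,6) by blast
  ultimately show ?thesis using DX(2) by force
 qed
 define nl where "nl t = k t - (\<Lambda> t + \<Theta> (k t))" for t
 have nl: "nl t \<in> X" "N (nl t) = 0" if "t \<in> U" for t
  using k[OF that] kX[OF that] LX[OF that] ThX[OF that] DX(5,6) by (auto simp: nl_def)
 have kdec: "k t = nl t + (\<Lambda> t + \<Theta> (k t))" for t by (simp add: nl_def)
 have klip: "N (k s - k t) \<le> 2 * N (\<Lambda> s - \<Lambda> t)" if s: "s \<in> U" and t: "t \<in> U" for s t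
 proof -
  have "k s - k t = (nl s - nl t) + ((\<Lambda> s - \<Lambda> t) + (\<Theta> (k s) - \<Theta> (k t)))"
   by (subst kdec[of s], subst kdec[of t]) simp
  then have "N (k s - k t) \<le> N (nl s - nl t) + N ((\<Lambda> s - \<Lambda> t) + (\<Theta> (k s) - \<Theta> (k t)))"
   using DX(3)[of "nl s - nl t" "(\<Lambda> s - \<Lambda> t) + (\<Theta> (k s) - \<Theta> (k t))"] nl LX ThX s t DX(5,6) by simp
  also have "N (nl s - nl t) \<le> 0" using seminormed_diff_le[OF sX nl(1)[OF s] nl(1)[OF t]] nl s t by simp
  also have "N ((\<Lambda> s - \<Lambda> t) + (\<Theta> (k s) - \<Theta> (k t))) \<le> N (\<Lambda> s - \<Lambda> t) + N (\<Theta> (k s) - \<Theta> (k t))"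
   using LX ThX s t DX(6) by (intro DX(3)) auto
  also have "N (\<Theta> (k s) - \<Theta> (k t)) \<le> N (k s - k t) / 2" using lip kO s t by blast
  finally show ?thesis by simp
 qed
 show ?thesis unfolding C1_map_def
 proof (intro conjI exI[of _ Dk] ballI allI impI)
  show "k ` U \<subseteq> X" using kX by auto
  fix t assume t: "t \<in> U"
  show "linear (Dk t)" by (rule linDk)
  show "Dk t ` UNIV \<subseteq> X" using DkX[OF t] by auto
  show "\<exists>K. \<forall>u\<in>UNIV. N (Dk t u) \<le> K * norm u"
   using sumle[of "kb t"] kb(1)[OF t]
   by (intro exI[of _ "\<Sum>b\<in>Basis. N (kb t b)"]) (auto simp: Dk_def mult.commute)
  obtain C d0 where C: "C > 0" "d0 > 0" "\<forall>s\<in>U. norm (s - t) < d0 \<longrightarrow> N (\<Lambda> s - \<Lambda> t) \<le> C * norm (s - t)"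
   using C1_map_locally_Lipschitz[OF seminormed_norm sX subset_UNIV L t] by blast
  have kC: "N (k s - k t) \<le> 2 * C * norm (s - t)" if "s \<in> U" "norm (s - t) < d0" for s
   using klip[OF that(1) t] C(3) that by fastforce
  have near: "\<exists>d'>0. d' \<le> d0 \<and> (\<forall>s\<in>U. norm (s - t) < d' \<longrightarrow> N (k s - k t) < d)" if d: "d > 0" for d :: real
  proof (intro exI[of _ "min d0 (d / (2 * C))"] conjI ballI impI)
   show "0 < min d0 (d / (2 * C))" using C d by simp
   fix s assume s: "s \<in> U" "norm (s - t) < min d0 (d / (2 * C))"
   have "2 * C * norm (s - t) < d" using s C by (simp add: pos_less_divide_eq mult.commute)
   then show "N (k s - k t) < d" using kC s by fastforce
  qed simp
  fix e :: real assume e: "e > 0"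
  show "\<exists>d>0. \<forall>s\<in>U. norm (s - t) < d \<longrightarrow> N (k s - k t - Dk t (s - t)) \<le> e * norm (s - t)"
  proof -
   obtain d1 where d1: "d1 > 0" "\<forall>s\<in>U. norm (s - t) < d1 \<longrightarrow> N (\<Lambda> s - \<Lambda> t - DL t (s - t)) \<le> e / 4 * norm (s - t)"
    using DL(4)[OF t, of "e / 4"] e by auto
   obtain d2 where d2: "d2 > 0" "\<forall>y\<in>\<Omega>. N (y - k t) < d2 \<longrightarrow>
     N (\<Theta> y - \<Theta> (k t) - DT (k t) (y - k t)) \<le> e / (8 * C) * N (y - k t)"
    using DT(4)[OF kO[OF t], of "e / (8 * C)"] e C by auto
   obtain d3 where d3: "d3 > 0" "d3 \<le> d0" "\<forall>s\<in>U. norm (s - t) < d3 \<longrightarrow> N (k s - k t) < d2"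
    using near[OF d2(1)] by blast
   show ?thesis
   proof (intro exI[of _ "min d1 d3"] conjI ballI impI)
    show "0 < min d1 d3" using d1 d3 by simp
    fix s assume s: "s \<in> U" "norm (s - t) < min d1 d3"
    define E where "E = k s - k t - Dk t (s - t)"
    define n2 where "n2 = Dk t (s - t) - (DL t (s - t) + DT (k t) (Dk t (s - t)))"
    define A where "A = \<Lambda> s - \<Lambda> t - DL t (s - t)"
    define B where "B = \<Theta> (k s) - \<Theta> (k t) - DT (k t) (k s - k t)"
    have ks: "k s - k t \<in> X" using kX s t DX(6) by blast
    have EX: "E \<in> X" using ks DkX[OF t] DX(6) unfolding E_def by blast
    have n2: "n2 \<in> X" "N n2 = 0" using eqn[OF t, of "s - t"] DkX[OF t] DL(3)[OF t] DTX[OF kO[OF t] DkX[OF t]] DX(5,6)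
     by (auto simp: n2_def)
    have AX: "A \<in> X" using LX s t DL(3)[OF t] DX(6) by (auto simp: A_def)
    have BX: "B \<in> X" using ThX s t DTX[OF kO[OF t] ks] DX(6) by (auto simp: B_def)
    have DE: "DT (k t) E \<in> X" using DTX[OF kO[OF t] EX] .
    have nn: "nl s - nl t \<in> X" "N (nl s - nl t) \<le> 0"
     using seminormed_diff_le[OF sX nl(1)[OF s(1)] nl(1)[OF t]] nl s t DX(6) by auto
    have "k s - k t = (nl s - nl t) + ((\<Lambda> s - \<Lambda> t) + (\<Theta> (k s) - \<Theta> (k t)))"
     by (subst kdec[of s], subst kdec[of t]) simp
    \<comment> \<open>\<open>E\<close> satisfies the linearised equation up to the Taylor remainders
      \<open>A\<close> of \<Lambda> and \<open>B\<close> of \<Theta> and up to null vectors; the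
      term \<open>DT (k t) E\<close> is absorbed on the left.\<close>
    then have "E = (nl s - nl t) + ((A + B) + (DT (k t) E - n2))"
     by (simp add: E_def A_def B_def n2_def linear_diff[OF DT(2)[OF kO[OF t]]])
    then have "N E \<le> N (nl s - nl t) + N ((A + B) + (DT (k t) E - n2))"
     using DX(3)[OF nn(1), of "(A + B) + (DT (k t) E - n2)"] AX BX DE n2 DX(5,6) by simp
    also have "N ((A + B) + (DT (k t) E - n2)) \<le> N (A + B) + N (DT (k t) E - n2)"
     using AX BX DE n2 DX(5,6) by (intro DX(3)) auto
    also have "N (A + B) \<le> N A + N B" using AX BX by (rule DX(3))
    also have "N (DT (k t) E - n2) \<le> N (DT (k t) E) + N n2" using DE n2(1) by (rule seminormed_diff_le[OF sX])
    also have "N (DT (k t) E) \<le> N E / 2" using half[OF kO[OF t] EX] .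
    finally have "N E \<le> 2 * N A + 2 * N B" using nn n2 by simp
    moreover have "N A \<le> e / 4 * norm (s - t)" using d1 s by (auto simp: A_def)
    moreover have "N B \<le> e / 4 * norm (s - t)"
    proof -
     have "N B \<le> e / (8 * C) * N (k s - k t)" using d2 d3 s kO[OF s(1)] by (auto simp: B_def)
     also have "\<dots> \<le> e / (8 * C) * (2 * C * norm (s - t))"
      using kC[OF s(1)] s d3 e C by (intro mult_left_mono) auto
     finally show ?thesis using C(1) by simp
    qed
    ultimately show "N (k s - k t - Dk t (s - t)) \<le> e * norm (s - t)" by (simp add: E_def)
   qed
  qed
  show "\<exists>d>0. \<forall>s\<in>U. norm (s - t) < d \<longrightarrow> (\<forall>u\<in>UNIV. N (Dk s u - Dk t u) \<le> e * norm u)"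
  proof -
   define M where "M = 1 + (\<Sum>b\<in>Basis. N (kb t b))"
   \<comment> \<open>Each basis column of the derivative changes by at most \<open>4 * c\<close>;
     summed over the basis this is e.\<close>
   define c where "c = e / (4 * DIM('e))"
   have M: "M > 0" "\<And>b. b \<in> Basis \<Longrightarrow> N (kb t b) \<le> M"
   proof -
    have nn: "N (kb t b) \<ge> 0" for b using DX(2) kb(1)[OF t] by blast
    then have "0 \<le> (\<Sum>b\<in>Basis. N (kb t b))" by (intro sum_nonneg) auto
    then show "M > 0" by (simp add: M_def)
    show "N (kb t b) \<le> M" if "b \<in> Basis" for b
     using member_le_sum[OF that, of "\<lambda>b. N (kb t b)"] nn by (simp add: M_def)
   qed
   have c: "c > 0" using e by (simp add: c_def)
   obtain d1 where d1: "d1 > 0" "\<forall>s\<in>U. norm (s - t) < d1 \<longrightarrow> (\<forall>u. N (DL s u - DL t u) \<le> c * norm u)"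
    using DL(5)[OF t c] by blast
   obtain d2 where d2: "d2 > 0" "\<forall>y\<in>\<Omega>. N (y - k t) < d2 \<longrightarrow> (\<forall>u\<in>X. N (DT y u - DT (k t) u) \<le> c / M * N u)"
    using DT(5)[OF kO[OF t], of "c / M"] c M by auto
   obtain d3 where d3: "d3 > 0" "\<forall>s\<in>U. norm (s - t) < d3 \<longrightarrow> N (k s - k t) < d2"
    using near[OF d2(1)] by blast
   show ?thesis
   proof (intro exI[of _ "min d1 d3"] conjI ballI impI)
    show "0 < min d1 d3" using d1 d3 by simp
    fix s u assume s: "s \<in> U" "norm (s - t) < min d1 d3"
    have Z: "N (kb s b - kb t b) \<le> 4 * c" if b: "b \<in> Basis" for b
    proof -
     define Z where "Z = kb s b - kb t b"
     define n1 where "n1 = kb s b - (DL s b + DT (k s) (kb s b))"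
     define n2 where "n2 = kb t b - (DL t b + DT (k t) (kb t b))"
     have kk: "kb s b \<in> X" "kb t b \<in> X" using kb(1) s t by auto
     have mem: "DT (k s) (kb s b) \<in> X" "DT (k t) (kb t b) \<in> X" "DT (k s) (kb t b) \<in> X"
      using DTX kO s t kk by auto
     have n: "n1 \<in> X" "n2 \<in> X" "N n1 = 0" "N n2 = 0"
      using kb(2)[OF s(1), of b] kb(2)[OF t, of b] kk mem DL(3) s t DX(5,6) by (auto simp: n1_def n2_def)
     have ZX: "Z \<in> X" using kk DX(6) by (simp add: Z_def)
     have DZ: "DT (k s) Z \<in> X" using DTX[OF kO[OF s(1)] ZX] .
     define P where "P = DL s b - DL t b"
     define R where "R = DT (k s) (kb t b) - DT (k t) (kb t b)"
     have PX: "P \<in> X" "R \<in> X" using DL(3) s t mem DX(6) by (auto simp: P_def R_def)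
     have "Z = (n1 - n2) + ((P + R) + DT (k s) Z)"
      by (simp add: Z_def n1_def n2_def P_def R_def linear_diff[OF DT(2)[OF kO[OF s(1)]]])
     then have "N Z \<le> N (n1 - n2) + N ((P + R) + DT (k s) Z)"
      using DX(3)[of "n1 - n2" "(P + R) + DT (k s) Z"] n PX DZ DX(5,6) by simp
     also have "N (n1 - n2) \<le> 0" using seminormed_diff_le[OF sX n(1,2)] n by simp
     also have "N ((P + R) + DT (k s) Z) \<le> N (P + R) + N (DT (k s) Z)" using PX DZ DX(5) by (intro DX(3)) auto
     also have "N (P + R) \<le> N P + N R" using PX by (rule DX(3))
     also have "N (DT (k s) Z) \<le> N Z / 2" using half[OF kO[OF s(1)] ZX] .
     finally have "N Z \<le> 2 * N P + 2 * N R" by simp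
     moreover have "N P \<le> c" using d1(2)[rule_format, OF s(1), of b] s(2) b by (simp add: P_def)
     moreover have "N R \<le> c"
     proof -
      have "N R \<le> c / M * N (kb t b)" using d2 d3 s kO[OF s(1)] kk by (auto simp: R_def)
      also have "\<dots> \<le> c / M * M" using M c b by (intro mult_left_mono) auto
      finally show ?thesis using M(1) by simp
     qed
     ultimately show ?thesis by (simp add: Z_def)
    qed
    have "N (Dk s u - Dk t u) = N (\<Sum>b\<in>Basis. (u \<bullet> b) *\<^sub>R (kb s b - kb t b))"
     by (simp add: Dk_def sum_subtractf scaleR_diff_right)
    also have "\<dots> \<le> norm u * (\<Sum>b\<in>Basis. N (kb s b - kb t b))"
     using sumle[of "\<lambda>b. kb s b - kb t b" u] kb(1) s t DX(6) by auto
    also have "\<dots> \<le> norm u * (\<Sum>b\<in>(Basis::'e set). 4 * c)"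
     using Z by (intro mult_left_mono sum_mono) auto
    also have "\<dots> = e * norm u" by (simp add: c_def)
    finally show "N (Dk s u - Dk t u) \<le> e * norm u" .
   qed
  qed
 qed
qed

subsection \<open>Hoelder spaces\<close>

lemma holder_space_iff: "f \<in> \<H> \<alpha> \<longleftrightarrow>
  (\<exists>C\<ge>0. \<forall>\<xi>\<in>sphere 0 1. \<forall>\<eta>\<in>sphere 0 1. norm (f \<xi> - f \<eta>) \<le> C * dist \<xi> \<eta> powr \<alpha>)"
proof
 assume "f \<in> \<H> \<alpha>"
 then obtain C where C: "\<forall>\<xi>\<in>sphere 0 1. \<forall>\<eta>\<in>sphere 0 1. norm (f \<xi> - f \<eta>) \<le> C * dist \<xi> \<eta> powr \<alpha>"
  by (auto simp: holder_space_def)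
 have "norm (f \<xi> - f \<eta>) \<le> \<bar>C\<bar> * dist \<xi> \<eta> powr \<alpha>" if "\<xi> \<in> sphere 0 1" "\<eta> \<in> sphere 0 1" for \<xi> \<eta>
  using C[rule_format, OF that] mult_right_mono[of C "\<bar>C\<bar>" "dist \<xi> \<eta> powr \<alpha>"]
  by (meson abs_ge_self order_trans powr_ge_zero)
 then show "\<exists>C\<ge>0. \<forall>\<xi>\<in>sphere 0 1. \<forall>\<eta>\<in>sphere 0 1. norm (f \<xi> - f \<eta>) \<le> C * dist \<xi> \<eta> powr \<alpha>"
  by (intro exI[of _ "\<bar>C\<bar>"]) auto
qed (auto simp: holder_space_def)

lemma dist_sphere_powr_le:
 assumes "0 < \<alpha>" "\<xi> \<in> sphere 0 (1::real)" "\<eta> \<in> sphere (0::complex) 1"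
 shows "dist \<xi> \<eta> powr \<alpha> \<le> 2 powr \<alpha>"
proof -
 have "dist \<xi> \<eta> \<le> 2" using dist_triangle2[of \<xi> \<eta> 0] assms by (simp add: dist_norm norm_minus_commute)
 then show ?thesis using assms by (intro powr_mono2) auto
qed

lemma holderI:
 assumes a: "0 < \<alpha>" and b: "0 \<le> b" and sup: "\<And>\<xi>. \<xi> \<in> sphere 0 1 \<Longrightarrow> norm (f \<xi>) \<le> a"
  and hol: "\<And>\<xi> \<eta>. \<xi> \<in> sphere 0 1 \<Longrightarrow> \<eta> \<in> sphere 0 1 \<Longrightarrow> norm (f \<xi> - f \<eta>) \<le> b * dist \<xi> \<eta> powr \<alpha>"
 shows "f \<in> \<H> \<alpha>" "\<N> \<alpha> f \<le> a + b"
proof -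
 show "f \<in> \<H> \<alpha>" using hol b by (auto simp: holder_space_iff)
 have ne: "(1::complex) \<in> sphere 0 1" "(-1::complex) \<in> sphere 0 1" by auto
 have "(SUP \<xi>\<in>sphere 0 1. norm (f \<xi>)) \<le> a" using sup ne by (intro cSUP_least) auto
 moreover have "(SUP (\<xi>, \<eta>)\<in>{(\<xi>, \<eta>). \<xi> \<in> sphere 0 1 \<and> \<eta> \<in> sphere 0 1 \<and> \<xi> \<noteq> \<eta>}.
    norm (f \<xi> - f \<eta>) / dist \<xi> \<eta> powr \<alpha>) \<le> b"
 proof (rule cSUP_least)
  show "{(\<xi>, \<eta>). \<xi> \<in> sphere 0 1 \<and> \<eta> \<in> sphere 0 1 \<and> \<xi> \<noteq> (\<eta>::complex)} \<noteq> {}"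
  proof -
   have "(1, -1) \<in> {(\<xi>, \<eta>). \<xi> \<in> sphere 0 1 \<and> \<eta> \<in> sphere 0 1 \<and> \<xi> \<noteq> (\<eta>::complex)}" using ne by simp
   then show ?thesis by blast
  qed
 qed (use hol in \<open>auto simp: divide_le_eq\<close>)
 ultimately show "\<N> \<alpha> f \<le> a + b" by (simp add: holder_norm_def)
qed

text \<open>The fourth fact splits the norm into a bound \<open>A\<close> for the values and a bound
  \<open>B\<close> for the Hoelder quotients. Sums, products and linear images are estimated on the
  two parts separately and then reassembled with \<open>holderI\<close>, which keeps the constants
  multiplicative.\<close>

lemma holderD:
 assumes a: "0 < \<alpha>" and f: "f \<in> \<H> \<alpha>"
 shows "0 \<le> \<N> \<alpha> f"
  and "\<And>\<xi>. \<xi> \<in> sphere 0 1 \<Longrightarrow> norm (f \<xi>) \<le> \<N> \<alpha> f"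
  and "\<And>\<xi> \<eta>. \<xi> \<in> sphere 0 1 \<Longrightarrow> \<eta> \<in> sphere 0 1 \<Longrightarrow>
   norm (f \<xi> - f \<eta>) \<le> \<N> \<alpha> f * dist \<xi> \<eta> powr \<alpha>"
  and "\<exists>A B. 0 \<le> A \<and> 0 \<le> B \<and> \<N> \<alpha> f = A + B \<and>
   (\<forall>\<xi>\<in>sphere 0 1. norm (f \<xi>) \<le> A) \<and>
   (\<forall>\<xi>\<in>sphere 0 1. \<forall>\<eta>\<in>sphere 0 1. norm (f \<xi> - f \<eta>) \<le> B * dist \<xi> \<eta> powr \<alpha>)"
proof -
 obtain C where C: "C \<ge> 0" "\<forall>\<xi>\<in>sphere 0 1. \<forall>\<eta>\<in>sphere 0 1. norm (f \<xi> - f \<eta>) \<le> C * dist \<xi> \<eta> powr \<alpha>"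
  using f by (auto simp: holder_space_iff)
 have ne: "(1::complex) \<in> sphere 0 1" "(-1::complex) \<in> sphere 0 1" by auto
 \<comment> \<open>The suprema in \<open>holder_norm\<close> carry information only for sets that
   are bounded above; for the values this follows from the Hoelder condition because the circle has
   diameter 2.\<close>
 have b1: "norm (f \<xi>) \<le> norm (f 1) + C * 2 powr \<alpha>" if z: "\<xi> \<in> sphere 0 1" for \<xi>
 proof -
  have "norm (f \<xi>) \<le> norm (f 1) + norm (f \<xi> - f 1)" by (metis norm_triangle_sub)
  also have "norm (f \<xi> - f 1) \<le> C * dist \<xi> 1 powr \<alpha>" using C z ne by blast
  also have "\<dots> \<le> C * 2 powr \<alpha>" using C dist_sphere_powr_le[OF a z ne(1)] by (intro mult_left_mono) auto
  finally show ?thesis by simp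
 qed
 define A where "A = (SUP \<xi>\<in>sphere 0 1. norm (f \<xi>))"
 have bdd1: "bdd_above ((\<lambda>\<xi>. norm (f \<xi>)) ` sphere 0 1)" using b1 by (auto intro!: bdd_aboveI2)
 have A: "norm (f \<xi>) \<le> A" if "\<xi> \<in> sphere 0 1" for \<xi>
  using cSUP_upper[OF that bdd1] by (simp add: A_def)
 define S where "S = {(\<xi>, \<eta>). \<xi> \<in> sphere 0 1 \<and> \<eta> \<in> sphere 0 1 \<and> \<xi> \<noteq> (\<eta>::complex)}"
 define B where "B = (SUP (\<xi>, \<eta>)\<in>S. norm (f \<xi> - f \<eta>) / dist \<xi> \<eta> powr \<alpha>)"
 have bdd2: "bdd_above ((\<lambda>(\<xi>, \<eta>). norm (f \<xi> - f \<eta>) / dist \<xi> \<eta> powr \<alpha>) ` S)"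
  using C by (intro bdd_aboveI2[of _ _ C]) (auto simp: S_def divide_le_eq)
 have B': "norm (f \<xi> - f \<eta>) / dist \<xi> \<eta> powr \<alpha> \<le> B" if "(\<xi>, \<eta>) \<in> S" for \<xi> \<eta>
  using cSUP_upper[OF that bdd2] by (simp add: B_def)
 have B0: "0 \<le> B"
 proof -
  have "(1, -1) \<in> S" using ne by (simp add: S_def)
  moreover have "0 \<le> norm (f 1 - f (-1)) / dist 1 (-1::complex) powr \<alpha>" by simp
  ultimately show ?thesis using B' order_trans by blast
 qed
 have B: "norm (f \<xi> - f \<eta>) \<le> B * dist \<xi> \<eta> powr \<alpha>" if "\<xi> \<in> sphere 0 1" "\<eta> \<in> sphere 0 1" for \<xi> \<eta>
  using B'[of \<xi> \<eta>] that B0 by (cases "\<xi> = \<eta>") (auto simp: S_def divide_le_eq)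
 have A0: "0 \<le> A" using A[OF ne(1)] norm_ge_zero order_trans by blast
 have N: "\<N> \<alpha> f = A + B" by (simp add: holder_norm_def A_def B_def S_def)
 show "0 \<le> \<N> \<alpha> f" using N A0 B0 by simp
 show "norm (f \<xi>) \<le> \<N> \<alpha> f" if "\<xi> \<in> sphere 0 1" for \<xi> using A[OF that] N B0 by simp
 show "norm (f \<xi> - f \<eta>) \<le> \<N> \<alpha> f * dist \<xi> \<eta> powr \<alpha>"
  if "\<xi> \<in> sphere 0 1" "\<eta> \<in> sphere 0 1" for \<xi> \<eta>
 proof -
  have "B * dist \<xi> \<eta> powr \<alpha> \<le> \<N> \<alpha> f * dist \<xi> \<eta> powr \<alpha>"
   using N A0 by (intro mult_right_mono) auto
  then show ?thesis using B[OF that] by linarith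
 qed
 show "\<exists>A B. 0 \<le> A \<and> 0 \<le> B \<and> \<N> \<alpha> f = A + B \<and>
   (\<forall>\<xi>\<in>sphere 0 1. norm (f \<xi>) \<le> A) \<and>
   (\<forall>\<xi>\<in>sphere 0 1. \<forall>\<eta>\<in>sphere 0 1. norm (f \<xi> - f \<eta>) \<le> B * dist \<xi> \<eta> powr \<alpha>)"
  using A B A0 B0 N by blast
qed

lemma holder_norm_cong:
 assumes "\<And>\<xi>. \<xi> \<in> sphere 0 1 \<Longrightarrow> f \<xi> = g \<xi>"
 shows "\<N> \<alpha> f = \<N> \<alpha> g" "f \<in> \<H> \<alpha> \<longleftrightarrow> g \<in> \<H> \<alpha>"
proof -
 have "(SUP \<xi>\<in>sphere 0 1. norm (f \<xi>)) = (SUP \<xi>\<in>sphere 0 1. norm (g \<xi>))"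
  by (intro SUP_cong) (use assms in auto)
 moreover have "(SUP (\<xi>, \<eta>)\<in>{(\<xi>, \<eta>). \<xi> \<in> sphere 0 1 \<and> \<eta> \<in> sphere 0 1 \<and> \<xi> \<noteq> \<eta>}.
    norm (f \<xi> - f \<eta>) / dist \<xi> \<eta> powr \<alpha>) =
   (SUP (\<xi>, \<eta>)\<in>{(\<xi>, \<eta>). \<xi> \<in> sphere 0 1 \<and> \<eta> \<in> sphere 0 1 \<and> \<xi> \<noteq> \<eta>}.
    norm (g \<xi> - g \<eta>) / dist \<xi> \<eta> powr \<alpha>)"
  by (intro SUP_cong) (use assms in auto)
 ultimately show "\<N> \<alpha> f = \<N> \<alpha> g" by (simp only: holder_norm_def)
 show "f \<in> \<H> \<alpha> \<longleftrightarrow> g \<in> \<H> \<alpha>" using assms by (simp add: holder_space_def)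
qed

lemma seminormed_holder:
 assumes a: "0 < \<alpha>"
 shows "seminormed (\<H> \<alpha> :: (complex \<Rightarrow> 'b::real_normed_vector) set) (\<N> \<alpha>)"
proof -
 have add: "f + g \<in> \<H> \<alpha> \<and> \<N> \<alpha> (f + g) \<le> \<N> \<alpha> f + \<N> \<alpha> g"
  if f: "f \<in> \<H> \<alpha>" and g: "g \<in> \<H> \<alpha>" for f g :: "complex \<Rightarrow> 'b"
 proof -
  obtain A B where 1: "0 \<le> A" "0 \<le> B" "\<N> \<alpha> f = A + B" "\<forall>\<xi>\<in>sphere 0 1. norm (f \<xi>) \<le> A"
   "\<forall>\<xi>\<in>sphere 0 1. \<forall>\<eta>\<in>sphere 0 1. norm (f \<xi> - f \<eta>) \<le> B * dist \<xi> \<eta> powr \<alpha>"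
   using holderD(4)[OF a f] by blast
  obtain A' B' where 2: "0 \<le> A'" "0 \<le> B'" "\<N> \<alpha> g = A' + B'" "\<forall>\<xi>\<in>sphere 0 1. norm (g \<xi>) \<le> A'"
   "\<forall>\<xi>\<in>sphere 0 1. \<forall>\<eta>\<in>sphere 0 1. norm (g \<xi> - g \<eta>) \<le> B' * dist \<xi> \<eta> powr \<alpha>"
   using holderD(4)[OF a g] by blast
  have s: "norm ((f + g) \<xi>) \<le> A + A'" if "\<xi> \<in> sphere 0 1" for \<xi>
   using 1(4) 2(4) that norm_triangle_mono[of "f \<xi>" A "g \<xi>" A'] by simp
  have h: "norm ((f + g) \<xi> - (f + g) \<eta>) \<le> (B + B') * dist \<xi> \<eta> powr \<alpha>"
   if "\<xi> \<in> sphere 0 1" "\<eta> \<in> sphere 0 1" for \<xi> \<eta>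
  proof -
   have "norm ((f \<xi> - f \<eta>) + (g \<xi> - g \<eta>)) \<le> B * dist \<xi> \<eta> powr \<alpha> + B' * dist \<xi> \<eta> powr \<alpha>"
    using 1(5) 2(5) that by (intro norm_triangle_mono) auto
   then show ?thesis by (simp add: algebra_simps)
  qed
  have "0 \<le> B + B'" using 1 2 by simp
  then have "f + g \<in> \<H> \<alpha>" "\<N> \<alpha> (f + g) \<le> (A + A') + (B + B')"
   using holderI[where f="f + g", OF a _ s h] by blast+
  then show ?thesis using 1(3) 2(3) by linarith
 qed
 have scale: "c *\<^sub>R f \<in> \<H> \<alpha> \<and> \<N> \<alpha> (c *\<^sub>R f) \<le> \<bar>c\<bar> * \<N> \<alpha> f"
  if f: "f \<in> \<H> \<alpha>" for f :: "complex \<Rightarrow> 'b" and c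
 proof -
  obtain A B where 1: "0 \<le> A" "0 \<le> B" "\<N> \<alpha> f = A + B" "\<forall>\<xi>\<in>sphere 0 1. norm (f \<xi>) \<le> A"
   "\<forall>\<xi>\<in>sphere 0 1. \<forall>\<eta>\<in>sphere 0 1. norm (f \<xi> - f \<eta>) \<le> B * dist \<xi> \<eta> powr \<alpha>"
   using holderD(4)[OF a f] by blast
  have s: "norm ((c *\<^sub>R f) \<xi>) \<le> \<bar>c\<bar> * A" if "\<xi> \<in> sphere 0 1" for \<xi>
   using 1 that by (simp add: scaleR_fun_def mult_left_mono)
  have h: "norm ((c *\<^sub>R f) \<xi> - (c *\<^sub>R f) \<eta>) \<le> (\<bar>c\<bar> * B) * dist \<xi> \<eta> powr \<alpha>"
   if "\<xi> \<in> sphere 0 1" "\<eta> \<in> sphere 0 1" for \<xi> \<eta>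
  proof -
   have "norm ((c *\<^sub>R f) \<xi> - (c *\<^sub>R f) \<eta>) = \<bar>c\<bar> * norm (f \<xi> - f \<eta>)"
    by (simp add: scaleR_fun_def flip: scaleR_diff_right)
   also have "\<dots> \<le> \<bar>c\<bar> * (B * dist \<xi> \<eta> powr \<alpha>)" using 1 that by (intro mult_left_mono) auto
   finally show ?thesis by simp
  qed
  have "0 \<le> \<bar>c\<bar> * B" using 1 by simp
  then have "c *\<^sub>R f \<in> \<H> \<alpha>" "\<N> \<alpha> (c *\<^sub>R f) \<le> \<bar>c\<bar> * A + \<bar>c\<bar> * B"
   using holderI[where f="c *\<^sub>R f", OF a _ s h] by blast+
  then show ?thesis using 1(3) by (simp add: distrib_left)
 qed
 have zero: "(0 :: complex \<Rightarrow> 'b) \<in> \<H> \<alpha>" by (auto simp: holder_space_def intro!: exI[of _ 0])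
 have eq: "\<N> \<alpha> (c *\<^sub>R f) = \<bar>c\<bar> * \<N> \<alpha> f" if f: "f \<in> \<H> \<alpha>" for f :: "complex \<Rightarrow> 'b" and c
 proof (cases "c = 0")
  case True
  then show ?thesis using scale[OF f, of c] holderD(1)[OF a conjunct1[OF scale[OF f, of c]]] by simp
 next
  case False
  \<comment> \<open>Homogeneity needs the reverse inequality, which is the inequality already shown
    applied to the inverse scalar.\<close>
  have "\<N> \<alpha> f = \<N> \<alpha> (inverse c *\<^sub>R (c *\<^sub>R f))" using False by simp
  also have "\<dots> \<le> \<bar>inverse c\<bar> * \<N> \<alpha> (c *\<^sub>R f)" using scale[of "c *\<^sub>R f" "inverse c"] scale[OF f, of c] by blast
  finally have "\<bar>c\<bar> * \<N> \<alpha> f \<le> \<N> \<alpha> (c *\<^sub>R f)"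
   using False by (simp add: field_simps abs_inverse)
  then show ?thesis using scale[OF f, of c] by simp
 qed
 show ?thesis unfolding seminormed_def
 proof (intro conjI ballI allI)
  show "subspace (\<H> \<alpha> :: (complex \<Rightarrow> 'b) set)"
   unfolding subspace_def using zero add scale by blast
 qed (use add eq holderD(1)[OF a] in blast)+
qed

text \<open>The values converge pointwise on the circle because they are dominated by the norm. The
  bounds for the values and for the Hoelder quotients of \<open>s n - s m\<close> survive the
  pointwise limit in m, so the convergence is in norm.\<close>

lemma seminorm_complete_holder:
 assumes a: "0 < \<alpha>"
 shows "seminorm_complete (\<H> \<alpha> :: (complex \<Rightarrow> 'b::banach) set) (\<N> \<alpha>)"
 unfolding seminorm_complete_def
proof (intro allI impI)
 fix s :: "nat \<Rightarrow> complex \<Rightarrow> 'b" and C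
 assume s: "\<forall>n. s n \<in> \<H> \<alpha> \<and> \<N> \<alpha> (s (Suc n) - s n) \<le> C / 2 ^ n"
 note sn = seminormed_holder[OF a, where 'b='b]
 have sX: "s n \<in> \<H> \<alpha>" for n using s by blast
 have dX: "s m - s n \<in> \<H> \<alpha>" for m n using seminormedD(6)[OF sn sX sX] .
 \<comment> \<open>The right-hand side is exactly the sum of \<open>C / 2 ^ i\<close> over n \<le> i
   < n + k; in this telescoped form the induction closes without loss.\<close>
 have dec: "\<N> \<alpha> (s (n + k) - s n) \<le> 2 * C / 2 ^ n - 2 * C / 2 ^ (n + k)" for n k
 proof (induction k)
  case 0
  show ?case unfolding add_0_right diff_self seminormed_zero[OF sn] by simp
 next
  case (Suc k)
  note IH = Suc
  have "\<N> \<alpha> (s (n + Suc k) - s n) \<le> \<N> \<alpha> (s (Suc (n + k)) - s (n + k)) + \<N> \<alpha> (s (n + k) - s n)"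
   using seminormed_triangle[OF sn sX sX sX] by simp
  also have "\<dots> \<le> C / 2 ^ (n + k) + (2 * C / 2 ^ n - 2 * C / 2 ^ (n + k))" by (intro add_mono IH s[rule_format, THEN conjunct2])
  also have "\<dots> = 2 * C / 2 ^ n - 2 * C / 2 ^ (n + Suc k)" by simp
  finally show ?case .
 qed
 have C: "0 \<le> C" using s[rule_format, of 0] holderD(1)[OF a dX[of 1 0]] by simp
 have N: "\<N> \<alpha> (s m - s n) \<le> 2 * C / 2 ^ n" if "n \<le> m" for m n
 proof -
  have "0 \<le> 2 * C / 2 ^ m" using C by simp
  then show ?thesis using dec[of n "m - n"] that by simp
 qed
 have conv: "\<exists>l. (\<lambda>n. s n \<xi>) \<longlonglongrightarrow> l" if z: "\<xi> \<in> sphere 0 1" for \<xi>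
 proof -
  have "norm (s (Suc n) \<xi> - s n \<xi>) \<le> C / 2 ^ n" for n
   using holderD(2)[OF a dX z, of "Suc n" n] s[rule_format, of n] by simp
  then have "\<forall>n. s n \<xi> \<in> UNIV \<and> norm (s (Suc n) \<xi> - s n \<xi>) \<le> C / 2 ^ n" by simp
  with seminorm_complete_norm[where 'a='b, unfolded seminorm_complete_def, THEN spec, of "\<lambda>n. s n \<xi>", THEN spec, of C]
  obtain l where "(\<lambda>n. norm (s n \<xi> - l)) \<longlonglongrightarrow> 0" by (elim impE bexE)
  then have "(\<lambda>n. s n \<xi>) \<longlonglongrightarrow> l" by (rule LIM_zero_cancel[OF tendsto_norm_zero_cancel])
  then show ?thesis by (rule exI)
 qed
 define g where "g \<xi> = lim (\<lambda>n. s n \<xi>)" for \<xi>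
 have g: "(\<lambda>n. s n \<xi>) \<longlonglongrightarrow> g \<xi>" if "\<xi> \<in> sphere 0 1" for \<xi>
  using conv[OF that] by (auto simp: g_def limI)
 have 1: "norm ((s n - g) \<xi>) \<le> 2 * C / 2 ^ n" if z: "\<xi> \<in> sphere 0 1" for \<xi> n
 proof (rule tendsto_upperbound)
  show "(\<lambda>m. norm (s n \<xi> - s m \<xi>)) \<longlonglongrightarrow> norm ((s n - g) \<xi>)"
   using g[OF z] by (auto intro!: tendsto_intros)
  show "\<forall>\<^sub>F m in sequentially. norm (s n \<xi> - s m \<xi>) \<le> 2 * C / 2 ^ n"
  proof (rule eventually_sequentiallyI[of n])
   fix m assume "n \<le> m"
   then show "norm (s n \<xi> - s m \<xi>) \<le> 2 * C / 2 ^ n"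
    using holderD(2)[OF a dX z, of m n] N[of n m] by (simp add: norm_minus_commute)
  qed
 qed simp
 have 2: "norm ((s n - g) \<xi> - (s n - g) \<eta>) \<le> 2 * C / 2 ^ n * dist \<xi> \<eta> powr \<alpha>"
  if z: "\<xi> \<in> sphere 0 1" "\<eta> \<in> sphere 0 1" for \<xi> \<eta> n
 proof (rule tendsto_upperbound)
  show "(\<lambda>m. norm ((s n \<xi> - s m \<xi>) - (s n \<eta> - s m \<eta>))) \<longlonglongrightarrow> norm ((s n - g) \<xi> - (s n - g) \<eta>)"
   using g[OF z(1)] g[OF z(2)] by (auto intro!: tendsto_intros)
  show "\<forall>\<^sub>F m in sequentially. norm ((s n \<xi> - s m \<xi>) - (s n \<eta> - s m \<eta>)) \<le> 2 * C / 2 ^ n * dist \<xi> \<eta> powr \<alpha>"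
  proof (rule eventually_sequentiallyI[of n])
   fix m assume m: "n \<le> m"
   have "norm ((s n \<xi> - s m \<xi>) - (s n \<eta> - s m \<eta>)) = norm ((s m - s n) \<xi> - (s m - s n) \<eta>)"
    by (simp add: norm_minus_commute algebra_simps)
   also have "\<dots> \<le> \<N> \<alpha> (s m - s n) * dist \<xi> \<eta> powr \<alpha>" using holderD(3)[OF a dX z] .
   also have "\<dots> \<le> 2 * C / 2 ^ n * dist \<xi> \<eta> powr \<alpha>" using N[OF m] by (intro mult_right_mono) auto
   finally show "norm ((s n \<xi> - s m \<xi>) - (s n \<eta> - s m \<eta>)) \<le> 2 * C / 2 ^ n * dist \<xi> \<eta> powr \<alpha>" .
  qed
 qed simp
 have 3: "s n - g \<in> \<H> \<alpha>" "\<N> \<alpha> (s n - g) \<le> 2 * C / 2 ^ n + 2 * C / 2 ^ n" for n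
 proof -
  have "0 \<le> 2 * C / 2 ^ n" using C by simp
  then show "s n - g \<in> \<H> \<alpha>"
   "\<N> \<alpha> (s n - g) \<le> 2 * C / 2 ^ n + 2 * C / 2 ^ n"
   using holderI[where f="s n - g", OF a _ 1 2] by blast+
 qed
 have gX: "g \<in> \<H> \<alpha>" using seminormedD(6)[OF sn sX 3(1), of 0 0] by simp
 have "(\<lambda>n. \<N> \<alpha> (s n - g)) \<longlonglongrightarrow> 0"
 proof (rule tendsto_sandwich[OF _ _ tendsto_const])
  show "\<forall>\<^sub>F n in sequentially. 0 \<le> \<N> \<alpha> (s n - g)" using holderD(1)[OF a 3(1)] by simp
  show "\<forall>\<^sub>F n in sequentially. \<N> \<alpha> (s n - g) \<le> 4 * C * (1/2) ^ n"
   using 3(2) by (simp add: power_divide)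
  show "(\<lambda>n. 4 * C * (1/2) ^ n) \<longlonglongrightarrow> 0"
   by (intro tendsto_mult_right_zero LIMSEQ_realpow_zero) auto
 qed
 then show "\<exists>x\<in>\<H> \<alpha>. (\<lambda>n. \<N> \<alpha> (s n - x)) \<longlonglongrightarrow> 0" using gX by blast
qed

lemma holder_null:
 assumes "0 < \<alpha>" "f \<in> \<H> \<alpha>" "g \<in> \<H> \<alpha>"
 shows "\<N> \<alpha> (f - g) = 0 \<longleftrightarrow> (\<forall>\<xi>\<in>sphere 0 1. f \<xi> = g \<xi>)"
proof
 assume "\<N> \<alpha> (f - g) = 0"
 then show "\<forall>\<xi>\<in>sphere 0 1. f \<xi> = g \<xi>"
  using holderD(2)[OF assms(1) seminormedD(6)[OF seminormed_holder[OF assms(1)] assms(2,3)]] by force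
next
 assume "\<forall>\<xi>\<in>sphere 0 1. f \<xi> = g \<xi>"
 then have "\<N> \<alpha> (f - g) = \<N> \<alpha> (0 :: complex \<Rightarrow> 'a)" by (intro holder_norm_cong) simp
 then show "\<N> \<alpha> (f - g) = 0" using seminormed_zero[OF seminormed_holder[OF assms(1)]] by metis
qed

lemma holder_compose_bounded_linear:
 assumes a: "0 < \<alpha>" and f: "f \<in> \<H> \<alpha>" and L: "linear L" and K: "0 \<le> K" "\<And>x. norm (L x) \<le> K * norm x"
 shows "(\<lambda>\<xi>. L (f \<xi>)) \<in> \<H> \<alpha>" "\<N> \<alpha> (\<lambda>\<xi>. L (f \<xi>)) \<le> K * \<N> \<alpha> f"
proof -
 obtain A B where 1: "0 \<le> A" "0 \<le> B" "\<N> \<alpha> f = A + B" "\<forall>\<xi>\<in>sphere 0 1. norm (f \<xi>) \<le> A"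
  "\<forall>\<xi>\<in>sphere 0 1. \<forall>\<eta>\<in>sphere 0 1. norm (f \<xi> - f \<eta>) \<le> B * dist \<xi> \<eta> powr \<alpha>"
  using holderD(4)[OF a f] by blast
 have s: "norm (L (f \<xi>)) \<le> K * A" if "\<xi> \<in> sphere 0 1" for \<xi>
  using K(2)[of "f \<xi>"] mult_left_mono[OF 1(4)[rule_format, OF that] K(1)] by linarith
 have h: "norm (L (f \<xi>) - L (f \<eta>)) \<le> (K * B) * dist \<xi> \<eta> powr \<alpha>"
  if "\<xi> \<in> sphere 0 1" "\<eta> \<in> sphere 0 1" for \<xi> \<eta>
  using K(2)[of "f \<xi> - f \<eta>"] mult_left_mono[OF 1(5)[rule_format, OF that] K(1)]
  by (simp add: linear_diff[OF L])
 have "0 \<le> K * B" using 1 K by simp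
 from holderI[OF a this s h] show "(\<lambda>\<xi>. L (f \<xi>)) \<in> \<H> \<alpha>"
  "\<N> \<alpha> (\<lambda>\<xi>. L (f \<xi>)) \<le> K * \<N> \<alpha> f"
  using 1(3) by (simp_all add: distrib_left)
qed

text \<open>The difference of the products is split as f(\<xi>)(g(\<xi>) - g(\<eta>)) + (f(\<xi>) -
  f(\<eta>))g(\<eta>). The resulting AA' + AB' + BA' is at most (A + B)(A' + B'), so the norm is
  submultiplicative with just the constant of the bilinear map.\<close>

lemma holder_mult:
 fixes prod :: "'b::real_normed_vector \<Rightarrow> 'c::real_normed_vector \<Rightarrow> 'd::real_normed_vector"
 assumes a: "0 < \<alpha>" and f: "f \<in> \<H> \<alpha>" and g: "g \<in> \<H> \<alpha>"
  and b: "bounded_bilinear prod" and K: "0 \<le> K" "\<And>x y. norm (prod x y) \<le> K * norm x * norm y"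
 shows "(\<lambda>\<xi>. prod (f \<xi>) (g \<xi>)) \<in> \<H> \<alpha>"
  "\<N> \<alpha> (\<lambda>\<xi>. prod (f \<xi>) (g \<xi>)) \<le> K * \<N> \<alpha> f * \<N> \<alpha> g"
proof -
 interpret bounded_bilinear prod by fact
 obtain A B where 1: "0 \<le> A" "0 \<le> B" "\<N> \<alpha> f = A + B" "\<forall>\<xi>\<in>sphere 0 1. norm (f \<xi>) \<le> A"
  "\<forall>\<xi>\<in>sphere 0 1. \<forall>\<eta>\<in>sphere 0 1. norm (f \<xi> - f \<eta>) \<le> B * dist \<xi> \<eta> powr \<alpha>"
  using holderD(4)[OF a f] by blast
 obtain A' B' where 2: "0 \<le> A'" "0 \<le> B'" "\<N> \<alpha> g = A' + B'" "\<forall>\<xi>\<in>sphere 0 1. norm (g \<xi>) \<le> A'"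
  "\<forall>\<xi>\<in>sphere 0 1. \<forall>\<eta>\<in>sphere 0 1. norm (g \<xi> - g \<eta>) \<le> B' * dist \<xi> \<eta> powr \<alpha>"
  using holderD(4)[OF a g] by blast
 have KK: "norm (prod x y) \<le> K * X * Y" if "norm x \<le> X" "norm y \<le> Y" for x y X Y
 proof -
  have "K * norm x * norm y \<le> K * X * Y"
  proof -
   have "0 \<le> X" using norm_ge_zero that(1) by (rule order_trans)
   then show ?thesis using that K(1) by (intro mult_mono) auto
  qed
  then show ?thesis using K(2)[of x y] by linarith
 qed
 have s: "norm (prod (f \<xi>) (g \<xi>)) \<le> K * A * A'" if "\<xi> \<in> sphere 0 1" for \<xi>
  using KK 1(4) 2(4) that by blast
 have h: "norm (prod (f \<xi>) (g \<xi>) - prod (f \<eta>) (g \<eta>)) \<le> (K * A * B' + K * B * A') * dist \<xi> \<eta> powr \<alpha>"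
  if z: "\<xi> \<in> sphere 0 1" "\<eta> \<in> sphere 0 1" for \<xi> \<eta>
 proof -
  have "norm (prod (f \<xi>) (g \<xi>) - prod (f \<eta>) (g \<eta>)) = norm (prod (f \<xi>) (g \<xi> - g \<eta>) + prod (f \<xi> - f \<eta>) (g \<eta>))"
   by (simp add: diff_left diff_right)
  also have "\<dots> \<le> K * A * (B' * dist \<xi> \<eta> powr \<alpha>) + K * (B * dist \<xi> \<eta> powr \<alpha>) * A'"
   using 1(4,5) 2(4,5) z by (intro norm_triangle_mono KK) auto
  finally show ?thesis by (simp add: algebra_simps)
 qed
 have "K * A * A' + (K * A * B' + K * B * A') \<le> K * (A + B) * (A' + B')"
  using 1 2 K by (simp add: algebra_simps)
 moreover have "0 \<le> K * A * B' + K * B * A'" using 1 2 K by simp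
 note holderI[OF a this s h]
 ultimately show "(\<lambda>\<xi>. prod (f \<xi>) (g \<xi>)) \<in> \<H> \<alpha>"
  "\<N> \<alpha> (\<lambda>\<xi>. prod (f \<xi>) (g \<xi>)) \<le> K * \<N> \<alpha> f * \<N> \<alpha> g"
  using 1(3) 2(3) by simp_all
qed

lemma holder_continuous_on:
 assumes a: "0 < \<alpha>" and f: "f \<in> \<H> \<alpha>"
 shows "continuous_on (sphere 0 1) f"
proof -
 obtain C where C: "C \<ge> 0" "\<forall>\<xi>\<in>sphere 0 1. \<forall>\<eta>\<in>sphere 0 1. norm (f \<xi> - f \<eta>) \<le> C * dist \<xi> \<eta> powr \<alpha>"
  using f by (auto simp: holder_space_iff)
 show ?thesis unfolding continuous_on_def
 proof
  fix x assume x: "x \<in> sphere (0::complex) 1"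
  have "((\<lambda>y. norm (f y - f x)) \<longlongrightarrow> 0) (at x within sphere 0 1)"
  proof (rule tendsto_sandwich[OF _ _ tendsto_const])
   show "\<forall>\<^sub>F y in at x within sphere 0 1. norm (f y - f x) \<le> C * dist y x powr \<alpha>"
    unfolding eventually_at_filter using C(2) x by (intro always_eventually) blast
   have "((\<lambda>y. dist y x powr \<alpha>) \<longlongrightarrow> dist x x powr \<alpha>) (at x within sphere 0 1)"
   proof (rule tendsto_powr')
    show "((\<lambda>y. dist y x) \<longlongrightarrow> dist x x) (at x within sphere 0 1)"
     by (intro tendsto_dist tendsto_ident_at tendsto_const)
    show "((\<lambda>_. \<alpha>) \<longlongrightarrow> \<alpha>) (at x within sphere 0 1)" by (rule tendsto_const)
    show "dist x x \<noteq> 0 \<or> 0 < \<alpha> \<and> (\<forall>\<^sub>F y in at x within sphere 0 1. 0 \<le> dist y x)" using a by simp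
   qed
   then show "((\<lambda>y. C * dist y x powr \<alpha>) \<longlongrightarrow> 0) (at x within sphere 0 1)"
    using tendsto_mult_right_zero[of "\<lambda>y. dist y x powr \<alpha>"] by simp
  qed simp
  then show "(f \<longlongrightarrow> f x) (at x within sphere 0 1)"
   by (rule LIM_zero_cancel[OF tendsto_norm_zero_cancel])
 qed
qed

subsection \<open>Composition operators on Hoelder spaces\<close>

text \<open>A quantitative counterpart of \<open>Ck_on\<close> with one constant for all orders,
  because the estimates have to be uniform over all \<rho> near the quadric. Derivatives are taken
  along basis vectors; in a general direction the bound would have to scale with the vector.\<close>

primrec Ck_bounded :: "nat \<Rightarrow> real \<Rightarrow> ('a::euclidean_space \<Rightarrow> 'b::real_normed_vector) \<Rightarrow> 'a set \<Rightarrow> bool" where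
 "Ck_bounded 0 K f S \<longleftrightarrow> continuous_on S f \<and> (\<forall>x\<in>S. norm (f x) \<le> K)"
| "Ck_bounded (Suc k) K f S \<longleftrightarrow> (\<forall>x\<in>S. f differentiable (at x) \<and> norm (f x) \<le> K) \<and>
   (\<forall>v\<in>Basis. Ck_bounded k K (\<lambda>x. \<D> f (at x) v) S)"

lemma Ck_bounded_norm: "Ck_bounded k K f S \<Longrightarrow> x \<in> S \<Longrightarrow> norm (f x) \<le> K"
 by (cases k) auto

lemma frechet_derivative_cong_open:
 assumes "open S" "x \<in> S" "\<And>x. x \<in> S \<Longrightarrow> f x = g x" "f differentiable (at x)"
 shows "g differentiable (at x)" "frechet_derivative g (at x) = \<D> f (at x)"
proof -
 have "(f has_derivative \<D> f (at x)) (at x)" using assms(4) frechet_derivative_works by blast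
 then have g: "(g has_derivative \<D> f (at x)) (at x)"
  by (rule has_derivative_transform_within_open[OF _ assms(1,2)]) (rule assms(3))
 show "g differentiable (at x)" using g by (rule differentiableI)
 show "frechet_derivative g (at x) = \<D> f (at x)" using frechet_derivative_at[OF g] by simp
qed

lemma Ck_bounded_cong:
 assumes "open S" "\<And>x. x \<in> S \<Longrightarrow> f x = g x" "Ck_bounded k K f S"
 shows "Ck_bounded k K g S"
 using assms(2,3)
proof (induction k arbitrary: f g)
 case 0
 then show ?case using continuous_on_cong[of S S f g] by auto
next
 case (Suc k)
 have fg: "g differentiable (at x)" "frechet_derivative g (at x) = \<D> f (at x)" if "x \<in> S" for x
  using frechet_derivative_cong_open[OF assms(1) that, of f g] Suc.prems that by auto
 show ?case unfolding Ck_bounded.simps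
 proof (intro conjI ballI)
  show "norm (g x) \<le> K" if "x \<in> S" for x using Suc.prems that by fastforce
  show "Ck_bounded k K (\<lambda>x. \<D> g (at x) v) S" if v: "v \<in> Basis" for v
   by (rule Suc.IH[of "\<lambda>x. \<D> f (at x) v"]) (use Suc.prems v fg in auto)
 qed (use fg in auto)
qed

lemma Ck_bounded_SucI:
 assumes S: "open S" and d: "\<And>x. x \<in> S \<Longrightarrow> (f has_derivative D x) (at x)"
  and n: "\<And>x. x \<in> S \<Longrightarrow> norm (f x) \<le> K" and D: "\<And>v. v \<in> Basis \<Longrightarrow> Ck_bounded k K (\<lambda>x. D x v) S"
 shows "Ck_bounded (Suc k) K f S"
 unfolding Ck_bounded.simps
proof (intro conjI ballI)
 show "f differentiable (at x)" if "x \<in> S" for x using d[OF that] by (rule differentiableI)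
 show "norm (f x) \<le> K" if "x \<in> S" for x using n[OF that] .
 show "Ck_bounded k K (\<lambda>x. \<D> f (at x) v) S" if v: "v \<in> Basis" for v
 proof (rule Ck_bounded_cong[OF S _ D[OF v]])
  show "D x v = \<D> f (at x) v" if "x \<in> S" for x
   using frechet_derivative_at[OF d[OF that]] by simp
 qed
qed

lemma Ck_bounded_mono: "Ck_bounded k K f S \<Longrightarrow> K \<le> K' \<Longrightarrow> Ck_bounded k K' f S"
 by (induction k arbitrary: f) fastforce+

lemma Ck_bounded_has_derivative:
 "Ck_bounded (Suc k) K f S \<Longrightarrow> x \<in> S \<Longrightarrow> (f has_derivative \<D> f (at x)) (at x)"
 using frechet_derivative_works by auto

lemma Ck_bounded_Suc: "Ck_bounded (Suc k) K f S \<Longrightarrow> Ck_bounded k K f S"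
proof (induction k arbitrary: f)
 case 0
 then show ?case
  by (auto simp del: Ck_bounded.simps(1) simp: Ck_bounded.simps(1)
    intro!: continuous_at_imp_continuous_on differentiable_imp_continuous_within)
next
 case (Suc k)
 show ?case unfolding Ck_bounded.simps(2)[of k]
 proof (intro conjI ballI)
  fix v :: 'a assume v: "v \<in> Basis"
  have "Ck_bounded (Suc k) K (\<lambda>x. \<D> f (at x) v) S"
   using Suc.prems v unfolding Ck_bounded.simps(2)[of "Suc k"] by blast
  then show "Ck_bounded k K (\<lambda>x. \<D> f (at x) v) S" by (rule Suc.IH)
 qed (use Suc.prems in auto)
qed

lemma Ck_bounded_const: "norm c \<le> K \<Longrightarrow> open S \<Longrightarrow> Ck_bounded k K (\<lambda>_. c) S"
proof (induction k arbitrary: c)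
 case (Suc k)
 have "0 \<le> K" using Suc.prems norm_ge_zero order_trans by blast
 then show ?case using Suc by (intro Ck_bounded_SucI[where D="\<lambda>_ _. 0"]) auto
qed auto

lemma Ck_bounded_linear:
 assumes S: "open S" and L: "bounded_linear L" and "\<And>x. x \<in> S \<Longrightarrow> norm (L x) \<le> K" "\<And>v. v \<in> Basis \<Longrightarrow> norm (L v) \<le> K"
 shows "Ck_bounded k K L S"
proof (cases k)
 case 0
 then show ?thesis using assms linear_continuous_on by auto
next
 case (Suc l)
 show ?thesis unfolding Suc
  by (rule Ck_bounded_SucI[OF S bounded_linear_imp_has_derivative[OF L]])
   (use assms Ck_bounded_const[OF _ S] in blast)+
qed

lemma Ck_bounded_add:
 assumes "open S" "Ck_bounded k K f S" "Ck_bounded k K' g S"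
 shows "Ck_bounded k (K + K') (\<lambda>x. f x + g x) S"
 using assms(2,3)
proof (induction k arbitrary: f g)
 case 0
 then show ?case by (auto intro!: continuous_intros norm_triangle_mono)
next
 case (Suc k)
 show ?case
 proof (rule Ck_bounded_SucI[OF assms(1)])
  fix x assume "x \<in> S"
  then show "((\<lambda>x. f x + g x) has_derivative (\<lambda>v. \<D> f (at x) v + \<D> g (at x) v)) (at x)"
   by (intro has_derivative_add Ck_bounded_has_derivative[OF Suc.prems(1)] Ck_bounded_has_derivative[OF Suc.prems(2)])
  show "norm (f x + g x) \<le> K + K'"
   using \<open>x \<in> S\<close> by (intro norm_triangle_mono Ck_bounded_norm[OF Suc.prems(1)] Ck_bounded_norm[OF Suc.prems(2)])
 next
  fix v :: 'a assume "v \<in> Basis"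
  then show "Ck_bounded k (K + K') (\<lambda>x. \<D> f (at x) v + \<D> g (at x) v) S"
   using Suc.prems by (intro Suc.IH) auto
 qed
qed

lemma Ck_bounded_sum:
 assumes "open S" "finite I" "\<And>i. i \<in> I \<Longrightarrow> Ck_bounded k (K i) (f i) S"
 shows "Ck_bounded k (\<Sum>i\<in>I. K i) (\<lambda>x. \<Sum>i\<in>I. f i x) S"
 using assms(2,3)
 by (induction I rule: finite_induct) (auto intro!: Ck_bounded_const Ck_bounded_add assms(1))

lemma Ck_bounded_compose_linear:
 assumes S: "open S" and L: "bounded_linear L" and M: "0 \<le> M" "\<And>x. norm (L x) \<le> M * norm x"
  and f: "Ck_bounded k K f S"
 shows "Ck_bounded k (M * K) (\<lambda>x. L (f x)) S"
 using f
proof (induction k arbitrary: f)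
 have n: "norm (L y) \<le> M * K" if "norm y \<le> K" for y
  using M(2)[of y] mult_left_mono[OF that M(1)] by linarith
 {
  case 0
  then show ?case using n by (auto intro!: bounded_linear.continuous_on[OF L])
 next
  case (Suc k)
  show ?case
  proof (rule Ck_bounded_SucI[OF S])
   fix x assume x: "x \<in> S"
   then show "((\<lambda>x. L (f x)) has_derivative (\<lambda>v. L (\<D> f (at x) v))) (at x)"
    by (intro bounded_linear.has_derivative[OF L] Ck_bounded_has_derivative[OF Suc.prems])
   show "norm (L (f x)) \<le> M * K" by (intro n Ck_bounded_norm[OF Suc.prems x])
  qed (use Suc in auto)
 }
qed

text \<open>Every differentiation doubles the number of terms, hence the factor
  \<open>2 ^ k\<close>.\<close>

lemma Ck_bounded_mult:
 fixes f g :: "'a::euclidean_space \<Rightarrow> 'b::real_normed_algebra"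
 assumes S: "open S" and K: "0 \<le> K" "0 \<le> K'" and f: "Ck_bounded k K f S" and g: "Ck_bounded k K' g S"
 shows "Ck_bounded k (2 ^ k * K * K') (\<lambda>x. f x * g x) S"
 using f g
proof (induction k arbitrary: f g)
 have n: "norm (x * y) \<le> K * K'" if "norm x \<le> K" "norm y \<le> K'" for x y :: 'b
  using norm_mult_ineq[of x y] mult_mono[OF that K(1) norm_ge_zero] by linarith
 {
  case 0
  then show ?case using n by (auto intro!: continuous_intros)
 next
  case (Suc k)
  show ?case
  proof (rule Ck_bounded_SucI[OF S])
   fix x assume x: "x \<in> S"
   show "((\<lambda>x. f x * g x) has_derivative
     (\<lambda>v. f x * \<D> g (at x) v + \<D> f (at x) v * g x)) (at x)"
    by (intro has_derivative_mult Ck_bounded_has_derivative[OF Suc.prems(1) x] Ck_bounded_has_derivative[OF Suc.prems(2) x])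
   have "norm (f x * g x) \<le> K * K'" using Ck_bounded_norm[OF Suc.prems(1) x] Ck_bounded_norm[OF Suc.prems(2) x] by (rule n)
   also have "\<dots> \<le> 2 ^ Suc k * (K * K')"
    using mult_right_mono[OF one_le_power[of "2::real" "Suc k"] mult_nonneg_nonneg[OF K]] by simp
   finally show "norm (f x * g x) \<le> 2 ^ Suc k * K * K'" by (simp add: mult.assoc)
  next
   fix v :: 'a assume v: "v \<in> Basis"
   have "Ck_bounded k (2 ^ k * K * K' + 2 ^ k * K * K')
     (\<lambda>x. f x * \<D> g (at x) v + \<D> f (at x) v * g x) S"
    using Suc.prems v Ck_bounded_Suc[OF Suc.prems(1)] Ck_bounded_Suc[OF Suc.prems(2)]
    by (intro Ck_bounded_add[OF S] Suc.IH) auto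
   then show "Ck_bounded k (2 ^ Suc k * K * K')
     (\<lambda>x. f x * \<D> g (at x) v + \<D> f (at x) v * g x) S"
    by (simp add: algebra_simps)
  qed
 }
qed

text \<open>The constant is quantified before the function and the domain, so that one choice serves
  all \<rho>. The derivative of the inverse is a product of functions that are controlled at one
  order less, which drives the induction.\<close>

lemma Ck_bounded_inverse:
 assumes K: "0 \<le> K" and c: "0 \<le> c"
 shows "\<exists>M\<ge>0. \<forall>(f :: 'a::euclidean_space \<Rightarrow> 'b::real_normed_field) S. open S \<longrightarrow> Ck_bounded k K f S \<longrightarrow>
  (\<forall>x\<in>S. f x \<noteq> 0 \<and> norm (inverse (f x)) \<le> c) \<longrightarrow> Ck_bounded k M (\<lambda>x. inverse (f x)) S"
proof (induction k)
 case 0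
 show ?case using c by (intro exI[of _ c]) (auto intro!: continuous_intros)
next
 case (Suc k)
 then obtain M where M0: "M \<ge> 0" and M1: "\<forall>(f :: 'a \<Rightarrow> 'b) S. open S \<longrightarrow> Ck_bounded k K f S \<longrightarrow>
  (\<forall>x\<in>S. f x \<noteq> 0 \<and> norm (inverse (f x)) \<le> c) \<longrightarrow> Ck_bounded k M (\<lambda>x. inverse (f x)) S"
  by (elim exE conjE)
 note M = M0 M1[rule_format]
 define M' where "M' = 2 ^ k * (2 ^ k * M * K) * M"
 have M': "0 \<le> M'" using M K by (simp add: M'_def)
 show ?case
 proof (intro exI[of _ "max c M'"] conjI allI impI)
  show "0 \<le> max c M'" using c by simp
  fix f :: "'a \<Rightarrow> 'b" and S assume S: "open S" and f: "Ck_bounded (Suc k) K f S"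
   and nz: "\<forall>x\<in>S. f x \<noteq> 0 \<and> norm (inverse (f x)) \<le> c"
  have inv: "Ck_bounded k M (\<lambda>x. inverse (f x)) S" using M(2)[OF S Ck_bounded_Suc[OF f]] nz by blast
  show "Ck_bounded (Suc k) (max c M') (\<lambda>x. inverse (f x)) S"
  proof (rule Ck_bounded_SucI[OF S])
   fix x assume x: "x \<in> S"
   show "((\<lambda>x. inverse (f x)) has_derivative (\<lambda>v. - (inverse (f x) * \<D> f (at x) v * inverse (f x)))) (at x)"
    using nz x by (intro Deriv.has_derivative_inverse Ck_bounded_has_derivative[OF f x]) auto
   show "norm (inverse (f x)) \<le> max c M'" using nz x by fastforce
  next
   fix v :: 'a assume v: "v \<in> Basis"
   have "Ck_bounded k K (\<lambda>x. \<D> f (at x) v) S" using f v by simp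
   then have "Ck_bounded k M' (\<lambda>x. inverse (f x) * \<D> f (at x) v * inverse (f x)) S"
    unfolding M'_def using M K by (intro Ck_bounded_mult S inv) auto
   then have "Ck_bounded k (1 * M') (\<lambda>x. - (inverse (f x) * \<D> f (at x) v * inverse (f x))) S"
    by (intro Ck_bounded_compose_linear[of S uminus] S bounded_linear_minus bounded_linear_ident) auto
   then show "Ck_bounded k (max c M') (\<lambda>x. - (inverse (f x) * \<D> f (at x) v * inverse (f x))) S"
    by (rule Ck_bounded_mono) simp
  qed
 qed
qed

lemma frechet_derivative_basis_sum:
 fixes f :: "'a::euclidean_space \<Rightarrow> 'b::real_normed_vector"
 assumes "f differentiable (at x)"
 shows "frechet_derivative f (at x) v = (\<Sum>b\<in>Basis. (v \<bullet> b) *\<^sub>R \<D> f (at x) b)"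
proof -
 have l: "linear (\<D> f (at x))" using linear_frechet_derivative[OF assms] .
 have "frechet_derivative f (at x) v = \<D> f (at x) (\<Sum>b\<in>Basis. (v \<bullet> b) *\<^sub>R b)"
  by (simp add: euclidean_representation)
 then show ?thesis by (simp add: linear_sum[OF l] linear_scale[OF l])
qed

lemma norm_basis_sum_le:
 fixes f :: "'a::euclidean_space \<Rightarrow> 'b::real_normed_vector"
 assumes "\<And>b. b \<in> Basis \<Longrightarrow> norm (f b) \<le> K"
 shows "norm (\<Sum>b\<in>Basis. (v \<bullet> b) *\<^sub>R f b) \<le> real DIM('a) * K * norm v"
proof -
 have "norm (\<Sum>b\<in>Basis. (v \<bullet> b) *\<^sub>R f b) \<le> (\<Sum>b\<in>Basis. \<bar>v \<bullet> b\<bar> * norm (f b))"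
  using norm_sum[of "\<lambda>b. (v \<bullet> b) *\<^sub>R f b" Basis] by simp
 also have "\<dots> \<le> (\<Sum>b\<in>(Basis::'a set). norm v * K)"
  using assms by (intro sum_mono mult_mono) (auto intro: Basis_le_norm)
 finally show ?thesis by (simp add: mult_ac)
qed

lemma Ck_bounded_derivative_norm:
 fixes f :: "'a::euclidean_space \<Rightarrow> 'b::real_normed_vector"
 assumes "Ck_bounded (Suc k) K f S" "x \<in> S"
 shows "norm (\<D> f (at x) v) \<le> real DIM('a) * K * norm v"
proof -
 have d: "f differentiable (at x)" using assms by auto
 show ?thesis unfolding frechet_derivative_basis_sum[OF d, of v]
 proof (rule norm_basis_sum_le)
  fix b :: 'a assume "b \<in> Basis"
  then have "Ck_bounded k K (\<lambda>x. \<D> f (at x) b) S" using assms by simp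
  then show "norm (\<D> f (at x) b) \<le> K" using assms(2) by (rule Ck_bounded_norm)
 qed
qed

section \<open>Mean value estimates\<close>

lemma norm_mvt_unit_interval:
 fixes \<phi> :: "real \<Rightarrow> 'b::real_normed_vector"
 assumes d: "\<And>s. 0 \<le> s \<Longrightarrow> s \<le> 1 \<Longrightarrow> (\<phi> has_vector_derivative \<phi>' s) (at s)"
  and b: "\<And>s. 0 \<le> s \<Longrightarrow> s \<le> 1 \<Longrightarrow> norm (\<phi>' s) \<le> B"
 shows "norm (\<phi> 1 - \<phi> 0) \<le> B"
proof -
 have "norm (\<phi> 1 - \<phi> 0) \<le> B * 1 - B * 0"
 proof (rule differentiable_bound_general)
  show "continuous_on {0..1} \<phi>"
   using has_vector_derivative_continuous[OF d] by (intro continuous_at_imp_continuous_on) auto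
  show "continuous_on {0..1} (\<lambda>s. B * s)" by (intro continuous_intros)
  show "((\<lambda>s. B * s) has_vector_derivative B) (at x)" for x
   by (auto intro!: derivative_eq_intros simp: has_real_derivative_iff_has_vector_derivative[symmetric])
  show "(\<phi> has_vector_derivative \<phi>' x) (at x)" if "0 < x" "x < 1" for x using d that by simp
  show "norm (\<phi>' x) \<le> B" if "0 < x" "x < 1" for x using b that by simp
 qed simp
 then show ?thesis by simp
qed

lemma has_vector_derivative_along:
 assumes "(f has_derivative D) (at (x + s *\<^sub>R v))"
 shows "((\<lambda>s. f (x + s *\<^sub>R v)) has_vector_derivative D v) (at s)"
proof -
 have "((\<lambda>s. x + s *\<^sub>R v) has_vector_derivative v) (at s)"
  by (auto intro!: derivative_eq_intros simp: has_vector_derivative_def)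
 from vector_derivative_diff_chain_within[OF this, of f D] assms show ?thesis
  by (auto simp: o_def intro: has_derivative_at_withinI)
qed

lemma convex_segment_point:
 assumes "convex S" "x \<in> S" "x + v \<in> S" "0 \<le> s" "s \<le> (1::real)"
 shows "x + s *\<^sub>R v \<in> S"
proof -
 have "(1 - s) *\<^sub>R x + s *\<^sub>R (x + v) \<in> S" using assms by (intro convexD_alt) auto
 then show ?thesis by (simp add: algebra_simps)
qed

lemma Ck_bounded_Lipschitz:
 fixes f :: "'a::euclidean_space \<Rightarrow> 'b::real_normed_vector"
 assumes f: "Ck_bounded (Suc k) K f S" and S: "convex S" and x: "x \<in> S" and y: "y \<in> S"
 shows "norm (f x - f y) \<le> real DIM('a) * K * norm (x - y)"
proof -
 have p: "y + s *\<^sub>R (x - y) \<in> S" if "0 \<le> s" "s \<le> 1" for s using convex_segment_point[OF S y _ that, of "x - y"] x by simp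
 have "norm (f (y + 1 *\<^sub>R (x - y)) - f (y + 0 *\<^sub>R (x - y))) \<le> real DIM('a) * K * norm (x - y)"
  by (rule norm_mvt_unit_interval[OF has_vector_derivative_along[OF Ck_bounded_has_derivative[OF f p]]
   Ck_bounded_derivative_norm[OF f p]])
 then show ?thesis by simp
qed

lemma Ck_bounded_derivative_Lipschitz:
 fixes f :: "'a::euclidean_space \<Rightarrow> 'b::real_normed_vector"
 assumes f: "Ck_bounded (Suc (Suc k)) K f S" and S: "convex S" and x: "x \<in> S" and y: "y \<in> S"
 shows "norm (\<D> f (at x) v - \<D> f (at y) v) \<le> (real DIM('a))\<^sup>2 * K * norm (x - y) * norm v"
proof -
 have d: "f differentiable (at x)" "f differentiable (at y)" using assms by auto
 have "norm (\<Sum>b\<in>Basis. (v \<bullet> b) *\<^sub>R (\<D> f (at x) b - \<D> f (at y) b))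
   \<le> real DIM('a) * (real DIM('a) * K * norm (x - y)) * norm v"
 proof (rule norm_basis_sum_le)
  fix b :: 'a assume "b \<in> Basis"
  then have "Ck_bounded (Suc k) K (\<lambda>x. \<D> f (at x) b) S"
   using f unfolding Ck_bounded.simps(2)[of "Suc k"] by blast
  from Ck_bounded_Lipschitz[OF this S x y]
  show "norm (\<D> f (at x) b - \<D> f (at y) b) \<le> real DIM('a) * K * norm (x - y)" .
 qed
 then show ?thesis
  unfolding frechet_derivative_basis_sum[OF d(1), of v] frechet_derivative_basis_sum[OF d(2), of v]
  by (simp add: scaleR_diff_right sum_subtractf power2_eq_square mult.assoc)
qed

section \<open>Hoelder estimates for composition with a fixed map\<close>

lemma holder_compose:
 fixes f :: "'a::euclidean_space \<Rightarrow> 'b::real_normed_vector"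
 assumes a: "0 < \<alpha>" and f: "Ck_bounded (Suc k) K f S" and S: "convex S"
  and h: "h \<in> \<H> \<alpha>" "h ` sphere 0 1 \<subseteq> S"
 shows "(\<lambda>\<xi>. f (h \<xi>)) \<in> \<H> \<alpha>"
  "\<N> \<alpha> (\<lambda>\<xi>. f (h \<xi>)) \<le> K + real DIM('a) * K * \<N> \<alpha> h"
proof -
 have hS: "h \<xi> \<in> S" if "\<xi> \<in> sphere 0 1" for \<xi> using h(2) that by blast
 have "h 1 \<in> S" by (rule hS) simp
 then have K: "0 \<le> K" using Ck_bounded_norm[OF f] norm_ge_zero order_trans by blast
 have 1: "norm (f (h \<xi>)) \<le> K" if "\<xi> \<in> sphere 0 1" for \<xi> using Ck_bounded_norm[OF f hS[OF that]] .
 have 2: "norm (f (h \<xi>) - f (h \<eta>)) \<le> real DIM('a) * K * \<N> \<alpha> h * dist \<xi> \<eta> powr \<alpha>"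
  if z: "\<xi> \<in> sphere 0 1" "\<eta> \<in> sphere 0 1" for \<xi> \<eta>
 proof -
  have "norm (f (h \<xi>) - f (h \<eta>)) \<le> real DIM('a) * K * norm (h \<xi> - h \<eta>)"
   using Ck_bounded_Lipschitz[OF f S hS hS] z by blast
  also have "\<dots> \<le> real DIM('a) * K * (\<N> \<alpha> h * dist \<xi> \<eta> powr \<alpha>)"
   using K holderD(3)[OF a h(1) z] by (intro mult_left_mono) auto
  finally show ?thesis by (simp add: mult.assoc)
 qed
 have "0 \<le> real DIM('a) * K * \<N> \<alpha> h" using K holderD(1)[OF a h(1)] by simp
 from holderI[OF a this 1 2] show "(\<lambda>\<xi>. f (h \<xi>)) \<in> \<H> \<alpha>"
  "\<N> \<alpha> (\<lambda>\<xi>. f (h \<xi>)) \<le> K + real DIM('a) * K * \<N> \<alpha> h" by auto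
qed

text \<open>The common core of the Lipschitz and the continuity estimate. The modulus \<omega>
  measures how much the derivative of \<open>g\<close> varies: with a second derivative it is
  proportional to the distance, with a first derivative it comes from uniform continuity. The second
  point is restricted to the convex hull of the image of \<open>h\<close> because that set is
  compact.\<close>

lemma holder_compose_diff:
 fixes g :: "'a::euclidean_space \<Rightarrow> 'b::real_normed_vector"
 assumes a: "0 < \<alpha>" and g: "Ck_bounded (Suc k) K g S" and S: "convex S"
  and h: "h \<in> \<H> \<alpha>" "h ` sphere 0 1 \<subseteq> S" and h': "h' \<in> \<H> \<alpha>" "h' ` sphere 0 1 \<subseteq> S"
  and \<omega>: "0 \<le> \<omega>" "\<And>x y v. x \<in> S \<Longrightarrow> y \<in> S \<Longrightarrow> y \<in> convex hull (h ` sphere 0 1) \<Longrightarrow> norm (x - y) \<le> \<N> \<alpha> (h' - h) \<Longrightarrow>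
   norm (\<D> g (at x) v - \<D> g (at y) v) \<le> \<omega> * norm v"
 shows "\<N> \<alpha> ((\<lambda>\<xi>. g (h' \<xi>)) - (\<lambda>\<xi>. g (h \<xi>))) \<le> 2 * (real DIM('a) * K) * \<N> \<alpha> (h' - h) + \<omega> * \<N> \<alpha> h"
proof -
 let ?n = "real DIM('a)" and ?N = "\<N> \<alpha> (h' - h)" and ?D = "(\<lambda>\<xi>. g (h' \<xi>)) - (\<lambda>\<xi>. g (h \<xi>))"
 have hS: "h \<xi> \<in> S" "h' \<xi> \<in> S" if "\<xi> \<in> sphere 0 1" for \<xi> using h(2) h'(2) that by auto
 have "h 1 \<in> S" by (rule hS) simp
 then have K: "0 \<le> K" using Ck_bounded_norm[OF g] norm_ge_zero order_trans by blast
 have hC: "h \<xi> \<in> convex hull (h ` sphere 0 1)" if "\<xi> \<in> sphere 0 1" for \<xi> using that by (intro hull_inc) auto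
 have CS: "convex hull (h ` sphere 0 1) \<subseteq> S" using h(2) S by (intro hull_minimal) auto
 have dX: "h' - h \<in> \<H> \<alpha>" using seminormedD(6)[OF seminormed_holder[OF a] h'(1) h(1)] .
 have N0: "0 \<le> ?N" using holderD(1)[OF a dX] .
 define u where "u \<xi> = h' \<xi> - h \<xi>" for \<xi>
 have u: "norm (u \<xi>) \<le> ?N" if "\<xi> \<in> sphere 0 1" for \<xi> using holderD(2)[OF a dX that] by (simp add: u_def)
 have u2: "norm (u \<xi> - u \<eta>) \<le> ?N * dist \<xi> \<eta> powr \<alpha>" if "\<xi> \<in> sphere 0 1" "\<eta> \<in> sphere 0 1" for \<xi> \<eta>
  using holderD(3)[OF a dX that] by (simp add: u_def)
 have 1: "norm (?D \<xi>) \<le> ?n * K * ?N" if z: "\<xi> \<in> sphere 0 1" for \<xi>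
 proof -
  have "norm (g (h' \<xi>) - g (h \<xi>)) \<le> ?n * K * norm (h' \<xi> - h \<xi>)"
   using Ck_bounded_Lipschitz[OF g S hS(2,1)[OF z]] .
  also have "\<dots> \<le> ?n * K * ?N" using u[OF z] K by (intro mult_left_mono) (auto simp: u_def)
  finally show ?thesis by simp
 qed
 have 2: "norm (?D \<xi> - ?D \<eta>) \<le> (?n * K * ?N + \<omega> * \<N> \<alpha> h) * dist \<xi> \<eta> powr \<alpha>"
  if z: "\<xi> \<in> sphere 0 1" "\<eta> \<in> sphere 0 1" for \<xi> \<eta>
 proof -
  let ?d = "dist \<xi> \<eta> powr \<alpha>"
  \<comment> \<open>The increment of \<phi> over the unit interval is the mixed difference that
    enters the Hoelder quotient of \<open>?D\<close>: two segments, one for \<open>h'\<close> and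
    one for \<open>h\<close>, are traversed simultaneously.\<close>
  define \<phi> where "\<phi> s = g (h' \<eta> + s *\<^sub>R (h' \<xi> - h' \<eta>)) - g (h \<eta> + s *\<^sub>R (h \<xi> - h \<eta>))" for s
  define \<phi>' where "\<phi>' s = \<D> g (at (h' \<eta> + s *\<^sub>R (h' \<xi> - h' \<eta>))) (h' \<xi> - h' \<eta>) -
   \<D> g (at (h \<eta> + s *\<^sub>R (h \<xi> - h \<eta>))) (h \<xi> - h \<eta>)" for s
  have "norm (\<phi> 1 - \<phi> 0) \<le> (?n * K * ?N + \<omega> * \<N> \<alpha> h) * ?d"
  proof (rule norm_mvt_unit_interval)
   fix s :: real assume s: "0 \<le> s" "s \<le> 1"
   let ?x = "h' \<eta> + s *\<^sub>R (h' \<xi> - h' \<eta>)" and ?y = "h \<eta> + s *\<^sub>R (h \<xi> - h \<eta>)"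
   have yC: "?y \<in> convex hull (h ` sphere 0 1)"
    using convex_segment_point[OF convex_convex_hull hC[OF z(2)] _ s, of "h \<xi> - h \<eta>"] hC[OF z(1)] by simp
   have xS: "?x \<in> S" using convex_segment_point[OF S hS(2)[OF z(2)] _ s, of "h' \<xi> - h' \<eta>"] hS(2)[OF z(1)] by simp
   have yS: "?y \<in> S" using yC CS by blast
   have eq: "?x - ?y = (1 - s) *\<^sub>R u \<eta> + s *\<^sub>R u \<xi>" by (simp add: u_def algebra_simps)
   have "norm (?x - ?y) \<le> (1 - s) * norm (u \<eta>) + s * norm (u \<xi>)"
    unfolding eq using s norm_triangle_ineq[of "(1 - s) *\<^sub>R u \<eta>" "s *\<^sub>R u \<xi>"] by simp
   also have "\<dots> \<le> (1 - s) * ?N + s * ?N" using s u z by (intro add_mono mult_left_mono) auto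
   finally have xyN: "norm (?x - ?y) \<le> ?N" by (simp add: algebra_simps)
   show "(\<phi> has_vector_derivative \<phi>' s) (at s)" unfolding \<phi>_def \<phi>'_def
    by (intro has_vector_derivative_diff has_vector_derivative_along Ck_bounded_has_derivative[OF g] xS yS)
   have dx: "g differentiable (at ?x)" using g xS by auto
   \<comment> \<open>The first term is linear in the increment of \<open>u = h' - h\<close>; the
     second compares the derivatives of \<open>g\<close> at two points at distance at most
     \<open>?N\<close> and is paid for by \<omega>.\<close>
   have "\<phi>' s = \<D> g (at ?x) (u \<xi> - u \<eta>) +
     (\<D> g (at ?x) (h \<xi> - h \<eta>) - \<D> g (at ?y) (h \<xi> - h \<eta>))"
    by (simp add: \<phi>'_def u_def linear_diff[OF linear_frechet_derivative[OF dx]])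
   also have "norm \<dots> \<le> ?n * K * norm (u \<xi> - u \<eta>) + \<omega> * norm (h \<xi> - h \<eta>)"
    by (intro norm_triangle_mono Ck_bounded_derivative_norm[OF g xS] \<omega>(2)[OF xS yS yC xyN])
   also have "\<dots> \<le> ?n * K * (?N * ?d) + \<omega> * (\<N> \<alpha> h * ?d)"
    using u2[OF z] holderD(3)[OF a h(1) z] K \<omega>(1) by (intro add_mono mult_left_mono) auto
   finally show "norm (\<phi>' s) \<le> (?n * K * ?N + \<omega> * \<N> \<alpha> h) * ?d" by (simp add: algebra_simps)
  qed
  then show ?thesis by (simp add: \<phi>_def)
 qed
 have "0 \<le> ?n * K * ?N + \<omega> * \<N> \<alpha> h" using K N0 \<omega>(1) holderD(1)[OF a h(1)] by simp
 from holderI(2)[where f="?D", OF a this 1 2] show ?thesis by (simp add: algebra_simps)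
qed

text \<open>Second derivatives make \<omega> proportional to the distance of the two functions. The
  composition operator is thus Lipschitz on bounded sets, and its constant is proportional to the
  size \<open>K\<close> of \<open>f\<close>; this is how a small perturbation of the quadric becomes
  a contraction.\<close>

lemma holder_compose_Lipschitz:
 fixes f :: "'a::euclidean_space \<Rightarrow> 'b::real_normed_vector"
 assumes a: "0 < \<alpha>" and f: "Ck_bounded 2 K f S" and S: "convex S"
  and h: "h \<in> \<H> \<alpha>" "h ` sphere 0 1 \<subseteq> S"
  and k: "k \<in> \<H> \<alpha>" "k ` sphere 0 1 \<subseteq> S" "\<N> \<alpha> k \<le> B"
 shows "\<N> \<alpha> ((\<lambda>\<xi>. f (h \<xi>)) - (\<lambda>\<xi>. f (k \<xi>))) \<le> (2 * real DIM('a) + (real DIM('a))\<^sup>2 * B) * K * \<N> \<alpha> (h - k)"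
proof -
 let ?n = "real DIM('a)" and ?N = "\<N> \<alpha> (h - k)"
 have f2: "Ck_bounded (Suc (Suc 0)) K f S" using f by (simp add: numeral_2_eq_2)
 have "k 1 \<in> S" using k(2) by auto
 then have K: "0 \<le> K" using Ck_bounded_norm[OF f] norm_ge_zero order_trans by blast
 have N: "0 \<le> ?N" using holderD(1)[OF a seminormedD(6)[OF seminormed_holder[OF a] h(1) k(1)]] .
 have "\<N> \<alpha> ((\<lambda>\<xi>. f (h \<xi>)) - (\<lambda>\<xi>. f (k \<xi>))) \<le> 2 * (?n * K) * ?N + (?n\<^sup>2 * K * ?N) * \<N> \<alpha> k"
 proof (rule holder_compose_diff[OF a f2 S k(1,2) h])
  fix x y v assume xy: "x \<in> S" "y \<in> S" "norm (x - y) \<le> ?N"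
  have "norm (\<D> f (at x) v - \<D> f (at y) v) \<le> ?n\<^sup>2 * K * norm (x - y) * norm v"
   by (rule Ck_bounded_derivative_Lipschitz[OF f2 S xy(1,2)])
  also have "\<dots> \<le> ?n\<^sup>2 * K * ?N * norm v" using xy(3) K by (intro mult_right_mono mult_left_mono) auto
  finally show "norm (\<D> f (at x) v - \<D> f (at y) v) \<le> ?n\<^sup>2 * K * ?N * norm v" .
 qed (use K N in simp)
 also have "\<dots> \<le> 2 * (?n * K) * ?N + (?n\<^sup>2 * K * ?N) * B" using k(3) K N by (intro add_left_mono mult_left_mono) auto
 finally show ?thesis by (simp add: algebra_simps)
qed

lemma fun_sum_apply: "sum f I x = (\<Sum>i\<in>I. f i x)" for f :: "'i \<Rightarrow> 'a \<Rightarrow> 'b::comm_monoid_add"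
 by (induction I rule: infinite_finite_induct) auto

text \<open>With one derivative only, the modulus \<omega> comes from uniform continuity on a
  compact set that depends on \<open>h\<close>, so the radius \<open>d\<close> is not uniform in
  \<open>h\<close>.\<close>

lemma holder_compose_continuous:
 fixes g :: "'a::euclidean_space \<Rightarrow> 'b::real_normed_vector"
 assumes a: "0 < \<alpha>" and g: "Ck_bounded 1 K g S" and S: "convex S" "open S"
  and h: "h \<in> \<H> \<alpha>" "h ` sphere 0 1 \<subseteq> S" and e: "0 < e"
 shows "\<exists>d>0. \<forall>h'\<in>\<H> \<alpha>. h' ` sphere 0 1 \<subseteq> S \<longrightarrow> \<N> \<alpha> (h' - h) < d \<longrightarrow>
  \<N> \<alpha> ((\<lambda>\<xi>. g (h' \<xi>)) - (\<lambda>\<xi>. g (h \<xi>))) \<le> e"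
proof -
 have g2: "Ck_bounded (Suc 0) K g S" using g by simp
 let ?n = "real DIM('a)"
 have "h 1 \<in> S" using h(2) by auto
 then have K: "0 \<le> K" using Ck_bounded_norm[OF g] norm_ge_zero order_trans by blast
 define C where "C = convex hull (h ` sphere 0 1)"
 have "compact (h ` sphere 0 1)" using holder_continuous_on[OF a h(1)] by (intro compact_continuous_image) auto
 then have C: "compact C" "convex C" unfolding C_def by (auto intro: compact_convex_hull)
 have CS: "C \<subseteq> S" unfolding C_def using h(2) S by (intro hull_minimal) auto
 obtain d0 where d0: "d0 > 0" "(\<Union>x\<in>C. cball x d0) \<subseteq> S"
  using compact_subset_open_imp_cball_epsilon_subset[OF C(1) S(2) CS] by blast
 \<comment> \<open>A compact neighbourhood, inside \<open>S\<close>, of the hull of the image of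
   \<open>h\<close>: it contains all points at which the derivatives are compared.\<close>
 define T where "T = {x + y | x y. x \<in> C \<and> y \<in> cball 0 d0}"
 have T: "compact T" unfolding T_def by (intro compact_sums C) auto
 have TS: "T \<subseteq> S"
 proof
  fix z assume "z \<in> T"
  then obtain x y where "z = x + y" "x \<in> C" "y \<in> cball 0 d0" by (auto simp: T_def)
  then have "z \<in> cball x d0" by (simp add: dist_norm)
  then show "z \<in> S" using d0(2) \<open>x \<in> C\<close> by blast
 qed
 define e' where "e' = e / (2 * (?n * \<N> \<alpha> h + 1))"
 have hn: "0 \<le> \<N> \<alpha> h" using holderD(1)[OF a h(1)] .
 have e': "e' > 0" unfolding e'_def using e hn by (intro divide_pos_pos mult_pos_pos add_nonneg_pos) auto
 have uc: "\<exists>\<delta>>0. \<forall>x\<in>T. \<forall>y\<in>T. dist y x < \<delta> \<longrightarrow>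
   dist (\<D> g (at y) b) (\<D> g (at x) b) < e'" if b: "b \<in> Basis" for b :: 'a
 proof -
  have "continuous_on S (\<lambda>x. \<D> g (at x) b)" using g2 b by simp
  then have "uniformly_continuous_on T (\<lambda>x. \<D> g (at x) b)"
   using T TS by (intro compact_uniformly_continuous) (auto intro: continuous_on_subset)
  then show ?thesis using e' unfolding uniformly_continuous_on_def by blast
 qed
 then obtain \<delta>b where \<delta>b: "\<And>b::'a. b \<in> Basis \<Longrightarrow> \<delta>b b > 0"
  "\<And>(b::'a) x y. b \<in> Basis \<Longrightarrow> x \<in> T \<Longrightarrow> y \<in> T \<Longrightarrow> dist y x < \<delta>b b \<Longrightarrow>
   dist (\<D> g (at y) b) (\<D> g (at x) b) < e'" by metis
 define \<delta> where "\<delta> = Min (\<delta>b ` Basis)"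
 have \<delta>: "\<delta> > 0" "\<And>b. b \<in> Basis \<Longrightarrow> \<delta> \<le> \<delta>b b" using \<delta>b(1) by (auto simp: \<delta>_def Min_gr_iff)
 have fd: "norm (\<D> g (at x) v - \<D> g (at y) v) \<le> ?n * e' * norm v"
  if x: "x \<in> T" and y: "y \<in> T" and d: "norm (x - y) < \<delta>" for x y v
 proof -
  have di: "g differentiable (at x)" "g differentiable (at y)" using g2 x y TS by auto
  have "norm (\<Sum>b\<in>Basis. (v \<bullet> b) *\<^sub>R (\<D> g (at x) b - \<D> g (at y) b))
    \<le> ?n * e' * norm v"
  proof (rule norm_basis_sum_le)
   fix b :: 'a assume b: "b \<in> Basis"
   have "dist x y < \<delta>b b" using d \<delta>(2)[OF b] by (simp add: dist_norm)
   from \<delta>b(2)[OF b y x this] show "norm (\<D> g (at x) b - \<D> g (at y) b) \<le> e'"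
    by (simp add: dist_norm)
  qed
  then show ?thesis
   unfolding frechet_derivative_basis_sum[OF di(1), of v] frechet_derivative_basis_sum[OF di(2), of v]
   by (simp add: scaleR_diff_right sum_subtractf)
 qed
 \<comment> \<open>The bounds by \<open>d0\<close> and \<delta> keep the compared points in
   \<open>T\<close> and close to each other; the last one makes the Lipschitz term at most
   \<open>e / 2\<close>, the other half being left for \<omega>.\<close>
 define d where "d = min (min d0 \<delta>) (e / (4 * (?n * K + 1)))"
 have nK: "0 \<le> ?n * K" using K by simp
 have d: "d > 0" using d0(1) \<delta>(1) e nK by (simp add: d_def)
 show ?thesis
 proof (intro exI[of _ d] conjI ballI impI)
  show "d > 0" by fact
  fix h' assume h': "h' \<in> \<H> \<alpha>" "h' ` sphere 0 1 \<subseteq> S" "\<N> \<alpha> (h' - h) < d"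
  have dX: "h' - h \<in> \<H> \<alpha>" using seminormedD(6)[OF seminormed_holder[OF a] h'(1) h(1)] .
  let ?N = "\<N> \<alpha> (h' - h)"
  have N0: "0 \<le> ?N" using holderD(1)[OF a dX] .
  have c0: "\<N> \<alpha> ((\<lambda>\<xi>. g (h' \<xi>)) - (\<lambda>\<xi>. g (h \<xi>))) \<le> 2 * (?n * K) * ?N + (?n * e') * \<N> \<alpha> h"
  proof (rule holder_compose_diff[OF a g2 S(1) h h'(1,2)])
   fix x y v assume xy: "y \<in> convex hull (h ` sphere 0 1)" "norm (x - y) \<le> ?N"
   then have "x - y \<in> cball 0 d0" using h'(3) by (simp add: d_def)
   then have "y + (x - y) \<in> T" unfolding T_def using xy(1) C_def by blast
   moreover have "y + 0 \<in> T" unfolding T_def using xy(1) C_def d0(1) by (intro CollectI exI[of _ y] exI[of _ 0]) auto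
   ultimately show "norm (\<D> g (at x) v - \<D> g (at y) v) \<le> ?n * e' * norm v"
    using xy(2) h'(3) by (intro fd) (simp_all add: d_def)
  qed (use e' in simp)
  have "2 * (?n * K) * ?N \<le> 2 * (?n * K + 1) * (e / (4 * (?n * K + 1)))"
   using h'(3) nK N0 by (intro mult_mono) (auto simp: d_def)
  also have "\<dots> = e / 2" using nK by (simp add: field_simps add_nonneg_eq_0_iff)
  finally have c1: "2 * (?n * K) * ?N \<le> e / 2" .
  have c2: "?n * \<N> \<alpha> h * e' \<le> e / 2"
  proof -
   have p: "0 \<le> ?n * \<N> \<alpha> h" using hn by simp
   have "?n * \<N> \<alpha> h * e' \<le> (?n * \<N> \<alpha> h + 1) * e'" using e' by (intro mult_right_mono) auto
   also have "\<dots> = e / 2" using p unfolding e'_def by (simp add: field_simps add_nonneg_eq_0_iff)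
   finally show ?thesis .
  qed
  show "\<N> \<alpha> ((\<lambda>\<xi>. g (h' \<xi>)) - (\<lambda>\<xi>. g (h \<xi>))) \<le> e" using c0 c1 c2 by (simp add: mult_ac)
 qed
qed

text \<open>The derivative multiplies \<open>u\<close> by the first derivatives of \<open>f\<close>
  along \<open>h\<close>. That it depends continuously on \<open>h\<close> in the Hoelder norm is
  \<open>holder_compose_continuous\<close> for these derivatives, which costs the second derivative
  of \<open>f\<close>. Differentiability then follows from this continuity by the mean value theorem
  on the segment from \<open>h\<close> to \<open>h'\<close>.\<close>

lemma C1_map_holder_compose:
 fixes f :: "'a::euclidean_space \<Rightarrow> 'b::real_normed_vector"
 assumes a: "0 < \<alpha>" and f: "Ck_bounded 2 K f S" and S: "convex S" "open S"
 shows "C1_map (\<H> \<alpha>) (\<N> \<alpha>) {h \<in> \<H> \<alpha>. h ` sphere 0 1 \<subseteq> S}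
  (\<H> \<alpha>) (\<N> \<alpha>) (\<lambda>h \<xi>. f (h \<xi>))"
proof -
 let ?H = "\<H> \<alpha>" and ?N = "\<N> \<alpha>"
 note sa = seminormed_holder[OF a, where 'b='a] and sb = seminormed_holder[OF a, where 'b='b]
 have f2: "Ck_bounded (Suc (Suc 0)) K f S" using f by (simp add: numeral_2_eq_2)
 have fb: "Ck_bounded (Suc 0) K (\<lambda>x. \<D> f (at x) b) S" if "b \<in> Basis" for b
  using f2 that unfolding Ck_bounded.simps(2)[of "Suc 0"] by blast
 define G where "G b h = (\<lambda>\<xi>. \<D> f (at (h \<xi>)) b)" for b :: 'a and h :: "complex \<Rightarrow> 'a"
 define D where "D h u = (\<lambda>\<xi>. \<Sum>b\<in>Basis. (u \<xi> \<bullet> b) *\<^sub>R G b h \<xi>)" for h u :: "complex \<Rightarrow> 'a"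
 have Gmem: "G b h \<in> ?H" if "h \<in> ?H" "h ` sphere 0 1 \<subseteq> S" "b \<in> Basis" for b h
  unfolding G_def using holder_compose(1)[OF a fb[OF that(3)] S(1) that(1,2)] .
 have trm: "(\<lambda>\<xi>. (u \<xi> \<bullet> b) *\<^sub>R g \<xi>) \<in> ?H \<and> ?N (\<lambda>\<xi>. (u \<xi> \<bullet> b) *\<^sub>R g \<xi>) \<le> ?N u * ?N g"
  if u: "u \<in> ?H" and g: "g \<in> ?H" and b: "b \<in> Basis" for u :: "complex \<Rightarrow> 'a" and g :: "complex \<Rightarrow> 'b" and b
 proof -
  have ub: "(\<lambda>\<xi>. u \<xi> \<bullet> b) \<in> ?H" "?N (\<lambda>\<xi>. u \<xi> \<bullet> b) \<le> 1 * ?N u"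
   using holder_compose_bounded_linear[OF a u, of "\<lambda>x. x \<bullet> b" 1] b
   by (auto simp: bounded_linear.linear[OF bounded_linear_inner_left] Basis_le_norm)
  have "(\<lambda>\<xi>. (u \<xi> \<bullet> b) *\<^sub>R g \<xi>) \<in> ?H"
   "?N (\<lambda>\<xi>. (u \<xi> \<bullet> b) *\<^sub>R g \<xi>) \<le> 1 * ?N (\<lambda>\<xi>. u \<xi> \<bullet> b) * ?N g"
   using holder_mult[OF a ub(1) g bounded_bilinear_scaleR, of 1] by auto
  moreover have "?N (\<lambda>\<xi>. u \<xi> \<bullet> b) * ?N g \<le> ?N u * ?N g"
   using ub(2) holderD(1)[OF a g] by (intro mult_right_mono) auto
  ultimately show ?thesis by simp
 qed
 have sumb: "(\<lambda>\<xi>. \<Sum>b\<in>Basis. (u \<xi> \<bullet> b) *\<^sub>R g b \<xi>) \<in> ?H \<and>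
   ?N (\<lambda>\<xi>. \<Sum>b\<in>Basis. (u \<xi> \<bullet> b) *\<^sub>R g b \<xi>) \<le> ?N u * (\<Sum>b\<in>Basis. ?N (g b))"
  if u: "u \<in> ?H" and g: "\<And>b. b \<in> Basis \<Longrightarrow> g b \<in> ?H" for u :: "complex \<Rightarrow> 'a" and g :: "'a \<Rightarrow> complex \<Rightarrow> 'b"
 proof -
  have eq: "(\<lambda>\<xi>. \<Sum>b\<in>Basis. (u \<xi> \<bullet> b) *\<^sub>R g b \<xi>) = (\<Sum>b\<in>Basis. (\<lambda>\<xi>. (u \<xi> \<bullet> b) *\<^sub>R g b \<xi>))"
   by (simp add: fun_eq_iff fun_sum_apply)
  have "(\<Sum>b\<in>Basis. (\<lambda>\<xi>. (u \<xi> \<bullet> b) *\<^sub>R g b \<xi>)) \<in> ?H \<and>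
   ?N (\<Sum>b\<in>Basis. (\<lambda>\<xi>. (u \<xi> \<bullet> b) *\<^sub>R g b \<xi>)) \<le> (\<Sum>b\<in>Basis. ?N (\<lambda>\<xi>. (u \<xi> \<bullet> b) *\<^sub>R g b \<xi>))"
   using trm[OF u g] by (intro seminormed_sum[OF sb]) auto
  moreover have "(\<Sum>b\<in>Basis. ?N (\<lambda>\<xi>. (u \<xi> \<bullet> b) *\<^sub>R g b \<xi>)) \<le> (\<Sum>b\<in>Basis. ?N u * ?N (g b))"
   using trm[OF u g] by (intro sum_mono) auto
  ultimately show ?thesis unfolding eq by (simp add: sum_distrib_left)
 qed
 have Dsub: "D h' u - D h u = (\<lambda>\<xi>. \<Sum>b\<in>Basis. (u \<xi> \<bullet> b) *\<^sub>R (G b h' - G b h) \<xi>)" for h h' u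
  by (simp add: D_def fun_eq_iff scaleR_diff_right sum_subtractf)
 have cont: "\<exists>d>0. \<forall>h'\<in>{h \<in> ?H. h ` sphere 0 1 \<subseteq> S}. ?N (h' - h) < d \<longrightarrow> (\<forall>u\<in>?H. ?N (D h' u - D h u) \<le> e * ?N u)"
  if h: "h \<in> {h \<in> ?H. h ` sphere 0 1 \<subseteq> S}" and e: "e > 0" for h e
 proof -
  define e' where "e' = e / DIM('a)"
  have e': "e' > 0" using e by (simp add: e'_def)
  have "\<forall>b\<in>Basis. \<exists>d>0. \<forall>h'\<in>?H. h' ` sphere 0 1 \<subseteq> S \<longrightarrow> ?N (h' - h) < d \<longrightarrow> ?N (G b h' - G b h) \<le> e'"
  proof
   fix b :: 'a assume "b \<in> Basis"
   with fb have "Ck_bounded 1 K (\<lambda>x. \<D> f (at x) b) S" by simp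
   from holder_compose_continuous[OF a this S _ _ e'] h
   show "\<exists>d>0. \<forall>h'\<in>?H. h' ` sphere 0 1 \<subseteq> S \<longrightarrow> ?N (h' - h) < d \<longrightarrow> ?N (G b h' - G b h) \<le> e'"
    by (simp add: G_def)
  qed
  then obtain db where db: "\<forall>b\<in>Basis. db b > 0 \<and> (\<forall>h'\<in>?H. h' ` sphere 0 1 \<subseteq> S \<longrightarrow>
    ?N (h' - h) < db b \<longrightarrow> ?N (G b h' - G b h) \<le> e')" by metis
  show ?thesis
  proof (intro exI[of _ "Min (db ` Basis)"] conjI ballI impI)
   show "0 < Min (db ` Basis)" using db by (simp add: Min_gr_iff)
   fix h' and u :: "complex \<Rightarrow> 'a" assume h': "h' \<in> {h \<in> ?H. h ` sphere 0 1 \<subseteq> S}" "?N (h' - h) < Min (db ` Basis)" and u: "u \<in> ?H"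
   have le: "?N (G b h' - G b h) \<le> e'" if b: "b \<in> Basis" for b using db b h' by (auto simp: Min_gr_iff)
   have mem: "G b h' - G b h \<in> ?H" if b: "b \<in> Basis" for b
    using Gmem h h' b by (intro seminormedD(6)[OF sb]) auto
   have "?N (D h' u - D h u) \<le> ?N u * (\<Sum>b\<in>Basis. ?N (G b h' - G b h))"
    unfolding Dsub using sumb[OF u mem] by simp
   also have "\<dots> \<le> ?N u * (\<Sum>b\<in>(Basis::'a set). e')"
    using le holderD(1)[OF a u] by (intro mult_left_mono sum_mono) auto
   finally show "?N (D h' u - D h u) \<le> e * ?N u" by (simp add: e'_def mult.commute)
  qed
 qed
 show ?thesis
 proof (rule C1_mapI[of _ _ _ D])
  fix h assume h: "h \<in> {h \<in> ?H. h ` sphere 0 1 \<subseteq> S}"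
  show "(\<lambda>\<xi>. f (h \<xi>)) \<in> ?H" using holder_compose(1)[OF a f2 S(1)] h by blast
  show "linear (D h)"
   by (rule linearI) (auto simp: D_def fun_eq_iff inner_add_left scaleR_add_left sum.distrib scaleR_fun_def scaleR_sum_right)
  show "D h u \<in> ?H" if "u \<in> ?H" for u unfolding D_def using sumb[OF that, of "\<lambda>b. G b h"] Gmem h by simp
  show "\<exists>K. \<forall>u\<in>?H. ?N (D h u) \<le> K * ?N u"
  proof (intro exI[of _ "\<Sum>b\<in>Basis. ?N (G b h)"] ballI)
   fix u :: "complex \<Rightarrow> 'a" assume u: "u \<in> ?H"
   show "?N (D h u) \<le> (\<Sum>b\<in>Basis. ?N (G b h)) * ?N u"
    unfolding D_def using sumb[OF u, of "\<lambda>b. G b h"] Gmem h by (simp add: mult.commute)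
  qed
  fix e :: real assume e: "e > 0"
  show "\<exists>d>0. \<forall>h'\<in>{h \<in> ?H. h ` sphere 0 1 \<subseteq> S}. ?N (h' - h) < d \<longrightarrow> (\<forall>u\<in>?H. ?N (D h' u - D h u) \<le> e * ?N u)"
   by (rule cont[OF h e])
  obtain d where d: "d > 0" "\<forall>h'\<in>{h \<in> ?H. h ` sphere 0 1 \<subseteq> S}. ?N (h' - h) < d \<longrightarrow> (\<forall>u\<in>?H. ?N (D h' u - D h u) \<le> e / 2 * ?N u)"
   using cont[OF h, of "e / 2"] e by auto
  show "\<exists>d>0. \<forall>h'\<in>{h \<in> ?H. h ` sphere 0 1 \<subseteq> S}. ?N (h' - h) < d \<longrightarrow>
    ?N ((\<lambda>\<xi>. f (h' \<xi>)) - (\<lambda>\<xi>. f (h \<xi>)) - D h (h' - h)) \<le> e * ?N (h' - h)"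
  proof (intro exI[of _ d] conjI ballI impI)
   show "d > 0" by (rule d)
   fix h' assume h': "h' \<in> {h \<in> ?H. h ` sphere 0 1 \<subseteq> S}" "?N (h' - h) < d"
   define u where "u = h' - h"
   have u: "u \<in> ?H" unfolding u_def using h h' by (intro seminormedD(6)[OF sa]) auto
   have Nu: "0 \<le> ?N u" using holderD(1)[OF a u] .
   define hs where "hs s = h + s *\<^sub>R u" for s
   have hsX: "hs s \<in> ?H" for s unfolding hs_def using h u by (intro seminormedD(5)[OF sa] seminormedD(7)[OF sa]) auto
   have hsz: "hs s \<xi> = h \<xi> + s *\<^sub>R u \<xi>" for s \<xi> by (simp add: hs_def scaleR_fun_def)
   have hsS: "hs s \<xi> \<in> S" if "0 \<le> s" "s \<le> 1" "\<xi> \<in> sphere 0 1" for s \<xi>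
   proof -
    have "h \<xi> \<in> S" "h \<xi> + u \<xi> \<in> S" using h h' that(3) by (auto simp: u_def)
    from convex_segment_point[OF S(1) this that(1,2)] show ?thesis by (simp add: hsz)
   qed
   have Dhs: "?N (D (hs s) u - D h u) \<le> e / 2 * ?N u" "D (hs s) u - D h u \<in> ?H" if s: "0 \<le> s" "s \<le> 1" for s
   proof -
    have m: "hs s \<in> {h \<in> ?H. h ` sphere 0 1 \<subseteq> S}" using hsX hsS[OF s] by auto
    have "hs s - h = s *\<^sub>R u" by (simp add: hs_def)
    then have "?N (hs s - h) = s * ?N u" using seminormedD(4)[OF sa u] s by simp
    also have "\<dots> \<le> 1 * ?N u" using s Nu by (intro mult_right_mono) auto
    finally have "?N (hs s - h) < d" using h'(2) by (simp add: u_def)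
    with d m u show "?N (D (hs s) u - D h u) \<le> e / 2 * ?N u" by blast
    show "D (hs s) u - D h u \<in> ?H"
     unfolding D_def using sumb[OF u, of "\<lambda>b. G b (hs s)"] sumb[OF u, of "\<lambda>b. G b h"] Gmem h m
     by (intro seminormedD(6)[OF sb]) auto
   qed
   \<comment> \<open>The remainder is the increment from s = 0 to s = 1 of the function f(h + s u) -
     s D h u, whose derivative is at most \<open>e / 2 * ?N u\<close> in the Hoelder norm along the
     whole segment.\<close>
   let ?R = "(\<lambda>\<xi>. f (h' \<xi>)) - (\<lambda>\<xi>. f (h \<xi>)) - D h u"
   have der: "((\<lambda>s. f (hs s \<xi>) - s *\<^sub>R D h u \<xi>) has_vector_derivative (D (hs s) u - D h u) \<xi>) (at s)"
    if s: "0 \<le> s" "s \<le> 1" and z: "\<xi> \<in> sphere 0 1" for s \<xi>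
   proof -
    have "(f has_derivative \<D> f (at (h \<xi> + s *\<^sub>R u \<xi>))) (at (h \<xi> + s *\<^sub>R u \<xi>))"
     using Ck_bounded_has_derivative[OF f2 hsS[OF s z]] by (simp add: hsz)
    from has_vector_derivative_along[OF this]
    have "((\<lambda>s. f (hs s \<xi>)) has_vector_derivative \<D> f (at (hs s \<xi>)) (u \<xi>)) (at s)"
     by (simp add: hsz)
    moreover have "frechet_derivative f (at (hs s \<xi>)) (u \<xi>) = D (hs s) u \<xi>"
     unfolding D_def G_def using f2 hsS[OF s z] by (intro frechet_derivative_basis_sum) auto
    moreover have "((\<lambda>s. s *\<^sub>R D h u \<xi>) has_vector_derivative D h u \<xi>) (at s)"
     by (auto simp: has_vector_derivative_def intro!: derivative_eq_intros)
    ultimately show ?thesis by (auto intro!: has_vector_derivative_diff)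
   qed
   have R: "?R \<xi> = (f (hs 1 \<xi>) - 1 *\<^sub>R D h u \<xi>) - (f (hs 0 \<xi>) - 0 *\<^sub>R D h u \<xi>)" for \<xi>
    by (simp add: hsz u_def)
   have 1: "norm (?R \<xi>) \<le> e / 2 * ?N u" if z: "\<xi> \<in> sphere 0 1" for \<xi>
    unfolding R
   proof (rule norm_mvt_unit_interval[OF der])
    fix s :: real assume s: "0 \<le> s" "s \<le> 1"
    show "norm ((D (hs s) u - D h u) \<xi>) \<le> e / 2 * ?N u"
     using holderD(2)[OF a Dhs(2)[OF s] z] Dhs(1)[OF s] by linarith
   qed (use z in auto)
   have 2: "norm (?R \<xi> - ?R \<eta>) \<le> (e / 2 * ?N u) * dist \<xi> \<eta> powr \<alpha>"
    if z: "\<xi> \<in> sphere 0 1" "\<eta> \<in> sphere 0 1" for \<xi> \<eta>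
   proof -
    have "?R \<xi> - ?R \<eta> = ((f (hs 1 \<xi>) - 1 *\<^sub>R D h u \<xi>) - (f (hs 1 \<eta>) - 1 *\<^sub>R D h u \<eta>)) -
      ((f (hs 0 \<xi>) - 0 *\<^sub>R D h u \<xi>) - (f (hs 0 \<eta>) - 0 *\<^sub>R D h u \<eta>))" unfolding R by simp
    also have "norm \<dots> \<le> (e / 2 * ?N u) * dist \<xi> \<eta> powr \<alpha>"
    proof (rule norm_mvt_unit_interval[OF has_vector_derivative_diff[OF der der]])
     fix s :: real assume s: "0 \<le> s" "s \<le> 1"
     have "norm ((D (hs s) u - D h u) \<xi> - (D (hs s) u - D h u) \<eta>) \<le> ?N (D (hs s) u - D h u) * dist \<xi> \<eta> powr \<alpha>"
      using holderD(3)[OF a Dhs(2)[OF s] z] .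
     also have "\<dots> \<le> e / 2 * ?N u * dist \<xi> \<eta> powr \<alpha>" using Dhs(1)[OF s] by (intro mult_right_mono) auto
     finally show "norm ((D (hs s) u - D h u) \<xi> - (D (hs s) u - D h u) \<eta>) \<le> e / 2 * ?N u * dist \<xi> \<eta> powr \<alpha>" .
    qed (use z in auto)
    finally show ?thesis .
   qed
   have "0 \<le> e / 2 * ?N u" using e Nu by simp
   from holderI(2)[where f="?R", OF a this 1 2]
   show "?N ((\<lambda>\<xi>. f (h' \<xi>)) - (\<lambda>\<xi>. f (h \<xi>)) - D h (h' - h)) \<le> e * ?N (h' - h)"
    by (simp add: u_def)
  qed
 qed
qed

subsection \<open>The Cauchy transform on Hoelder spaces\<close>

text \<open>Jordan's inequality: sine is concave on this interval and lies above its chord.\<close>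

lemma sin_ge_chord: "0 \<le> x \<Longrightarrow> x \<le> pi / 2 \<Longrightarrow> 2 / pi * x \<le> sin x"
proof -
 assume x: "0 \<le> x" "x \<le> pi / 2"
 have "convex_on {0..pi/2} (\<lambda>x. - sin x)"
  by (rule f''_ge0_imp_convex[where f'="\<lambda>x. - cos x" and f''="sin"])
   (auto intro!: derivative_eq_intros sin_ge_zero)
 from convex_onD[OF this, of "2 * x / pi" 0 "pi / 2"] x
 show ?thesis by (simp add: field_simps)
qed

lemma norm_cis_diff_ge:
 assumes "\<bar>\<tau>\<bar> \<le> pi" shows "2 / pi * \<bar>\<tau>\<bar> \<le> norm (cis \<tau> - 1)"
proof -
 have "(norm (cis \<tau> - 1))\<^sup>2 = (cos \<tau> - 1)\<^sup>2 + (sin \<tau>)\<^sup>2" by (simp add: cmod_power2)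
 also have "\<dots> = (2 * sin (\<bar>\<tau>\<bar> / 2))\<^sup>2"
  using cos_double_sin[of "\<tau> / 2"] sin_cos_squared_add[of \<tau>]
  by (cases "\<tau> \<ge> 0") (simp_all add: power2_eq_square algebra_simps)
 finally have "(norm (cis \<tau> - 1))\<^sup>2 = \<bar>2 * sin (\<bar>\<tau>\<bar> / 2)\<bar>\<^sup>2" by (simp only: power2_abs)
 then have "norm (cis \<tau> - 1) = \<bar>2 * sin (\<bar>\<tau>\<bar> / 2)\<bar>" by (rule power2_eq_imp_eq) auto
 moreover have "2 / pi * (\<bar>\<tau>\<bar> / 2) \<le> sin (\<bar>\<tau>\<bar> / 2)" using assms by (intro sin_ge_chord) auto
 ultimately show ?thesis by simp
qed

text \<open>Seen from the point at radius r, the distance to the circle point at angle \<tau>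
  dominates 1 - r, hence half of the chord \<open>cis \<tau> - 1\<close> and a multiple of the
  angle.\<close>

lemma norm_cis_minus_ge:
 assumes "\<bar>\<tau>\<bar> \<le> pi" "0 \<le> r" "r \<le> 1"
 shows "((1 - r) + \<bar>\<tau>\<bar>) / (1 + pi) \<le> norm (cis \<tau> - of_real r)"
proof -
 have 1: "1 - r \<le> norm (cis \<tau> - of_real r)"
  using norm_triangle_ineq2[of "cis \<tau>" "of_real r"] assms by simp
 have "norm (cis \<tau> - 1) \<le> norm (cis \<tau> - of_real r) + norm (of_real r - 1 :: complex)"
  using norm_triangle_ineq[of "cis \<tau> - of_real r" "of_real r - 1"] by simp
 also have "norm (of_real r - 1 :: complex) = 1 - r"
  using assms norm_of_real[of "r - 1", where 'a=complex] by simp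
 finally have "2 / pi * \<bar>\<tau>\<bar> \<le> 2 * norm (cis \<tau> - of_real r)" using 1 norm_cis_diff_ge[OF assms(1)] by linarith
 then have "\<bar>\<tau>\<bar> \<le> pi * norm (cis \<tau> - of_real r)" by (simp add: field_simps)
 then show ?thesis using 1 pi_gt_zero by (simp add: divide_le_eq algebra_simps add_pos_pos)
qed

section \<open>Integrals over the circle and a kernel estimate\<close>

definition circ_int :: "(complex \<Rightarrow> complex) \<Rightarrow> complex" where
 "circ_int g = integral {0..2*pi} (\<lambda>t. g (cis t))"

lemma continuous_on_circ:
 "continuous_on (sphere 0 1) g \<Longrightarrow> continuous_on T (\<lambda>t. g (cis t))"
 by (rule continuous_on_compose2[where g=g]) (auto intro!: continuous_intros)

lemma circ_int_shift:
 assumes g: "continuous_on (sphere 0 1) g" and a: "0 \<le> a" "a \<le> 2 * pi"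
 shows "circ_int g = integral {a..a + 2 * pi} (\<lambda>t. g (cis t))"
proof -
 let ?g = "\<lambda>t. g (cis t)"
 have int: "?g integrable_on {c..d}" for c d by (intro integrable_continuous_real continuous_on_circ g)
 have per: "?g (t + 2 * pi) = ?g t" for t by (simp flip: cis_mult)
 have "integral {a..a + 2 * pi} ?g = integral {a..2 * pi} ?g + integral {2 * pi..a + 2 * pi} ?g"
  using Henstock_Kurzweil_Integration.integral_combine[of a "2 * pi" "a + 2 * pi" ?g] a int by simp
 also have "integral {2 * pi..a + 2 * pi} ?g = integral {0..a} ?g"
  using integral_shift_Icc_real[of 0 a ?g "2 * pi"] by (simp add: o_def per add.commute[of "2 * pi"])
 also have "integral {a..2 * pi} ?g + integral {0..a} ?g = integral {0..2 * pi} ?g"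
  unfolding Henstock_Kurzweil_Integration.integral_combine[OF a int, symmetric] by simp
 finally show ?thesis by (simp add: circ_int_def)
qed

lemma circ_int_contour:
 "contour_integral (circlepath 0 1) f = circ_int (\<lambda>u. f u * (\<i> * u))"
 unfolding circlepath_def circ_int_def
 by (subst contour_integral_part_circlepath_eq) (simp_all add: mult.assoc)

text \<open>The power of \<open>1 + pi\<close> comes from \<open>norm_cis_minus_ge\<close>,
  \<open>1 / (1 - \<alpha>)\<close> from integrating
  \<open>(\<delta> + s) powr (\<alpha> - 2)\<close> over s \<ge> 0, and the 2 from the two sides of
  the nearest point.\<close>

definition kernel_const :: "real \<Rightarrow> real" where
 "kernel_const \<alpha> = 2 * (1 + pi) powr (2 - \<alpha>) / (1 - \<alpha>)"

lemma kernel_const_pos: "\<alpha> < 1 \<Longrightarrow> 0 < kernel_const \<alpha>"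
 using add_pos_pos[OF zero_less_one pi_gt_zero]
 by (auto simp: kernel_const_def intro!: divide_pos_pos mult_pos_pos)

text \<open>The only estimate of singular integrals that is needed. In the angle measured from the
  argument of z the kernel is dominated by a multiple of
  \<open>(\<delta> + \<bar>t - c\<bar>) powr (\<alpha> - 2)\<close>, which has an elementary
  primitive.\<close>

lemma norm_circ_int_le:
 assumes a: "0 < \<alpha>" "\<alpha> < 1" and z: "norm z < 1" and M: "0 \<le> M" and g: "continuous_on (sphere 0 1) g"
  and b: "\<And>u. norm u = 1 \<Longrightarrow> norm (g u) \<le> M * norm (u - z) powr (\<alpha> - 2)"
 shows "norm (circ_int g) \<le> kernel_const \<alpha> * M * (1 - norm z) powr (\<alpha> - 1)"
proof -
 define \<delta> where "\<delta> = 1 - norm z"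
 have \<delta>: "0 < \<delta>" using z by (simp add: \<delta>_def)
 \<comment> \<open>With \<open>a0\<close> the argument of -z, the window from \<open>a0\<close> to
   \<open>a0 + 2 * pi\<close> is centred at an argument \<open>c\<close> of z, and \<open>a0\<close>
   lies in the range that \<open>circ_int_shift\<close> admits.\<close>
 define a0 where "a0 = Arg2pi (- z)"
 have a0: "0 \<le> a0" "a0 \<le> 2 * pi" using Arg2pi[of "- z"] by (auto simp: a0_def)
 define c where "c = a0 + pi"
 have zc: "z = of_real (norm z) * cis c"
 proof -
  have "- z = of_real (norm (- z)) * cis a0" using Arg2pi_eq[of "- z"] by (simp add: a0_def cis_conv_exp)
  then have "z = - (of_real (norm z) * cis a0)" by (metis minus_minus norm_minus_cancel)
  then have "z = of_real (norm z) * (cis a0 * cis pi)" by simp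
  then show ?thesis by (simp only: c_def cis_mult)
 qed
 let ?g = "\<lambda>t. g (cis t)"
 define \<kappa> where "\<kappa> = (1 + pi) powr (2 - \<alpha>)"
 have pi1: "0 < 1 + pi" using pi_gt_zero by (rule add_pos_pos[OF zero_less_one])
 have \<kappa>: "0 < \<kappa>" using pi1 unfolding \<kappa>_def by simp
 have gb: "norm (?g t) \<le> M * \<kappa> * (\<delta> + \<bar>t - c\<bar>) powr (\<alpha> - 2)" if t: "\<bar>t - c\<bar> \<le> pi" for t
 proof -
  have p: "0 < (\<delta> + \<bar>t - c\<bar>) / (1 + pi)" using \<delta> pi1 by (intro divide_pos_pos) auto
  have "cis t = cis (t - c) * cis c" by (simp add: cis_mult)
  then have "cis t - z = (cis (t - c) - of_real (norm z)) * cis c" by (subst (1) zc) (simp add: left_diff_distrib)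
  then have "norm (cis t - z) = norm (cis (t - c) - of_real (norm z))" by (simp add: norm_mult)
  then have "(\<delta> + \<bar>t - c\<bar>) / (1 + pi) \<le> norm (cis t - z)"
   using norm_cis_minus_ge[OF t, of "norm z"] z by (simp add: \<delta>_def)
  then have "norm (cis t - z) powr (\<alpha> - 2) \<le> ((\<delta> + \<bar>t - c\<bar>) / (1 + pi)) powr (\<alpha> - 2)"
   using p a by (intro powr_mono2') auto
  also have "\<dots> = \<kappa> * (\<delta> + \<bar>t - c\<bar>) powr (\<alpha> - 2)"
  proof -
   have "((\<delta> + \<bar>t - c\<bar>) / (1 + pi)) powr (\<alpha> - 2) = (\<delta> + \<bar>t - c\<bar>) powr (\<alpha> - 2) / (1 + pi) powr (\<alpha> - 2)"
    by (rule powr_divide)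
   moreover have "(1 + pi) powr (\<alpha> - 2) = inverse \<kappa>"
    unfolding \<kappa>_def powr_minus[symmetric] by simp
   ultimately show ?thesis by (simp add: field_simps)
  qed
  finally have "M * norm (cis t - z) powr (\<alpha> - 2) \<le> M * (\<kappa> * (\<delta> + \<bar>t - c\<bar>) powr (\<alpha> - 2))" using M by (intro mult_left_mono) auto
  then show ?thesis using b[of "cis t"] by (simp add: mult.assoc)
 qed
 define F where "F s = - ((\<delta> + s) powr (\<alpha> - 1) / (1 - \<alpha>))" for s
 have F: "(F has_real_derivative (\<delta> + s) powr (\<alpha> - 2)) (at s)" if "0 \<le> s" for s
 proof -
  have "((\<lambda>s. (\<delta> + s) powr (\<alpha> - 1)) has_real_derivative (\<alpha> - 1) * (\<delta> + s) powr (\<alpha> - 2)) (at s)"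
  proof -
   have "((\<lambda>s. \<delta> + s) has_real_derivative 1) (at s)" by (auto intro!: derivative_eq_intros)
   from DERIV_fun_powr[OF this, of "\<alpha> - 1"] that \<delta> show ?thesis by simp
  qed
  from DERIV_cmult[OF this, of "- (1 / (1 - \<alpha>))"]
  have "((\<lambda>s. - (1 / (1 - \<alpha>)) * (\<delta> + s) powr (\<alpha> - 1)) has_real_derivative
    - (1 / (1 - \<alpha>)) * ((\<alpha> - 1) * (\<delta> + s) powr (\<alpha> - 2))) (at s)" .
  moreover have "- (1 / (1 - \<alpha>)) * ((\<alpha> - 1) * (\<delta> + s) powr (\<alpha> - 2)) = (\<delta> + s) powr (\<alpha> - 2)"
   using a by (simp add: divide_simps) (simp add: algebra_simps)
  ultimately show ?thesis by (simp add: F_def[abs_def])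
 qed
 have int: "?g integrable_on {x..y}" for x y by (intro integrable_continuous_real continuous_on_circ g)
 \<comment> \<open>The sign \<sigma> treats both half circles at once:
   \<open>\<sigma> * F (\<sigma> * (t - c))\<close> is a primitive on the side where \<sigma> is the
   sign of t - c.\<close>
 have part: "norm (integral {x..y} ?g) \<le> M * \<kappa> * F pi - M * \<kappa> * F 0"
  if \<sigma>: "\<sigma> * \<sigma> = 1" "\<bar>\<sigma>\<bar> = 1" and xy: "x \<le> y" "\<sigma> * F (\<sigma> * (y - c)) - \<sigma> * F (\<sigma> * (x - c)) = F pi - F 0"
   and nn: "\<And>t. t \<in> {x..y} \<Longrightarrow> 0 \<le> \<sigma> * (t - c) \<and> \<sigma> * (t - c) \<le> pi" for \<sigma> x y
 proof -
  have i: "((\<lambda>t. M * \<kappa> * (\<delta> + \<sigma> * (t - c)) powr (\<alpha> - 2)) has_integral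
    (M * \<kappa> * (\<sigma> * F (\<sigma> * (y - c))) - M * \<kappa> * (\<sigma> * F (\<sigma> * (x - c))))) {x..y}"
  proof (rule fundamental_theorem_of_calculus[OF xy(1)])
   fix t assume t: "t \<in> {x..y}"
   have "((\<lambda>t. F (\<sigma> * (t - c))) has_real_derivative (\<delta> + \<sigma> * (t - c)) powr (\<alpha> - 2) * \<sigma>) (at t)"
    by (rule DERIV_chain2[OF F]) (use nn[OF t] in \<open>auto intro!: derivative_eq_intros\<close>)
   from DERIV_cmult[OF DERIV_cmult[OF this, of \<sigma>], of "M * \<kappa>"]
   have "((\<lambda>t. M * \<kappa> * (\<sigma> * F (\<sigma> * (t - c)))) has_real_derivative
     M * \<kappa> * (\<sigma> * ((\<delta> + \<sigma> * (t - c)) powr (\<alpha> - 2) * \<sigma>))) (at t)" .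
   moreover have "\<sigma> * (q * \<sigma>) = q" for q using \<sigma>(1) by (simp add: mult.left_commute)
   ultimately show "((\<lambda>t. M * \<kappa> * (\<sigma> * F (\<sigma> * (t - c)))) has_vector_derivative
     M * \<kappa> * (\<delta> + \<sigma> * (t - c)) powr (\<alpha> - 2)) (at t within {x..y})"
    by (simp add: has_real_derivative_iff_has_vector_derivative has_vector_derivative_at_within)
  qed
  have "norm (integral {x..y} ?g) \<le> integral {x..y} (\<lambda>t. M * \<kappa> * (\<delta> + \<sigma> * (t - c)) powr (\<alpha> - 2))"
  proof (rule integral_norm_bound_integral)
   fix t assume "t \<in> {x..y}"
   moreover have "\<bar>t - c\<bar> = \<bar>\<sigma> * (t - c)\<bar>" using \<sigma>(2) by (simp add: abs_mult)
   ultimately show "norm (?g t) \<le> M * \<kappa> * (\<delta> + \<sigma> * (t - c)) powr (\<alpha> - 2)" using gb[of t] nn[of t] by simp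
  qed (use int i in auto)
  also have "\<dots> = M * \<kappa> * (\<sigma> * F (\<sigma> * (y - c)) - \<sigma> * F (\<sigma> * (x - c)))"
   unfolding integral_unique[OF i] by (simp only: right_diff_distrib)
  finally show ?thesis unfolding xy(2) by (simp only: right_diff_distrib)
 qed
 have n1: "norm (integral {c..c + pi} ?g) \<le> M * \<kappa> * F pi - M * \<kappa> * F 0" by (rule part[of 1]) auto
 have n2: "norm (integral {c - pi..c} ?g) \<le> M * \<kappa> * F pi - M * \<kappa> * F 0" by (rule part[of "- 1"]) auto
 have "circ_int g = integral {c - pi..c + pi} ?g"
  using circ_int_shift[OF g a0] by (simp add: c_def add.commute)
 also have "\<dots> = integral {c - pi..c} ?g + integral {c..c + pi} ?g"
  using Henstock_Kurzweil_Integration.integral_combine[of "c - pi" c "c + pi" ?g] int by simp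
 also have "norm \<dots> \<le> 2 * (M * \<kappa> * F pi - M * \<kappa> * F 0)" unfolding mult_2 by (rule norm_triangle_mono[OF n2 n1])
 also have "\<dots> \<le> 2 * (M * \<kappa> * (\<delta> powr (\<alpha> - 1) / (1 - \<alpha>)))"
 proof -
  have "F pi \<le> 0" using a by (simp add: F_def)
  moreover have "0 \<le> M * \<kappa>" using M \<kappa> by simp
  ultimately have "M * \<kappa> * F pi \<le> 0" by (simp add: mult_nonneg_nonpos)
  then show ?thesis by (simp add: F_def)
 qed
 finally show ?thesis by (simp add: kernel_const_def \<kappa>_def \<delta>_def mult_ac)
qed

text \<open>In the angle parameter du = \<i> u dt, so this is the usual Cauchy integral; the form
  without contours makes conjugation and norm estimates immediate.\<close>

definition cauchy_int :: "(complex \<Rightarrow> complex) \<Rightarrow> complex \<Rightarrow> complex" where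
 "cauchy_int f z = circ_int (\<lambda>u. f u * u / (u - z)) / (2 * pi)"

lemma sphere_ne: "norm (u::complex) = 1 \<Longrightarrow> norm z < 1 \<Longrightarrow> u - z \<noteq> 0"
 by auto

lemma circ_int_cong: "(\<And>u. norm u = 1 \<Longrightarrow> f u = g u) \<Longrightarrow> circ_int f = circ_int g"
 by (simp add: circ_int_def)

lemma circ_int_integrable:
 fixes f :: "complex \<Rightarrow> complex"
 shows "continuous_on (sphere 0 1) f \<Longrightarrow> (\<lambda>t. f (cis t)) integrable_on {0..2*pi}"
 by (rule integrable_continuous_real[OF continuous_on_circ])

lemma circ_int_add:
 "continuous_on (sphere 0 1) f \<Longrightarrow> continuous_on (sphere 0 1) g \<Longrightarrow>
  circ_int (\<lambda>u. f u + g u) = circ_int f + circ_int g"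
 unfolding circ_int_def by (intro integral_add circ_int_integrable)

lemma circ_int_diff:
 "continuous_on (sphere 0 1) f \<Longrightarrow> continuous_on (sphere 0 1) g \<Longrightarrow>
  circ_int (\<lambda>u. f u - g u) = circ_int f - circ_int g"
 unfolding circ_int_def by (intro integral_diff circ_int_integrable)

lemma circ_int_cmult: "circ_int (\<lambda>u. c * f u) = c * circ_int f"
 unfolding circ_int_def by simp

lemma circ_int_cnj: "cnj (circ_int f) = circ_int (\<lambda>u. cnj (f u))"
 unfolding circ_int_def by (rule integral_cnj)

lemma circ_int_bound:
 assumes "continuous_on (sphere 0 1) f" "\<And>u. norm u = 1 \<Longrightarrow> norm (f u) \<le> B"
 shows "norm (circ_int f) \<le> B * (2 * pi)"
 unfolding circ_int_def using integral_bound[of 0 "2 * pi" "\<lambda>t. f (cis t)" B] continuous_on_circ[OF assms(1)] assms(2)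
 by simp

lemma cauchy_int_contour:
 "cauchy_int f z = contour_integral (circlepath 0 1) (\<lambda>u. f u / (u - z)) / (2 * pi * \<i>)"
proof -
 have "circ_int (\<lambda>u. \<i> * (f u * u / (u - z))) = \<i> * circ_int (\<lambda>u. f u * u / (u - z))" by (rule circ_int_cmult)
 then show ?thesis unfolding cauchy_int_def circ_int_contour by (simp add: mult_ac)
qed

lemma continuous_on_cauchy_kernel:
 fixes f :: "complex \<Rightarrow> complex"
 shows "continuous_on (sphere 0 1) f \<Longrightarrow> norm z < 1 \<Longrightarrow> continuous_on (sphere 0 1) (\<lambda>u. f u / (u - z) ^ k)"
 by (rule continuous_on_divide) (auto intro!: continuous_intros)

lemma cauchy_int_has_field_derivative:
 assumes f: "continuous_on (sphere 0 1) f" and z: "norm z < 1"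
 shows "(cauchy_int f has_field_derivative circ_int (\<lambda>u. f u * u / (u - z)\<^sup>2) / (2 * pi)) (at z)"
proof -
 have pth: "continuous_on (path_image (circlepath 0 1)) f" using f by simp
 have "((\<lambda>u. f u / (u - w) ^ 1) has_contour_integral (2 * pi * \<i> * cauchy_int f w)) (circlepath 0 1)"
  if w: "w \<in> ball 0 1" for w
 proof -
  have "(\<lambda>u. f u / (u - w) ^ 1) contour_integrable_on (circlepath 0 1)"
   using continuous_on_cauchy_kernel[OF f, of w 1] w
   by (intro contour_integrable_continuous_circlepath) (auto simp: path_image_circlepath)
  then show ?thesis unfolding cauchy_int_contour by (auto simp: has_contour_integral_integral)
 qed
 from Cauchy_next_derivative_circlepath(2)[OF pth this, of z] z
 have "((\<lambda>w. 2 * pi * \<i> * cauchy_int f w) has_field_derivative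
   contour_integral (circlepath 0 1) (\<lambda>u. f u / (u - z)\<^sup>2)) (at z)"
  by (simp add: numeral_2_eq_2)
 from DERIV_cdivide[OF this, of "2 * pi * \<i>"]
 have "(cauchy_int f has_field_derivative
   contour_integral (circlepath 0 1) (\<lambda>u. f u / (u - z)\<^sup>2) / (2 * pi * \<i>)) (at z)" by simp
 moreover have "contour_integral (circlepath 0 1) (\<lambda>u. f u / (u - z)\<^sup>2) = \<i> * circ_int (\<lambda>u. f u * u / (u - z)\<^sup>2)"
  unfolding circ_int_contour circ_int_cmult[symmetric] by (intro circ_int_cong) simp
 ultimately show ?thesis by simp
qed

lemma cauchy_int_holomorphic:
 assumes "continuous_on (sphere 0 1) f" "f holomorphic_on ball 0 1" "continuous_on (cball 0 1) f" "norm z < 1"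
 shows "cauchy_int f z = f z"
 using contour_integral_unique[OF Cauchy_integral_circlepath[OF assms(3,2), of z]] assms(4)
 unfolding cauchy_int_contour by simp

lemma cauchy_int_const: "norm z < 1 \<Longrightarrow> cauchy_int (\<lambda>_. c) z = c"
 by (rule cauchy_int_holomorphic) auto

lemma cauchy_int_add:
 assumes "continuous_on (sphere 0 1) f" "continuous_on (sphere 0 1) g" "norm z < 1"
 shows "cauchy_int (\<lambda>u. f u + g u) z = cauchy_int f z + cauchy_int g z"
proof -
 have c: "continuous_on (sphere 0 1) (\<lambda>u. f u * u / (u - z))" if "continuous_on (sphere 0 1) f" for f :: "complex \<Rightarrow> complex"
  using that assms(3) by (intro continuous_intros) auto
 show ?thesis unfolding cauchy_int_def
  using circ_int_add[OF c[OF assms(1)] c[OF assms(2)]] by (simp add: distrib_right add_divide_distrib)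
qed

lemma cauchy_int_cmult: "cauchy_int (\<lambda>u. c * f u) z = c * cauchy_int f z"
proof -
 have "circ_int (\<lambda>u. c * f u * u / (u - z)) = c * circ_int (\<lambda>u. f u * u / (u - z))"
  unfolding circ_int_cmult[symmetric] by (intro circ_int_cong) simp
 then show ?thesis by (simp add: cauchy_int_def)
qed

lemma cauchy_int_diff_const:
 assumes "continuous_on (sphere 0 1) f" "norm z < 1"
 shows "cauchy_int (\<lambda>u. f u - c) z = cauchy_int f z - c"
 using cauchy_int_add[OF assms(1), of "\<lambda>_. - c" z] cauchy_int_const[OF assms(2), of "- c"] assms(2) by simp

text \<open>If v is not farther from z than u, then the distance of u and v is at most twice that of
  u and z. This lets the Hoelder condition on the circle cancel part of a kernel singular at
  z.\<close>

lemma holder_dist_le: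
 assumes a: "0 < \<alpha>" and f: "f \<in> \<H> \<alpha>" and u: "norm u = 1" and v: "norm v = 1"
  and zv: "norm (z - v) \<le> norm (u - z)"
 shows "norm (f u - f v) \<le> \<N> \<alpha> f * 2 powr \<alpha> * norm (u - z) powr \<alpha>"
proof -
 have "dist u v \<le> norm (u - z) + norm (z - v)" using norm_triangle_ineq[of "u - z" "z - v"] by (simp add: dist_norm)
 then have d: "dist u v \<le> 2 * norm (u - z)" using zv by simp
 have "norm (f u - f v) \<le> \<N> \<alpha> f * dist u v powr \<alpha>" using holderD(3)[OF a f, of u v] u v by simp
 also have "\<dots> \<le> \<N> \<alpha> f * (2 * norm (u - z)) powr \<alpha>"
  using d a holderD(1)[OF a f] by (intro mult_left_mono powr_mono2) auto
 finally show ?thesis by (simp add: powr_mult mult.assoc)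
qed

lemma exists_nearest_on_sphere:
 assumes "norm (z::complex) < 1"
 shows "\<exists>v. norm v = 1 \<and> norm (z - v) = 1 - norm z"
proof (cases "z = 0")
 case True
 then show ?thesis by (intro exI[of _ 1]) auto
next
 case False
 define v where "v = z / of_real (norm z)"
 have "norm v = 1" using False by (simp add: v_def norm_divide)
 have "z = of_real (norm z) * v" using False by (simp add: v_def)
 then have "z - v = of_real (norm z - 1) * v" by (metis left_diff_distrib mult_1 of_real_1 of_real_diff)
 then have "norm (z - v) = \<bar>norm z - 1\<bar>" using \<open>norm v = 1\<close> by (simp add: norm_mult del: of_real_diff)
 then show ?thesis using assms \<open>norm v = 1\<close> by (intro exI[of _ v]) auto
qed

text \<open>Subtracting the value of \<open>f\<close> at the circle point v nearest to z does not
  change the derivative, since the Cauchy integral of a constant is constant. The Hoelder condition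
  then lowers the singularity of the kernel to the exponent \<open>\<alpha> - 2\<close>.\<close>

lemma cauchy_int_derivative_bound:
 assumes a: "0 < \<alpha>" "\<alpha> < 1" and f: "f \<in> \<H> \<alpha>" and z: "norm z < 1"
 shows "norm (circ_int (\<lambda>u. f u * u / (u - z)\<^sup>2) / (2 * pi)) \<le>
  kernel_const \<alpha> * 2 powr \<alpha> * \<N> \<alpha> f * (1 - norm z) powr (\<alpha> - 1)"
proof -
 have cf: "continuous_on (sphere 0 1) f" using holder_continuous_on[OF a(1) f] .
 obtain v where v: "norm v = 1" "norm (z - v) = 1 - norm z" using exists_nearest_on_sphere[OF z] by blast
 have c: "continuous_on (sphere 0 1) (\<lambda>u. g u * u / (u - z)\<^sup>2)" if "continuous_on (sphere 0 1) g" for g :: "complex \<Rightarrow> complex"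
  using that z by (intro continuous_intros) auto
 have cfv: "continuous_on (sphere 0 1) (\<lambda>u. f u - f v)" using cf by (intro continuous_intros)
 have "(cauchy_int (\<lambda>_. f v) has_field_derivative 0) (at z)"
 proof (rule has_field_derivative_transform_within_open[of "\<lambda>_. f v" 0 z "ball 0 1"])
  show "f v = cauchy_int (\<lambda>_. f v) w" if "w \<in> ball 0 1" for w using cauchy_int_const[of w "f v"] that by simp
 qed (use z in auto)
 with cauchy_int_has_field_derivative[of "\<lambda>_. f v" z] z
 have zero: "circ_int (\<lambda>u. f v * u / (u - z)\<^sup>2) = 0" using DERIV_unique by fastforce
 have eq: "circ_int (\<lambda>u. f u * u / (u - z)\<^sup>2) = circ_int (\<lambda>u. (f u - f v) * u / (u - z)\<^sup>2)"
  using circ_int_diff[OF c[OF cf] c[OF continuous_on_const[of _ "f v"]]] zero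
  by (simp add: left_diff_distrib diff_divide_distrib)
 have "norm (circ_int (\<lambda>u. (f u - f v) * u / (u - z)\<^sup>2)) \<le>
   kernel_const \<alpha> * (\<N> \<alpha> f * 2 powr \<alpha>) * (1 - norm z) powr (\<alpha> - 1)"
 proof (rule norm_circ_int_le[OF a z _ c[OF cfv]])
  show "0 \<le> \<N> \<alpha> f * 2 powr \<alpha>" using holderD(1)[OF a(1) f] by simp
  fix u :: complex assume u: "norm u = 1"
  have ne: "norm (u - z) > 0" using sphere_ne[OF u z] by simp
  have "1 - norm z \<le> norm (u - z)" using norm_triangle_ineq2[of u z] u by simp
  then have "norm (f u - f v) \<le> \<N> \<alpha> f * 2 powr \<alpha> * norm (u - z) powr \<alpha>"
   using holder_dist_le[OF a(1) f u v(1), of z] v(2) by simp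
  then have "norm (f u - f v) / (norm (u - z))\<^sup>2 \<le> \<N> \<alpha> f * 2 powr \<alpha> * norm (u - z) powr \<alpha> / (norm (u - z))\<^sup>2"
   by (rule divide_right_mono) simp
  also have "\<dots> = \<N> \<alpha> f * 2 powr \<alpha> * norm (u - z) powr (\<alpha> - 2)"
   using ne by (simp add: powr_diff powr_numeral)
  finally show "norm ((f u - f v) * u / (u - z)\<^sup>2) \<le> \<N> \<alpha> f * 2 powr \<alpha> * norm (u - z) powr (\<alpha> - 2)"
   using u by (simp add: norm_divide norm_mult norm_power)
 qed
 moreover have "norm (circ_int (\<lambda>u. (f u - f v) * u / (u - z)\<^sup>2) / (2 * pi)) \<le> norm (circ_int (\<lambda>u. (f u - f v) * u / (u - z)\<^sup>2))"
 proof -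
  have "norm (2 * pi) \<ge> 1" using pi_ge_two by simp
  then show ?thesis by (simp add: norm_divide divide_le_eq mult_le_cancel_left1 norm_mult del: norm_ge_zero)
 qed
 ultimately show ?thesis unfolding eq by (simp add: mult_ac)
qed

text \<open>The Hardy--Littlewood argument: compare \<open>g z\<close> and \<open>g w\<close> along radii down to the circle of radius
 about \<open>1 - \<bar>z - w\<bar>\<close>, where the derivative is bounded by \<open>C \<bar>z - w\<bar> powr (\<alpha> - 1)\<close>.\<close>

lemma Hardy_Littlewood_Lipschitz:
 fixes g g' :: "complex \<Rightarrow> complex"
 assumes a: "0 < \<alpha>" "\<alpha> < 1" and C: "0 \<le> C"
  and d: "\<And>z. norm z < 1 \<Longrightarrow> (g has_field_derivative g' z) (at z)"
  and b: "\<And>z. norm z < 1 \<Longrightarrow> norm (g' z) \<le> C * (1 - norm z) powr (\<alpha> - 1)"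
  and z: "norm z < 1" and w: "norm w < 1"
 shows "norm (g z - g w) \<le> (2 / \<alpha> + 1) * C * norm (z - w) powr \<alpha>"
proof -
 \<comment> \<open>The length of the radial detour; the cap at 1 keeps the factor
   \<open>1 - e\<close> nonnegative.\<close>
 define e where "e = min (norm (z - w)) 1"
 have e: "0 \<le> e" "e \<le> 1" "e \<le> norm (z - w)" by (auto simp: e_def)
 have radial: "norm (g x - g (of_real (1 - e) * x)) \<le> C / \<alpha> * e powr \<alpha>" if x: "norm x < 1" for x
 proof (cases "e = 0")
  case True
  then show ?thesis by simp
 next
  case False
  \<comment> \<open>A primitive of the bound \<open>C * (1 - s) powr (\<alpha> - 1)\<close> along
    the radius. The bound is unbounded near s = 1, but \<phi> is continuous there, and the mean
    value theorem asks for derivatives in the open interval only.\<close>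
  define \<phi> where "\<phi> s = - (C / \<alpha>) * (1 - s) powr \<alpha>" for s
  have "norm (g (of_real 1 * x) - g (of_real (1 - e) * x)) \<le> \<phi> 1 - \<phi> (1 - e)"
  proof (rule differentiable_bound_general)
   show "1 - e < 1" using False e by simp
   have n: "norm (of_real s * x) < 1" if "s \<in> {1 - e..1}" for s
   proof -
    have "norm (of_real s * x) = \<bar>s\<bar> * norm x" by (simp add: norm_mult)
    also have "\<dots> \<le> 1 * norm x" using that e by (intro mult_right_mono) auto
    finally show ?thesis using x by simp
   qed
   have D: "((\<lambda>s. g (of_real s * x)) has_vector_derivative g' (of_real s * x) * x) (at s)" if "s \<in> {1 - e..1}" for s
   proof -
    have "((\<lambda>s. of_real s * x) has_vector_derivative x) (at s)"
     by (auto intro!: derivative_eq_intros simp: has_vector_derivative_def scaleR_conv_of_real)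
    from field_vector_diff_chain_at[OF this d[OF n[OF that]]] show ?thesis by (simp add: o_def mult.commute)
   qed
   show "continuous_on {1 - e..1} (\<lambda>s. g (of_real s * x))"
    using has_vector_derivative_continuous[OF D] by (intro continuous_at_imp_continuous_on) auto
   show "continuous_on {1 - e..1} \<phi>" unfolding \<phi>_def
    using a by (intro continuous_on_mult continuous_on_const continuous_on_powr' continuous_on_diff continuous_on_id) auto
   fix s assume s: "1 - e < s" "s < 1"
   then have s': "s \<in> {1 - e..1}" by simp
   show "((\<lambda>s. g (of_real s * x)) has_vector_derivative g' (of_real s * x) * x) (at s)" using D[OF s'] .
   have "(\<phi> has_real_derivative C * (1 - s) powr (\<alpha> - 1)) (at s)"
    unfolding \<phi>_def using s a by (auto intro!: derivative_eq_intros simp: field_simps)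
   then show "(\<phi> has_vector_derivative C * (1 - s) powr (\<alpha> - 1)) (at s)"
    by (simp add: has_real_derivative_iff_has_vector_derivative)
   have s0: "0 \<le> s" using s e by simp
   have nx: "norm (of_real s * x) \<le> s" using s0 x by (simp add: norm_mult mult_left_le)
   have "norm (g' (of_real s * x) * x) \<le> norm (g' (of_real s * x)) * 1"
    unfolding norm_mult using x by (intro mult_left_mono) auto
   also have "\<dots> \<le> C * (1 - norm (of_real s * x)) powr (\<alpha> - 1)" using b[OF n[OF s']] by simp
   also have "\<dots> \<le> C * (1 - s) powr (\<alpha> - 1)"
    using nx s a C by (intro mult_left_mono powr_mono2') auto
   finally show "norm (g' (of_real s * x) * x) \<le> C * (1 - s) powr (\<alpha> - 1)" .
  qed
  then show ?thesis by (simp add: \<phi>_def)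
 qed
 have inner: "norm (g (of_real (1 - e) * z) - g (of_real (1 - e) * w)) \<le> C * norm (z - w) powr \<alpha>"
 proof (cases "e = 0 \<or> e = 1")
  case True
  then show ?thesis using C by (auto simp: e_def min_def split: if_splits)
 next
  case False
  then have e1: "0 < e" "e < 1" "e = norm (z - w)" using e by (auto simp: e_def min_def split: if_splits)
  let ?S = "cball 0 (1 - e) :: complex set"
  have "norm (g (of_real (1 - e) * z) - g (of_real (1 - e) * w)) \<le>
    (C * e powr (\<alpha> - 1)) * norm (of_real (1 - e) * z - of_real (1 - e) * w)"
  proof (rule field_differentiable_bound[of ?S _ g'])
   fix x assume x: "x \<in> ?S"
   then have x1: "norm x < 1" using e1(1) by (simp only: mem_cball_0)
   show "(g has_field_derivative g' x) (at x within ?S)" using d[OF x1] by (rule has_field_derivative_at_within)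
   have "norm (g' x) \<le> C * (1 - norm x) powr (\<alpha> - 1)" by (rule b[OF x1])
   also have "\<dots> \<le> C * e powr (\<alpha> - 1)" using x e1 a C by (intro mult_left_mono powr_mono2') auto
   finally show "norm (g' x) \<le> C * e powr (\<alpha> - 1)" .
  next
   have m: "of_real (1 - e) * y \<in> ?S" if "norm y < 1" for y
   proof -
    have "norm (of_real (1 - e) * y) = \<bar>1 - e\<bar> * norm y" unfolding norm_mult norm_of_real ..
    also have "\<dots> \<le> (1 - e) * 1" using that e1 by (intro mult_mono) auto
    finally show ?thesis by simp
   qed
   show "of_real (1 - e) * z \<in> ?S" "of_real (1 - e) * w \<in> ?S" using m z w by auto
  qed simp
  also have "\<dots> \<le> (C * e powr (\<alpha> - 1)) * e"
  proof (rule mult_left_mono)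
   have "of_real (1 - e) * z - of_real (1 - e) * w = of_real (1 - e) * (z - w)" by (simp add: right_diff_distrib)
   then have "norm (of_real (1 - e) * z - of_real (1 - e) * w) = \<bar>1 - e\<bar> * norm (z - w)" by (simp only: norm_mult norm_of_real)
   also have "\<dots> \<le> 1 * e" using e1 by (intro mult_mono) auto
   finally show "norm (of_real (1 - e) * z - of_real (1 - e) * w) \<le> e" by simp
  qed (use C in auto)
  also have "\<dots> = C * e powr \<alpha>" using e1 powr_add[of e "\<alpha> - 1" 1] by simp
  finally show ?thesis using e1 by simp
 qed
 have "norm (g z - g w) = norm ((g z - g (of_real (1 - e) * z)) + (g (of_real (1 - e) * z) - g (of_real (1 - e) * w))
   - (g w - g (of_real (1 - e) * w)))" by simp
 also have "\<dots> \<le> C / \<alpha> * e powr \<alpha> + C * norm (z - w) powr \<alpha> + C / \<alpha> * e powr \<alpha>"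
  by (intro norm_triangle_le_diff add_mono norm_triangle_le radial z w inner)
 also have "\<dots> \<le> C / \<alpha> * norm (z - w) powr \<alpha> + C * norm (z - w) powr \<alpha> + C / \<alpha> * norm (z - w) powr \<alpha>"
  using e a C by (intro add_mono mult_left_mono powr_mono2) auto
 finally show ?thesis by (simp add: algebra_simps)
qed

section \<open>Boundary values of the Cauchy transform\<close>

definition cauchy :: "(complex \<Rightarrow> complex) \<Rightarrow> complex \<Rightarrow> complex" where
 "cauchy f z = (if norm z < 1 then cauchy_int f z else Lim (at z within ball 0 1) (cauchy_int f))"

text \<open>The factor of the Hardy-Littlewood argument times the constant of the derivative
  bound.\<close>

definition cauchy_const :: "real \<Rightarrow> real" where
 "cauchy_const \<alpha> = (2 / \<alpha> + 1) * (kernel_const \<alpha> * 2 powr \<alpha>)"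

lemma cauchy_const_nonneg: "0 < \<alpha> \<Longrightarrow> \<alpha> < 1 \<Longrightarrow> 0 \<le> cauchy_const \<alpha>"
 using kernel_const_pos[of \<alpha>] by (simp add: cauchy_const_def)

lemma cauchy_int_Lipschitz:
 assumes a: "0 < \<alpha>" "\<alpha> < 1" and f: "f \<in> \<H> \<alpha>" and z: "norm z < 1" and w: "norm w < 1"
 shows "norm (cauchy_int f z - cauchy_int f w) \<le> cauchy_const \<alpha> * \<N> \<alpha> f * norm (z - w) powr \<alpha>"
proof -
 have "norm (cauchy_int f z - cauchy_int f w) \<le>
   (2 / \<alpha> + 1) * (kernel_const \<alpha> * 2 powr \<alpha> * \<N> \<alpha> f) * norm (z - w) powr \<alpha>"
 proof (rule Hardy_Littlewood_Lipschitz[OF a _ cauchy_int_has_field_derivative cauchy_int_derivative_bound[OF a f] z w])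
  show "0 \<le> kernel_const \<alpha> * 2 powr \<alpha> * \<N> \<alpha> f"
   using kernel_const_pos[OF a(2)] holderD(1)[OF a(1) f] by simp
 qed (use holder_continuous_on[OF a(1) f] in auto)
 then show ?thesis by (simp add: cauchy_const_def mult_ac)
qed

text \<open>The Hoelder estimate inside the disc makes the Cauchy integral uniformly continuous, so
  that it extends to the closed disc. The estimate is then carried to the boundary in one variable
  at a time.\<close>

lemma cauchy_extension:
 assumes a: "0 < \<alpha>" "\<alpha> < 1" and f: "f \<in> \<H> \<alpha>"
 shows "continuous_on (cball 0 1) (cauchy f)"
  and "\<And>z w. z \<in> cball 0 1 \<Longrightarrow> w \<in> cball 0 1 \<Longrightarrow>
   norm (cauchy f z - cauchy f w) \<le> cauchy_const \<alpha> * \<N> \<alpha> f * norm (z - w) powr \<alpha>"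
proof -
 let ?C = "cauchy_const \<alpha> * \<N> \<alpha> f"
 have C: "0 \<le> ?C" using cauchy_const_nonneg[OF a] holderD(1)[OF a(1) f] by simp
 have "uniformly_continuous_on (ball 0 1) (cauchy_int f)"
  unfolding uniformly_continuous_on_def
 proof (intro allI impI)
  fix e :: real assume e: "0 < e"
  \<comment> \<open>Chosen so that \<open>?C * d powr \<alpha> < e\<close>; the added 1 covers
    \<open>?C = 0\<close>.\<close>
  define d where "d = (e / (?C + 1)) powr (1 / \<alpha>)"
  have d: "d > 0" using e C by (simp add: d_def add_nonneg_eq_0_iff)
  show "\<exists>d>0. \<forall>x\<in>ball 0 1. \<forall>x'\<in>ball 0 1. dist x' x < d \<longrightarrow> dist (cauchy_int f x') (cauchy_int f x) < e"
  proof (intro exI[of _ d] conjI ballI impI d)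
   fix x x' :: complex assume x: "x \<in> ball 0 1" "x' \<in> ball 0 1" "dist x' x < d"
   have "norm (cauchy_int f x' - cauchy_int f x) \<le> ?C * norm (x' - x) powr \<alpha>"
    using cauchy_int_Lipschitz[OF a f] x by simp
   also have "\<dots> \<le> ?C * d powr \<alpha>" using x a C by (intro mult_left_mono powr_mono2) (auto simp: dist_norm)
   also have "d powr \<alpha> = e / (?C + 1)" using a e C by (simp add: d_def powr_powr)
   also have "?C * (e / (?C + 1)) < e" using e C by (simp add: field_simps add_nonneg_pos)
   finally show "dist (cauchy_int f x') (cauchy_int f x) < e" by (simp add: dist_norm)
  qed
 qed
 then obtain G where G: "uniformly_continuous_on (closure (ball 0 1)) G" "\<And>x. x \<in> ball 0 1 \<Longrightarrow> cauchy_int f x = G x"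
  by (rule uniformly_continuous_on_extension_on_closure) blast
 have cG: "continuous_on (cball 0 1) G" using uniformly_continuous_imp_continuous[OF G(1)] by simp
 have ntb: "at z within ball 0 1 \<noteq> bot" if "z \<in> cball 0 1" for z :: complex
  using that by (simp add: trivial_limit_within islimpt_ball)
 have eqG: "cauchy f z = G z" if z: "z \<in> cball 0 1" for z
 proof (cases "norm z < 1")
  case True
  then show ?thesis using G(2) by (simp add: cauchy_def)
 next
  case False
  have "(G \<longlongrightarrow> G z) (at z within cball 0 1)" using cG z by (simp add: continuous_on_def)
  then have "(G \<longlongrightarrow> G z) (at z within ball 0 1)" by (rule tendsto_within_subset) auto
  then have "(cauchy_int f \<longlongrightarrow> G z) (at z within ball 0 1)"
   by (rule Lim_transform_within[of _ _ _ _ 1]) (use G(2) in auto)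
  then show ?thesis using tendsto_Lim[OF ntb[OF z]] False by (simp add: cauchy_def)
 qed
 show cc: "continuous_on (cball 0 1) (cauchy f)" using cG continuous_on_cong[of "cball 0 1" "cball 0 1" "cauchy f" G] eqG by simp
 have half: "norm (cauchy f z - cauchy f w) \<le> ?C * norm (z - w) powr \<alpha>"
  if z: "z \<in> ball 0 1" and w: "w \<in> cball 0 1" for z w
 proof (rule tendsto_le[OF ntb[OF w]])
  have "(cauchy f \<longlongrightarrow> cauchy f w) (at w within cball 0 1)" using cc w by (simp add: continuous_on_def)
  then have "(cauchy f \<longlongrightarrow> cauchy f w) (at w within ball 0 1)" by (rule tendsto_within_subset) auto
  then show "((\<lambda>y. norm (cauchy f z - cauchy f y)) \<longlongrightarrow> norm (cauchy f z - cauchy f w)) (at w within ball 0 1)"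
   by (intro tendsto_intros)
  show "((\<lambda>y. ?C * norm (z - y) powr \<alpha>) \<longlongrightarrow> ?C * norm (z - w) powr \<alpha>) (at w within ball 0 1)"
   using a by (intro tendsto_mult tendsto_const tendsto_powr' tendsto_norm tendsto_diff tendsto_ident_at) auto
  show "\<forall>\<^sub>F y in at w within ball 0 1. norm (cauchy f z - cauchy f y) \<le> ?C * norm (z - y) powr \<alpha>"
   unfolding eventually_at_filter using cauchy_int_Lipschitz[OF a f] z
   by (intro always_eventually) (auto simp: cauchy_def)
 qed
 show "norm (cauchy f z - cauchy f w) \<le> ?C * norm (z - w) powr \<alpha>"
  if z: "z \<in> cball 0 1" and w: "w \<in> cball 0 1" for z w
 proof (rule tendsto_le[OF ntb[OF z]])
  have "(cauchy f \<longlongrightarrow> cauchy f z) (at z within cball 0 1)" using cc z by (simp add: continuous_on_def)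
  then have "(cauchy f \<longlongrightarrow> cauchy f z) (at z within ball 0 1)" by (rule tendsto_within_subset) auto
  then show "((\<lambda>y. norm (cauchy f y - cauchy f w)) \<longlongrightarrow> norm (cauchy f z - cauchy f w)) (at z within ball 0 1)"
   by (intro tendsto_intros)
  show "((\<lambda>y. ?C * norm (y - w) powr \<alpha>) \<longlongrightarrow> ?C * norm (z - w) powr \<alpha>) (at z within ball 0 1)"
   using a by (intro tendsto_mult tendsto_const tendsto_powr' tendsto_norm tendsto_diff tendsto_ident_at) auto
  show "\<forall>\<^sub>F y in at z within ball 0 1. norm (cauchy f y - cauchy f w) \<le> ?C * norm (y - w) powr \<alpha>"
   unfolding eventually_at_filter using half w by (intro always_eventually) blast
 qed
qed

definition disc_alg :: "(complex \<Rightarrow> complex) \<Rightarrow> bool" where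
 "disc_alg f \<longleftrightarrow> continuous_on (cball 0 1) f \<and> f holomorphic_on ball 0 1"

lemma cauchy_disc_alg:
 assumes a: "0 < \<alpha>" "\<alpha> < 1" and f: "f \<in> \<H> \<alpha>"
 shows "disc_alg (cauchy f)"
proof -
 have "cauchy_int f holomorphic_on ball 0 1"
  unfolding holomorphic_on_open[OF open_ball]
  using cauchy_int_has_field_derivative[OF holder_continuous_on[OF a(1) f]] by (meson mem_ball_0)
 then have "cauchy f holomorphic_on ball 0 1"
  by (rule holomorphic_transform) (auto simp: cauchy_def)
 then show ?thesis using cauchy_extension(1)[OF a f] by (simp add: disc_alg_def)
qed

lemma cauchy_0: "cauchy f 0 = circ_int f / (2 * pi)"
proof -
 have "circ_int (\<lambda>u. f u * u / (u - 0)) = circ_int f" by (rule circ_int_cong) auto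
 then show ?thesis by (simp add: cauchy_def cauchy_int_def)
qed

lemma norm_cauchy_0_le:
 assumes "continuous_on (sphere 0 1) f" "\<And>u. norm u = 1 \<Longrightarrow> norm (f u) \<le> B"
 shows "norm (cauchy f 0) \<le> B"
 using circ_int_bound[OF assms] by (simp add: cauchy_0 norm_divide norm_mult divide_le_eq)

lemma cauchy_holder:
 assumes a: "0 < \<alpha>" "\<alpha> < 1" and f: "f \<in> \<H> \<alpha>"
 shows "cauchy f \<in> \<H> \<alpha>" "\<N> \<alpha> (cauchy f) \<le> (1 + 2 * cauchy_const \<alpha>) * \<N> \<alpha> f"
proof -
 let ?C = "cauchy_const \<alpha> * \<N> \<alpha> f"
 have C: "0 \<le> ?C" using cauchy_const_nonneg[OF a] holderD(1)[OF a(1) f] by simp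
 have "norm (cauchy f 0) \<le> \<N> \<alpha> f"
  using norm_cauchy_0_le[OF holder_continuous_on[OF a(1) f]] holderD(2)[OF a(1) f] by simp
 then have 1: "norm (cauchy f \<xi>) \<le> \<N> \<alpha> f + ?C" if "\<xi> \<in> sphere 0 1" for \<xi>
  using cauchy_extension(2)[OF a f, of \<xi> 0] that norm_triangle_sub[of "cauchy f \<xi>" "cauchy f 0"] by simp
 have 2: "norm (cauchy f \<xi> - cauchy f \<eta>) \<le> ?C * dist \<xi> \<eta> powr \<alpha>" if "\<xi> \<in> sphere 0 1" "\<eta> \<in> sphere 0 1" for \<xi> \<eta>
  using cauchy_extension(2)[OF a f, of \<xi> \<eta>] that by (simp add: dist_norm)
 from holderI[OF a(1) C 1 2] show "cauchy f \<in> \<H> \<alpha>"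
  "\<N> \<alpha> (cauchy f) \<le> (1 + 2 * cauchy_const \<alpha>) * \<N> \<alpha> f" by (simp_all add: algebra_simps)
qed

text \<open>Radial limits transport identities between Cauchy integrals, which are statements about
  the open disc, to the circle.\<close>

lemma cauchy_tendsto:
 assumes a: "0 < \<alpha>" "\<alpha> < 1" and f: "f \<in> \<H> \<alpha>" and z: "z \<in> cball 0 1"
 shows "((\<lambda>s. cauchy_int f (of_real s * z)) \<longlongrightarrow> cauchy f z) (at_left 1)"
proof -
 have "((\<lambda>s. of_real s * z) \<longlongrightarrow> of_real 1 * z) (at_left (1::real))" by (intro tendsto_intros)
 moreover have ev: "\<forall>\<^sub>F s in at_left (1::real). s \<in> {0<..<1}"
  using eventually_at_left_field[of _ "1::real"] by (auto intro!: exI[of _ 0])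
 have n: "norm (of_real s * z) < 1" if "s \<in> {0<..<1}" for s
 proof -
  have "norm (of_real s * z) = s * norm z" using that by (simp add: norm_mult)
  also have "\<dots> \<le> s * 1" using that z by (intro mult_left_mono) auto
  finally show ?thesis using that by simp
 qed
 have "\<forall>\<^sub>F s in at_left (1::real). of_real s * z \<in> cball 0 1"
  using ev by eventually_elim (use n in force)
 ultimately have "((\<lambda>s. cauchy f (of_real s * z)) \<longlongrightarrow> cauchy f (of_real 1 * z)) (at_left (1::real))"
  using z by (intro continuous_on_tendsto_compose[OF cauchy_extension(1)[OF a f]]) auto
 moreover have "\<forall>\<^sub>F s in at_left (1::real). cauchy f (of_real s * z) = cauchy_int f (of_real s * z)"
  using ev by eventually_elim (use n in \<open>simp add: cauchy_def\<close>)
 ultimately have "((\<lambda>s. cauchy_int f (of_real s * z)) \<longlongrightarrow> cauchy f (of_real 1 * z)) (at_left 1)"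
  by (rule Lim_transform_eventually)
 then show ?thesis by simp
qed

lemma holder_cnj:
 assumes "0 < \<alpha>" "f \<in> \<H> \<alpha>"
 shows "(\<lambda>u. cnj (f u)) \<in> \<H> \<alpha>" "\<N> \<alpha> (\<lambda>u. cnj (f u)) \<le> \<N> \<alpha> f"
 using holder_compose_bounded_linear[OF assms bounded_linear.linear[OF bounded_linear_cnj], of 1] by auto

lemma cauchy_add:
 assumes a: "0 < \<alpha>" "\<alpha> < 1" and f: "f \<in> \<H> \<alpha>" and g: "g \<in> \<H> \<alpha>" and z: "z \<in> cball 0 1"
 shows "cauchy (\<lambda>u. f u + g u) z = cauchy f z + cauchy g z"
proof -
 have fg: "(\<lambda>u. f u + g u) \<in> \<H> \<alpha>" using seminormedD(5)[OF seminormed_holder[OF a(1)] f g] by (simp add: plus_fun_def)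
 note c = holder_continuous_on[OF a(1) f] holder_continuous_on[OF a(1) g]
 have lim: "((\<lambda>s. cauchy_int f (of_real s * z) + cauchy_int g (of_real s * z)) \<longlongrightarrow> cauchy f z + cauchy g z) (at_left 1)"
  by (intro tendsto_add cauchy_tendsto[OF a] f g z)
 have ev: "\<forall>\<^sub>F s in at_left (1::real). s \<in> {0<..<1}"
  using eventually_at_left_field[of _ "1::real"] by (auto intro!: exI[of _ 0])
 have "((\<lambda>s. cauchy_int (\<lambda>u. f u + g u) (of_real s * z)) \<longlongrightarrow> cauchy f z + cauchy g z) (at_left 1)"
 proof (rule Lim_transform_eventually[OF lim], use ev in eventually_elim)
  fix s :: real assume s: "s \<in> {0<..<1}"
  have "norm (of_real s * z) = s * norm z" using s by (simp add: norm_mult)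
  also have "\<dots> \<le> s * 1" using s z by (intro mult_left_mono) auto
  finally have "norm (of_real s * z) < 1" using s by simp
  from cauchy_int_add[OF c this]
  show "cauchy_int f (of_real s * z) + cauchy_int g (of_real s * z) = cauchy_int (\<lambda>u. f u + g u) (of_real s * z)" by simp
 qed
 from tendsto_unique[OF _ cauchy_tendsto[OF a fg z] this] show ?thesis by simp
qed

lemma cauchy_cmult:
 assumes a: "0 < \<alpha>" "\<alpha> < 1" and f: "f \<in> \<H> \<alpha>" and z: "z \<in> cball 0 1"
 shows "cauchy (\<lambda>u. c * f u) z = c * cauchy f z"
proof -
 have cf: "(\<lambda>u. c * f u) \<in> \<H> \<alpha>"
  using holder_compose_bounded_linear(1)[OF a(1) f, of "\<lambda>x. c * x" "norm c"] by (simp add: linear_iff norm_mult distrib_left)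
 have "((\<lambda>s. c * cauchy_int f (of_real s * z)) \<longlongrightarrow> c * cauchy f z) (at_left 1)"
  by (intro tendsto_mult tendsto_const cauchy_tendsto[OF a] f z)
 then have "((\<lambda>s. cauchy_int (\<lambda>u. c * f u) (of_real s * z)) \<longlongrightarrow> c * cauchy f z) (at_left 1)"
  by (simp add: cauchy_int_cmult)
 from tendsto_unique[OF _ cauchy_tendsto[OF a cf z] this] show ?thesis by simp
qed

lemma cauchy_cong:
 assumes "\<And>u. norm u = 1 \<Longrightarrow> f u = g u" shows "cauchy f = cauchy g"
proof -
 have "cauchy_int f = cauchy_int g" unfolding cauchy_int_def
  by (intro ext arg_cong2[where f="(/)"] circ_int_cong) (simp_all add: assms)
 then show ?thesis unfolding cauchy_def[abs_def]
  by (rule arg_cong[where f="\<lambda>h z. if norm z < 1 then h z else Lim (at z within ball 0 1) h"])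
qed

lemma cauchy_of_disc_alg:
 assumes "disc_alg f" "z \<in> ball 0 1" shows "cauchy f z = f z"
 using assms cauchy_int_holomorphic[of f z] continuous_on_subset[of "cball 0 1" f "sphere 0 1"]
 by (auto simp: disc_alg_def cauchy_def sphere_cball)

text \<open>The sum of the two Cauchy kernels is the Poisson kernel.\<close>

lemma poisson_kernel_bound:
 assumes u: "norm (u::complex) = 1" and z: "norm z < 1"
 shows "norm (u / (u - z) + cnj (u / (u - z)) - 1) \<le> 2 * (1 - norm z) / (norm (u - z))\<^sup>2"
proof -
 have ne: "u - z \<noteq> 0" using sphere_ne[OF u z] .
 then have ne': "cnj (u - z) \<noteq> 0" by simp
 have uu: "u * cnj u = 1" using u by (simp add: complex_norm_square[symmetric])
 have zz: "z * cnj z = of_real ((norm z)\<^sup>2)" by (simp only: complex_norm_square)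
 have nn: "(u - z) * cnj (u - z) = of_real ((norm (u - z))\<^sup>2)" by (simp only: complex_norm_square)
 have "u / (u - z) + cnj (u / (u - z)) - 1 = (u * cnj (u - z) + cnj u * (u - z) - (u - z) * cnj (u - z)) / ((u - z) * cnj (u - z))"
 proof -
  have "x / d + y / e - 1 = (x * e + y * d - d * e) / (d * e)" if "d \<noteq> 0" "e \<noteq> 0" for x y d e :: complex
   using that by (simp add: field_simps)
  from this[OF ne ne', of u "cnj u"] show ?thesis by simp
 qed
 also have "u * cnj (u - z) + cnj u * (u - z) - (u - z) * cnj (u - z) = u * cnj u - z * cnj z"
  by (simp add: algebra_simps)
 also have "\<dots> = of_real (1 - (norm z)\<^sup>2)" by (simp add: uu zz)
 finally have "u / (u - z) + cnj (u / (u - z)) - 1 = of_real ((1 - (norm z)\<^sup>2) / (norm (u - z))\<^sup>2)" by (simp only: nn of_real_divide)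
 then have "norm (u / (u - z) + cnj (u / (u - z)) - 1) = \<bar>(1 - (norm z)\<^sup>2) / (norm (u - z))\<^sup>2\<bar>" by (simp only: norm_of_real)
 also have "\<dots> = (1 - norm z) * (1 + norm z) / (norm (u - z))\<^sup>2"
  using z power_le_one[of "norm z" 2] by (simp add: power2_eq_square algebra_simps)
 also have "\<dots> \<le> (1 - norm z) * 2 / (norm (u - z))\<^sup>2"
  using z by (intro divide_right_mono mult_left_mono) auto
 finally show ?thesis by (simp add: mult.commute)
qed

text \<open>The splitting of a Hoelder function into boundary values of a holomorphic and an
  antiholomorphic function. Inside the disc the left-hand side is the Poisson integral of
  \<open>f\<close>; at radius s it differs from f(\<xi>) by at most a multiple of
  \<open>(1 - s) powr \<alpha>\<close>, so the identity holds in the limit.\<close>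

lemma cauchy_decomposition:
 assumes a: "0 < \<alpha>" "\<alpha> < 1" and f: "f \<in> \<H> \<alpha>" and z: "norm \<xi> = 1"
 shows "cauchy f \<xi> + cnj (cauchy (\<lambda>u. cnj (f u)) \<xi>) - cauchy f 0 = f \<xi>"
proof -
 have cf: "continuous_on (sphere 0 1) f" using holder_continuous_on[OF a(1) f] .
 note fc = holder_cnj(1)[OF a(1) f]
 \<comment> \<open>After this normalisation the error \<open>W\<close> is the Poisson integral of
   \<open>F\<close>. The factor 1 - s of the Poisson kernel and the decay of \<open>F\<close> near
   \<xi> together leave a positive power of 1 - s.\<close>
 define F where "F u = f u - f \<xi>" for u
 have cF: "continuous_on (sphere 0 1) F" unfolding F_def using cf by (intro continuous_intros)
 have cFc: "continuous_on (sphere 0 1) (\<lambda>u. cnj (F u))" using cF by (intro continuous_intros)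
 define W where "W s = cauchy_int f (of_real s * \<xi>) + cnj (cauchy_int (\<lambda>u. cnj (f u)) (of_real s * \<xi>)) - cauchy f 0 - f \<xi>" for s
 let ?K = "kernel_const \<alpha> * (\<N> \<alpha> f * 2 powr \<alpha> * 2)"
 have W: "norm (W s) \<le> ?K * (1 - s) powr \<alpha>" if s: "s \<in> {0<..<1}" for s
 proof -
  define x where "x = of_real s * \<xi>"
  let ?P = "\<lambda>u. F u * (u / (u - x) + cnj (u / (u - x)) - 1)"
  have nx: "norm x = s" using s z by (simp add: x_def norm_mult)
  then have x1: "norm x < 1" using s by simp
  have k: "continuous_on (sphere 0 1) (\<lambda>u. g u * u / (u - x))" if "continuous_on (sphere 0 1) g" for g :: "complex \<Rightarrow> complex"
   using that x1 by (intro continuous_intros) auto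
  have "cauchy_int F x = cauchy_int f x - f \<xi>" unfolding F_def by (rule cauchy_int_diff_const[OF cf x1])
  moreover have "cauchy_int (\<lambda>u. cnj (F u)) x = cauchy_int (\<lambda>u. cnj (f u)) x - cnj (f \<xi>)"
   unfolding F_def complex_cnj_diff using cauchy_int_diff_const[OF _ x1] continuous_on_cnj[OF cf] by blast
  moreover have "circ_int F / (2 * pi) = cauchy f 0 - f \<xi>"
   using cauchy_int_diff_const[OF cf, of 0 "f \<xi>"] cauchy_0[of F] cauchy_0[of f] by (simp add: cauchy_def F_def[abs_def])
  ultimately have "W s = cauchy_int F x + cnj (cauchy_int (\<lambda>u. cnj (F u)) x) - circ_int F / (2 * pi)"
   by (simp add: W_def x_def)
  also have "cnj (cauchy_int (\<lambda>u. cnj (F u)) x) = circ_int (\<lambda>u. cnj (cnj (F u) * u / (u - x))) / (2 * pi)"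
   unfolding cauchy_int_def complex_cnj_divide[of "circ_int g" for g] circ_int_cnj by simp
  also have "cauchy_int F x + circ_int (\<lambda>u. cnj (cnj (F u) * u / (u - x))) / (2 * pi) - circ_int F / (2 * pi) =
    circ_int (\<lambda>u. F u * u / (u - x) + cnj (cnj (F u) * u / (u - x)) - F u) / (2 * pi)"
  proof -
   have c1: "continuous_on (sphere 0 1) (\<lambda>u. F u * u / (u - x))" by (rule k[OF cF])
   have c2: "continuous_on (sphere 0 1) (\<lambda>u. cnj (cnj (F u) * u / (u - x)))" by (rule continuous_on_cnj[OF k[OF cFc]])
   show ?thesis unfolding cauchy_int_def
    by (subst circ_int_diff[OF continuous_on_add[OF c1 c2] cF], subst circ_int_add[OF c1 c2])
     (simp add: add_divide_distrib diff_divide_distrib)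
  qed
  also have "circ_int (\<lambda>u. F u * u / (u - x) + cnj (cnj (F u) * u / (u - x)) - F u) =
    circ_int ?P"
   by (intro circ_int_cong) (simp add: algebra_simps)
  finally have Ws: "W s = circ_int ?P / (2 * pi)" .
  have "norm (circ_int ?P) \<le>
    kernel_const \<alpha> * (\<N> \<alpha> f * 2 powr \<alpha> * (2 * (1 - s))) * (1 - norm x) powr (\<alpha> - 1)"
  proof (rule norm_circ_int_le[OF a x1])
   show "0 \<le> \<N> \<alpha> f * 2 powr \<alpha> * (2 * (1 - s))" using holderD(1)[OF a(1) f] s by simp
   show "continuous_on (sphere 0 1) ?P"
    using cF x1 by (intro continuous_intros) auto
   fix u :: complex assume u: "norm u = 1"
   have ne: "norm (u - x) > 0" using sphere_ne[OF u x1] by simp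
   have "x - \<xi> = of_real (s - 1) * \<xi>" by (simp add: x_def algebra_simps)
   then have "norm (x - \<xi>) = 1 - s" using s z by (simp add: norm_mult del: of_real_diff)
   also have "1 - s \<le> norm (u - x)" using norm_triangle_ineq2[of u x] u nx by simp
   finally have "norm (F u) \<le> \<N> \<alpha> f * 2 powr \<alpha> * norm (u - x) powr \<alpha>"
    unfolding F_def using holder_dist_le[OF a(1) f u z, of x] by simp
   then have "norm (F u * (u / (u - x) + cnj (u / (u - x)) - 1)) \<le>
     (\<N> \<alpha> f * 2 powr \<alpha> * norm (u - x) powr \<alpha>) * (2 * (1 - s) / (norm (u - x))\<^sup>2)"
    unfolding norm_mult using poisson_kernel_bound[OF u x1] nx holderD(1)[OF a(1) f] by (intro mult_mono) auto
   also have "\<dots> = \<N> \<alpha> f * 2 powr \<alpha> * (2 * (1 - s)) * norm (u - x) powr (\<alpha> - 2)"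
    using ne by (simp add: powr_diff powr_numeral)
   finally show "norm (F u * (u / (u - x) + cnj (u / (u - x)) - 1)) \<le>
     \<N> \<alpha> f * 2 powr \<alpha> * (2 * (1 - s)) * norm (u - x) powr (\<alpha> - 2)" .
  qed
  also have "\<dots> = ?K * (1 - s) powr \<alpha>" using s powr_add[of "1 - s" "\<alpha> - 1" 1] by (simp add: nx mult_ac)
  finally have 1: "norm (circ_int ?P) \<le> ?K * (1 - s) powr \<alpha>" .
  have "norm (W s) = norm (circ_int ?P) / (2 * pi)"
   unfolding Ws by (simp add: norm_divide norm_mult)
  also have "\<dots> \<le> norm (circ_int ?P) / 1"
   using pi_ge_two by (intro divide_left_mono) auto
  finally show ?thesis using 1 by simp
 qed
 have ev: "\<forall>\<^sub>F s in at_left (1::real). s \<in> {0<..<1}"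
  using eventually_at_left_field[of _ "1::real"] by (auto intro!: exI[of _ 0])
 have "((\<lambda>s. ?K * (1 - s) powr \<alpha>) \<longlongrightarrow> ?K * (1 - 1) powr \<alpha>) (at_left 1)"
 proof (intro tendsto_mult tendsto_const tendsto_powr' tendsto_diff tendsto_ident_at)
  show "(1::real) - 1 \<noteq> 0 \<or> 0 < \<alpha> \<and> (\<forall>\<^sub>F s in at_left (1::real). 0 \<le> 1 - s)"
   using a ev by (auto elim!: eventually_mono)
 qed
 then have "(W \<longlongrightarrow> 0) (at_left 1)"
  by (intro Lim_null_comparison[of W "\<lambda>s. ?K * (1 - s) powr \<alpha>"]) (use ev W in \<open>auto elim!: eventually_mono\<close>)
 moreover have "(W \<longlongrightarrow> cauchy f \<xi> + cnj (cauchy (\<lambda>u. cnj (f u)) \<xi>) - cauchy f 0 - f \<xi>) (at_left 1)"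
  unfolding W_def by (intro tendsto_diff tendsto_add tendsto_cnj tendsto_const cauchy_tendsto[OF a] f fc) (use z in auto)
 ultimately have "cauchy f \<xi> + cnj (cauchy (\<lambda>u. cnj (f u)) \<xi>) - cauchy f 0 - f \<xi> = 0"
  by (intro tendsto_unique[of "at_left (1::real)"]) auto
 then show ?thesis by simp
qed

section \<open>The disc algebra\<close>

no_notation fps_nth (infixl "$" 75)

lemma disc_alg_const [simp, intro]: "disc_alg (\<lambda>_. c)"
 and disc_alg_ident [simp, intro]: "disc_alg (\<lambda>z. z)"
 by (auto simp: disc_alg_def)

lemma disc_alg_add [intro]: "disc_alg f \<Longrightarrow> disc_alg g \<Longrightarrow> disc_alg (\<lambda>z. f z + g z)"
 and disc_alg_diff [intro]: "disc_alg f \<Longrightarrow> disc_alg g \<Longrightarrow> disc_alg (\<lambda>z. f z - g z)"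
 and disc_alg_minus [intro]: "disc_alg f \<Longrightarrow> disc_alg (\<lambda>z. - f z)"
 and disc_alg_mult [intro]: "disc_alg f \<Longrightarrow> disc_alg g \<Longrightarrow> disc_alg (\<lambda>z. f z * g z)"
 and disc_alg_exp [intro]: "disc_alg f \<Longrightarrow> disc_alg (\<lambda>z. exp (f z))"
 by (auto simp: disc_alg_def intro!: continuous_intros holomorphic_intros)

lemma disc_alg_divide [intro]:
 "disc_alg f \<Longrightarrow> disc_alg g \<Longrightarrow> (\<And>z. norm z \<le> 1 \<Longrightarrow> g z \<noteq> 0) \<Longrightarrow> disc_alg (\<lambda>z. f z / g z)"
 by (auto simp: disc_alg_def intro!: continuous_intros holomorphic_intros)

lemma disc_alg_sum [intro]:
 "finite I \<Longrightarrow> (\<And>i. i \<in> I \<Longrightarrow> disc_alg (f i)) \<Longrightarrow> disc_alg (\<lambda>z. \<Sum>i\<in>I. f i z)"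
 by (auto simp: disc_alg_def intro!: continuous_intros holomorphic_intros)

lemma disc_alg_norm_le:
 assumes f: "disc_alg f" and b: "\<And>\<xi>. norm \<xi> = 1 \<Longrightarrow> norm (f \<xi>) \<le> B" and z: "norm z \<le> 1"
 shows "norm (f z) \<le> B"
proof (cases "norm z = 1")
 case False
 show ?thesis
  by (rule maximum_modulus_frontier[of f "ball 0 1"]) (use False assms in \<open>auto simp: disc_alg_def\<close>)
qed (use b in auto)

text \<open>Both exp f and exp (-f) have modulus 1 on the circle and hence at most 1 inside, so Re f
  vanishes on the whole disc. Then exp f has constant modulus, is constant by the maximum principle,
  and so is f because its derivative vanishes.\<close>

lemma disc_alg_imaginary_const:
 assumes f: "disc_alg f" and re: "\<And>\<xi>. norm \<xi> = 1 \<Longrightarrow> Re (f \<xi>) = 0" and z: "norm z \<le> 1"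
 shows "f z = f 0"
proof -
 have holf: "f holomorphic_on ball 0 1" and cf: "continuous_on (cball 0 1) f" using f by (auto simp: disc_alg_def)
 have "norm (exp (f w)) \<le> 1" "norm (exp (- f w)) \<le> 1" if "norm w \<le> 1" for w
  using disc_alg_norm_le[OF disc_alg_exp[OF f], of 1 w] disc_alg_norm_le[OF disc_alg_exp[OF disc_alg_minus[OF f]], of 1 w] re that
  by (simp_all add: norm_exp_eq_Re)
 then have re0: "Re (f w) = 0" if "norm w \<le> 1" for w using that by (force simp: norm_exp_eq_Re)
 have "(\<lambda>w. exp (f w)) constant_on ball 0 1"
  by (rule maximum_modulus_principle[of _ _ "ball 0 1" 0])
   (use holf re0 in \<open>auto intro!: holomorphic_intros simp: norm_exp_eq_Re\<close>)
 then obtain c where c: "\<And>w. w \<in> ball 0 1 \<Longrightarrow> exp (f w) = c" by (auto simp: constant_on_def)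
 have "\<exists>k. \<forall>x\<in>ball 0 1. f x = k"
 proof (rule has_field_derivative_zero_constant)
  fix w :: complex assume w: "w \<in> ball 0 1"
  have d: "(f has_field_derivative deriv f w) (at w)" using holf w by (intro holomorphic_derivI) auto
  then have "((\<lambda>w. exp (f w)) has_field_derivative exp (f w) * deriv f w) (at w)" by (rule DERIV_fun_exp)
  moreover have "((\<lambda>w. exp (f w)) has_field_derivative 0) (at w)"
   by (rule has_field_derivative_transform_within_open[of "\<lambda>_. c" 0 w "ball 0 1"]) (use w c in auto)
  ultimately have "deriv f w = 0" using DERIV_unique by fastforce
  then show "(f has_field_derivative 0) (at w within ball 0 1)" using d by (auto intro: has_field_derivative_at_within)
 qed auto
 then have k: "f w = f 0" if "w \<in> ball 0 1" for w using that by (metis centre_in_ball zero_less_one)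
 have "f z = (\<lambda>_. f 0) z"
 proof (rule continuous_constant_on_closure[of "ball 0 1" f])
  show "continuous_on (closure (ball 0 1)) f" using cf by simp
  show "z \<in> closure (ball 0 1)" using z by simp
 qed (rule k)
 then show ?thesis by simp
qed

text \<open>A function that is both holomorphic and antiholomorphic on the boundary is constant: f -
  g and \<i> (f + g) have zero real part on the circle.\<close>

lemma disc_alg_eq_cnj_const:
 assumes f: "disc_alg f" and g: "disc_alg g" and eq: "\<And>\<xi>. norm \<xi> = 1 \<Longrightarrow> f \<xi> = cnj (g \<xi>)" and z: "norm z \<le> 1"
 shows "f z = f 0"
proof -
 have d: "f z - g z = f 0 - g 0"
  using disc_alg_imaginary_const[OF disc_alg_diff[OF f g] _ z] eq by simp
 have "\<i> * (f z + g z) = \<i> * (f 0 + g 0)"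
  using disc_alg_imaginary_const[OF disc_alg_mult[OF disc_alg_const disc_alg_add[OF f g]] _ z, of \<i>] eq by simp
 then have "f z + g z = f 0 + g 0" by (simp only: mult_cancel_left) simp
 moreover have "2 * f w = (f w + g w) + (f w - g w)" for w by simp
 ultimately have "2 * f z = 2 * f 0" using d by metis
 then show ?thesis by simp
qed

text \<open>The quotient has a removable singularity at 0. Iterated, this reads off Taylor
  coefficients while staying inside the disc algebra, where the maximum principle is at
  hand.\<close>

lemma disc_alg_factor:
 assumes f: "disc_alg f"
 obtains g where "disc_alg g" "\<And>z. norm z \<le> 1 \<Longrightarrow> f z = f 0 + z * g z" "g 0 = deriv f 0"
proof -
 define g where "g = (\<lambda>z. if z = 0 then deriv f 0 else (f z - f 0) / (z - 0))"
 have hol: "g holomorphic_on ball 0 1"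
  unfolding g_def by (rule pole_lemma) (use f in \<open>auto simp: disc_alg_def\<close>)
 have c1: "continuous_on (ball 0 1) g" using hol by (rule holomorphic_on_imp_continuous_on)
 have "continuous_on (cball 0 1 - {0}) (\<lambda>z. (f z - f 0) / (z - 0))"
  using f by (intro continuous_intros) (auto simp: disc_alg_def intro: continuous_on_subset)
 then have c2: "continuous_on (cball 0 1 - {0}) g"
  using continuous_on_cong[of "cball 0 1 - {0}" "cball 0 1 - {0}" g "\<lambda>z. (f z - f 0) / (z - 0)"] by (auto simp: g_def)
 have "continuous (at z within cball 0 1) g" if z: "z \<in> cball 0 1" for z
 proof (cases "z = 0")
  case True
  then have "continuous (at z) g" using c1 continuous_on_eq_continuous_at[of "ball 0 1" g] by auto
  then show ?thesis by (rule continuous_at_imp_continuous_at_within)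
 next
  case False
  then have "continuous (at z within cball 0 1 - {0}) g" using c2 z by (auto simp: continuous_on_eq_continuous_within)
  moreover have "at z within cball 0 1 - {0} = at z within cball 0 1"
   by (rule at_within_nhd[of _ "- {0}"]) (use False in auto)
  ultimately show ?thesis by (simp add: continuous_within)
 qed
 then have "disc_alg g" using hol by (auto simp: disc_alg_def continuous_on_eq_continuous_within)
 moreover have "f z = f 0 + z * g z" for z by (simp add: g_def)
 ultimately show ?thesis using that[of g] by (simp add: g_def)
qed

lemma disc_alg_at_0_bound:
 assumes f: "disc_alg f" and b: "\<And>\<xi>. norm \<xi> = 1 \<Longrightarrow> norm (f \<xi>) \<le> B"
 shows "norm (f 0) \<le> B" "norm (deriv f 0) \<le> 2 * B"
proof -
 show f0: "norm (f 0) \<le> B" by (rule disc_alg_norm_le[OF f b]) auto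
 obtain g where g: "disc_alg g" "\<And>z. norm z \<le> 1 \<Longrightarrow> f z = f 0 + z * g z" "g 0 = deriv f 0"
  using disc_alg_factor[OF f] by blast
 have "norm (g \<xi>) \<le> 2 * B" if z: "norm \<xi> = 1" for \<xi>
 proof -
  have "norm (g \<xi>) = norm (f \<xi> - f 0)" using g(2)[of \<xi>] z by (simp add: norm_mult)
  also have "\<dots> \<le> norm (f \<xi>) + norm (f 0)" by (rule norm_triangle_ineq4)
  finally show ?thesis using b[OF z] f0 by simp
 qed
 from disc_alg_norm_le[OF g(1) this, of 0] g(3) show "norm (deriv f 0) \<le> 2 * B" by simp
qed

lemma holomorphic_disc_iff:
 "holomorphic_disc h \<longleftrightarrow> disc_alg (\<lambda>z. fst (h z)) \<and> (\<forall>j. disc_alg (\<lambda>z. snd (h z) $ j))"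
proof
 assume h: "holomorphic_disc h"
 then have c: "continuous_on (cball 0 1) h" by (simp add: holomorphic_disc_def)
 show "disc_alg (\<lambda>z. fst (h z)) \<and> (\<forall>j. disc_alg (\<lambda>z. snd (h z) $ j))"
  using h c by (auto simp: holomorphic_disc_def disc_alg_def intro!: continuous_intros)
next
 assume h: "disc_alg (\<lambda>z. fst (h z)) \<and> (\<forall>j. disc_alg (\<lambda>z. snd (h z) $ j))"
 have "continuous_on (cball 0 1) (\<lambda>z. (fst (h z), \<chi> j. snd (h z) $ j))"
  by (intro continuous_on_Pair continuous_on_vec_lambda) (use h in \<open>auto simp: disc_alg_def\<close>)
 then have "continuous_on (cball 0 1) h" by simp
 then show "holomorphic_disc h" using h by (simp add: holomorphic_disc_def disc_alg_def)
qed

subsection \<open>Hoelder functions with values in \<open>\<complex>\<^sup>n\<^sup>+\<^sup>1\<close>\<close>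

lemma holder_fst:
 assumes "0 < \<alpha>" "(f :: complex \<Rightarrow> 'n::finite cpoint) \<in> \<H> \<alpha>"
 shows "(\<lambda>z. fst (f z)) \<in> \<H> \<alpha>" "\<N> \<alpha> (\<lambda>z. fst (f z)) \<le> \<N> \<alpha> f"
proof -
 have "norm (fst x) \<le> 1 * norm x" for x :: "'n cpoint" using norm_fst_le[of "fst x" "snd x"] by simp
 with holder_compose_bounded_linear[OF assms bounded_linear.linear[OF bounded_linear_fst], of 1]
 show "(\<lambda>z. fst (f z)) \<in> \<H> \<alpha>" "\<N> \<alpha> (\<lambda>z. fst (f z)) \<le> \<N> \<alpha> f" by auto
qed

lemma norm_snd_nth_le: "norm (snd x $ j) \<le> norm (x :: 'n::finite cpoint)"
 using Finite_Cartesian_Product.norm_nth_le[of "snd x" j] norm_snd_le[of "snd x" "fst x"] by simp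

lemma holder_snd:
 assumes "0 < \<alpha>" "(f :: complex \<Rightarrow> 'n::finite cpoint) \<in> \<H> \<alpha>"
 shows "(\<lambda>z. snd (f z) $ j) \<in> \<H> \<alpha>" "\<N> \<alpha> (\<lambda>z. snd (f z) $ j) \<le> \<N> \<alpha> f"
proof -
 have "linear (\<lambda>x::'n cpoint. snd x $ j)" by (rule linearI) auto
 from holder_compose_bounded_linear[OF assms this, of 1] norm_snd_nth_le[of _ j]
 show "(\<lambda>z. snd (f z) $ j) \<in> \<H> \<alpha>" "\<N> \<alpha> (\<lambda>z. snd (f z) $ j) \<le> \<N> \<alpha> f" by auto
qed

lemma norm_axis: "norm (axis j (x :: 'a::real_inner) :: 'a ^ 'n) = norm x"
 by (simp add: norm_eq_sqrt_inner inner_axis_axis)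

lemma holder_pair:
 fixes a :: "complex \<Rightarrow> complex" and b :: "'n::finite \<Rightarrow> complex \<Rightarrow> complex"
 assumes \<alpha>: "0 < \<alpha>" and a: "a \<in> \<H> \<alpha>" and b: "\<And>j. b j \<in> \<H> \<alpha>"
 shows "(\<lambda>z. (a z, \<chi> j. b j z) :: 'n cpoint) \<in> \<H> \<alpha>"
  "\<N> \<alpha> (\<lambda>z. (a z, \<chi> j. b j z) :: 'n cpoint) \<le> \<N> \<alpha> a + (\<Sum>j\<in>UNIV. \<N> \<alpha> (b j))"
proof -
 note sn = seminormed_holder[OF \<alpha>, where 'b="'n cpoint"]
 let ?A = "\<lambda>z. (a z, 0) :: 'n cpoint" and ?B = "\<lambda>j z. (0, axis j (b j z)) :: 'n cpoint"
 have A: "?A \<in> \<H> \<alpha>" "\<N> \<alpha> ?A \<le> 1 * \<N> \<alpha> a"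
  by (rule holder_compose_bounded_linear[OF \<alpha> a, of "\<lambda>x. (x, 0)" 1]; auto simp: linear_iff)+
 have B: "?B j \<in> \<H> \<alpha>" "\<N> \<alpha> (?B j) \<le> 1 * \<N> \<alpha> (b j)" for j
 proof -
  have l: "linear (\<lambda>x. (0, axis j x) :: 'n cpoint)" by (auto simp: linear_iff axis_def vec_eq_iff)
  have n: "norm ((0, axis j x) :: 'n cpoint) \<le> 1 * norm x" for x :: complex by (simp add: norm_axis)
  show "?B j \<in> \<H> \<alpha>" "\<N> \<alpha> (?B j) \<le> 1 * \<N> \<alpha> (b j)"
   using holder_compose_bounded_linear[OF \<alpha> b l _ n] by auto
 qed
 have eq: "(\<lambda>z. (a z, \<chi> j. b j z) :: 'n cpoint) = ?A + (\<Sum>j\<in>UNIV. ?B j)"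
  by (auto simp: fun_eq_iff fun_sum_apply prod_eq_iff fst_sum snd_sum vec_eq_iff axis_def)
 have S: "(\<Sum>j\<in>UNIV. ?B j) \<in> \<H> \<alpha> \<and> \<N> \<alpha> (\<Sum>j\<in>UNIV. ?B j) \<le> (\<Sum>j\<in>UNIV. \<N> \<alpha> (?B j))"
  using B(1) by (intro seminormed_sum[OF sn]) auto
 have "(\<Sum>j\<in>UNIV. \<N> \<alpha> (?B j)) \<le> (\<Sum>j\<in>UNIV. \<N> \<alpha> (b j))"
  using B(2) by (intro sum_mono) auto
 then show "\<N> \<alpha> (\<lambda>z. (a z, \<chi> j. b j z) :: 'n cpoint) \<le> \<N> \<alpha> a + (\<Sum>j\<in>UNIV. \<N> \<alpha> (b j))"
  unfolding eq using seminormedD(3)[OF sn A(1) conjunct1[OF S]] S A(2) by linarith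
 show "(\<lambda>z. (a z, \<chi> j. b j z) :: 'n cpoint) \<in> \<H> \<alpha>"
  unfolding eq using seminormedD(5)[OF sn A(1) conjunct1[OF S]] .
qed

text \<open>An element of the Hoelder space has no values inside the disc. For boundary values of a
  holomorphic disc the Cauchy transform restores them, linearly and boundedly, so evaluation and
  differentiation at the centre become functionals on the whole Hoelder space.\<close>

definition vcauchy :: "(complex \<Rightarrow> 'n::finite cpoint) \<Rightarrow> complex \<Rightarrow> 'n cpoint" where
 "vcauchy f z = (cauchy (\<lambda>u. fst (f u)) z, \<chi> j. cauchy (\<lambda>u. snd (f u) $ j) z)"

text \<open>The Schwarz operator (holomorphic completion of a real part) on the first component and the
 projection onto positive frequencies on the others.\<close>

definition stat_op :: "(complex \<Rightarrow> 'n::finite cpoint) \<Rightarrow> complex \<Rightarrow> 'n cpoint" where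
 "stat_op f z =
   (2 * cauchy (\<lambda>u. of_real (Re (fst (f u)))) z - cauchy (\<lambda>u. of_real (Re (fst (f u)))) 0,
   \<chi> j. cauchy (\<lambda>u. snd (f u) $ j) z - cauchy (\<lambda>u. snd (f u) $ j) 0)"

lemma holder_of_real_Re:
 assumes "0 < \<alpha>" "f \<in> \<H> \<alpha>"
 shows "(\<lambda>z. complex_of_real (Re (f z))) \<in> \<H> \<alpha>" "\<N> \<alpha> (\<lambda>z. complex_of_real (Re (f z))) \<le> \<N> \<alpha> f"
proof -
 have "linear (\<lambda>x. complex_of_real (Re x))" by (rule linearI) (auto simp: scaleR_conv_of_real)
 from holder_compose_bounded_linear[OF assms this, of 1] abs_Re_le_cmod
 show "(\<lambda>z. complex_of_real (Re (f z))) \<in> \<H> \<alpha>" "\<N> \<alpha> (\<lambda>z. complex_of_real (Re (f z))) \<le> \<N> \<alpha> f"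
  by auto
qed

lemma holder_lincomb:
 assumes \<alpha>: "0 < \<alpha>" and f: "f \<in> \<H> \<alpha>" and B: "norm (k :: complex) \<le> B"
 shows "(\<lambda>z. c * f z - k) \<in> \<H> \<alpha>" "\<N> \<alpha> (\<lambda>z. c * f z - k) \<le> norm c * \<N> \<alpha> f + B"
proof -
 note sn = seminormed_holder[OF \<alpha>, where 'b=complex]
 have 1: "(\<lambda>z. c * f z) \<in> \<H> \<alpha>" "\<N> \<alpha> (\<lambda>z. c * f z) \<le> norm c * \<N> \<alpha> f"
  by (rule holder_compose_bounded_linear[OF \<alpha> f, of "\<lambda>x. c * x" "norm c"]; auto simp: linear_iff norm_mult distrib_left)+
 have 2: "(\<lambda>z. k) \<in> \<H> \<alpha>" "\<N> \<alpha> (\<lambda>z. k) \<le> B + 0"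
  by (rule holderI[OF \<alpha>, of 0]; use B in auto)+
 have eq: "(\<lambda>z. c * f z - k) = (\<lambda>z. c * f z) - (\<lambda>_. k)" by (simp add: fun_eq_iff)
 show "(\<lambda>z. c * f z - k) \<in> \<H> \<alpha>" "\<N> \<alpha> (\<lambda>z. c * f z - k) \<le> norm c * \<N> \<alpha> f + B"
  unfolding eq using seminormedD(6)[OF sn 1(1) 2(1)] seminormed_diff_le[OF sn 1(1) 2(1)] 1(2) 2(2) by simp_all
qed

lemma norm_cauchy_0_holder:
 assumes "0 < \<alpha>" "f \<in> \<H> \<alpha>" shows "norm (cauchy f 0) \<le> \<N> \<alpha> f"
 using norm_cauchy_0_le[OF holder_continuous_on[OF assms]] holderD(2)[OF assms] by simp

text \<open>There are \<open>1 + CARD('n)\<close> components, each at most twice a Cauchy transform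
  minus the value of that transform at 0.\<close>

definition stat_op_const :: "real \<Rightarrow> 'n::finite itself \<Rightarrow> real" where
 "stat_op_const \<alpha> _ = (1 + real CARD('n)) * (2 * (1 + 2 * cauchy_const \<alpha>) + 1)"

lemma stat_op_holder:
 fixes f :: "complex \<Rightarrow> 'n::finite cpoint"
 assumes \<alpha>: "0 < \<alpha>" "\<alpha> < 1" and f: "f \<in> \<H> \<alpha>"
 shows "stat_op f \<in> \<H> \<alpha>" "\<N> \<alpha> (stat_op f) \<le> stat_op_const \<alpha> TYPE('n) * \<N> \<alpha> f"
proof -
 let ?K = "2 * (1 + 2 * cauchy_const \<alpha>) + 1"
 have cc: "0 \<le> cauchy_const \<alpha>" using cauchy_const_nonneg[OF \<alpha>] .
 have nf: "0 \<le> \<N> \<alpha> f" using holderD(1)[OF \<alpha>(1) f] .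
 have gen: "(\<lambda>z. c * cauchy g z - cauchy g 0) \<in> \<H> \<alpha> \<and> \<N> \<alpha> (\<lambda>z. c * cauchy g z - cauchy g 0) \<le> ?K * \<N> \<alpha> f"
  if g: "g \<in> \<H> \<alpha>" and ng: "\<N> \<alpha> g \<le> \<N> \<alpha> f" and c: "norm c \<le> 2" for g c
 proof -
  have k: "norm (cauchy g 0) \<le> \<N> \<alpha> f" using norm_cauchy_0_holder[OF \<alpha>(1) g] ng by simp
  have "\<N> \<alpha> (cauchy g) \<le> (1 + 2 * cauchy_const \<alpha>) * \<N> \<alpha> g" by (rule cauchy_holder[OF \<alpha> g])
  also have "\<dots> \<le> (1 + 2 * cauchy_const \<alpha>) * \<N> \<alpha> f" using ng cc by (intro mult_left_mono) auto
  finally have "norm c * \<N> \<alpha> (cauchy g) \<le> 2 * ((1 + 2 * cauchy_const \<alpha>) * \<N> \<alpha> f)"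
   using c holderD(1)[OF \<alpha>(1) cauchy_holder(1)[OF \<alpha> g]] by (intro mult_mono) auto
  then show ?thesis using holder_lincomb[OF \<alpha>(1) cauchy_holder(1)[OF \<alpha> g] k, of c] by (simp add: algebra_simps)
 qed
 note r = holder_of_real_Re[OF \<alpha>(1) holder_fst(1)[OF \<alpha>(1) f]]
 note A = gen[OF r(1) order_trans[OF r(2) holder_fst(2)[OF \<alpha>(1) f]], of 2]
 note B = gen[OF holder_snd[OF \<alpha>(1) f], of 1, unfolded mult_1]
 have eq: "stat_op f = (\<lambda>z. (2 * cauchy (\<lambda>u. of_real (Re (fst (f u)))) z - cauchy (\<lambda>u. of_real (Re (fst (f u)))) 0,
   \<chi> j. cauchy (\<lambda>u. snd (f u) $ j) z - cauchy (\<lambda>u. snd (f u) $ j) 0))" by (simp add: fun_eq_iff stat_op_def)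
 show "stat_op f \<in> \<H> \<alpha>" unfolding eq using A B by (intro holder_pair[OF \<alpha>(1)]) auto
 have "\<N> \<alpha> (stat_op f) \<le> ?K * \<N> \<alpha> f + (\<Sum>j\<in>(UNIV::'n set). ?K * \<N> \<alpha> f)"
  unfolding eq using A B by (intro order_trans[OF holder_pair(2)[OF \<alpha>(1)]] add_mono sum_mono) auto
 then show "\<N> \<alpha> (stat_op f) \<le> stat_op_const \<alpha> TYPE('n) * \<N> \<alpha> f"
  by (simp add: stat_op_const_def algebra_simps)
qed

lemma stat_op_holomorphic:
 fixes f :: "complex \<Rightarrow> 'n::finite cpoint"
 assumes \<alpha>: "0 < \<alpha>" "\<alpha> < 1" and f: "f \<in> \<H> \<alpha>"
 shows "holomorphic_disc (stat_op f)"
 unfolding holomorphic_disc_iff stat_op_def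
 using disc_alg_diff[OF disc_alg_mult[OF disc_alg_const
   cauchy_disc_alg[OF \<alpha> holder_of_real_Re(1)[OF \<alpha>(1) holder_fst(1)[OF \<alpha>(1) f]]]] disc_alg_const]
  disc_alg_diff[OF cauchy_disc_alg[OF \<alpha> holder_snd(1)[OF \<alpha>(1) f]] disc_alg_const] by simp

lemma stat_op_cong:
 assumes "\<And>u. norm u = 1 \<Longrightarrow> f u = g u" shows "stat_op f = stat_op g"
proof -
 have "cauchy (\<lambda>u. of_real (Re (fst (f u)))) = cauchy (\<lambda>u. of_real (Re (fst (g u))))" by (rule cauchy_cong) (simp add: assms)
 moreover have "cauchy (\<lambda>u. snd (f u) $ j) = cauchy (\<lambda>u. snd (g u) $ j)" for j by (rule cauchy_cong) (simp add: assms)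
 ultimately show ?thesis by (simp add: stat_op_def fun_eq_iff)
qed

lemma stat_op_add:
 fixes f g :: "complex \<Rightarrow> 'n::finite cpoint"
 assumes \<alpha>: "0 < \<alpha>" "\<alpha> < 1" and f: "f \<in> \<H> \<alpha>" and g: "g \<in> \<H> \<alpha>" and z: "norm z \<le> 1"
 shows "stat_op (\<lambda>u. f u + g u) z = stat_op f z + stat_op g z"
proof -
 have z': "z \<in> cball 0 1" "0 \<in> cball (0::complex) 1" using z by auto
 note r = holder_of_real_Re(1)[OF \<alpha>(1) holder_fst(1)[OF \<alpha>(1) f]] holder_of_real_Re(1)[OF \<alpha>(1) holder_fst(1)[OF \<alpha>(1) g]]
 show ?thesis
  using cauchy_add[OF \<alpha> r z'(1)] cauchy_add[OF \<alpha> r z'(2)]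
   cauchy_add[OF \<alpha> holder_snd(1)[OF \<alpha>(1) f] holder_snd(1)[OF \<alpha>(1) g] z'(1)]
   cauchy_add[OF \<alpha> holder_snd(1)[OF \<alpha>(1) f] holder_snd(1)[OF \<alpha>(1) g] z'(2)]
  by (simp add: stat_op_def vec_eq_iff algebra_simps)
qed

lemma stat_op_scaleR:
 fixes f :: "complex \<Rightarrow> 'n::finite cpoint"
 assumes \<alpha>: "0 < \<alpha>" "\<alpha> < 1" and f: "f \<in> \<H> \<alpha>" and z: "norm z \<le> 1"
 shows "stat_op (\<lambda>u. c *\<^sub>R f u) z = c *\<^sub>R stat_op f z"
proof -
 have z': "z \<in> cball 0 1" "0 \<in> cball (0::complex) 1" using z by auto
 note r = holder_of_real_Re(1)[OF \<alpha>(1) holder_fst(1)[OF \<alpha>(1) f]]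
 show ?thesis
  using cauchy_cmult[OF \<alpha> r z'(1), of "of_real c"] cauchy_cmult[OF \<alpha> r z'(2), of "of_real c"]
   cauchy_cmult[OF \<alpha> holder_snd(1)[OF \<alpha>(1) f] z'(1), of "of_real c"]
   cauchy_cmult[OF \<alpha> holder_snd(1)[OF \<alpha>(1) f] z'(2), of "of_real c"]
  by (simp add: stat_op_def vec_eq_iff scaleR_conv_of_real[where 'a=complex] algebra_simps)
qed

lemma stat_op_diff:
 fixes f g :: "complex \<Rightarrow> 'n::finite cpoint"
 assumes \<alpha>: "0 < \<alpha>" "\<alpha> < 1" and f: "f \<in> \<H> \<alpha>" and g: "g \<in> \<H> \<alpha>" and z: "norm z \<le> 1"
 shows "stat_op (f - g) z = stat_op f z - stat_op g z"
proof -
 have d: "f - g \<in> \<H> \<alpha>" using seminormedD(6)[OF seminormed_holder[OF \<alpha>(1)] f g] .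
 have "(\<lambda>u. (f - g) u + g u) = f" by (simp add: fun_eq_iff)
 then show ?thesis using stat_op_add[OF \<alpha> d g z] by simp
qed

lemma cauchy_real_0:
 assumes "\<And>u. norm u = 1 \<Longrightarrow> Im (f u) = 0" shows "Im (cauchy f 0) = 0"
proof -
 have "cnj (circ_int f) = circ_int f"
  unfolding circ_int_cnj by (rule circ_int_cong) (simp add: assms complex_eq_iff)
 then have "Im (circ_int f) = 0" by (simp add: complex_eq_iff)
 moreover have "cauchy f 0 = circ_int f / of_real (2 * pi)" by (simp add: cauchy_0)
 ultimately show ?thesis by (simp only: Im_divide_of_real)
qed

text \<open>The Cauchy transform at 0 is the mean over the circle, which is real for real functions.
  Thanks to this normalisation the parameters \<open>v\<close> and \<open>y\<close> of a model disc
  can be read off exactly from the centre of the perturbed disc.\<close>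

lemma stat_op_0: "snd (stat_op f 0) = 0" "Im (fst (stat_op f 0)) = 0"
 using cauchy_real_0[of "\<lambda>u. of_real (Re (fst (f u)))"] by (simp_all add: stat_op_def vec_eq_iff)

lemma stat_op_Re:
 fixes f :: "complex \<Rightarrow> 'n::finite cpoint"
 assumes \<alpha>: "0 < \<alpha>" "\<alpha> < 1" and f: "f \<in> \<H> \<alpha>" and z: "norm \<xi> = 1"
 shows "Re (fst (stat_op f \<xi>)) = Re (fst (f \<xi>))"
proof -
 let ?u = "\<lambda>u. complex_of_real (Re (fst (f u)))"
 note r = holder_of_real_Re(1)[OF \<alpha>(1) holder_fst(1)[OF \<alpha>(1) f]]
 have "cauchy ?u \<xi> + cnj (cauchy (\<lambda>u. cnj (?u u)) \<xi>) - cauchy ?u 0 = ?u \<xi>" by (rule cauchy_decomposition[OF \<alpha> r z])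
 then have "2 * Re (cauchy ?u \<xi>) - Re (cauchy ?u 0) = Re (fst (f \<xi>))" by (simp add: complex_eq_iff)
 then show ?thesis by (simp add: stat_op_def)
qed

text \<open>The constant Fourier coefficient is subtracted in \<open>stat_op\<close> and is
  therefore carried by the antiholomorphic part \<open>m\<close>.\<close>

lemma stat_op_snd:
 fixes f :: "complex \<Rightarrow> 'n::finite cpoint"
 assumes \<alpha>: "0 < \<alpha>" "\<alpha> < 1" and f: "f \<in> \<H> \<alpha>"
 obtains m where "disc_alg m" "\<And>\<xi>. norm \<xi> = 1 \<Longrightarrow> snd (f \<xi>) $ j = snd (stat_op f \<xi>) $ j + cnj (m \<xi>)"
proof
 note s = holder_snd(1)[OF \<alpha>(1) f, of j]
 show "disc_alg (cauchy (\<lambda>u. cnj (snd (f u) $ j)))" by (rule cauchy_disc_alg[OF \<alpha> holder_cnj(1)[OF \<alpha>(1) s]])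
 show "snd (f \<xi>) $ j = snd (stat_op f \<xi>) $ j + cnj (cauchy (\<lambda>u. cnj (snd (f u) $ j)) \<xi>)" if "norm \<xi> = 1" for \<xi>
  using cauchy_decomposition[OF \<alpha> s that] by (simp add: stat_op_def algebra_simps)
qed

text \<open>A function of the disc algebra is determined by its real part on the circle up to an
  imaginary constant, and the Schwarz operator is normalised to be real at 0.\<close>

lemma stat_op_fst_unique:
 fixes f :: "complex \<Rightarrow> 'n::finite cpoint"
 assumes \<alpha>: "0 < \<alpha>" "\<alpha> < 1" and f: "f \<in> \<H> \<alpha>" and g: "disc_alg g"
  and re: "\<And>\<xi>. norm \<xi> = 1 \<Longrightarrow> Re (g \<xi>) = Re (fst (f \<xi>))" and z: "norm z \<le> 1"
 shows "g z = \<i> * Im (g 0) + fst (stat_op f z)"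
proof -
 have s: "disc_alg (\<lambda>z. fst (stat_op f z))" using stat_op_holomorphic[OF \<alpha> f] by (simp add: holomorphic_disc_iff)
 have c: "g w - fst (stat_op f w) = g 0 - fst (stat_op f 0)" if "norm w \<le> 1" for w
  by (rule disc_alg_imaginary_const[OF disc_alg_diff[OF g s] _ that]) (simp add: re stat_op_Re[OF \<alpha> f])
 have "Re (g 0 - fst (stat_op f 0)) = 0"
  using c[of 1] re[of 1] stat_op_Re[OF \<alpha> f, of 1] by (metis diff_self minus_complex.sel(1) norm_one order_refl)
 then have "g 0 - fst (stat_op f 0) = \<i> * Im (g 0)" using stat_op_0(2)[of f] by (simp add: complex_eq_iff)
 with c[OF z] have "g z - fst (stat_op f z) = \<i> * Im (g 0)" by (rule trans)
 then show ?thesis by (simp add: diff_eq_eq)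
qed

lemma vcauchy_linear:
 fixes f g :: "complex \<Rightarrow> 'n::finite cpoint"
 assumes \<alpha>: "0 < \<alpha>" "\<alpha> < 1" and f: "f \<in> \<H> \<alpha>" and g: "g \<in> \<H> \<alpha>" and z: "norm z \<le> 1"
 shows "vcauchy (f + g) z = vcauchy f z + vcauchy g z" "vcauchy (c *\<^sub>R f) z = c *\<^sub>R vcauchy f z"
proof -
 have z': "z \<in> cball 0 1" using z by auto
 show "vcauchy (f + g) z = vcauchy f z + vcauchy g z"
  using cauchy_add[OF \<alpha> holder_fst(1)[OF \<alpha>(1) f] holder_fst(1)[OF \<alpha>(1) g] z']
   cauchy_add[OF \<alpha> holder_snd(1)[OF \<alpha>(1) f] holder_snd(1)[OF \<alpha>(1) g] z'] by (simp add: vcauchy_def vec_eq_iff)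
 show "vcauchy (c *\<^sub>R f) z = c *\<^sub>R vcauchy f z"
  using cauchy_cmult[OF \<alpha> holder_fst(1)[OF \<alpha>(1) f] z', of "of_real c"]
   cauchy_cmult[OF \<alpha> holder_snd(1)[OF \<alpha>(1) f] z', of "of_real c"]
  by (simp add: vcauchy_def vec_eq_iff scaleR_fun_def scaleR_conv_of_real[where 'a=complex])
qed

lemma vcauchy_holomorphic_disc:
 assumes \<alpha>: "0 < \<alpha>" "\<alpha> < 1" and f: "f \<in> \<H> \<alpha>"
 shows "holomorphic_disc (vcauchy f)"
 unfolding holomorphic_disc_iff vcauchy_def
 using cauchy_disc_alg[OF \<alpha> holder_fst(1)[OF \<alpha>(1) f]] cauchy_disc_alg[OF \<alpha> holder_snd(1)[OF \<alpha>(1) f]] by simp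

lemma vcauchy_of_holomorphic_disc:
 "holomorphic_disc h \<Longrightarrow> z \<in> ball 0 1 \<Longrightarrow> vcauchy h z = h z"
 unfolding holomorphic_disc_iff using cauchy_of_disc_alg by (simp add: vcauchy_def prod_eq_iff vec_eq_iff)

lemma norm_cpoint_le: "norm (x :: 'n::finite cpoint) \<le> norm (fst x) + (\<Sum>j\<in>UNIV. norm (snd x $ j))"
proof -
 have "norm x \<le> norm (fst x) + norm (snd x)" using norm_Pair_le[of "fst x" "snd x"] by simp
 moreover have "norm (snd x) \<le> (\<Sum>j\<in>UNIV. norm (snd x $ j))" unfolding norm_vec_def by (rule L2_set_le_sum) simp
 ultimately show ?thesis by linarith
qed

lemma holomorphic_disc_at_0_bound:
 fixes h :: "complex \<Rightarrow> 'n::finite cpoint"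
 assumes h: "holomorphic_disc h" and b: "\<And>\<xi>. norm \<xi> = 1 \<Longrightarrow> norm (h \<xi>) \<le> B"
 shows "norm (h 0) \<le> (1 + real CARD('n)) * B" "norm (disc_deriv h 0) \<le> (1 + real CARD('n)) * (2 * B)"
proof -
 have b1: "norm (fst (h \<xi>)) \<le> B" "norm (snd (h \<xi>) $ j) \<le> B" if "norm \<xi> = 1" for \<xi> j
  using b[OF that] norm_fst_le[of "fst (h \<xi>)" "snd (h \<xi>)"] norm_snd_nth_le[of "h \<xi>" j] by auto
 have d: "disc_alg (\<lambda>z. fst (h z))" "disc_alg (\<lambda>z. snd (h z) $ j)" for j using h by (auto simp: holomorphic_disc_iff)
 note e1 = disc_alg_at_0_bound[OF d(1) b1(1)] and e2 = disc_alg_at_0_bound[OF d(2) b1(2)]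
 have "norm (h 0) \<le> B + (\<Sum>j\<in>(UNIV::'n set). B)"
  by (rule order_trans[OF norm_cpoint_le]) (intro add_mono sum_mono e1 e2)
 then show "norm (h 0) \<le> (1 + real CARD('n)) * B" by (simp add: algebra_simps)
 have "norm (disc_deriv h 0) \<le> 2 * B + (\<Sum>j\<in>(UNIV::'n set). 2 * B)"
  unfolding disc_deriv_def
  by (rule order_trans[OF norm_cpoint_le], unfold fst_conv snd_conv vec_lambda_beta) (intro add_mono sum_mono e1 e2)
 then show "norm (disc_deriv h 0) \<le> (1 + real CARD('n)) * (2 * B)" by (simp add: algebra_simps)
qed

subsection \<open>Stationary discs as solutions of an equation\<close>

text \<open>The left side has frequencies at least 0, the right side at most 1, so \<open>F\<close>
  is affine. Removing F(0) and dividing by \<xi> reduces this to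
  \<open>disc_alg_eq_cnj_const\<close>.\<close>

lemma disc_alg_times_cnj:
 fixes F D :: "complex \<Rightarrow> complex"
 assumes F: "disc_alg F" and D: "disc_alg D" and eq: "\<And>\<xi>. norm \<xi> = 1 \<Longrightarrow> F \<xi> = \<xi> * cnj (D \<xi>)"
 shows "\<exists>w. \<forall>z. norm z \<le> 1 \<longrightarrow> F z = F 0 + w * z"
proof -
 obtain F1 :: "complex \<Rightarrow> complex" where F1: "disc_alg F1" "\<And>z. norm z \<le> 1 \<Longrightarrow> F z = F 0 + z * F1 z" "F1 0 = deriv F 0"
  by (rule disc_alg_factor[OF F], rule that)
 have "F1 \<xi> = cnj (D \<xi> - cnj (F 0) * \<xi>)" if z: "norm \<xi> = 1" for \<xi>
 proof -
  have u: "cnj \<xi> * \<xi> = 1" using z by (simp add: complex_norm_square[symmetric] mult.commute)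
  have "F1 \<xi> = cnj \<xi> * (\<xi> * F1 \<xi>)" using u by (simp add: mult.assoc[symmetric])
  also have "\<xi> * F1 \<xi> = \<xi> * cnj (D \<xi>) - F 0" using F1(2)[of \<xi>] eq[OF z] z by simp
  also have "cnj \<xi> * (\<xi> * cnj (D \<xi>) - F 0) = (cnj \<xi> * \<xi>) * cnj (D \<xi>) - F 0 * cnj \<xi>" by (simp add: algebra_simps)
  finally show ?thesis using u by simp
 qed
 moreover have "disc_alg (\<lambda>\<xi>. D \<xi> - cnj (F 0) * \<xi>)" using D by (intro disc_alg_diff disc_alg_mult disc_alg_const disc_alg_ident)
 ultimately have c: "F1 z = F1 0" if "norm z \<le> 1" for z
  using disc_alg_eq_cnj_const[OF F1(1) _ _ that] by presburger
 show ?thesis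
 proof (intro exI[of _ "F1 0"] allI impI)
  show "F z = F 0 + F1 0 * z" if "norm z \<le> 1" for z using F1(2)[OF that] c[OF that] by simp
 qed
qed

text \<open>The hypothesis says that G(\<xi>)/\<xi> is real on the circle. Only the frequencies 0,
  1, 2 survive, with conjugate outer coefficients and a real middle one.\<close>

lemma disc_alg_reflection:
 fixes G :: "complex \<Rightarrow> complex"
 assumes G: "disc_alg G" and eq: "\<And>\<xi>. norm \<xi> = 1 \<Longrightarrow> G \<xi> = \<xi>\<^sup>2 * cnj (G \<xi>)"
 shows "\<exists>b :: real. \<forall>z. norm z \<le> 1 \<longrightarrow> G z = G 0 + of_real b * z + cnj (G 0) * z\<^sup>2"
proof -
 obtain K :: "complex \<Rightarrow> complex" where K: "disc_alg K" "\<And>z. norm z \<le> 1 \<Longrightarrow> G z = G 0 + z * K z" "K 0 = deriv G 0"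
  by (rule disc_alg_factor[OF G], rule that)
 define M where "M z = K z - cnj (G 0) * z" for z
 have M: "disc_alg M" unfolding M_def by (intro disc_alg_diff disc_alg_mult disc_alg_const disc_alg_ident K(1))
 have sym: "M \<xi> = cnj (M \<xi>)" if z: "norm \<xi> = 1" for \<xi>
 proof -
  have u: "\<xi> * cnj \<xi> = 1" using z by (simp add: complex_norm_square[symmetric])
  then have ne: "\<xi> \<noteq> 0" by auto
  have Gz: "G \<xi> = G 0 + \<xi> * K \<xi>" using K(2)[of \<xi>] z by simp
  have "G 0 + \<xi> * K \<xi> = \<xi>\<^sup>2 * (cnj (G 0) + cnj \<xi> * cnj (K \<xi>))"
   using eq[OF z] unfolding Gz complex_cnj_add complex_cnj_mult .
  also have "\<dots> = \<xi>\<^sup>2 * cnj (G 0) + \<xi> * (\<xi> * cnj \<xi>) * cnj (K \<xi>)" by (simp add: power2_eq_square algebra_simps)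
  finally have "\<xi> * (K \<xi> - \<xi> * cnj (G 0)) = \<xi> * cnj (K \<xi>) - G 0" using u by (simp add: power2_eq_square algebra_simps)
  also have "\<dots> = \<xi> * (cnj (K \<xi>) - cnj \<xi> * G 0)" using u by (simp add: right_diff_distrib mult.assoc[symmetric])
  finally show ?thesis using ne by (simp add: M_def mult.commute)
 qed
 have "M z = M 0" if "norm z \<le> 1" for z using disc_alg_eq_cnj_const[OF M M sym that] .
 note Mc = this
 have M0: "M 0 = of_real (Re (M 0))" using sym[of 1] Mc[of 1] by (simp add: complex_eq_iff)
 have "K z = of_real (Re (M 0)) + cnj (G 0) * z" if "norm z \<le> 1" for z
 proof -
  have "K z = M z + cnj (G 0) * z" by (simp add: M_def)
  then show ?thesis unfolding Mc[OF that] M0[symmetric] .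
 qed
 then have "G z = G 0 + of_real (Re (M 0)) * z + cnj (G 0) * z\<^sup>2" if "norm z \<le> 1" for z
  using K(2)[OF that] that by (simp add: power2_eq_square algebra_simps)
 then show ?thesis by blast
qed

text \<open>The roots of such a polynomial are symmetric with respect to the circle, like
  \<open>cnj a\<close> and \<open>1 / a\<close>. Having none on the circle amounts to
  \<open>2 * norm G0 < \<bar>b\<bar>\<close>, and then exactly one lies inside.\<close>

lemma real_trig_factor:
 fixes G0 :: complex and b :: real
 assumes nz: "\<And>\<xi>. norm \<xi> = 1 \<Longrightarrow> G0 + of_real b * \<xi> + cnj G0 * \<xi>\<^sup>2 \<noteq> 0"
 shows "\<exists>(a :: complex) (\<kappa> :: real). norm a < 1 \<and> \<kappa> \<noteq> 0 \<and>
  (\<forall>z. G0 + of_real b * z + cnj G0 * z\<^sup>2 = of_real \<kappa> * ((z - cnj a) * (1 - a * z)))"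
proof -
 have b: "2 * norm G0 < \<bar>b\<bar>"
 proof (rule ccontr)
  assume n: "\<not> 2 * norm G0 < \<bar>b\<bar>"
  show False
  proof (cases "G0 = 0")
   case True
   then have "b = 0" using n by simp
   then show False using nz[of 1] True by simp
  next
   case False
   define t where "t = - b / (2 * norm G0)"
   have t: "\<bar>t\<bar> \<le> 1" using n False by (simp add: t_def abs_divide divide_le_eq)
   \<comment> \<open>If \<open>\<bar>b\<bar> \<le> 2 * norm G0\<close>, this point of the circle
     solves \<open>2 * Re (G0 * cnj \<xi>) + b = 0\<close> and is a root.\<close>
   define \<xi> where "\<xi> = G0 / of_real (norm G0) * cnj (cis (arccos t))"
   have z: "norm \<xi> = 1" using False by (simp add: \<xi>_def norm_mult norm_divide)
   have u: "\<xi> * cnj \<xi> = 1" using z by (simp add: complex_norm_square[symmetric])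
   have "G0 * cnj \<xi> = of_real (norm G0) * cis (arccos t)"
   proof -
    have "G0 * cnj \<xi> = (G0 * cnj G0) / of_real (norm G0) * cis (arccos t)" by (simp add: \<xi>_def)
    also have "G0 * cnj G0 = of_real (norm G0) * of_real (norm G0)" by (simp add: complex_norm_square[symmetric] power2_eq_square)
    finally show ?thesis using False by simp
   qed
   then have "Re (G0 * cnj \<xi>) = norm G0 * t" using t by (simp add: cos_arccos_abs)
   then have r: "2 * Re (G0 * cnj \<xi>) + b = 0" using False by (simp add: t_def)
   have "G0 + of_real b * \<xi> + cnj G0 * \<xi>\<^sup>2 = \<xi> * (G0 * cnj \<xi> + cnj (G0 * cnj \<xi>) + of_real b)"
    using u by (simp add: algebra_simps power2_eq_square)
   also have "G0 * cnj \<xi> + cnj (G0 * cnj \<xi>) = of_real (2 * Re (G0 * cnj \<xi>))" by (rule complex_add_cnj)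
   also have "of_real (2 * Re (G0 * cnj \<xi>)) + of_real b = (of_real (2 * Re (G0 * cnj \<xi>) + b) :: complex)" by (rule of_real_add[symmetric])
   finally have "G0 + of_real b * \<xi> + cnj G0 * \<xi>\<^sup>2 = \<xi> * of_real (2 * Re (G0 * cnj \<xi>) + b)" .
   then show False using nz[OF z] by (simp only: r) simp
  qed
 qed
 define d where "d = sqrt (b\<^sup>2 - 4 * (norm G0)\<^sup>2)"
 have "(2 * norm G0)\<^sup>2 \<le> \<bar>b\<bar>\<^sup>2" using b by (intro power_mono) auto
 then have d2: "d\<^sup>2 = b\<^sup>2 - 4 * (norm G0)\<^sup>2" and d0: "0 \<le> d" by (auto simp: d_def power_mult_distrib)
 \<comment> \<open>A root of \<kappa>^2 - b \<kappa> + |G0|^2 = 0. The sign of b selects the root of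
   larger modulus, so that \<open>norm G0 < \<bar>\<kappa>\<bar>\<close> and hence
   \<open>norm a < 1\<close>.\<close>
 define \<kappa> where "\<kappa> = (b + sgn b * d) / 2"
 have b0: "b \<noteq> 0" using b by force
 have s2: "sgn b * sgn b = 1" using b0 by (simp add: sgn_mult_self_eq)
 have "\<kappa> = (sgn b * \<bar>b\<bar> + sgn b * d) / 2" unfolding \<kappa>_def mult_sgn_abs ..
 then have "\<kappa> = sgn b * (\<bar>b\<bar> + d) / 2" by (simp only: distrib_left)
 then have "\<bar>\<kappa>\<bar> = \<bar>sgn b\<bar> * \<bar>\<bar>b\<bar> + d\<bar> / 2" by (simp only: abs_mult abs_divide abs_numeral)
 then have ak: "\<bar>\<kappa>\<bar> = (\<bar>b\<bar> + d) / 2" using b0 d0 by (simp add: abs_sgn_eq)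
 have "g < (x + d) / 2" if "2 * g < x" "0 \<le> d" for g x :: real
  using add_less_le_mono[OF that] by simp
 from this[OF b d0] have kb: "norm G0 < \<bar>\<kappa>\<bar>" by (simp only: ak)
 have k0: "\<kappa> \<noteq> 0"
 proof
  assume "\<kappa> = 0"
  then have "norm G0 < 0" using kb by simp
  then show False by simp
 qed
 have quad: "\<kappa> * \<kappa> + (norm G0)\<^sup>2 = b * \<kappa>"
 proof -
  have "2 * \<kappa> = b + sgn b * d" unfolding \<kappa>_def times_divide_eq_right by (rule nonzero_mult_div_cancel_left) simp
  then have "2 * \<kappa> - b = sgn b * d" by simp
  then have "(2 * \<kappa> - b)\<^sup>2 = (sgn b * sgn b) * d\<^sup>2" by (simp only: power2_eq_square mult_ac)
  then have "(2 * \<kappa> - b)\<^sup>2 = d\<^sup>2" unfolding s2 by simp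
  then show ?thesis using d2 by (simp add: power2_eq_square algebra_simps)
 qed
 define a where "a = - cnj G0 / of_real \<kappa>"
 have "norm a < 1" using kb k0 by (simp add: a_def norm_divide divide_less_eq)
 moreover have "G0 + of_real b * z + cnj G0 * z\<^sup>2 = of_real \<kappa> * ((z - cnj a) * (1 - a * z))" for z
 proof -
  have ka: "of_real \<kappa> * a = - cnj G0" and kca: "of_real \<kappa> * cnj a = - G0" using k0 by (simp_all add: a_def)
  have "of_real \<kappa> * (a * cnj a) = - (cnj G0 * cnj a)" using ka by (simp add: mult.assoc[symmetric])
  then have "of_real \<kappa> * (of_real \<kappa> * (a * cnj a)) = cnj G0 * G0" using kca by (simp add: mult.left_commute)
  also have "\<dots> = of_real ((norm G0)\<^sup>2)" by (simp only: complex_norm_square mult.commute)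
  finally have "of_real \<kappa> * (of_real \<kappa> + of_real \<kappa> * (a * cnj a)) = of_real (\<kappa> * \<kappa> + (norm G0)\<^sup>2)"
   by (simp add: distrib_left)
  also have "\<dots> = of_real \<kappa> * of_real b" unfolding quad by simp
  finally have kk: "of_real \<kappa> + of_real \<kappa> * (a * cnj a) = (of_real b :: complex)" using k0 by simp
  have "of_real \<kappa> * ((z - cnj a) * (1 - a * z)) =
    (of_real \<kappa> + of_real \<kappa> * (a * cnj a)) * z - of_real \<kappa> * cnj a - of_real \<kappa> * a * z\<^sup>2"
   by (simp add: algebra_simps power2_eq_square)
  then show ?thesis unfolding kk ka kca by simp
 qed
 ultimately show ?thesis using k0 by blast
qed

text \<open>\<open>(1 / 2, - cov A z)\<close> is the (1,0)-gradient of the quadric, see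
  \<open>del_quadric\<close>.\<close>

definition cov :: "complex ^ 'n ^ 'n \<Rightarrow> 'n::finite cpoint \<Rightarrow> 'n \<Rightarrow> complex" where
 "cov A z j = (\<Sum>i\<in>UNIV. cnj (snd z $ i) * A $ i $ j)"

text \<open>With \<open>\<rho>\<^sub>0\<close>, \<open>\<rho>\<^sub>j\<close> the components of \<open>del \<rho>\<close>, this is defined so that
 \<open>\<rho>\<^sub>j / \<rho>\<^sub>0 = -2 (c\<^sub>j - E\<^sub>j)\<close> where \<open>c = cov A\<close>; it vanishes when \<open>\<rho>\<close> is the quadric. The covector \<open>E\<close>
 corresponds to the vector \<open>stat_pert\<close> under the hermitian form \<open>A\<close>, with inverse \<open>B\<close>.\<close>

definition stat_err :: "complex ^ 'n ^ 'n \<Rightarrow> ('n::finite cpoint \<Rightarrow> real) \<Rightarrow> 'n cpoint \<Rightarrow> 'n \<Rightarrow> complex" where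
 "stat_err A \<rho> z j = cov A z j + snd (del \<rho> z) $ j / (2 * fst (del \<rho> z))"

definition stat_pert :: "complex ^ 'n ^ 'n \<Rightarrow> complex ^ 'n ^ 'n \<Rightarrow> ('n::finite cpoint \<Rightarrow> real) \<Rightarrow> 'n cpoint \<Rightarrow> 'n \<Rightarrow> complex" where
 "stat_pert A B \<rho> z i = cnj (\<Sum>j\<in>UNIV. stat_err A \<rho> z j * B $ j $ i)"

type_synonym 'n params = "complex \<times> (complex ^ 'n) \<times> (complex ^ 'n) \<times> real"

definition model_disc :: "'n params \<Rightarrow> complex \<Rightarrow> 'n::finite cpoint" where
 "model_disc t z = (case t of (a, v, w, y) \<Rightarrow> (\<i> * of_real y, \<chi> j. v $ j + w $ j * (z / (1 - a * z))))"

lemma matrix_inverse_contract: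
 fixes A B :: "complex ^ 'n::finite ^ 'n"
 assumes "A ** B = mat 1"
 shows "(\<Sum>j\<in>UNIV. (\<Sum>i\<in>UNIV. x i * A $ i $ j) * B $ j $ l) = x l"
proof -
 have AB: "(\<Sum>j\<in>UNIV. A $ i $ j * B $ j $ l) = (if i = l then 1 else 0)" for i
  using arg_cong[OF assms, of "\<lambda>M. M $ i $ l"] by (simp add: matrix_matrix_mult_def mat_def)
 have "(\<Sum>j\<in>UNIV. (\<Sum>i\<in>UNIV. x i * A $ i $ j) * B $ j $ l) = (\<Sum>j\<in>UNIV. \<Sum>i\<in>UNIV. x i * (A $ i $ j * B $ j $ l))"
  by (simp add: sum_distrib_right mult.assoc)
 also have "\<dots> = (\<Sum>i\<in>UNIV. x i * (\<Sum>j\<in>UNIV. A $ i $ j * B $ j $ l))"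
  by (subst sum.swap) (simp add: sum_distrib_left)
 finally show ?thesis by (simp add: AB if_distrib cong: if_cong)
qed

lemma one_minus_mult_ne: "norm a < 1 \<Longrightarrow> norm z \<le> 1 \<Longrightarrow> 1 - a * z \<noteq> (0::complex)"
proof
 assume a: "norm a < 1" "norm z \<le> 1" and "1 - a * z = 0"
 then have "norm a * norm z = 1" by (metis eq_iff_diff_eq_0 norm_mult norm_one)
 moreover have "norm a * norm z \<le> norm a * 1" using a by (intro mult_left_mono) auto
 ultimately show False using a by simp
qed

text \<open>The exponential of \<open>k\<close> carries the phase of the first derivative of \<rho>.
  Without it the first component of the lift \<open>g\<close> is \<xi> times a real function, hence
  \<kappa> (z - cnj a)(1 - a z). Contracted with the inverse matrix, the other components are this
  polynomial times the conjugate of a component of \<open>h\<close> minus its perturbation. Clearing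
  the zero-free factor and comparing frequencies leaves an affine function divided by 1 - a z, plus
  the positive-frequency part \<open>f1\<close> of the perturbation.\<close>

lemma stationary_imp_form:
 fixes h :: "complex \<Rightarrow> 'n::finite cpoint" and A B :: "complex ^ 'n ^ 'n"
 assumes AB: "A ** B = mat 1" and h: "holomorphic_disc h"
  and c: "\<And>\<xi>. norm \<xi> = 1 \<Longrightarrow> c \<xi> \<noteq> (0::real)" and g: "holomorphic_disc g"
  and gc: "\<And>\<xi>. norm \<xi> = 1 \<Longrightarrow> g \<xi> = (\<xi> * of_real (c \<xi>) * fst (del \<rho> (h \<xi>)), (\<xi> * of_real (c \<xi>)) *s snd (del \<rho> (h \<xi>)))"
  and k: "disc_alg k" and p: "\<And>\<xi>. norm \<xi> = 1 \<Longrightarrow> p \<xi> \<noteq> (0::real)"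
  and pk: "\<And>\<xi>. norm \<xi> = 1 \<Longrightarrow> 2 * fst (del \<rho> (h \<xi>)) = of_real (p \<xi>) * exp (k \<xi>)"
  and f: "\<And>i. disc_alg (f1 i)" "\<And>i. disc_alg (f2 i)"
  and ff: "\<And>i \<xi>. norm \<xi> = 1 \<Longrightarrow> stat_pert A B \<rho> (h \<xi>) i = f1 i \<xi> + cnj (f2 i \<xi>)"
 obtains a v w where "norm a < 1" "\<And>z i. norm z \<le> 1 \<Longrightarrow> snd (h z) $ i = v $ i + w $ i * (z / (1 - a * z)) + f1 i z"
proof -
 have BA: "B ** A = mat 1" using AB by (simp add: matrix_left_right_inverse)
 have hj: "disc_alg (\<lambda>z. snd (h z) $ j)" for j using h by (simp add: holomorphic_disc_iff)
 have g0: "disc_alg (\<lambda>z. fst (g z))" and gj: "disc_alg (\<lambda>z. snd (g z) $ j)" for j using g by (auto simp: holomorphic_disc_iff)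
 \<comment> \<open>On the circle this is \<open>\<xi> * of_real (c \<xi> * p \<xi>)\<close>, so that
   both the unknown multiplier and the phase have disappeared into one real factor.\<close>
 define G where "G z = 2 * fst (g z) * exp (- k z)" for z
 have G: "disc_alg G" unfolding G_def using g0 k by (intro disc_alg_mult disc_alg_const disc_alg_exp disc_alg_minus)
 have Gc: "G \<xi> = \<xi> * of_real (c \<xi> * p \<xi>)" if z: "norm \<xi> = 1" for \<xi>
 proof -
  have "G \<xi> = \<xi> * of_real (c \<xi>) * (2 * fst (del \<rho> (h \<xi>))) * exp (- k \<xi>)" using gc[OF z] by (simp add: G_def)
  also have "\<dots> = \<xi> * of_real (c \<xi>) * of_real (p \<xi>) * (exp (k \<xi>) * exp (- k \<xi>))" unfolding pk[OF z] by simp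
  finally show ?thesis by (simp add: exp_minus_inverse)
 qed
 have refl: "G \<xi> = \<xi>\<^sup>2 * cnj (G \<xi>)" if z: "norm \<xi> = 1" for \<xi>
 proof -
  have u: "\<xi> * cnj \<xi> = 1" using z by (simp add: complex_norm_square[symmetric])
  have "\<xi>\<^sup>2 * cnj (G \<xi>) = \<xi> * (\<xi> * cnj \<xi>) * of_real (c \<xi> * p \<xi>)" unfolding Gc[OF z] by (simp add: power2_eq_square)
  then have "\<xi>\<^sup>2 * cnj (G \<xi>) = \<xi> * of_real (c \<xi> * p \<xi>)" unfolding u by (simp only: mult_1_right)
  then show ?thesis using Gc[OF z] by (simp only:)
 qed
 obtain b :: real where b: "\<And>z. norm z \<le> 1 \<Longrightarrow> G z = G 0 + of_real b * z + cnj (G 0) * z\<^sup>2"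
  using disc_alg_reflection[OF G refl] by blast
 have "G 0 + of_real b * \<xi> + cnj (G 0) * \<xi>\<^sup>2 \<noteq> 0" if z: "norm \<xi> = 1" for \<xi>
  using b[of \<xi>] Gc[OF z] c[OF z] p[OF z] z by auto
 then obtain a \<kappa> where a: "norm a < 1" "\<kappa> \<noteq> 0"
  "\<And>z. G 0 + of_real b * z + cnj (G 0) * z\<^sup>2 = of_real \<kappa> * ((z - cnj a) * (1 - a * z))"
  using real_trig_factor[of "G 0" b] by blast
 have Gf: "G z = of_real \<kappa> * ((z - cnj a) * (1 - a * z))" if "norm z \<le> 1" for z using b[OF that] a(3) by simp
 have ne: "1 - a * z \<noteq> 0" if "norm z \<le> 1" for z using one_minus_mult_ne[OF a(1) that] .
 have key: "\<exists>v w. \<forall>z. norm z \<le> 1 \<longrightarrow> snd (h z) $ l = v + w * (z / (1 - a * z)) + f1 l z" for l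
 proof -
  \<comment> \<open>Contraction with \<open>B\<close> isolates the conjugate of the single component
    l; the minus sign compensates that of \<rho>\<open>_j\<close> / \<rho>\<open>_0\<close> in terms
    of \<open>cov\<close>.\<close>
  define D where "D z = - (\<Sum>j\<in>UNIV. snd (g z) $ j * B $ j $ l) * exp (- k z)" for z
  have D: "disc_alg D" unfolding D_def
   using gj k by (intro disc_alg_mult disc_alg_minus disc_alg_sum disc_alg_exp disc_alg_const) auto
  have DG: "D \<xi> = G \<xi> * cnj (snd (h \<xi>) $ l - stat_pert A B \<rho> (h \<xi>) l)" if z: "norm \<xi> = 1" for \<xi>
  proof -
   have r0: "fst (del \<rho> (h \<xi>)) \<noteq> 0" using pk[OF z] p[OF z] by auto
   have gjz: "snd (g \<xi>) $ j = - (2 * fst (g \<xi>)) * (cov A (h \<xi>) j - stat_err A \<rho> (h \<xi>) j)" for j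
    using r0 gc[OF z] by (simp add: stat_err_def)
   have "(\<Sum>j\<in>UNIV. snd (g \<xi>) $ j * B $ j $ l) =
     - (2 * fst (g \<xi>)) * ((\<Sum>j\<in>UNIV. cov A (h \<xi>) j * B $ j $ l) - (\<Sum>j\<in>UNIV. stat_err A \<rho> (h \<xi>) j * B $ j $ l))"
   proof -
    have "- (2 * fst (g \<xi>)) * (x - y) * z = - (2 * fst (g \<xi>)) * (x * z - y * z)" for x y z by (simp add: algebra_simps)
    then show ?thesis unfolding gjz by (simp only: sum_subtractf[symmetric] sum_distrib_left)
   qed
   also have "(\<Sum>j\<in>UNIV. cov A (h \<xi>) j * B $ j $ l) = cnj (snd (h \<xi>) $ l)"
    unfolding cov_def by (rule matrix_inverse_contract[OF AB])
   finally show ?thesis by (simp add: D_def G_def stat_pert_def)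
  qed
  define f where "f z = snd (h z) $ l - f1 l z" for z
  have f': "disc_alg f" unfolding f_def using hj f(1) by (intro disc_alg_diff)
  \<comment> \<open>The term with \<open>f2\<close> is holomorphic and can be moved to the side of
    \<open>D\<close>. After division by \<kappa> (1 - a z), which has no zero on the closed disc,
    the boundary values are \<open>(\<xi> - cnj a) * cnj (f \<xi>)\<close>.\<close>
  define D3 where "D3 z = (D z / of_real \<kappa> + (z - cnj a) * (1 - a * z) * f2 l z) / (1 - a * z)" for z
  have D3: "disc_alg D3" unfolding D3_def using D f(2) a(2) ne
   by (intro disc_alg_divide disc_alg_add disc_alg_mult disc_alg_diff disc_alg_const disc_alg_ident) auto
  have D3f: "D3 \<xi> = (\<xi> - cnj a) * cnj (f \<xi>)" if z: "norm \<xi> = 1" for \<xi>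
  proof -
   have "cnj (snd (h \<xi>) $ l - stat_pert A B \<rho> (h \<xi>) l) = cnj (f \<xi>) - f2 l \<xi>"
    unfolding ff[OF z] f_def by simp
   then have "D \<xi> / of_real \<kappa> = (\<xi> - cnj a) * (1 - a * \<xi>) * (cnj (f \<xi>) - f2 l \<xi>)"
    using DG[OF z] Gf[of \<xi>] z a(2) by simp
   then have "D \<xi> / of_real \<kappa> + (\<xi> - cnj a) * (1 - a * \<xi>) * f2 l \<xi> = (\<xi> - cnj a) * cnj (f \<xi>) * (1 - a * \<xi>)"
    by (simp add: algebra_simps)
   then show ?thesis unfolding D3_def using ne[of \<xi>] z by simp
  qed
  \<comment> \<open>On the circle \<xi> times the conjugate of \<xi> - cnj a is 1 - a \<xi>, so
    \<open>F\<close> is \<xi> times the conjugate of \<open>D3\<close> and has only the frequencies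
    0 and 1.\<close>
  define F where "F z = (1 - a * z) * f z" for z
  have F: "disc_alg F" unfolding F_def using f' by (intro disc_alg_mult disc_alg_diff disc_alg_const disc_alg_ident)
  have "F \<xi> = \<xi> * cnj (D3 \<xi>)" if z: "norm \<xi> = 1" for \<xi>
  proof -
   have u: "\<xi> * cnj \<xi> = 1" using z by (simp add: complex_norm_square[symmetric])
   have "\<xi> * cnj (D3 \<xi>) = (\<xi> * cnj \<xi> - a * \<xi>) * f \<xi>" unfolding D3f[OF z] by (simp add: algebra_simps)
   then show ?thesis unfolding u F_def by simp
  qed
  then obtain w where w: "\<And>z. norm z \<le> 1 \<Longrightarrow> F z = F 0 + w * z" using disc_alg_times_cnj[OF F D3] by blast
  have "snd (h z) $ l = F 0 + (w + a * F 0) * (z / (1 - a * z)) + f1 l z" if z: "norm z \<le> 1" for z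
  proof -
   have "f z = (F 0 + w * z) / (1 - a * z)" using w[OF z] ne[OF z] by (simp add: F_def field_simps)
   also have "\<dots> = F 0 + (w + a * F 0) * (z / (1 - a * z))" using ne[OF z] by (simp add: field_simps)
   finally show ?thesis by (simp add: f_def algebra_simps)
  qed
  then show ?thesis by blast
 qed
 then obtain v w where "\<And>l. \<forall>z. norm z \<le> 1 \<longrightarrow> snd (h z) $ l = v l + w l * (z / (1 - a * z)) + f1 l z" by metis
 then show ?thesis using that[of a "\<chi> l. v l" "\<chi> l. w l"] a(1) by simp
qed

text \<open>The multiplier is dictated by the necessary form: \<open>c * p\<close> has to be \<xi>
  \<mapsto> |1 - a \<xi>|^2, because \<xi> |1 - a \<xi>|^2 = (\<xi> - cnj a)(1 - a \<xi>) on the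
  circle. The remaining work is to exhibit the holomorphic extension of the lift.\<close>

lemma form_imp_stationary:
 fixes F :: "complex \<Rightarrow> 'n::finite cpoint" and A B :: "complex ^ 'n ^ 'n"
 assumes AB: "A ** B = mat 1" and F: "holomorphic_disc F" and FS: "F ` sphere 0 1 \<subseteq> zero_hypersurface S \<rho>"
  and reg: "\<And>z. z \<in> zero_hypersurface S \<rho> \<Longrightarrow> \<D> \<rho> (at z) \<noteq> (\<lambda>_. 0)"
  and cont: "continuous_on (sphere 0 1) (\<lambda>\<xi>. fst (del \<rho> (F \<xi>)))"
  and k: "disc_alg k" and p: "\<And>\<xi>. norm \<xi> = 1 \<Longrightarrow> p \<xi> \<noteq> (0::real)"
  and pk: "\<And>\<xi>. norm \<xi> = 1 \<Longrightarrow> 2 * fst (del \<rho> (F \<xi>)) = of_real (p \<xi>) * exp (k \<xi>)"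
  and m: "\<And>i. disc_alg (m i)" and a: "norm a < 1"
  and form: "\<And>i \<xi>. norm \<xi> = 1 \<Longrightarrow> snd (F \<xi>) $ i - stat_pert A B \<rho> (F \<xi>) i = v $ i + w $ i * (\<xi> / (1 - a * \<xi>)) - cnj (m i \<xi>)"
 shows "stationary_disc S \<rho> F"
proof -
 have BA: "B ** A = mat 1" using AB by (simp add: matrix_left_right_inverse)
 have ne: "1 - a * z \<noteq> 0" if "norm z \<le> 1" for z using one_minus_mult_ne[OF a that] .
 define c where "c \<xi> = (norm (1 - a * \<xi>))\<^sup>2 / p \<xi>" for \<xi>
 have pe: "of_real (p \<xi>) = 2 * fst (del \<rho> (F \<xi>)) * exp (- k \<xi>)" if z: "norm \<xi> = 1" for \<xi>
  unfolding pk[OF z] by (simp add: mult.assoc exp_minus_inverse)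
 have "continuous_on (sphere 0 1) (\<lambda>\<xi>. Re (2 * fst (del \<rho> (F \<xi>)) * exp (- k \<xi>)))"
  using cont continuous_on_subset[of "cball 0 1" k "sphere 0 1"] k
  by (intro continuous_on_Re continuous_on_mult continuous_on_const continuous_on_exp continuous_on_minus) (auto simp: disc_alg_def)
 moreover have "Re (2 * fst (del \<rho> (F \<xi>)) * exp (- k \<xi>)) = p \<xi>" if "\<xi> \<in> sphere 0 1" for \<xi>
  using arg_cong[OF pe[of \<xi>], of Re] that by (simp only: Re_complex_of_real mem_sphere_0)
 ultimately have pc: "continuous_on (sphere 0 1) p" by (rule continuous_on_eq)
 have cc: "continuous_on (sphere 0 1) c" unfolding c_def using pc p by (intro continuous_intros) auto
 have c0: "c \<xi> \<noteq> 0" if "norm \<xi> = 1" for \<xi> using ne[of \<xi>] p[OF that] that by (simp add: c_def)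
 have zc: "\<xi> * of_real (c \<xi>) * (2 * fst (del \<rho> (F \<xi>))) = exp (k \<xi>) * ((\<xi> - cnj a) * (1 - a * \<xi>))" if z: "norm \<xi> = 1" for \<xi>
 proof -
  have u: "\<xi> * cnj \<xi> = 1" using z by (simp add: complex_norm_square[symmetric])
  have "of_real ((norm (1 - a * \<xi>))\<^sup>2) = (1 - a * \<xi>) * cnj (1 - a * \<xi>)" by (rule complex_norm_square)
  then have "\<xi> * of_real ((norm (1 - a * \<xi>))\<^sup>2) = \<xi> * ((1 - a * \<xi>) * cnj (1 - a * \<xi>))" by (simp only:)
  also have "\<dots> = (\<xi> - cnj a * (\<xi> * cnj \<xi>)) * (1 - a * \<xi>)" by (simp add: algebra_simps)
  finally have "\<xi> * of_real ((norm (1 - a * \<xi>))\<^sup>2) = (\<xi> - cnj a * (\<xi> * cnj \<xi>)) * (1 - a * \<xi>)" .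
  then have "\<xi> * of_real ((norm (1 - a * \<xi>))\<^sup>2) = (\<xi> - cnj a) * (1 - a * \<xi>)" unfolding u by simp
  moreover have "\<xi> * of_real (c \<xi>) * (2 * fst (del \<rho> (F \<xi>))) = \<xi> * of_real ((norm (1 - a * \<xi>))\<^sup>2) * exp (k \<xi>)"
   unfolding pk[OF z] using p[OF z] by (simp add: c_def)
  ultimately show ?thesis by simp
 qed
 \<comment> \<open>The conjugate of \<xi> / (1 - a \<xi>) equals 1 / (\<xi> - cnj a) on the circle;
   its pole in the disc is cancelled by the factor \<xi> - cnj a, leaving the summand
   \<open>cnj (w $ i)\<close>.\<close>
 define g where "g z = (exp (k z) * ((z - cnj a) * (1 - a * z)) / 2,
   \<chi> j. - exp (k z) * (1 - a * z) * (\<Sum>i\<in>UNIV. ((z - cnj a) * (cnj (v $ i) - m i z) + cnj (w $ i)) * A $ i $ j))" for z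
 have g: "holomorphic_disc g" unfolding holomorphic_disc_iff g_def fst_conv snd_conv vec_lambda_beta
  using k m by (intro conjI allI disc_alg_divide disc_alg_mult disc_alg_minus disc_alg_exp disc_alg_diff disc_alg_add disc_alg_sum
   disc_alg_const disc_alg_ident) auto
 have gc: "g \<xi> = (\<xi> * of_real (c \<xi>) * fst (del \<rho> (F \<xi>)), (\<xi> * of_real (c \<xi>)) *s snd (del \<rho> (F \<xi>)))" if z: "norm \<xi> = 1" for \<xi>
 proof -
  have u: "cnj \<xi> * \<xi> = 1" using z by (simp add: complex_norm_square[symmetric] mult.commute)
  have r0: "fst (del \<rho> (F \<xi>)) \<noteq> 0" using pk[OF z] p[OF z] by auto
  have 1: "fst (g \<xi>) = \<xi> * of_real (c \<xi>) * fst (del \<rho> (F \<xi>))" unfolding g_def fst_conv zc[OF z, symmetric] by simp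
  have 2: "snd (g \<xi>) $ j = \<xi> * of_real (c \<xi>) * snd (del \<rho> (F \<xi>)) $ j" for j
  proof -
   define x where "x i = cnj (snd (F \<xi>) $ i) - cnj (stat_pert A B \<rho> (F \<xi>) i)" for i
   have "cov A (F \<xi>) j - stat_err A \<rho> (F \<xi>) j = (\<Sum>i\<in>UNIV. x i * A $ i $ j)"
   proof -
    have "stat_err A \<rho> (F \<xi>) j = (\<Sum>i\<in>UNIV. (\<Sum>l\<in>UNIV. stat_err A \<rho> (F \<xi>) l * B $ l $ i) * A $ i $ j)"
     by (rule matrix_inverse_contract[OF BA, symmetric])
    also have "\<dots> = (\<Sum>i\<in>UNIV. cnj (stat_pert A B \<rho> (F \<xi>) i) * A $ i $ j)" unfolding stat_pert_def complex_cnj_cnj ..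
    finally show ?thesis by (simp add: cov_def x_def sum_subtractf left_diff_distrib)
   qed
   moreover have "snd (del \<rho> (F \<xi>)) $ j = - (2 * fst (del \<rho> (F \<xi>))) * (cov A (F \<xi>) j - stat_err A \<rho> (F \<xi>) j)"
    using r0 by (simp add: stat_err_def)
   ultimately have "\<xi> * of_real (c \<xi>) * snd (del \<rho> (F \<xi>)) $ j =
     - (\<xi> * of_real (c \<xi>) * (2 * fst (del \<rho> (F \<xi>)))) * (\<Sum>i\<in>UNIV. x i * A $ i $ j)" by simp
   also have "\<dots> = - exp (k \<xi>) * (1 - a * \<xi>) * (\<Sum>i\<in>UNIV. ((\<xi> - cnj a) * x i) * A $ i $ j)"
   proof -
    have "(\<Sum>i\<in>UNIV. ((\<xi> - cnj a) * x i) * A $ i $ j) = (\<xi> - cnj a) * (\<Sum>i\<in>UNIV. x i * A $ i $ j)"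
     by (simp add: sum_distrib_left mult.assoc)
    then show ?thesis unfolding zc[OF z] by (simp add: mult_ac)
   qed
   also have "(\<lambda>i. (\<xi> - cnj a) * x i) = (\<lambda>i. (\<xi> - cnj a) * (cnj (v $ i) - m i \<xi>) + cnj (w $ i))"
   proof
    fix i
    have nz: "cnj (1 - a * \<xi>) \<noteq> 0" using ne[of \<xi>] z by (simp del: complex_cnj_diff complex_cnj_mult)
    have "cnj (1 - a * \<xi>) = cnj \<xi> * (\<xi> - cnj a)" using u by (simp add: algebra_simps)
    define Q where "Q = cnj \<xi> / cnj (1 - a * \<xi>)"
    have "(\<xi> - cnj a) * cnj \<xi> = cnj (1 - a * \<xi>)" using \<open>cnj (1 - a * \<xi>) = cnj \<xi> * (\<xi> - cnj a)\<close> by (simp only: mult.commute)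
    then have Q1: "(\<xi> - cnj a) * Q = 1" unfolding Q_def times_divide_eq_right using nz by simp
    have xi: "x i = cnj (v $ i) + cnj (w $ i) * Q - m i \<xi>"
     using arg_cong[OF form[OF z, of i], of cnj] by (simp add: x_def Q_def)
    have "(\<xi> - cnj a) * x i = (\<xi> - cnj a) * (cnj (v $ i) - m i \<xi>) + cnj (w $ i) * ((\<xi> - cnj a) * Q)"
     unfolding xi by (simp add: algebra_simps)
    then show "(\<xi> - cnj a) * x i = (\<xi> - cnj a) * (cnj (v $ i) - m i \<xi>) + cnj (w $ i)" unfolding Q1 by simp
   qed
   finally show ?thesis by (simp add: g_def)
  qed
  show ?thesis using 1 2 by (simp add: prod_eq_iff vec_eq_iff)
 qed
 show ?thesis unfolding stationary_disc_def
  using reg F FS cc c0 g gc by (intro conjI ballI exI[of _ c] exI[of _ g]) auto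
qed

text \<open>The values of \<open>u\<close> stay in a disc around 1 on which the principal logarithm
  is holomorphic and Lipschitz, so L = Ln u is Hoelder. A holomorphic \<open>k\<close> with Im k =
  Im L on the circle comes from the Schwarz operator, and L - k is then real.\<close>

lemma exists_conjugate_exponent:
 assumes \<alpha>: "0 < \<alpha>" "\<alpha> < 1" and u: "u \<in> \<H> \<alpha>" and u1: "\<And>\<xi>. norm \<xi> = 1 \<Longrightarrow> norm (u \<xi> - 1) < 1 / 2"
 obtains k p where "disc_alg k" "\<And>\<xi>. norm \<xi> = 1 \<Longrightarrow> p \<xi> > (0::real)" "\<And>\<xi>. norm \<xi> = 1 \<Longrightarrow> u \<xi> = of_real (p \<xi>) * exp (k \<xi>)"
proof -
 have pos: "Re x > 1 / 2" if "norm (x - 1) < 1 / 2" for x :: complex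
  using abs_Re_le_cmod[of "x - 1"] that by auto
 have nR: "x \<notin> \<real>\<^sub>\<le>\<^sub>0" if "x \<in> ball 1 (1/2)" for x :: complex
  using pos[of x] that by (auto simp: complex_nonpos_Reals_iff dist_norm norm_minus_commute)
 have lip: "norm (Ln x - Ln y) \<le> 2 * norm (x - y)" if "x \<in> ball 1 (1/2)" "y \<in> ball 1 (1/2)" for x y :: complex
 proof (rule field_differentiable_bound[OF convex_ball _ _ that])
  fix z :: complex assume z: "z \<in> ball 1 (1/2)"
  then show "(Ln has_field_derivative inverse z) (at z within ball 1 (1/2))"
   using nR[OF z] by (intro has_field_derivative_Ln has_field_derivative_at_within)
  have "1 / 2 < norm z" using pos[of z] z complex_Re_le_cmod[of z] by (auto simp: dist_norm norm_minus_commute)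
  then have "inverse (norm z) \<le> inverse (1 / 2)" by (intro le_imp_inverse_le) auto
  then show "norm (inverse z) \<le> 2" by (simp only: norm_inverse) simp
 qed
 have ub: "u \<xi> \<in> ball 1 (1/2)" if "norm \<xi> = 1" for \<xi> using u1[OF that] by (simp add: dist_norm norm_minus_commute)
 define L where "L \<xi> = Ln (u \<xi>)" for \<xi>
 have L: "L \<in> \<H> \<alpha>"
 proof (rule holderI(1)[OF \<alpha>(1)])
  show "0 \<le> 2 * \<N> \<alpha> u" using holderD(1)[OF \<alpha>(1) u] by simp
  show "norm (L \<xi>) \<le> 2 * (1 / 2)" if "\<xi> \<in> sphere 0 1" for \<xi>
  proof -
   have "norm (Ln (u \<xi>) - Ln 1) \<le> 2 * norm (u \<xi> - 1)" using ub that by (intro lip) auto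
   also have "\<dots> \<le> 2 * (1 / 2)" using u1[of \<xi>] that by simp
   finally show ?thesis by (simp add: L_def)
  qed
  show "norm (L \<xi> - L \<eta>) \<le> 2 * \<N> \<alpha> u * dist \<xi> \<eta> powr \<alpha>" if "\<xi> \<in> sphere 0 1" "\<eta> \<in> sphere 0 1" for \<xi> \<eta>
  proof -
   have "norm (L \<xi> - L \<eta>) \<le> 2 * norm (u \<xi> - u \<eta>)" unfolding L_def using ub that by (intro lip) auto
   then show ?thesis using holderD(3)[OF \<alpha>(1) u that] by simp
  qed
 qed
 have "(\<lambda>\<xi>. - \<i> * L \<xi>) \<in> \<H> \<alpha>"
  by (rule holder_compose_bounded_linear(1)[OF \<alpha>(1) L, of "\<lambda>x. - \<i> * x" 1]) (auto simp: linear_iff norm_mult algebra_simps)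
 \<comment> \<open>The scalar Schwarz operator is the first component of \<open>stat_op\<close>,
   used here with a zero vector part of dimension one; the real part of -\<i> L is Im L.\<close>
 then have V: "(\<lambda>\<xi>. (- \<i> * L \<xi>, \<chi> j. 0) :: 1 cpoint) \<in> \<H> \<alpha>"
  using seminormedD(8)[OF seminormed_holder[OF \<alpha>(1), where 'b=complex]]
  by (intro holder_pair[OF \<alpha>(1)]) (auto simp: zero_fun_def)
 define k where "k z = \<i> * fst (stat_op (\<lambda>\<xi>. (- \<i> * L \<xi>, \<chi> j. 0) :: 1 cpoint) z)" for z
 have k: "disc_alg k" unfolding k_def using stat_op_holomorphic[OF \<alpha> V] by (auto simp: holomorphic_disc_iff)
 have Imk: "Im (k \<xi>) = Im (L \<xi>)" if "norm \<xi> = 1" for \<xi> using stat_op_Re[OF \<alpha> V that] by (simp add: k_def)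
 have "u \<xi> = of_real (exp (Re (L \<xi> - k \<xi>))) * exp (k \<xi>)" if z: "norm \<xi> = 1" for \<xi>
 proof -
  have "u \<xi> \<noteq> 0" using pos[OF u1[OF z]] by auto
  then have "u \<xi> = exp ((L \<xi> - k \<xi>) + k \<xi>)" by (simp add: L_def)
  also have "\<dots> = exp (L \<xi> - k \<xi>) * exp (k \<xi>)" by (rule exp_add)
  also have "L \<xi> - k \<xi> = of_real (Re (L \<xi> - k \<xi>))" using Imk[OF z] by (simp add: complex_eq_iff)
  finally show ?thesis by (simp only: exp_of_real)
 qed
 then show ?thesis using that[of k "\<lambda>\<xi>. exp (Re (L \<xi> - k \<xi>))"] k by simp
qed

subsection \<open>A criterion for local diffeomorphisms\<close>

lemma C1_map_UNIV_has_derivative: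
 fixes f :: "'e::euclidean_space \<Rightarrow> 'b::real_normed_vector"
 assumes U: "open U" and x: "x \<in> U" and D: "linear D"
  and d: "\<And>e. e > 0 \<Longrightarrow> \<exists>d>0. \<forall>y\<in>U. norm (y - x) < d \<longrightarrow> norm (f y - f x - D (y - x)) \<le> e * norm (y - x)"
 shows "(f has_derivative D) (at x)"
 unfolding has_derivative_at_alt
proof (intro conjI allI impI)
 show "bounded_linear D" using D by (rule linear_conv_bounded_linear[THEN iffD1])
 fix e :: real assume "0 < e"
 then obtain d1 where d1: "d1 > 0" "\<forall>y\<in>U. norm (y - x) < d1 \<longrightarrow> norm (f y - f x - D (y - x)) \<le> e * norm (y - x)"
  using d by blast
 obtain d2 where d2: "d2 > 0" "ball x d2 \<subseteq> U" using U x open_contains_ball by blast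
 show "\<exists>d>0. \<forall>y. norm (y - x) < d \<longrightarrow> norm (f y - f x - D (y - x)) \<le> e * norm (y - x)"
 proof (intro exI[of _ "min d1 d2"] conjI allI impI)
  fix y assume y: "norm (y - x) < min d1 d2"
  then have "y \<in> U" using d2 by (auto simp: dist_norm norm_minus_commute subset_eq)
  then show "norm (f y - f x - D (y - x)) \<le> e * norm (y - x)" using d1 y by simp
 qed (use d1 d2 in auto)
qed

text \<open>No manifold structure of the slice {\<beta> = b0} is presupposed. The lower bound makes
  t \<mapsto> (\<beta>, \<phi>)(F t) an immersion with Lipschitz inverse on its image; a linear left
  inverse L of its derivative gives a local C1 inverse defined on an open set, which restricts to
  the slice. \<open>B\<close> and \<Phi> are linear functionals on the whole of \<open>X\<close>
  that agree with \<beta> and \<phi> on the family, as is necessary when \<beta> and \<phi> refer to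
  interior values.\<close>

lemma local_diffeo_criterion:
 fixes F :: "'e::euclidean_space \<Rightarrow> 'a::real_vector" and \<beta> B :: "'a \<Rightarrow> 'b::euclidean_space"
  and \<phi> \<Phi> :: "'a \<Rightarrow> 'c::euclidean_space"
 assumes sX: "seminormed X nX" and U: "open U" and F: "C1_map UNIV norm U X nX F"
  and Badd: "\<And>x y. x \<in> X \<Longrightarrow> y \<in> X \<Longrightarrow> B (x + y) = B x + B y"
  and Bscale: "\<And>r x. x \<in> X \<Longrightarrow> B (r *\<^sub>R x) = r *\<^sub>R B x"
  and Bbd: "\<And>x. x \<in> X \<Longrightarrow> norm (B x) \<le> KB * nX x"
  and Beq: "\<And>t. t \<in> U \<Longrightarrow> B (F t) = \<beta> (F t)"
  and Padd: "\<And>x y. x \<in> X \<Longrightarrow> y \<in> X \<Longrightarrow> \<Phi> (x + y) = \<Phi> x + \<Phi> y"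
  and Pscale: "\<And>r x. x \<in> X \<Longrightarrow> \<Phi> (r *\<^sub>R x) = r *\<^sub>R \<Phi> x"
  and Pbd: "\<And>x. x \<in> X \<Longrightarrow> norm (\<Phi> x) \<le> KP * nX x"
  and Peq: "\<And>t. t \<in> U \<Longrightarrow> \<Phi> (F t) = \<phi> (F t)"
  and c: "0 < c" and low: "\<And>s t. s \<in> U \<Longrightarrow> t \<in> U \<Longrightarrow>
   c * norm (s - t) \<le> norm (\<beta> (F s) - \<beta> (F t)) + norm (\<phi> (F s) - \<phi> (F t))"
 shows "local_diffeo_onto_image X nX {h \<in> F ` U. \<beta> h = b0} \<phi>"
 unfolding local_diffeo_onto_image_def
proof (intro ballI)
 note DX = seminormedD[OF sX]
 note sE = seminormed_norm[where 'a='e] and sBC = seminormed_norm[where 'a="'b \<times> 'c"] and sC = seminormed_norm[where 'a='c]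
 have FX: "F t \<in> X" if "t \<in> U" for t using F that unfolding C1_map_def by auto
 define T where "T h = (B h, \<Phi> h)" for h
 define f where "f t = T (F t)" for t
 define KT where "KT = \<bar>KB\<bar> + \<bar>KP\<bar>"
 have KT: "0 \<le> KT" by (simp add: KT_def)
 have Tadd: "T (x + y) = T x + T y" if "x \<in> X" "y \<in> X" for x y using that Badd Padd by (simp add: T_def)
 have Tscale: "T (r *\<^sub>R x) = r *\<^sub>R T x" if "x \<in> X" for r x using that Bscale Pscale by (simp add: T_def)
 have Tbd: "norm (T x) \<le> KT * nX x" if x: "x \<in> X" for x
 proof -
  have "norm (T x) \<le> norm (B x) + norm (\<Phi> x)" unfolding T_def by (rule norm_Pair_le)
  also have "\<dots> \<le> KB * nX x + KP * nX x" using Bbd[OF x] Pbd[OF x] by (rule add_mono)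
  also have "\<dots> \<le> \<bar>KB\<bar> * nX x + \<bar>KP\<bar> * nX x" using DX(2)[OF x] by (intro add_mono mult_right_mono) auto
  finally show ?thesis by (simp add: KT_def distrib_right)
 qed
 have Tdiff: "T x - T y = T (x - y)" if "x \<in> X" "y \<in> X" for x y
  using Tadd[OF DX(6)[OF that] that(2)] by simp
 have TC1: "C1_map X nX X UNIV norm T"
  by (rule C1_map_linear_on[OF sX sBC subset_refl Tadd Tscale _ Tbd]) auto
 have fC1: "C1_map UNIV norm U UNIV norm f"
  unfolding f_def by (rule C1_map_compose[OF sE sX sBC subset_UNIV subset_refl F TC1]) (rule FX)
 obtain Df where "C1_derivative UNIV norm U UNIV norm f Df" using fC1 unfolding C1_map_iff by (rule exE)
 note Df = C1_derivativeD[OF this]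
 have fder: "(f has_derivative Df x) (at x)" if "x \<in> U" for x
  by (rule C1_map_UNIV_has_derivative[OF U that Df(2)[OF that] Df(5)[OF that]])
 have flow: "c * norm (s - t) \<le> 2 * norm (f s - f t)" if "s \<in> U" "t \<in> U" for s t
 proof -
  have "norm (\<beta> (F s) - \<beta> (F t)) \<le> norm (f s - f t)" "norm (\<phi> (F s) - \<phi> (F t)) \<le> norm (f s - f t)"
   using norm_fst_le[of "\<beta> (F s) - \<beta> (F t)" "\<phi> (F s) - \<phi> (F t)"]
    norm_snd_le[of "\<phi> (F s) - \<phi> (F t)" "\<beta> (F s) - \<beta> (F t)"]
    that Beq Peq by (simp_all add: f_def T_def)
  then show ?thesis using low[OF that] by linarith
 qed
 let ?S = "{h \<in> F ` U. \<beta> h = b0}"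
 fix g0 assume "g0 \<in> ?S"
 then obtain s0 where s0: "s0 \<in> U" "g0 = F s0" "\<beta> (F s0) = b0" by auto
 \<comment> \<open>Along a kernel vector f would move by little compared with the step, which
   contradicts \<open>flow\<close>.\<close>
 have inj: "inj (Df s0)"
 proof (rule linear_injective_0[OF Df(2)[OF s0(1)], THEN iffD2], intro allI impI, rule ccontr)
  fix u assume u: "Df s0 u = 0" "u \<noteq> 0"
  obtain d1 where d1: "d1 > 0" "\<forall>y\<in>U. norm (y - s0) < d1 \<longrightarrow> norm (f y - f s0 - Df s0 (y - s0)) \<le> c / 4 * norm (y - s0)"
   using Df(5)[OF s0(1), of "c / 4"] c by auto
  obtain d2 where d2: "d2 > 0" "ball s0 d2 \<subseteq> U" using U s0(1) open_contains_ball by blast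
  define \<tau> where "\<tau> = min d1 d2 / (2 * norm u)"
  have \<tau>: "\<tau> > 0" using d1 d2 u by (simp add: \<tau>_def)
  have n: "norm (\<tau> *\<^sub>R u) = min d1 d2 / 2" using u d1(1) d2(1) by (simp add: \<tau>_def)
  have "norm (\<tau> *\<^sub>R u) < min d1 d2" unfolding n using d1(1) d2(1) by (cases "d1 \<le> d2") auto
  then have y: "s0 + \<tau> *\<^sub>R u \<in> U" "norm (s0 + \<tau> *\<^sub>R u - s0) < d1" using d2(2) by (auto simp: dist_norm subset_eq)
  have "norm (f (s0 + \<tau> *\<^sub>R u) - f s0) \<le> c / 4 * norm (\<tau> *\<^sub>R u)"
   using d1(2)[rule_format, OF y] u(1) by (simp add: linear_scale[OF Df(2)[OF s0(1)]])
  moreover have "c * norm (\<tau> *\<^sub>R u) \<le> 2 * norm (f (s0 + \<tau> *\<^sub>R u) - f s0)" using flow[OF y(1) s0(1)] by simp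
  ultimately have "c * norm (\<tau> *\<^sub>R u) \<le> c * norm (\<tau> *\<^sub>R u) / 2" by simp
  then show False using c \<tau> u(2) by simp
 qed
 \<comment> \<open>The left inverse projects the possibly larger target space to the parameter
   space, so that \<open>G = L \<circ> f\<close> below has derivative the identity at
   \<open>s0\<close>.\<close>
 obtain L where L: "linear L" "L \<circ> Df s0 = id" using linear_injective_left_inverse[OF Df(2)[OF s0(1)] inj] by blast
 have L0: "L (Df s0 u) = u" for u using fun_cong[OF L(2), of u] by simp
 have bL: "bounded_linear L" using L(1) by (rule linear_conv_bounded_linear[THEN iffD1])
 obtain KL where KL: "KL > 0" "\<And>x. norm (L x) \<le> norm x * KL" using bounded_linear.pos_bounded[OF bL] by blast
 obtain d1 where d1: "d1 > 0" "\<forall>y\<in>U. norm (y - s0) < d1 \<longrightarrow> (\<forall>u\<in>UNIV. norm (Df y u - Df s0 u) \<le> 1 / (2 * KL) * norm u)"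
  using Df(6)[OF s0(1), of "1 / (2 * KL)"] KL by auto
 obtain d2 where d2: "d2 > 0" "ball s0 d2 \<subseteq> U" using U s0(1) open_contains_ball by blast
 define d where "d = min d1 d2"
 have d: "d > 0" using d1 d2 by (simp add: d_def)
 define \<Omega> where "\<Omega> = ball s0 d"
 have OU: "\<Omega> \<subseteq> U" using d2 by (auto simp: \<Omega>_def d_def subset_eq)
 define G where "G s = L (f s)" for s
 define \<Theta> where "\<Theta> s = s - G s" for s
 have Thder: "(\<Theta> has_derivative (\<lambda>u. u - L (Df s u))) (at s)" if "s \<in> \<Omega>" for s
  unfolding \<Theta>_def G_def using fder OU that
  by (intro has_derivative_diff has_derivative_ident bounded_linear.has_derivative[OF bL]) auto
 have lip: "norm (\<Theta> x - \<Theta> y) \<le> norm (x - y) / 2" if xy: "x \<in> \<Omega>" "y \<in> \<Omega>" for x y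
 proof -
  have "norm (\<Theta> x - \<Theta> y) \<le> 1 / 2 * norm (x - y)"
  proof (rule differentiable_bound[of \<Omega> \<Theta> "\<lambda>s u. u - L (Df s u)"])
   show "convex \<Omega>" by (simp add: \<Omega>_def)
   fix s assume s: "s \<in> \<Omega>"
   show "(\<Theta> has_derivative (\<lambda>u. u - L (Df s u))) (at s within \<Omega>)" using Thder[OF s] by (rule has_derivative_at_withinI)
   show "onorm (\<lambda>u. u - L (Df s u)) \<le> 1 / 2"
   proof (rule onorm_le)
    fix u
    have sd: "s \<in> U" "norm (s - s0) < d1" using s OU by (auto simp: \<Omega>_def d_def dist_norm norm_minus_commute)
    have "u - L (Df s u) = - L (Df s u - Df s0 u)" by (simp add: linear_diff[OF L(1)] L0)
    then have "norm (u - L (Df s u)) \<le> norm (Df s u - Df s0 u) * KL" using KL(2) by simp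
    also have "\<dots> \<le> (1 / (2 * KL) * norm u) * KL" using d1(2)[rule_format, OF sd, of u] KL(1) by (intro mult_right_mono) auto
    finally show "norm (u - L (Df s u)) \<le> 1 / 2 * norm u" using KL(1) by simp
   qed
  qed (use xy in auto)
  then show ?thesis by simp
 qed
 have Ginj: "inj_on G \<Omega>"
 proof (rule inj_onI)
  fix x y assume xy: "x \<in> \<Omega>" "y \<in> \<Omega>" "G x = G y"
  then have "norm (x - y) \<le> norm (x - y) / 2" using lip[OF xy(1,2)] by (simp add: \<Theta>_def)
  then show "x = y" by simp
 qed
 define W where "W = G ` \<Omega>"
 \<comment> \<open>Openness comes from invariance of domain. That the inverse \<open>gi\<close> is
   C1 comes from \<open>C1_map_fixed_point\<close>, since s = \<open>gi l\<close> solves s = l +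
   \<Theta> s.\<close>
 have W: "open W" unfolding W_def
 proof (rule invariance_of_domain[OF _ _ Ginj])
  show "open \<Omega>" by (simp add: \<Omega>_def)
  have "continuous_on \<Omega> f" using fder OU
   by (intro continuous_at_imp_continuous_on) (auto intro!: has_derivative_continuous)
  then show "continuous_on \<Omega> G" unfolding G_def by (rule bounded_linear.continuous_on[OF bL])
 qed
 define gi where "gi = inv_into \<Omega> G"
 have gi: "gi l \<in> \<Omega>" "G (gi l) = l" if "l \<in> W" for l
  using that inv_into_into[of l G \<Omega>] f_inv_into_f[of l G \<Omega>] by (auto simp: W_def gi_def)
 have giG: "gi (G s) = s" if "s \<in> \<Omega>" for s unfolding gi_def by (rule inv_into_f_f[OF Ginj that])
 have idC1: "C1_map UNIV norm V UNIV norm (\<lambda>x. x)" for V :: "'e set"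
  by (rule C1_map_linear_on[OF sE sE subset_UNIV, where K=1]) auto
 have mLC1: "C1_map UNIV norm UNIV UNIV norm (\<lambda>x. - L x)"
  by (rule C1_map_linear_on[OF sBC sE subset_refl, where K=KL]) (simp_all only: linear_add[OF L(1)] linear_scale[OF L(1)] KL(2) mult.commute[of KL] norm_minus_cancel
    UNIV_I minus_add_distrib scaleR_minus_right add.commute)
 have "C1_map UNIV norm \<Omega> UNIV norm (\<lambda>s. s + - L (f s))"
  by (rule C1_map_linear_add[OF sE sE subset_UNIV C1_map_compose[OF sE sBC sE subset_UNIV subset_UNIV C1_map_subset[OF fC1 OU] mLC1], where K=1]) auto
 then have ThC1: "C1_map UNIV norm \<Omega> UNIV norm \<Theta>" by (simp add: \<Theta>_def[abs_def] G_def)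
 have giC1: "C1_map UNIV norm W UNIV norm gi"
 proof (rule C1_map_fixed_point[OF sE seminorm_complete_norm idC1 ThC1])
  show "\<exists>d>0. \<forall>y\<in>UNIV. norm (y - x) < d \<longrightarrow> y \<in> \<Omega>" if "x \<in> \<Omega>" for x
   using open_ball[of s0 d] that unfolding \<Omega>_def open_dist dist_norm by blast
  show "norm (\<Theta> x - \<Theta> y) \<le> norm (x - y) / 2" if "x \<in> \<Omega>" "y \<in> \<Omega>" for x y using lip that .
  show "gi l \<in> \<Omega> \<and> norm (gi l - (l + \<Theta> (gi l))) = 0" if "l \<in> W" for l using gi[OF that] by (simp add: \<Theta>_def)
 qed auto
 \<comment> \<open>By the lower bound a member \<open>F s\<close> of the family within e of
   \<open>g0\<close> has its parameter within \<open>d\<close> of \<open>s0\<close>; the added 1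
   covers \<open>KT = 0\<close>.\<close>
 define e where "e = c * d / (2 * (KT + 1))"
 have e: "e > 0" using c d KT by (simp add: e_def)
 define N where "N = {g \<in> ?S. nX (g - g0) < e}"
 have Nd: "s \<in> \<Omega>" if s: "s \<in> U" "nX (F s - g0) < e" for s
 proof -
  have "c * norm (s - s0) \<le> 2 * norm (f s - f s0)" using flow[OF s(1) s0(1)] .
  also have "f s - f s0 = T (F s - F s0)" unfolding f_def by (rule Tdiff[OF FX[OF s(1)] FX[OF s0(1)]])
  also have "2 * norm (T (F s - F s0)) \<le> 2 * (KT * nX (F s - F s0))"
   using Tbd[OF DX(6)[OF FX[OF s(1)] FX[OF s0(1)]]] by simp
  also have "\<dots> \<le> 2 * ((KT + 1) * nX (F s - F s0))"
   using DX(2)[OF DX(6)[OF FX[OF s(1)] FX[OF s0(1)]]] by (intro mult_left_mono mult_right_mono) auto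
  also have "\<dots> < 2 * ((KT + 1) * e)" using s(2) s0(2) KT by (intro mult_strict_left_mono) auto
  also have "\<dots> = c * d" using KT by (simp add: e_def field_simps)
  finally have "norm (s - s0) < d" using c by simp
  then show ?thesis by (simp add: \<Omega>_def dist_norm norm_minus_commute)
 qed
 \<comment> \<open>On the slice the term with \<beta> drops out of the lower bound, so parameters
   are controlled by \<phi> alone, and F is locally Lipschitz.\<close>
 have opn: "openin (top_of_set (\<phi> ` ?S)) (\<phi> ` N)"
  unfolding openin_euclidean_subtopology_iff
 proof (intro conjI ballI)
  show "\<phi> ` N \<subseteq> \<phi> ` ?S" by (auto simp: N_def)
  fix y assume "y \<in> \<phi> ` N"
  then obtain s where s: "s \<in> U" "\<beta> (F s) = b0" "nX (F s - g0) < e" "y = \<phi> (F s)" by (auto simp: N_def)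
  obtain C d3 where C: "C > 0" "d3 > 0" "\<forall>t\<in>U. norm (t - s) < d3 \<longrightarrow> nX (F t - F s) \<le> C * norm (t - s)"
   using C1_map_locally_Lipschitz[OF sE sX subset_UNIV F s(1)] by blast
  define \<eta> where "\<eta> = c * min d3 ((e - nX (F s - g0)) / C)"
  have \<eta>: "\<eta> > 0" using c C s(3) by (simp add: \<eta>_def)
  have "y' \<in> \<phi> ` N" if "y' \<in> \<phi> ` ?S" "dist y' y < \<eta>" for y'
  proof -
   obtain t where t: "t \<in> U" "\<beta> (F t) = b0" "y' = \<phi> (F t)" using \<open>y' \<in> \<phi> ` ?S\<close> by auto
   have "c * norm (t - s) \<le> norm (y' - y)" using low[OF t(1) s(1)] t s by simp
   also have "\<dots> < \<eta>" using \<open>dist y' y < \<eta>\<close> by (simp add: dist_norm)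
   finally have "norm (t - s) < min d3 ((e - nX (F s - g0)) / C)" using c by (simp add: \<eta>_def)
   then have ts: "norm (t - s) < d3" "norm (t - s) < (e - nX (F s - g0)) / C" by auto
   have "nX (F t - F s) \<le> C * norm (t - s)" using C(3) t(1) ts(1) by blast
   also have "\<dots> < e - nX (F s - g0)" using ts(2) C(1) by (simp add: pos_less_divide_eq mult.commute)
   finally have "nX (F t - F s) + nX (F s - g0) < e" by simp
   moreover have "nX (F t - g0) \<le> nX (F t - F s) + nX (F s - g0)"
    unfolding s0(2) by (rule seminormed_triangle[OF sX FX[OF t(1)] FX[OF s(1)] FX[OF s0(1)]])
   ultimately have "F t \<in> N" using t by (auto simp: N_def)
   then show ?thesis using t(3) by blast
  qed
  then show "\<exists>e>0. \<forall>x'\<in>\<phi> ` ?S. dist x' y < e \<longrightarrow> x' \<in> \<phi> ` N" using \<eta> by blast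
 qed
 have PhiC1: "C1_map X nX {g \<in> X. nX (g - g0) < e} UNIV norm \<Phi>"
  by (rule C1_map_linear_on[OF sX sC _ Padd Pscale _ Pbd]) auto
 have Phi: "\<Phi> g = \<phi> g" if "g \<in> N" for g using that Peq by (auto simp: N_def)
 define A where "A y = L (b0, y)" for y
 define V where "V = {y. A y \<in> W}"
 have AC: "A = (\<lambda>y. L (0, y) + L (b0, 0))" by (auto simp: A_def fun_eq_iff linear_add[OF L(1), symmetric])
 have contA: "continuous_on UNIV A" unfolding A_def by (intro bounded_linear.continuous_on[OF bL] continuous_intros)
 have V: "open V" using open_vimage[OF W contA] by (simp add: V_def vimage_def)
 have AC1: "C1_map UNIV norm V UNIV norm A" unfolding AC
 proof (rule C1_map_linear_add[OF sC sE subset_UNIV C1_map_const[OF sC sE subset_UNIV UNIV_I], where K=KL])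
  show "L (0, x + y) = L (0, x) + L (0, y)" for x y using linear_add[OF L(1), of "(0, x)" "(0, y)"] by simp
  show "L (0, r *\<^sub>R x) = r *\<^sub>R L (0, x)" for r x using linear_scale[OF L(1), of r "(0, x)"] by simp
  show "norm (L (0, x)) \<le> KL * norm x" for x using KL(2)[of "(0, x)"] by (simp add: mult.commute)
 qed auto
 have AV: "A y \<in> W" if "y \<in> V" for y using that by (simp add: V_def)
 have giAC1: "C1_map UNIV norm V UNIV norm (\<lambda>y. gi (A y))"
  by (rule C1_map_compose[OF sC sE sE subset_UNIV subset_UNIV AC1 giC1 AV])
 have PsiC1: "C1_map UNIV norm V X nX (\<lambda>y. F (gi (A y)))"
  by (rule C1_map_compose[OF sC sE sX subset_UNIV subset_UNIV giAC1 F]) (use gi(1)[OF AV] OU in blast)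
 have AN: "\<exists>s\<in>\<Omega>. g = F s \<and> A (\<phi> g) = G s" if g: "g \<in> N" for g
 proof -
  obtain s where s: "s \<in> U" "\<beta> (F s) = b0" "nX (F s - g0) < e" "g = F s" using g by (auto simp: N_def)
  have "A (\<phi> g) = G s" using s Beq Peq by (simp add: A_def G_def f_def T_def)
  then show ?thesis using Nd[OF s(1,3)] s(4) by blast
 qed
 have NV: "\<phi> ` N \<subseteq> V" using AN by (force simp: V_def W_def)
 have PsiN: "nX (F (gi (A (\<phi> g))) - g) = 0" if "g \<in> N" for g
  using AN[OF that] giG seminormed_zero[OF sX] by auto
 show "\<exists>e>0. \<exists>N. N = {g \<in> ?S. nX (g - g0) < e} \<and> openin (top_of_set (\<phi> ` ?S)) (\<phi> ` N) \<and>
    (\<exists>\<Phi>. C1_map X nX {g \<in> X. nX (g - g0) < e} UNIV norm \<Phi> \<and> (\<forall>g\<in>N. \<Phi> g = \<phi> g)) \<and>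
    (\<exists>T \<Psi>. open T \<and> \<phi> ` N \<subseteq> T \<and> C1_map UNIV norm T X nX \<Psi> \<and> (\<forall>g\<in>N. nX (\<Psi> (\<phi> g) - g) = 0))"
  using e opn PhiC1 Phi V NV PsiC1 PsiN
  by (intro exI[of _ e] conjI exI[of _ N] exI[of _ \<Phi>] exI[of _ V] exI[of _ "\<lambda>y. F (gi (A y))"] ballI) (simp_all add: N_def)
qed

subsection \<open>Perturbations of the quadric\<close>

text \<open>The last vector of the list is differentiated along first. Appending at the end
  therefore matches the recursion of \<open>Ck_bounded\<close>, which peels off the innermost
  derivative.\<close>

lemma iter_deriv_append: "iter_deriv f (vs @ ws) = iter_deriv (iter_deriv f ws) vs"
 by (induction vs) auto

text \<open>Membership in a \<open>Ck_ball\<close> compares the iterated derivatives of two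
  functions; linearity of the derivative at each order turns this into a bound for the derivatives
  of the difference.\<close>

lemma Ck_bounded_difference:
 assumes S: "open S" and "Ck_on k g S" "Ck_on k f S"
  and "\<And>vs x. set vs \<subseteq> Basis \<Longrightarrow> length vs \<le> k \<Longrightarrow> x \<in> S \<Longrightarrow> norm (iter_deriv g vs x - iter_deriv f vs x) \<le> \<epsilon>"
 shows "Ck_bounded k \<epsilon> (\<lambda>x. g x - f x) S"
 using assms(2-4)
proof (induction k arbitrary: f g)
 case 0
 then show ?case using "0.prems"(3)[of "[]"] by (auto intro!: continuous_intros)
next
 case (Suc k)
 show ?case
 proof (rule Ck_bounded_SucI[OF S])
  fix x assume x: "x \<in> S"
  show "((\<lambda>x. g x - f x) has_derivative (\<lambda>v. \<D> g (at x) v - \<D> f (at x) v)) (at x)"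
   using Suc.prems x by (intro has_derivative_diff) (auto simp: frechet_derivative_works)
  show "norm (g x - f x) \<le> \<epsilon>" using Suc.prems(3)[of "[]"] x by simp
 next
  fix v :: 'a assume v: "v \<in> Basis"
  show "Ck_bounded k \<epsilon> (\<lambda>x. \<D> g (at x) v - \<D> f (at x) v) S"
  proof (rule Suc.IH)
   fix vs x assume vs: "set vs \<subseteq> (Basis::'a set)" "length vs \<le> k" "x \<in> S"
   have "iter_deriv (\<lambda>x. \<D> h (at x) v) vs = iter_deriv h (vs @ [v])" for h :: "'a \<Rightarrow> 'b"
    by (simp add: iter_deriv_append)
   then show "norm (iter_deriv (\<lambda>x. \<D> g (at x) v) vs x - iter_deriv (\<lambda>x. \<D> f (at x) v) vs x) \<le> \<epsilon>"
    using Suc.prems(3)[of "vs @ [v]" x] vs v by simp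
  qed (use Suc.prems in auto)
 qed
qed

lemma Ck_on_const: "Ck_on k (\<lambda>_. c) S"
 by (induction k arbitrary: c) (auto simp: frechet_derivative_const)

lemma Ck_on_affine: "bounded_linear L \<Longrightarrow> Ck_on k (\<lambda>x. c + L x) S"
proof (cases k)
 case 0
 assume "bounded_linear L"
 then show ?thesis unfolding 0 by (simp only: Ck_on.simps, intro continuous_on_add continuous_on_const linear_continuous_on)
next
 case (Suc l)
 assume L: "bounded_linear L"
 have d: "((\<lambda>x. c + L x) has_derivative L) (at x)" for x
  using has_derivative_add[OF has_derivative_const bounded_linear_imp_has_derivative[OF L]] by simp
 show ?thesis unfolding Suc using d frechet_derivative_at[OF d, symmetric] Ck_on_const
  by (auto intro: differentiableI)
qed

section \<open>The quadric and its derivatives\<close>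

definition qform :: "complex ^ 'n ^ 'n \<Rightarrow> 'n::finite cpoint \<Rightarrow> 'n cpoint \<Rightarrow> real" where
 "qform A x y = Re (\<Sum>i\<in>UNIV. \<Sum>j\<in>UNIV. cnj (snd x $ i) * A $ i $ j * snd y $ j)"

lemma quadric_fun_qform: "quadric_fun A z = Re (fst z) - qform A z z"
 by (simp add: quadric_fun_def qform_def)

lemma bounded_bilinear_qform: "bounded_bilinear (qform A)"
proof -
 have "bilinear (qform A)"
  unfolding bilinear_def linear_iff
  by (auto simp: qform_def distrib_left distrib_right sum.distrib sum_distrib_left scaleR_conv_of_real[where 'a=complex] mult_ac)
 then show ?thesis by (simp add: bilinear_conv_bounded_bilinear)
qed

lemma qform_commute:
 assumes "hermitian_matrix A" shows "qform A x y = qform A y x"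
proof -
 have A: "cnj (A $ i $ j) = A $ j $ i" for i j using assms unfolding hermitian_matrix_def by metis
 have "cnj (\<Sum>i\<in>UNIV. \<Sum>j\<in>UNIV. cnj (snd x $ i) * A $ i $ j * snd y $ j) =
   (\<Sum>i\<in>UNIV. \<Sum>j\<in>UNIV. snd x $ i * A $ j $ i * cnj (snd y $ j))"
  by (simp add: A)
 also have "\<dots> = (\<Sum>j\<in>UNIV. \<Sum>i\<in>UNIV. cnj (snd y $ j) * A $ j $ i * snd x $ i)"
  unfolding sum.swap[of "\<lambda>j i. cnj (snd y $ j) * A $ j $ i * snd x $ i"]
  by (rule sum.cong[OF refl], rule sum.cong[OF refl], simp only: mult_ac)
 finally have "Re (cnj (\<Sum>i\<in>UNIV. \<Sum>j\<in>UNIV. cnj (snd x $ i) * A $ i $ j * snd y $ j)) =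
   Re (\<Sum>j\<in>UNIV. \<Sum>i\<in>UNIV. cnj (snd y $ j) * A $ j $ i * snd x $ i)" by (rule arg_cong)
 then show ?thesis unfolding qform_def cnj.sel(1) .
qed

lemma quadric_fun_has_derivative:
 "(quadric_fun A has_derivative (\<lambda>v. Re (fst v) - (qform A z v + qform A v z))) (at z)"
proof -
 have "((\<lambda>z. qform A z z) has_derivative (\<lambda>v. qform A z v + qform A v z)) (at z)"
  by (rule bounded_bilinear.FDERIV[OF bounded_bilinear_qform has_derivative_ident has_derivative_ident])
 moreover have "((\<lambda>z. Re (fst z)) has_derivative (\<lambda>v. Re (fst v))) (at z)"
  by (intro has_derivative_Re has_derivative_fst has_derivative_ident)
 ultimately have "((\<lambda>z. Re (fst z) - qform A z z) has_derivative (\<lambda>v. Re (fst v) - (qform A z v + qform A v z))) (at z)"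
  by (intro has_derivative_diff)
 then show ?thesis by (simp add: quadric_fun_qform[abs_def])
qed

lemma frechet_derivative_quadric:
 "frechet_derivative (quadric_fun A) (at z) = (\<lambda>v. Re (fst v) - (qform A z v + qform A v z))"
 using frechet_derivative_at[OF quadric_fun_has_derivative, symmetric] .

lemma Ck_on_quadric: "Ck_on (Suc k) (quadric_fun A) S"
proof -
 have "Ck_on k (\<lambda>x. Re (fst v) - (qform A x v + qform A v x)) S" for v
 proof -
  have "bounded_linear (\<lambda>x. - (qform A x v + qform A v x))"
   by (intro bounded_linear_minus bounded_linear_add
     bounded_bilinear.bounded_linear_left[OF bounded_bilinear_qform] bounded_bilinear.bounded_linear_right[OF bounded_bilinear_qform])
  from Ck_on_affine[OF this, of k "Re (fst v)" S] show ?thesis by (simp only: add_uminus_conv_diff)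
 qed
 moreover have "quadric_fun A differentiable (at x)" for x by (rule differentiableI[OF quadric_fun_has_derivative])
 ultimately show ?thesis by (simp add: frechet_derivative_quadric)
qed

lemma qform_axis:
 "qform A (0, axis j x) z = Re (\<Sum>l\<in>UNIV. cnj x * A $ j $ l * snd z $ l)"
 "qform A z (0, axis j x) = Re (cov A z j * x)"
proof -
 have "(\<Sum>i\<in>UNIV. \<Sum>l\<in>UNIV. cnj (axis j x $ i) * A $ i $ l * snd z $ l) = (\<Sum>i\<in>UNIV. if i = j then (\<Sum>l\<in>UNIV. cnj x * A $ j $ l * snd z $ l) else 0)"
  by (intro sum.cong) (auto simp: axis_def)
 then show "qform A (0, axis j x) z = Re (\<Sum>l\<in>UNIV. cnj x * A $ j $ l * snd z $ l)" by (simp add: qform_def)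
 have "(\<Sum>l\<in>UNIV. cnj (snd z $ i) * A $ i $ l * axis j x $ l) = cnj (snd z $ i) * A $ i $ j * x" for i
 proof -
  have "(\<Sum>l\<in>UNIV. cnj (snd z $ i) * A $ i $ l * axis j x $ l) = (\<Sum>l\<in>UNIV. if l = j then cnj (snd z $ i) * A $ i $ j * x else 0)"
   by (intro sum.cong) (auto simp: axis_def)
  then show ?thesis by simp
 qed
 then show "qform A z (0, axis j x) = Re (cov A z j * x)" by (simp add: qform_def cov_def sum_distrib_right)
qed

lemma del_quadric:
 assumes "hermitian_matrix A"
 shows "del (quadric_fun A) z = (1 / 2, \<chi> j. - cov A z j)"
proof -
 have 1: "qform A (a, 0) z = 0" "qform A z (a, 0) = 0" for a z by (simp_all add: qform_def)
 have 2: "of_real (2 * Re x) - \<i> * of_real (2 * Re (x * \<i>)) = 2 * x" for x by (simp add: complex_eq_iff)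
 have "of_real (- (2 * Re (cov A z j))) - \<i> * of_real (- (2 * Re (cov A z j * \<i>))) = - (2 * cov A z j)" for j
  using arg_cong[OF 2[of "cov A z j"], of uminus] by simp
 then show ?thesis
  using qform_axis(2)[of A z] qform_commute[OF assms, of _ z] 1
  by (simp add: del_def Let_def frechet_derivative_quadric vec_eq_iff mult_2[symmetric] del: mult_2)
qed

lemma basis_cpoint:
 "((1, 0) :: 'n::finite cpoint) \<in> Basis" "((\<i>, 0) :: 'n cpoint) \<in> Basis"
 "((0, axis j 1) :: 'n cpoint) \<in> Basis" "((0, axis j \<i>) :: 'n cpoint) \<in> Basis"
 by (auto simp: Basis_prod_def Basis_complex_def axis_in_Basis_iff)

text \<open>The map \<open>P\<^sub>\<rho>\<close>. Where \<rho> vanishes, its first component is the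
  correction in \<open>Re (fst z) = qform A z z + (quadric_fun A z - \<rho> z)\<close>; the others
  are the perturbation of the stationarity condition.\<close>

definition stat_map :: "complex ^ 'n ^ 'n \<Rightarrow> complex ^ 'n ^ 'n \<Rightarrow> ('n::finite cpoint \<Rightarrow> real) \<Rightarrow> 'n cpoint \<Rightarrow> 'n cpoint" where
 "stat_map A B \<rho> z = (of_real (quadric_fun A z - \<rho> z), \<chi> i. stat_pert A B \<rho> z i)"

definition qmap :: "complex ^ 'n ^ 'n \<Rightarrow> 'n::finite cpoint \<Rightarrow> 'n cpoint" where
 "qmap A z = (of_real (qform A z z), 0)"

lemma Ck_bounded_cmult:
 assumes "open S" "Ck_bounded k K f S" shows "Ck_bounded k (norm c * K) (\<lambda>x. c * f x :: complex) S"
 using Ck_bounded_compose_linear[OF assms(1) bounded_linear_mult_right[of c], of "norm c" k K f] assms(2)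
 by (simp add: norm_mult)

lemma Ck_bounded_of_real:
 assumes "open S" "Ck_bounded k K f S" shows "Ck_bounded k K (\<lambda>x. complex_of_real (f x)) S"
 using Ck_bounded_compose_linear[OF assms(1) bounded_linear_of_real[where 'a=complex], of 1 k K f] assms(2) by simp

lemma Ck_bounded_cpoint:
 fixes f :: "'a::euclidean_space \<Rightarrow> complex" and g :: "'n::finite \<Rightarrow> 'a \<Rightarrow> complex"
 assumes S: "open S" and f: "Ck_bounded k K f S" and g: "\<And>j. Ck_bounded k (K' j) (g j) S"
 shows "Ck_bounded k (K + (\<Sum>j\<in>UNIV. K' j)) (\<lambda>x. (f x, \<chi> j. g j x) :: 'n cpoint) S"
proof -
 have l1: "bounded_linear (\<lambda>x. (x, 0) :: 'n cpoint)"
  by (rule linear_conv_bounded_linear[THEN iffD1]) (auto simp: linear_iff)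
 have l2: "bounded_linear (\<lambda>x. (0, axis j x) :: 'n cpoint)" for j
  by (rule linear_conv_bounded_linear[THEN iffD1]) (auto simp: linear_iff axis_def vec_eq_iff)
 have "Ck_bounded k (1 * K + (\<Sum>j\<in>UNIV. 1 * K' j)) (\<lambda>x. (f x, 0) + (\<Sum>j\<in>UNIV. (0, axis j (g j x))) :: 'n cpoint) S"
 proof (intro Ck_bounded_add[OF S] Ck_bounded_sum[OF S])
  show "Ck_bounded k (1 * K) (\<lambda>x. (f x, 0) :: 'n cpoint) S"
   by (rule Ck_bounded_compose_linear[OF S l1 _ _ f]) auto
  show "Ck_bounded k (1 * K' j) (\<lambda>x. (0, axis j (g j x)) :: 'n cpoint) S" for j
   by (rule Ck_bounded_compose_linear[OF S l2 _ _ g]) (auto simp: norm_axis)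
 qed simp
 moreover have "(f x, 0) + (\<Sum>j\<in>UNIV. (0, axis j (g j x))) = ((f x, \<chi> j. g j x) :: 'n cpoint)" for x
  by (auto simp: prod_eq_iff fst_sum snd_sum vec_eq_iff axis_def)
 ultimately show ?thesis by simp
qed

lemma Ck_bounded_cov:
 fixes A :: "complex ^ 'n::finite ^ 'n"
 shows "\<exists>K\<ge>0. \<forall>j. Ck_bounded k K (\<lambda>z. cov A z j) (ball 0 R)"
proof -
 have l: "bounded_linear (\<lambda>z. cov A z j)" for j
  by (rule linear_conv_bounded_linear[THEN iffD1])
   (auto simp: linear_iff cov_def distrib_right sum.distrib scaleR_sum_right)
 have "\<exists>K\<ge>0. \<forall>z. norm (cov A z j) \<le> norm z * K" for j using bounded_linear.nonneg_bounded[OF l] by blast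
 then obtain K where K: "\<And>j. K j \<ge> 0" "\<And>j z. norm (cov A z j) \<le> norm z * K j" by metis
 define M where "M = (\<Sum>j\<in>UNIV. K j) * (\<bar>R\<bar> + 1)"
 have le: "norm (cov A z j) \<le> M" if "norm z \<le> \<bar>R\<bar> + 1" for z j
 proof -
  have "norm z * K j \<le> (\<bar>R\<bar> + 1) * (\<Sum>j\<in>UNIV. K j)"
   using that K(1) member_le_sum[of j UNIV K] by (intro mult_mono) auto
  then show ?thesis using K(2)[of z j] by (simp add: M_def mult.commute)
 qed
 have "Ck_bounded k M (\<lambda>z. cov A z j) (ball 0 R)" for j
  by (rule Ck_bounded_linear[OF open_ball l]) (use le in auto)
 moreover have "0 \<le> M" using K(1) by (simp add: M_def sum_nonneg)
 ultimately show ?thesis by blast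
qed

lemma Ck_bounded_qmap:
 fixes A :: "complex ^ 'n::finite ^ 'n"
 shows "\<exists>K\<ge>0. Ck_bounded k K (qmap A) (ball 0 R)"
proof -
 obtain K where K: "K \<ge> 0" "\<And>j. Ck_bounded k K (\<lambda>z. cov A z j) (ball 0 R)" using Ck_bounded_cov by blast
 have S: "open (ball (0 :: 'n cpoint) R)" by simp
 have l: "bounded_linear (\<lambda>z :: 'n cpoint. snd z $ j)" for j
  by (rule linear_conv_bounded_linear[THEN iffD1]) (auto simp: linear_iff)
 have n: "Ck_bounded k (\<bar>R\<bar> + 1) (\<lambda>z :: 'n cpoint. snd z $ j) (ball 0 R)" for j
 proof (rule Ck_bounded_linear[OF S l])
  show "norm (snd x $ j) \<le> \<bar>R\<bar> + 1" if "x \<in> ball 0 R" for x :: "'n cpoint"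
   using norm_snd_nth_le[of x j] that by simp
  show "norm (snd v $ j) \<le> \<bar>R\<bar> + 1" if "v \<in> Basis" for v :: "'n cpoint"
   using norm_snd_nth_le[of v j] that by simp
 qed
 define M where "M = (\<Sum>j\<in>(UNIV::'n set). 2 ^ k * K * (\<bar>R\<bar> + 1))"
 have 1: "Ck_bounded k M (\<lambda>z. \<Sum>j\<in>UNIV. cov A z j * snd z $ j) (ball 0 R)"
  unfolding M_def using K n by (intro Ck_bounded_sum[OF S] Ck_bounded_mult[OF S]) auto
 have "bounded_linear (\<lambda>x. complex_of_real (Re x))"
  by (rule linear_conv_bounded_linear[THEN iffD1]) (auto simp: linear_iff scaleR_conv_of_real)
 from Ck_bounded_compose_linear[OF S this _ _ 1, of 1]
 have 2: "Ck_bounded k M (\<lambda>z. complex_of_real (Re (\<Sum>j\<in>UNIV. cov A z j * snd z $ j))) (ball 0 R)"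
  using abs_Re_le_cmod by simp
 have "Ck_bounded k (M + (\<Sum>j\<in>(UNIV::'n set). 0)) (\<lambda>z. (complex_of_real (Re (\<Sum>j\<in>UNIV. cov A z j * snd z $ j)), \<chi> j. 0) :: 'n cpoint) (ball 0 R)"
  by (intro Ck_bounded_cpoint[OF S] 2 Ck_bounded_const[OF _ S]) simp
 moreover have "(complex_of_real (Re (\<Sum>j\<in>UNIV. cov A z j * snd z $ j)), \<chi> j. 0) = qmap A z" for z
 proof -
  have "(\<Sum>j\<in>UNIV. cov A z j * snd z $ j) = (\<Sum>i\<in>UNIV. \<Sum>j\<in>UNIV. cnj (snd z $ i) * A $ i $ j * snd z $ j)"
   unfolding cov_def sum_distrib_right by (rule sum.swap)
  then show ?thesis by (simp add: qmap_def qform_def prod_eq_iff vec_eq_iff)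
 qed
 moreover have "0 \<le> M" using K(1) by (simp add: M_def sum_nonneg)
 ultimately show ?thesis by auto
qed

text \<open>All the data that enter the fixed point equation depend on \<open>\<rho>\<close> through the second order
 jet of \<open>\<rho> - quadric_fun A\<close>, so they are small together with two derivatives.\<close>

lemma stat_map_small:
 fixes A B :: "complex ^ 'n::finite ^ 'n"
 assumes A: "hermitian_matrix A"
 shows "\<exists>C\<ge>0. \<forall>\<epsilon> \<rho>. 0 < \<epsilon> \<longrightarrow> \<epsilon> \<le> 1 / 8 \<longrightarrow> \<rho> \<in> Ck_ball 3 (ball 0 R) (quadric_fun A) \<epsilon> \<longrightarrow>
  Ck_bounded 2 (C * \<epsilon>) (stat_map A B \<rho>) (ball 0 R) \<and>
  Ck_bounded 1 2 (\<lambda>z. 2 * fst (del \<rho> z)) (ball 0 R) \<and>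
  (\<forall>z\<in>ball 0 R. norm (2 * fst (del \<rho> z) - 1) \<le> 2 * \<epsilon> \<and> \<D> \<rho> (at z) \<noteq> (\<lambda>_. 0))"
proof -
 let ?S = "ball 0 R :: 'n cpoint set"
 have S: "open ?S" by simp
 obtain Kc where Kc: "Kc \<ge> 0" "\<And>j. Ck_bounded 2 Kc (\<lambda>z. cov A z j) ?S" using Ck_bounded_cov by blast
 obtain M where M: "M \<ge> 0" "\<forall>(f :: 'n cpoint \<Rightarrow> complex) S. open S \<longrightarrow> Ck_bounded 2 2 f S \<longrightarrow>
  (\<forall>x\<in>S. f x \<noteq> 0 \<and> norm (inverse (f x)) \<le> 2) \<longrightarrow> Ck_bounded 2 M (\<lambda>x. inverse (f x)) S"
  using Ck_bounded_inverse[of 2 2 2] by auto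
 \<comment> \<open>Two applications of \<open>Ck_bounded_mult\<close> contribute a factor 4 each,
   the inner one also the 2 of \<open>2 * e0\<close>; \<open>Kc\<close> and \<open>M\<close> bound
   \<open>cov\<close> and the inverse of \<open>1 + 2 * e0\<close>.\<close>
 define D where "D = 4 * (1 + 4 * 2 * Kc) * M"
 define C where "C = 1 + (\<Sum>i\<in>(UNIV::'n set). \<Sum>j\<in>(UNIV::'n set). norm (B $ j $ i) * D)"
 have D0: "0 \<le> D" using Kc(1) M(1) by (simp add: D_def)
 have C0: "0 \<le> C" using D0 by (simp add: C_def add_nonneg_nonneg sum_nonneg)
 show ?thesis
 proof (intro exI[of _ C] conjI allI impI C0)
  fix \<epsilon> \<rho> assume e: "0 < \<epsilon>" "\<epsilon> \<le> 1 / 8" and rho: "\<rho> \<in> Ck_ball 3 ?S (quadric_fun A) \<epsilon>"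
  let ?r = "quadric_fun A"
  define \<sigma> where "\<sigma> z = \<rho> z - ?r z" for z
  have Crho: "Ck_on 3 \<rho> ?S" using rho by (simp add: Ck_ball_def)
  have sig3: "Ck_bounded 3 \<epsilon> \<sigma> ?S" unfolding \<sigma>_def
  proof (rule Ck_bounded_difference[OF S Crho])
   show "Ck_on 3 ?r ?S" using Ck_on_quadric[of 2 A ?S] by (simp add: eval_nat_numeral)
   show "norm (iter_deriv \<rho> vs x - iter_deriv ?r vs x) \<le> \<epsilon>" if "set vs \<subseteq> Basis" "length vs \<le> 3" "x \<in> ?S" for vs x
    using rho that unfolding Ck_ball_def by fastforce
  qed
  then have sigS: "Ck_bounded (Suc 2) \<epsilon> \<sigma> ?S" by (simp add: eval_nat_numeral)
  define d where "d b z = \<D> \<sigma> (at z) b" for b z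
  have d2: "Ck_bounded 2 \<epsilon> (d b) ?S" if "b \<in> Basis" for b
   using sigS that unfolding Ck_bounded.simps(2)[of 2] d_def[abs_def] by blast
  have drho: "frechet_derivative \<rho> (at z) v = \<D> ?r (at z) v + d v z" if z: "z \<in> ?S" for z v
  proof -
   have "(\<sigma> has_derivative \<D> \<sigma> (at z)) (at z)" by (rule Ck_bounded_has_derivative[OF sigS z])
   from has_derivative_add[OF this quadric_fun_has_derivative]
   have "((\<lambda>z. \<sigma> z + ?r z) has_derivative (\<lambda>v. \<D> \<sigma> (at z) v + \<D> ?r (at z) v)) (at z)"
    by (simp add: frechet_derivative_quadric)
   then have "(\<rho> has_derivative (\<lambda>v. \<D> \<sigma> (at z) v + \<D> ?r (at z) v)) (at z)"
    by (simp add: \<sigma>_def)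
   from frechet_derivative_at[OF this] show ?thesis by (metis add.commute d_def)
  qed
  define e0 where "e0 z = (of_real (d (1, 0) z) - \<i> * of_real (d (\<i>, 0) z)) / 2" for z
  define ej where "ej j z = (of_real (d (0, axis j 1) z) - \<i> * of_real (d (0, axis j \<i>) z)) / 2" for j z
  have comb: "Ck_bounded 2 \<epsilon> (\<lambda>z. (of_real (d b z) - \<i> * of_real (d b' z)) / 2) ?S" if "b \<in> Basis" "b' \<in> Basis" for b b'
  proof -
   have "Ck_bounded 2 (norm (1 / 2 :: complex) * \<epsilon> + norm (- \<i> / 2) * \<epsilon>) (\<lambda>z. (1 / 2) * of_real (d b z) + (- \<i> / 2) * of_real (d b' z)) ?S"
    by (intro Ck_bounded_add[OF S] Ck_bounded_cmult[OF S] Ck_bounded_of_real[OF S] d2 that)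
   then show ?thesis by (simp add: norm_divide diff_divide_distrib)
  qed
  have e0: "Ck_bounded 2 \<epsilon> e0 ?S" and ej: "Ck_bounded 2 \<epsilon> (ej j) ?S" for j
   unfolding e0_def[abs_def] ej_def[abs_def] by (intro comb basis_cpoint)+
  have del0: "fst (del \<rho> z) = 1 / 2 + e0 z" and delj: "snd (del \<rho> z) $ j = - cov A z j + ej j z" if z: "z \<in> ?S" for z j
  proof -
   have "fst (del \<rho> z) = fst (del ?r z) + e0 z"
    by (simp add: del_def Let_def drho[OF z] e0_def add_divide_distrib diff_divide_distrib distrib_left)
   then show "fst (del \<rho> z) = 1 / 2 + e0 z" by (simp add: del_quadric[OF A])
   have "snd (del \<rho> z) $ j = snd (del ?r z) $ j + ej j z"
    by (simp add: del_def Let_def drho[OF z] ej_def add_divide_distrib diff_divide_distrib distrib_left)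
   then show "snd (del \<rho> z) $ j = - cov A z j + ej j z" by (simp add: del_quadric[OF A])
  qed
  \<comment> \<open>\<open>\<epsilon> \<le> 1 / 8\<close> keeps \<open>1 + 2 * e0\<close>, which is
    twice the first component of \<open>del \<rho>\<close>, below 2 and at distance at least 1/2
    from 0, as the uniform inverse bound \<open>M\<close> presupposes.\<close>
  have u2: "Ck_bounded 2 2 (\<lambda>z. 1 + 2 * e0 z) ?S"
  proof (rule Ck_bounded_mono)
   show "Ck_bounded 2 (1 + norm (2::complex) * \<epsilon>) (\<lambda>z. 1 + 2 * e0 z) ?S"
    by (intro Ck_bounded_add[OF S] Ck_bounded_const[OF _ S] Ck_bounded_cmult[OF S] e0) simp
  qed (use e in simp)
  have e0n: "norm (e0 z) \<le> \<epsilon>" if "z \<in> ?S" for z by (rule Ck_bounded_norm[OF e0 that])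
  have inv: "1 + 2 * e0 z \<noteq> 0 \<and> norm (inverse (1 + 2 * e0 z)) \<le> 2" if z: "z \<in> ?S" for z
  proof -
   have "1 - norm (2 * e0 z) \<le> norm (1 + 2 * e0 z)" using norm_triangle_ineq2[of 1 "- (2 * e0 z)"] by simp
   then have h: "1 / 2 \<le> norm (1 + 2 * e0 z)" using e0n[OF z] e by (simp add: norm_mult)
   then have "inverse (norm (1 + 2 * e0 z)) \<le> inverse (1 / 2)" by (intro le_imp_inverse_le) auto
   then show ?thesis using h by (auto simp: norm_inverse)
  qed
  have invC: "Ck_bounded 2 M (\<lambda>z. inverse (1 + 2 * e0 z)) ?S"
   using M(2)[rule_format, OF S u2] inv by blast
  have err: "Ck_bounded 2 (D * \<epsilon>) (\<lambda>z. stat_err A \<rho> z j) ?S" for j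
  proof -
   have "Ck_bounded 2 (2 ^ 2 * (\<epsilon> + 2 ^ 2 * (norm (2::complex) * \<epsilon>) * Kc) * M)
     (\<lambda>z. (ej j z + (2 * e0 z) * cov A z j) * inverse (1 + 2 * e0 z)) ?S"
    using e Kc M(1) by (intro Ck_bounded_mult[OF S] Ck_bounded_add[OF S] Ck_bounded_cmult[OF S] e0 ej invC) auto
   then have "Ck_bounded 2 (D * \<epsilon>) (\<lambda>z. (ej j z + (2 * e0 z) * cov A z j) * inverse (1 + 2 * e0 z)) ?S"
    by (simp add: D_def algebra_simps)
   then show ?thesis
   proof (rule Ck_bounded_cong[OF S, rotated])
    fix z assume z: "z \<in> ?S"
    have "2 * fst (del \<rho> z) = 1 + 2 * e0 z" by (simp add: del0[OF z])
    then have "stat_err A \<rho> z j = cov A z j + (- cov A z j + ej j z) / (1 + 2 * e0 z)" by (simp add: stat_err_def delj[OF z])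
    also have "\<dots> = (ej j z + (2 * e0 z) * cov A z j) * inverse (1 + 2 * e0 z)" using inv[OF z] by (simp add: field_simps)
    finally show "(ej j z + (2 * e0 z) * cov A z j) * inverse (1 + 2 * e0 z) = stat_err A \<rho> z j" by simp
   qed
  qed
  have pert: "Ck_bounded 2 (\<Sum>j\<in>UNIV. norm (B $ j $ i) * (D * \<epsilon>)) (\<lambda>z. stat_pert A B \<rho> z i) ?S" for i
  proof -
   have "Ck_bounded 2 (\<Sum>j\<in>UNIV. norm (B $ j $ i) * (D * \<epsilon>)) (\<lambda>z. \<Sum>j\<in>UNIV. B $ j $ i * stat_err A \<rho> z j) ?S"
    by (intro Ck_bounded_sum[OF S] Ck_bounded_cmult[OF S] err) simp
   from Ck_bounded_compose_linear[OF S bounded_linear_cnj _ _ this, of 1]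
   show ?thesis by (simp add: stat_pert_def mult.commute)
  qed
  have sig2: "Ck_bounded 2 \<epsilon> (\<lambda>z. complex_of_real (- \<sigma> z)) ?S"
   using Ck_bounded_compose_linear[OF S bounded_linear_minus[OF bounded_linear_of_real[where 'a=complex]] _ _ Ck_bounded_Suc[OF sigS], of 1]
   by simp
  have "Ck_bounded 2 (\<epsilon> + (\<Sum>i\<in>UNIV. \<Sum>j\<in>UNIV. norm (B $ j $ i) * (D * \<epsilon>))) (\<lambda>z. (complex_of_real (- \<sigma> z), \<chi> i. stat_pert A B \<rho> z i)) ?S"
   by (rule Ck_bounded_cpoint[OF S sig2 pert])
  moreover have "\<epsilon> + (\<Sum>i\<in>UNIV. \<Sum>j\<in>UNIV. norm (B $ j $ i) * (D * \<epsilon>)) = C * \<epsilon>"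
   by (simp add: C_def distrib_right sum_distrib_right mult.assoc)
  moreover have "(\<lambda>z. (complex_of_real (- \<sigma> z), \<chi> i. stat_pert A B \<rho> z i)) = stat_map A B \<rho>"
   by (simp add: fun_eq_iff stat_map_def \<sigma>_def)
  ultimately show "Ck_bounded 2 (C * \<epsilon>) (stat_map A B \<rho>) ?S" by simp
  have "Ck_bounded 1 2 (\<lambda>z. 1 + 2 * e0 z) ?S"
   using Ck_bounded_Suc[of 1 2 "\<lambda>z. 1 + 2 * e0 z" ?S] u2 by (simp add: numeral_2_eq_2)
  then show "Ck_bounded 1 2 (\<lambda>z. 2 * fst (del \<rho> z)) ?S"
   by (rule Ck_bounded_cong[OF S, rotated]) (simp add: del0)
  show "\<forall>z\<in>?S. norm (2 * fst (del \<rho> z) - 1) \<le> 2 * \<epsilon> \<and> \<D> \<rho> (at z) \<noteq> (\<lambda>_. 0)"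
  proof
   fix z assume z: "z \<in> ?S"
   have 1: "norm (2 * fst (del \<rho> z) - 1) \<le> 2 * \<epsilon>" using e0n[OF z] by (simp add: del0[OF z] norm_mult)
   have "frechet_derivative \<rho> (at z) \<noteq> (\<lambda>_. 0)"
   proof
    assume "frechet_derivative \<rho> (at z) = (\<lambda>_. 0)"
    then have "fst (del \<rho> z) = 0" by (simp add: del_def Let_def)
    then show False using 1 e by simp
   qed
   then show "norm (2 * fst (del \<rho> z) - 1) \<le> 2 * \<epsilon> \<and> \<D> \<rho> (at z) \<noteq> (\<lambda>_. 0)" using 1 by blast
  qed
 qed
qed

subsection \<open>The model discs and the fixed point operator\<close>

lemma norm_vec_cmult: "norm (\<chi> j. w $ j * c :: complex ^ 'n::finite) = norm w * norm (c :: complex)"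
 by (simp add: norm_vec_def norm_mult L2_set_left_distrib)

lemma norm_fst_le_prod: "norm (fst x) \<le> norm x"
 by (metis norm_fst_le prod.collapse)

lemma norm_snd_le_prod: "norm (snd x) \<le> norm x"
 by (metis norm_snd_le prod.collapse)

lemma model_disc_holomorphic:
 fixes t :: "'n::finite params"
 assumes "norm (fst t) < 1" shows "holomorphic_disc (model_disc t :: complex \<Rightarrow> 'n::finite cpoint)"
proof -
 obtain a v w y where t: "t = (a, v, w, y)" by (cases t)
 have a: "norm a < 1" using assms t by simp
 show ?thesis unfolding holomorphic_disc_iff t model_disc_def
  by (auto intro!: disc_alg_add disc_alg_mult disc_alg_divide disc_alg_diff simp: one_minus_mult_ne[OF a, simplified])
qed

lemma model_disc_0: "model_disc (a, v, w, y) 0 = (\<i> * of_real y, v)"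
 by (simp add: model_disc_def vec_eq_iff)

text \<open>The disc with parameter (a, v, w, y) is f applied to (a \<xi>, v, w \<xi>, y), which is
  linear in the parameter, with f a fixed smooth map away from a \<xi> = 1. Differentiability and
  the Lipschitz bound are therefore instances of the results on composition.\<close>

lemma model_disc_C1:
 fixes t0 :: "'n::finite params"
 assumes \<alpha>: "0 < \<alpha>" "\<alpha> \<le> 1" and r: "r < 1"
 shows "\<exists>C\<ge>0. C1_map UNIV norm {t. norm (fst t) < r \<and> norm t < M} (\<H> \<alpha>) (\<N> \<alpha>) (model_disc :: _ \<Rightarrow> complex \<Rightarrow> 'n cpoint) \<and>
  (\<forall>s t. norm (fst s) < r \<longrightarrow> norm s < M \<longrightarrow> norm (fst t) < r \<longrightarrow> norm t < M \<longrightarrow>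
   \<N> \<alpha> (model_disc s - model_disc t :: complex \<Rightarrow> 'n cpoint) \<le> C * norm (s - t))"
proof -
 define u :: "'n params \<Rightarrow> complex \<Rightarrow> 'n params"
  where "u t \<xi> = (case t of (a, v, w, y) \<Rightarrow> (a * \<xi>, v, \<chi> j. w $ j * \<xi>, y))" for t \<xi>
 define S :: "('n params) set" where "S = (ball 0 r \<times> UNIV) \<inter> ball 0 M"
 define f :: "'n params \<Rightarrow> 'n cpoint" where
  "f x = (\<i> * of_real (snd (snd (snd x))), \<chi> j. fst (snd x) $ j + fst (snd (snd x)) $ j * inverse (1 + - fst x))" for x
 let ?O = "{t :: 'n params. norm (fst t) < r \<and> norm t < M}"
 have S: "open S" "convex S" unfolding S_def
  by (auto intro!: open_Int open_Times convex_Int convex_Times)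
 have nu: "norm (u t \<xi>) = norm t" if "norm \<xi> = 1" for t \<xi>
  using that by (cases t) (simp add: u_def norm_Pair norm_mult norm_vec_cmult)
 have nud: "norm (u t \<xi> - u t \<eta>) \<le> norm t * norm (\<xi> - \<eta>)" for t \<xi> \<eta>
 proof -
  obtain a v w y where t: "t = (a, v, w, y)" by (cases t)
  have "u t \<xi> - u t \<eta> = (a * (\<xi> - \<eta>), 0, \<chi> j. w $ j * (\<xi> - \<eta>), 0)"
   by (simp add: t u_def algebra_simps vec_eq_iff)
  then have "norm (u t \<xi> - u t \<eta>) = sqrt ((norm a)\<^sup>2 + (norm w)\<^sup>2) * norm (\<xi> - \<eta>)"
   by (simp add: norm_Pair norm_mult norm_vec_cmult power_mult_distrib flip: distrib_right)
     (simp add: real_sqrt_mult)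
  also have "sqrt ((norm a)\<^sup>2 + (norm w)\<^sup>2) \<le> norm t"
   by (simp add: t norm_Pair)
  finally show ?thesis by (simp add: mult_right_mono)
 qed
 \<comment> \<open>The factor 3 is 1 for the values plus 2 for the Hoelder quotient: distances on
   the circle are at most 2, so
   \<open>dist \<xi> \<eta> \<le> 2 * dist \<xi> \<eta> powr \<alpha>\<close>.\<close>
 have uH: "u t \<in> \<H> \<alpha>" and uN: "\<N> \<alpha> (u t) \<le> 3 * norm t" for t
 proof -
  have b: "norm (u t \<xi> - u t \<eta>) \<le> 2 * norm t * dist \<xi> \<eta> powr \<alpha>" if "\<xi> \<in> sphere 0 1" "\<eta> \<in> sphere 0 1" for \<xi> \<eta>
  proof (cases "\<xi> = \<eta>")
   case False
   then have d: "0 < dist \<xi> \<eta>" by simp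
   have "dist \<xi> \<eta> powr (1 - \<alpha>) \<le> 2 powr (1 - \<alpha>)"
    using that \<alpha> dist_triangle[of \<xi> \<eta> 0] by (intro powr_mono2) auto
   also have "\<dots> \<le> 2 powr 1" using \<alpha> by (intro powr_mono) auto
   finally have "dist \<xi> \<eta> powr (1 - \<alpha>) * dist \<xi> \<eta> powr \<alpha> \<le> 2 * dist \<xi> \<eta> powr \<alpha>" by (intro mult_right_mono) auto
   then have "dist \<xi> \<eta> \<le> 2 * dist \<xi> \<eta> powr \<alpha>" using d by (simp flip: powr_add)
   then have "norm t * dist \<xi> \<eta> \<le> norm t * (2 * dist \<xi> \<eta> powr \<alpha>)" by (intro mult_left_mono) auto
   then show ?thesis using nud[of t \<xi> \<eta>] by (simp add: dist_norm)
  qed simp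
  have "norm (u t \<xi>) \<le> norm t" if "\<xi> \<in> sphere 0 1" for \<xi> using nu that by simp
  from holderI[OF \<alpha>(1) _ this b] show "u t \<in> \<H> \<alpha>" "\<N> \<alpha> (u t) \<le> 3 * norm t" by simp_all
 qed
 have uadd: "u (s + t) = u s + u t" for s t
  by (cases s; cases t) (simp add: u_def fun_eq_iff algebra_simps vec_eq_iff)
 have uscale: "u (c *\<^sub>R t) = c *\<^sub>R u t" for c t
  by (cases t) (simp add: u_def fun_eq_iff scaleR_fun_def vec_eq_iff)
 have uS: "u t ` sphere 0 1 \<subseteq> S" if "norm (fst t) < r" "norm t < M" for t
 proof -
  have "norm (fst (u t \<xi>)) < r" if "norm \<xi> = 1" for \<xi>
   using that \<open>norm (fst t) < r\<close> by (cases t) (simp add: u_def norm_mult)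
  then show ?thesis unfolding S_def using nu that(2) by (intro image_subsetI) (simp add: mem_Times_iff)
 qed
 have fu: "(\<lambda>\<xi>. f (u t \<xi>)) = model_disc t" for t
  by (cases t) (simp add: f_def u_def model_disc_def fun_eq_iff divide_inverse mult.assoc)
 define N where "N = \<bar>M\<bar> + 1"
 have N: "norm x \<le> N" if "x \<in> S" for x
 proof -
  have "norm x < M" using that by (simp add: S_def)
  then show ?thesis by (simp add: N_def)
 qed
 have N1: "1 \<le> N" by (simp add: N_def)
 have lin: "Ck_bounded 2 N L S" if "bounded_linear L" "\<And>x. norm (L x) \<le> norm x" for L :: "_ \<Rightarrow> complex"
 proof (rule Ck_bounded_linear[OF S(1) that(1)])
  show "norm (L x) \<le> N" if "x \<in> S" for x using N[OF that] \<open>norm (L x) \<le> norm x\<close> by (rule order_trans[rotated])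
  show "norm (L x) \<le> N" if "x \<in> Basis" for x using N1 \<open>norm (L x) \<le> norm x\<close> that by simp
 qed
 have ln: "norm (fst (snd x)) \<le> norm x" "norm (fst (snd (snd x))) \<le> norm x" "norm (snd (snd (snd x))) \<le> norm x" "norm (fst x) \<le> norm x"
  for x :: "'n params"
  using norm_fst_le_prod[of x] norm_snd_le_prod[of x] norm_fst_le_prod[of "snd x"] norm_snd_le_prod[of "snd x"]
   norm_fst_le_prod[of "snd (snd x)"] norm_snd_le_prod[of "snd (snd x)"] by linarith+
 have l1: "Ck_bounded 2 N (\<lambda>x. \<i> * of_real (snd (snd (snd x)))) S"
  by (rule lin, rule linear_conv_bounded_linear[THEN iffD1])
   (use ln(3) in \<open>auto simp: linear_iff norm_mult algebra_simps scaleR_conv_of_real\<close>)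
 have l2: "Ck_bounded 2 N (\<lambda>x. fst (snd x) $ j) S" for j
  by (rule lin, rule linear_conv_bounded_linear[THEN iffD1], simp add: linear_iff)
   (rule order_trans[OF Finite_Cartesian_Product.norm_nth_le ln(1)])
 have l3: "Ck_bounded 2 N (\<lambda>x. fst (snd (snd x)) $ j) S" for j
  by (rule lin, rule linear_conv_bounded_linear[THEN iffD1], simp add: linear_iff)
   (rule order_trans[OF Finite_Cartesian_Product.norm_nth_le ln(2)])
 have l4: "Ck_bounded 2 N (\<lambda>x. - fst x) S"
  by (rule lin, rule linear_conv_bounded_linear[THEN iffD1])
   (use ln(4) in \<open>auto simp: linear_iff\<close>)
 have l5: "Ck_bounded 2 (1 + N) (\<lambda>x. 1 + - fst x) S"
  by (intro Ck_bounded_add[OF S(1)] Ck_bounded_const[OF _ S(1)] l4) simp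
 have inv: "1 + - fst x \<noteq> 0 \<and> norm (inverse (1 + - fst x)) \<le> 1 / (1 - r)" if "x \<in> S" for x
 proof -
  have x: "norm (fst x) < r" using that by (simp add: S_def mem_Times_iff)
  have "1 - norm (fst x) \<le> norm (1 + - fst x)" using norm_triangle_ineq2[of 1 "fst x"] by simp
  then have h: "1 - r \<le> norm (1 + - fst x)" using x by linarith
  then have "inverse (norm (1 + - fst x)) \<le> inverse (1 - r)" using r by (intro le_imp_inverse_le) auto
  then show ?thesis using h r by (auto simp: norm_divide inverse_eq_divide)
 qed
 obtain K where K: "K \<ge> 0" "\<forall>(f :: 'n params \<Rightarrow> complex) S. open S \<longrightarrow> Ck_bounded 2 (1 + N) f S \<longrightarrow>
  (\<forall>x\<in>S. f x \<noteq> 0 \<and> norm (inverse (f x)) \<le> 1 / (1 - r)) \<longrightarrow> Ck_bounded 2 K (\<lambda>x. inverse (f x)) S"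
  using Ck_bounded_inverse[of "1 + N" "1 / (1 - r)" 2] N1 r by auto
 have l6: "Ck_bounded 2 K (\<lambda>x. inverse (1 + - fst x)) S"
  using K(2)[rule_format, OF S(1) l5] inv by blast
 define Kf where "Kf = N + (\<Sum>j\<in>(UNIV::'n set). N + 2 ^ 2 * N * K)"
 have f: "Ck_bounded 2 Kf f S" unfolding f_def[abs_def] Kf_def
  using N1 K(1) by (intro Ck_bounded_cpoint[OF S(1)] l1 Ck_bounded_add[OF S(1)] l2 Ck_bounded_mult[OF S(1)] l3 l6) auto
 have Kf: "0 \<le> Kf" using N1 K(1) by (simp add: Kf_def sum_nonneg)
 let ?D = "real DIM('n params)"
 have sE: "seminormed (UNIV :: ('n params) set) norm" by (rule seminormed_norm)
 have uC1: "C1_map UNIV norm ?O (\<H> \<alpha>) (\<N> \<alpha>) u"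
  by (rule C1_map_linear_on[OF sE seminormed_holder[OF \<alpha>(1)] subset_UNIV]) (use uadd uscale uH uN in auto)
 have "C1_map UNIV norm ?O (\<H> \<alpha>) (\<N> \<alpha>) (\<lambda>t \<xi>. f (u t \<xi>))"
  by (rule C1_map_compose[OF sE seminormed_holder[OF \<alpha>(1)] seminormed_holder[OF \<alpha>(1)] subset_UNIV _ uC1 C1_map_holder_compose[OF \<alpha>(1) f S(2,1)]])
    (use uS uH in auto)
 then have C1: "C1_map UNIV norm ?O (\<H> \<alpha>) (\<N> \<alpha>) (model_disc :: _ \<Rightarrow> complex \<Rightarrow> 'n cpoint)"
  by (simp only: fu)
 define C where "C = (2 * ?D + ?D\<^sup>2 * (3 * N)) * Kf * 3"
 have "0 \<le> C" using Kf N1 by (simp add: C_def)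
 moreover have "\<N> \<alpha> (model_disc s - model_disc t :: complex \<Rightarrow> 'n cpoint) \<le> C * norm (s - t)"
  if s: "norm (fst s) < r" "norm s < M" and t: "norm (fst t) < r" "norm t < M" for s t
 proof -
  have b: "\<N> \<alpha> (u t) \<le> 3 * N" if "norm t < M" for t using uN[of t] that by (simp add: N_def)
  have "\<N> \<alpha> (model_disc s - model_disc t :: complex \<Rightarrow> 'n cpoint) \<le> (2 * ?D + ?D\<^sup>2 * (3 * N)) * Kf * \<N> \<alpha> (u s - u t)"
   using holder_compose_Lipschitz[OF \<alpha>(1) f S(2) uH uS[OF s] uH uS[OF t] b[OF t(2)]] by (simp only: fu)
  also have "u s - u t = u (s - t)" using uadd[of "s - t" t] by (simp add: fun_eq_iff)
  also have "(2 * ?D + ?D\<^sup>2 * (3 * N)) * Kf * \<N> \<alpha> (u (s - t)) \<le> (2 * ?D + ?D\<^sup>2 * (3 * N)) * Kf * (3 * norm (s - t))"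
   using Kf N1 by (intro mult_left_mono uN) auto
  finally show ?thesis unfolding C_def by (simp only: mult.assoc)
 qed
 ultimately show ?thesis using C1 by blast
qed

text \<open>The parameters of a model disc are read off its first Taylor coefficients at \<open>0\<close>.\<close>

lemma model_disc_param_dist:
 fixes s t :: "'n::finite params"
 assumes s: "norm (fst s) < 1" and t: "norm (fst t) < 1" and w: "fst (snd (snd t)) $ j \<noteq> 0"
  and d: "\<And>\<xi>. norm \<xi> = 1 \<Longrightarrow> norm (model_disc s \<xi> - model_disc t \<xi> :: 'n cpoint) \<le> d"
 shows "norm (s - t) \<le> (6 / norm (fst (snd (snd t)) $ j) + 3 * real CARD('n) + 1) * d"
proof -
 obtain a v w y where s': "s = (a, v, w, y)" by (cases s)
 obtain a' v' w' y' where t': "t = (a', v', w', y')" by (cases t)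
 have a: "norm a < 1" "norm a' < 1" using s t s' t' by simp_all
 note ne = one_minus_mult_ne[OF a(1)] one_minus_mult_ne[OF a(2)]
 have d0: "0 \<le> d" using d[of 1] by (meson norm_ge_zero norm_one order_trans)
 let ?m = "model_disc s 1 - model_disc t 1 :: 'n cpoint"
 have "norm (fst ?m) \<le> d" by (rule order_trans[OF norm_fst_le_prod d]) simp
 then have y: "\<bar>y - y'\<bar> \<le> d"
  by (simp add: s' t' model_disc_def flip: right_diff_distrib of_real_diff) (simp add: norm_mult del: of_real_diff)
 \<comment> \<open>\<open>g0\<close>, \<open>g1\<close>, \<open>g2\<close> arise from the difference
   of the discs by removing the constant term and dividing by z. By the maximum principle each step
   at most doubles the bound, giving d, 2d and 4d for the first three Taylor coefficients.\<close>
 define g0 where "g0 i z = (v $ i + w $ i * (z / (1 - a * z))) - (v' $ i + w' $ i * (z / (1 - a' * z)))" for i z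
 define g1 where "g1 i z = w $ i * (1 / (1 - a * z)) - w' $ i * (1 / (1 - a' * z))" for i z
 define g2 where "g2 i z = w $ i * (a / (1 - a * z)) - w' $ i * (a' / (1 - a' * z))" for i z
 have dg: "disc_alg (g0 i)" "disc_alg (g1 i)" "disc_alg (g2 i)" for i
  unfolding g0_def[abs_def] g1_def[abs_def] g2_def[abs_def]
  by (auto intro!: disc_alg_add disc_alg_mult disc_alg_divide disc_alg_diff simp: ne[simplified])
 have b0: "norm (g0 i z) \<le> d" if "norm z = 1" for i z
 proof -
  have "norm (snd (model_disc s z - model_disc t z :: 'n cpoint) $ i) \<le> d" using norm_snd_nth_le d[OF that] by (rule order_trans)
  then show ?thesis by (simp add: s' t' model_disc_def g0_def)
 qed
 have v: "norm (v $ i - v' $ i) \<le> d" for i using disc_alg_norm_le[OF dg(1)[of i] b0, of 0] by (simp add: g0_def)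
 have b1: "norm (g1 i z) \<le> 2 * d" if "norm z = 1" for i z
 proof -
  have "norm (z * g1 i z) = norm (g0 i z - (v $ i - v' $ i))" by (simp add: g0_def g1_def algebra_simps)
  also have "\<dots> \<le> d + d" by (rule order_trans[OF norm_triangle_ineq4 add_mono[OF b0[OF that] v]])
  finally show ?thesis using that by (simp add: norm_mult)
 qed
 have w1: "norm (w $ i - w' $ i) \<le> 2 * d" for i using disc_alg_norm_le[OF dg(2)[of i] b1, of 0] by (simp add: g1_def)
 have b2: "norm (g2 i z) \<le> 4 * d" if z: "norm z = 1" for i z
 proof -
  have e: "c * (1 / (1 - b * z)) = c + z * (c * (b / (1 - b * z)))" if "1 - b * z \<noteq> 0" for b c
   using that by (simp add: field_simps)
  have "g1 i z = (w $ i - w' $ i) + z * g2 i z"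
   unfolding g1_def g2_def using e[OF ne(1)[of z], of "w $ i"] e[OF ne(2)[of z], of "w' $ i"] z by (simp add: right_diff_distrib)
  then have "norm (z * g2 i z) = norm (g1 i z - (w $ i - w' $ i))" by simp
  also have "\<dots> \<le> 2 * d + 2 * d" by (rule order_trans[OF norm_triangle_ineq4 add_mono[OF b1[OF z] w1]])
  finally show ?thesis using z by (simp add: norm_mult)
 qed
 have w2: "norm (w $ i * a - w' $ i * a') \<le> 4 * d" for i using disc_alg_norm_le[OF dg(3)[of i] b2, of 0] by (simp add: g2_def)
 \<comment> \<open>The parameter a is visible only through the products w a. Combining the bounds
   for w a - w' a' and w - w' costs 4d + 2d, and division by the nonzero component of w' isolates a
   - a'.\<close>
 have "norm (a - a') * norm (w' $ j) = norm ((w $ j * a - w' $ j * a') - (w $ j - w' $ j) * a)"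
  by (simp add: algebra_simps flip: norm_mult)
 also have "\<dots> \<le> norm (w $ j * a - w' $ j * a') + norm (w $ j - w' $ j) * norm a"
  using norm_triangle_ineq4[of "w $ j * a - w' $ j * a'" "(w $ j - w' $ j) * a"] by (simp add: norm_mult)
 also have "\<dots> \<le> 4 * d + 2 * d * 1" using w2 w1 a d0 by (intro add_mono mult_mono) auto
 finally have "norm (a - a') * norm (w' $ j) \<le> 6 * d" by simp
 moreover have wj: "0 < norm (w' $ j)" using w t' by simp
 ultimately have "norm (a - a') \<le> 6 * d / norm (w' $ j)" by (simp add: pos_le_divide_eq)
 moreover have "norm (v - v') \<le> real CARD('n) * d"
 proof -
  have "norm (v - v') \<le> (\<Sum>i\<in>UNIV. norm ((v - v') $ i))" by (simp add: norm_vec_def L2_set_le_sum)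
  also have "\<dots> \<le> (\<Sum>i\<in>(UNIV :: 'n set). d)" by (intro sum_mono) (use v in simp)
  finally show ?thesis by simp
 qed
 moreover have "norm (w - w') \<le> real CARD('n) * (2 * d)"
 proof -
  have "norm (w - w') \<le> (\<Sum>i\<in>UNIV. norm ((w - w') $ i))" by (simp add: norm_vec_def L2_set_le_sum)
  also have "\<dots> \<le> (\<Sum>i\<in>(UNIV :: 'n set). 2 * d)" by (intro sum_mono) (use w1 in simp)
  finally show ?thesis by simp
 qed
 moreover have "norm (s - t) \<le> norm (a - a') + (norm (v - v') + (norm (w - w') + \<bar>y - y'\<bar>))"
 proof -
  have "norm (s - t) \<le> norm (a - a') + norm (v - v', w - w', y - y')" unfolding s' t' by (simp add: norm_Pair_le)
  also have "norm (v - v', w - w', y - y') \<le> norm (v - v') + norm (w - w', y - y')" by (rule norm_Pair_le)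
  also have "norm (w - w', y - y') \<le> norm (w - w') + norm (y - y')" by (rule norm_Pair_le)
  finally show ?thesis by simp
 qed
 moreover have "(6 / norm (w' $ j) + 3 * real CARD('n) + 1) * d = 6 * d / norm (w' $ j) + (real CARD('n) * d + (real CARD('n) * (2 * d) + d))"
  by (simp add: algebra_simps)
 ultimately show ?thesis using y unfolding t' fst_conv snd_conv by linarith
qed

lemma stat_op_const_nonneg: "0 < \<alpha> \<Longrightarrow> \<alpha> < 1 \<Longrightarrow> 0 \<le> stat_op_const \<alpha> TYPE('n::finite)"
 using cauchy_const_nonneg[of \<alpha>] by (simp add: stat_op_const_def)

lemma stat_op_Lipschitz:
 fixes f g :: "complex \<Rightarrow> 'n::finite cpoint"
 assumes \<alpha>: "0 < \<alpha>" "\<alpha> < 1" and f: "f \<in> \<H> \<alpha>" and g: "g \<in> \<H> \<alpha>"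
 shows "\<N> \<alpha> (stat_op f - stat_op g) \<le> stat_op_const \<alpha> TYPE('n) * \<N> \<alpha> (f - g)"
proof -
 have "\<N> \<alpha> (stat_op f - stat_op g) = \<N> \<alpha> (stat_op (f - g))"
  by (rule holder_norm_cong) (simp add: stat_op_diff[OF \<alpha> f g])
 also have "\<dots> \<le> stat_op_const \<alpha> TYPE('n) * \<N> \<alpha> (f - g)"
  by (rule stat_op_holder[OF \<alpha> seminormedD(6)[OF seminormed_holder[OF \<alpha>(1)] f g]])
 finally show ?thesis .
qed

text \<open>A bounded linear operator is C1, but \<open>stat_op\<close> is known to be linear at
  points of the closed disc only, while \<open>C1_map\<close> speaks about functions on the whole
  plane.\<close>

lemma C1_map_stat_op:
 assumes \<alpha>: "0 < \<alpha>" "\<alpha> < 1" and Om: "\<Omega> \<subseteq> \<H> \<alpha>"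
 shows "C1_map (\<H> \<alpha>) (\<N> \<alpha>) \<Omega> (\<H> \<alpha>) (\<N> \<alpha>) (stat_op :: (complex \<Rightarrow> 'n::finite cpoint) \<Rightarrow> _)"
proof -
 let ?H = "\<H> \<alpha> :: (complex \<Rightarrow> 'n cpoint) set" and ?N = "\<N> \<alpha> :: (complex \<Rightarrow> 'n cpoint) \<Rightarrow> real"
 note sH = seminormed_holder[OF \<alpha>(1), where 'b="'n cpoint"]
 \<comment> \<open>The truncation is linear as a map of functions and differs from
   \<open>stat_op\<close> by a null function.\<close>
 define T :: "(complex \<Rightarrow> 'n cpoint) \<Rightarrow> complex \<Rightarrow> 'n cpoint" where "T f z = (if norm z \<le> 1 then stat_op f z else 0)" for f z
 have TH: "T f \<in> ?H" and TN: "?N (T f) = ?N (stat_op f)" if "f \<in> ?H" for f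
 proof -
  have "T f \<xi> = stat_op f \<xi>" if "\<xi> \<in> sphere 0 1" for \<xi> using that by (simp add: T_def)
  from holder_norm_cong[OF this] show "T f \<in> ?H" "?N (T f) = ?N (stat_op f)" using stat_op_holder(1)[OF \<alpha> that] by auto
 qed
 have "C1_map ?H ?N \<Omega> ?H ?N T"
 proof (rule C1_map_linear_on[OF sH sH Om])
  fix f g assume "f \<in> ?H" "g \<in> ?H"
  then show "T (f + g) = T f + T g" using stat_op_add[OF \<alpha>, of f g] by (simp add: fun_eq_iff T_def plus_fun_def)
 next
  fix f c assume "f \<in> ?H"
  then show "T (c *\<^sub>R f) = c *\<^sub>R T f" using stat_op_scaleR[OF \<alpha>, of f] by (simp add: fun_eq_iff T_def scaleR_fun_def)
 next
  fix f assume f: "f \<in> ?H"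
  show "?N (T f) \<le> stat_op_const \<alpha> TYPE('n) * ?N f" using stat_op_holder(2)[OF \<alpha> f] by (simp add: TN[OF f])
 qed (rule TH)
 then show ?thesis
 proof (rule C1_map_null_cong[OF sH])
  fix f assume "f \<in> \<Omega>"
  then have f: "f \<in> ?H" using Om by blast
  have "?N (stat_op f - T f) = 0"
   using holder_null[OF \<alpha>(1) stat_op_holder(1)[OF \<alpha> f] TH[OF f]] by (simp add: T_def)
  then show "stat_op f \<in> ?H \<and> ?N (stat_op f - T f) = 0" using stat_op_holder(1)[OF \<alpha> f] by blast
 next
  show "y - x \<in> ?H" if "x \<in> \<Omega>" "y \<in> \<Omega>" for x y using seminormedD(6)[OF sH] that Om by blast
 qed
qed

lemma stat_op_compose:
 fixes f :: "'n::finite cpoint \<Rightarrow> 'n cpoint" and K :: real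
 assumes \<alpha>: "0 < \<alpha>" "\<alpha> < 1" and f: "Ck_bounded 2 K f S" and S: "convex S" "open S"
 shows "\<And>h. h \<in> \<H> \<alpha> \<Longrightarrow> h ` sphere 0 1 \<subseteq> S \<Longrightarrow> (\<lambda>u. f (h u)) \<in> \<H> \<alpha>"
  and "\<And>h. h \<in> \<H> \<alpha> \<Longrightarrow> h ` sphere 0 1 \<subseteq> S \<Longrightarrow>
   stat_op (\<lambda>u. f (h u)) \<in> \<H> \<alpha> \<and>
   \<N> \<alpha> (stat_op (\<lambda>u. f (h u))) \<le> stat_op_const \<alpha> TYPE('n) * (K + real DIM('n cpoint) * K * \<N> \<alpha> h)"
  and "\<And>h k. h \<in> \<H> \<alpha> \<Longrightarrow> h ` sphere 0 1 \<subseteq> S \<Longrightarrow> k \<in> \<H> \<alpha> \<Longrightarrow> k ` sphere 0 1 \<subseteq> S \<Longrightarrow>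
   \<N> \<alpha> k \<le> M \<Longrightarrow>
   \<N> \<alpha> (stat_op (\<lambda>u. f (h u)) - stat_op (\<lambda>u. f (k u))) \<le>
    stat_op_const \<alpha> TYPE('n) * ((2 * real DIM('n cpoint) + (real DIM('n cpoint))\<^sup>2 * M) * K * \<N> \<alpha> (h - k))"
  and "C1_map (\<H> \<alpha>) (\<N> \<alpha>) {h \<in> \<H> \<alpha>. h ` sphere 0 1 \<subseteq> S}
   (\<H> \<alpha>) (\<N> \<alpha>) (\<lambda>h. stat_op (\<lambda>u. f (h u)))"
proof -
 note sH = seminormed_holder[OF \<alpha>(1), where 'b="'n cpoint"]
 have f1: "Ck_bounded (Suc 1) K f S" using f by (simp add: numeral_2_eq_2)
 show c: "(\<lambda>u. f (h u)) \<in> \<H> \<alpha>" if "h \<in> \<H> \<alpha>" "h ` sphere 0 1 \<subseteq> S" for h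
  by (rule holder_compose(1)[OF \<alpha>(1) f1 S(1) that])
 show "stat_op (\<lambda>u. f (h u)) \<in> \<H> \<alpha> \<and>
   \<N> \<alpha> (stat_op (\<lambda>u. f (h u))) \<le> stat_op_const \<alpha> TYPE('n) * (K + real DIM('n cpoint) * K * \<N> \<alpha> h)"
  if "h \<in> \<H> \<alpha>" "h ` sphere 0 1 \<subseteq> S" for h
  using stat_op_holder[OF \<alpha> c[OF that]]
   mult_left_mono[OF holder_compose(2)[OF \<alpha>(1) f1 S(1) that] stat_op_const_nonneg[OF \<alpha>, where 'n='n]] by linarith
 show "\<N> \<alpha> (stat_op (\<lambda>u. f (h u)) - stat_op (\<lambda>u. f (k u))) \<le>
   stat_op_const \<alpha> TYPE('n) * ((2 * real DIM('n cpoint) + (real DIM('n cpoint))\<^sup>2 * M) * K * \<N> \<alpha> (h - k))"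
  if "h \<in> \<H> \<alpha>" "h ` sphere 0 1 \<subseteq> S" "k \<in> \<H> \<alpha>" "k ` sphere 0 1 \<subseteq> S"
   "\<N> \<alpha> k \<le> M" for h k
  using order_trans[OF stat_op_Lipschitz[OF \<alpha> c[OF that(1,2)] c[OF that(3,4)]]
   mult_left_mono[OF holder_compose_Lipschitz[OF \<alpha>(1) f S(1) that(1-5)] stat_op_const_nonneg[OF \<alpha>, where 'n='n]]] .
 show "C1_map (\<H> \<alpha>) (\<N> \<alpha>) {h \<in> \<H> \<alpha>. h ` sphere 0 1 \<subseteq> S}
   (\<H> \<alpha>) (\<N> \<alpha>) (\<lambda>h. stat_op (\<lambda>u. f (h u)))"
  by (rule C1_map_compose[OF sH sH sH _ subset_refl C1_map_holder_compose[OF \<alpha>(1) f S] C1_map_stat_op[OF \<alpha> subset_refl]])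
    (use c in auto)
qed

lemma qmap_cong: "snd x = snd y \<Longrightarrow> qmap A x = qmap A y"
 by (simp add: qmap_def qform_def)

section \<open>The substitution that removes the quadratic part\<close>

definition qpart :: "complex ^ 'n ^ 'n \<Rightarrow> (complex \<Rightarrow> 'n::finite cpoint) \<Rightarrow> complex \<Rightarrow> 'n cpoint" where
 "qpart A k = stat_op (\<lambda>u. qmap A (k u))"

lemma snd_qpart:
 fixes k :: "complex \<Rightarrow> 'n::finite cpoint"
 assumes "norm z \<le> 1" shows "snd (qpart A k z) = 0"
proof -
 \<comment> \<open>Any exponent serves: only the Cauchy transform of the zero function is
   computed.\<close>
 have a: "0 < (1/2::real)" "(1/2::real) < 1" by auto
 have "(\<lambda>u. 0 :: complex) \<in> \<H> (1/2)" using seminormedD(8)[OF seminormed_holder[OF a(1)]] by (simp add: zero_fun_def)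
 from cauchy_cmult[OF a this, of _ 0] assms show ?thesis
  by (simp add: qpart_def stat_op_def qmap_def vec_eq_iff)
qed

lemma qpart_cong: "(\<And>u. norm u = 1 \<Longrightarrow> snd (h u) = snd (k u)) \<Longrightarrow> qpart A h = qpart A k"
 unfolding qpart_def by (intro stat_op_cong qmap_cong)

definition quad_shift :: "complex ^ 'n ^ 'n \<Rightarrow> (complex \<Rightarrow> 'n::finite cpoint) \<Rightarrow> complex \<Rightarrow> 'n cpoint" where
 "quad_shift A k = k + qpart A k"

lemma snd_quad_shift: "norm z \<le> 1 \<Longrightarrow> snd (quad_shift A k z) = snd (k z)"
 by (simp add: quad_shift_def snd_qpart)

lemma quad_shift_inverse:
 "quad_shift A (h - qpart A h) = h" "norm z = 1 \<Longrightarrow> k z = quad_shift A k z - qpart A (quad_shift A k) z"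
proof -
 have "qpart A (h - qpart A h) = qpart A h" by (rule qpart_cong) (simp add: snd_qpart)
 then show "quad_shift A (h - qpart A h) = h" by (simp add: quad_shift_def)
 have "qpart A (quad_shift A k) = qpart A k" by (rule qpart_cong) (simp add: snd_quad_shift)
 then show "k z = quad_shift A k z - qpart A (quad_shift A k) z" by (simp add: quad_shift_def)
qed

lemma quad_shift_cong:
 "(\<And>u. norm u = 1 \<Longrightarrow> h u = k u) \<Longrightarrow> norm z = 1 \<Longrightarrow> quad_shift A h z = quad_shift A k z"
 using qpart_cong[of h k A] by (simp add: quad_shift_def)

lemma holder_norm_image_ball:
 assumes "0 < \<alpha>" "k \<in> \<H> \<alpha>" "\<N> \<alpha> k < M" shows "k ` sphere 0 1 \<subseteq> ball 0 M"
proof (rule image_subsetI)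
 fix \<xi> :: complex assume "\<xi> \<in> sphere 0 1"
 then have "norm (k \<xi>) < M" using holderD(2)[OF assms(1,2)] assms(3) by (meson le_less_trans)
 then show "k \<xi> \<in> ball 0 M" by simp
qed

text \<open>The quadratic map has bounded derivatives on bounded sets only, whence the Lipschitz
  constant depends on the radius M.\<close>

lemma qpart_bounds:
 fixes A :: "complex ^ 'n::finite ^ 'n"
 assumes \<alpha>: "0 < \<alpha>" "\<alpha> < 1"
 shows "\<exists>C\<ge>0. \<forall>k\<in>\<H> \<alpha>. \<forall>k'\<in>\<H> \<alpha>. \<N> \<alpha> k < M \<longrightarrow> \<N> \<alpha> k' < M \<longrightarrow>
  \<N> \<alpha> (qpart A k - qpart A k') \<le> C * \<N> \<alpha> (k - k')"
  and "k \<in> \<H> \<alpha> \<Longrightarrow> qpart A k \<in> \<H> \<alpha>"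
  and "k \<in> \<H> \<alpha> \<Longrightarrow> (\<lambda>u. qmap A (k u)) \<in> \<H> \<alpha>"
  and "\<Omega> \<subseteq> {k \<in> \<H> \<alpha>. \<N> \<alpha> k < M} \<Longrightarrow>
   C1_map (\<H> \<alpha>) (\<N> \<alpha>) \<Omega> (\<H> \<alpha>) (\<N> \<alpha>) (qpart A)"
proof -
 let ?D = "real DIM('n cpoint)"
 obtain K where K: "0 \<le> K" "Ck_bounded 2 K (qmap A) (ball 0 M)" using Ck_bounded_qmap by blast
 note so = stat_op_compose[OF \<alpha> K(2) convex_ball open_ball]
 define C where "C = stat_op_const \<alpha> TYPE('n) * ((2 * ?D + ?D\<^sup>2 * \<bar>M\<bar>) * K)"
 have "0 \<le> C" unfolding C_def using K(1) stat_op_const_nonneg[OF \<alpha>, where 'n='n] by (intro mult_nonneg_nonneg) auto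
 moreover have "\<N> \<alpha> (qpart A k - qpart A k') \<le> C * \<N> \<alpha> (k - k')"
  if "k \<in> \<H> \<alpha>" "k' \<in> \<H> \<alpha>" "\<N> \<alpha> k < M" "\<N> \<alpha> k' < M" for k k'
  using so(3)[OF that(1) holder_norm_image_ball[OF \<alpha>(1) that(1,3)] that(2) holder_norm_image_ball[OF \<alpha>(1) that(2,4)], of "\<bar>M\<bar>"] that(3,4)
  by (simp add: C_def qpart_def mult.assoc)
 ultimately show "\<exists>C\<ge>0. \<forall>k\<in>\<H> \<alpha>. \<forall>k'\<in>\<H> \<alpha>. \<N> \<alpha> k < M \<longrightarrow> \<N> \<alpha> k' < M \<longrightarrow>
  \<N> \<alpha> (qpart A k - qpart A k') \<le> C * \<N> \<alpha> (k - k')" by blast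
 show "C1_map (\<H> \<alpha>) (\<N> \<alpha>) \<Omega> (\<H> \<alpha>) (\<N> \<alpha>) (qpart A)"
  if Om: "\<Omega> \<subseteq> {k \<in> \<H> \<alpha>. \<N> \<alpha> k < M}"
  unfolding qpart_def[abs_def] by (rule C1_map_subset[OF so(4)]) (use Om holder_norm_image_ball[OF \<alpha>(1)] in blast)
 assume k: "k \<in> \<H> \<alpha>"
 obtain K' where K': "0 \<le> K'" "Ck_bounded 2 K' (qmap A) (ball 0 (\<N> \<alpha> k + 1))" using Ck_bounded_qmap by blast
 note so' = stat_op_compose[OF \<alpha> K'(2) convex_ball open_ball]
 have im: "k ` sphere 0 1 \<subseteq> ball 0 (\<N> \<alpha> k + 1)" by (rule holder_norm_image_ball[OF \<alpha>(1) k]) simp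
 show "(\<lambda>u. qmap A (k u)) \<in> \<H> \<alpha>" by (rule so'(1)[OF k im])
 show "qpart A k \<in> \<H> \<alpha>" unfolding qpart_def using so'(2)[OF k im] by blast
qed

definition theta :: "complex ^ 'n ^ 'n \<Rightarrow> complex ^ 'n ^ 'n \<Rightarrow> ('n::finite cpoint \<Rightarrow> real) \<Rightarrow> (complex \<Rightarrow> 'n cpoint) \<Rightarrow> complex \<Rightarrow> 'n cpoint" where
 "theta A B \<rho> k = stat_op (\<lambda>u. stat_map A B \<rho> (quad_shift A k u))"

lemma holomorphic_disc_add:
 "holomorphic_disc f \<Longrightarrow> holomorphic_disc g \<Longrightarrow> holomorphic_disc (\<lambda>z. f z + g z)"
 unfolding holomorphic_disc_iff by (auto intro: disc_alg_add)

lemma holomorphic_disc_diff: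
 "holomorphic_disc f \<Longrightarrow> holomorphic_disc g \<Longrightarrow> holomorphic_disc (\<lambda>z. f z - g z)"
 unfolding holomorphic_disc_iff by (auto intro: disc_alg_diff)

subsection \<open>The family of stationary discs\<close>

lemma stationary_discE:
 assumes "stationary_disc S \<rho> h"
 obtains c g where "\<And>\<xi>. norm \<xi> = 1 \<Longrightarrow> c \<xi> \<noteq> (0::real)" "holomorphic_disc g"
  "\<And>\<xi>. norm \<xi> = 1 \<Longrightarrow> g \<xi> = (\<xi> * of_real (c \<xi>) * fst (del \<rho> (h \<xi>)), (\<xi> * of_real (c \<xi>)) *s snd (del \<rho> (h \<xi>)))"
proof -
 have "\<exists>c :: complex \<Rightarrow> real. (\<forall>\<xi>\<in>sphere 0 1. c \<xi> \<noteq> 0) \<and> (\<exists>g. holomorphic_disc g \<and> (\<forall>\<xi>\<in>sphere 0 1.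
  g \<xi> = (\<xi> * of_real (c \<xi>) * fst (del \<rho> (h \<xi>)), (\<xi> * of_real (c \<xi>)) *s snd (del \<rho> (h \<xi>)))))"
  using assms unfolding stationary_disc_def by blast
 then obtain c g where c: "\<forall>\<xi>\<in>sphere 0 1. c \<xi> \<noteq> (0::real)" and g: "holomorphic_disc g" "\<forall>\<xi>\<in>sphere 0 1.
  g \<xi> = (\<xi> * of_real (c \<xi>) * fst (del \<rho> (h \<xi>)), (\<xi> * of_real (c \<xi>)) *s snd (del \<rho> (h \<xi>)))"
  by (elim exE conjE) (rule that, assumption+)
 show thesis by (rule that[of c g, OF _ g(1)]) (use c g(2) in \<open>simp_all add: Ball_def\<close>)
qed

text \<open>One \<rho> together with everything that closeness to the quadric provides, so that the
  constants can be chosen afterwards and independently of \<rho>. The number \<eta> bounds both the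
  size and the Lipschitz constant of the operator \<open>theta\<close>; the condition
  \<open>CL * \<tau> + \<eta> < r / 2\<close> starts the contraction on the ball \<Omega> for every
  parameter in the ball around \<open>t0\<close>.\<close>

locale stationary_family =
 fixes \<alpha> R :: real and A B :: "complex ^ 'n::finite ^ 'n" and \<rho> :: "'n cpoint \<Rightarrow> real"
  and t0 :: "'n params" and j0 :: 'n
  and \<tau> r CL \<eta> K :: real and \<Omega> :: "(complex \<Rightarrow> 'n cpoint) set"
 assumes alpha: "0 < \<alpha>" "\<alpha> < 1" and herm: "hermitian_matrix A" and AB: "A ** B = mat 1"
  and tau: "0 < \<tau>" and r: "0 < r" and CL: "0 \<le> CL" and eta: "0 \<le> \<eta>" "\<eta> \<le> 1 / 2" "CL * \<tau> + \<eta> < r / 2"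
  and param: "\<And>t. t \<in> ball t0 \<tau> \<Longrightarrow> norm (fst t) < 1 \<and> fst (snd (snd t)) $ j0 \<noteq> 0"
  and model_C1: "C1_map UNIV norm (ball t0 \<tau>) (\<H> \<alpha>) (\<N> \<alpha>) (model_disc :: _ \<Rightarrow> complex \<Rightarrow> 'n cpoint)"
  and model_Lip: "\<And>s t. s \<in> ball t0 \<tau> \<Longrightarrow> t \<in> ball t0 \<tau> \<Longrightarrow>
   \<N> \<alpha> (model_disc s - model_disc t :: complex \<Rightarrow> 'n cpoint) \<le> CL * norm (s - t)"
 defines "\<Omega> \<equiv> {k \<in> \<H> \<alpha>. \<N> \<alpha> (k - model_disc t0) < r}"
 assumes shift_Om: "\<And>k. k \<in> \<Omega> \<Longrightarrow> quad_shift A k \<in> \<H> \<alpha> \<and> quad_shift A k ` sphere 0 1 \<subseteq> ball 0 R"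
  and shift_C1: "C1_map (\<H> \<alpha>) (\<N> \<alpha>) \<Omega> (\<H> \<alpha>) (\<N> \<alpha>) (quad_shift A)"
  and theta_Om: "\<And>k. k \<in> \<Omega> \<Longrightarrow> theta A B \<rho> k \<in> \<H> \<alpha> \<and> \<N> \<alpha> (theta A B \<rho> k) \<le> \<eta>"
  and theta_Lip: "\<And>k k'. k \<in> \<Omega> \<Longrightarrow> k' \<in> \<Omega> \<Longrightarrow>
   \<N> \<alpha> (theta A B \<rho> k - theta A B \<rho> k') \<le> \<eta> * \<N> \<alpha> (k - k')"
  and theta_C1: "C1_map (\<H> \<alpha>) (\<N> \<alpha>) \<Omega> (\<H> \<alpha>) (\<N> \<alpha>) (theta A B \<rho>)"
  and rho_pert: "Ck_bounded 2 K (stat_map A B \<rho>) (ball 0 R)"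
  and rho_del: "Ck_bounded 1 2 (\<lambda>z. 2 * fst (del \<rho> z)) (ball 0 R)"
  and rho_reg: "\<And>z. z \<in> ball 0 R \<Longrightarrow> norm (2 * fst (del \<rho> z) - 1) < 1 / 2 \<and> \<D> \<rho> (at z) \<noteq> (\<lambda>_. 0)"
begin

abbreviation "H \<equiv> \<H> \<alpha> :: (complex \<Rightarrow> 'n cpoint) set"
abbreviation "N \<equiv> \<N> \<alpha> :: (complex \<Rightarrow> 'n cpoint) \<Rightarrow> real"
abbreviation "\<Lambda> \<equiv> model_disc :: 'n params \<Rightarrow> complex \<Rightarrow> 'n cpoint"
abbreviation "\<Theta> \<equiv> theta A B \<rho>"

lemmas sH = seminormed_holder[OF alpha(1), where 'b="'n cpoint"]
lemmas DH = seminormedD[OF sH]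

lemma t0: "t0 \<in> ball t0 \<tau>" using tau by simp

lemma model_H: "t \<in> ball t0 \<tau> \<Longrightarrow> \<Lambda> t \<in> H"
 using model_C1 unfolding C1_map_def by blast

lemma Om_H: "k \<in> \<Omega> \<Longrightarrow> k \<in> H" by (simp add: \<Omega>_def)

lemma contraction:
 assumes t: "t \<in> ball t0 \<tau>" shows "\<exists>k\<in>\<Omega>. N (k - (\<Lambda> t + \<Theta> k)) = 0"
proof -
 have "\<exists>k\<in>H. N (k - \<Lambda> t0) < r \<and> N (k - (\<Lambda> t + \<Theta> k)) = 0"
 proof (rule contraction_fixed_point[OF sH seminorm_complete_holder[OF alpha(1)] model_H[OF t0]])
  show "\<Lambda> t + \<Theta> k \<in> H" if "k \<in> H" "N (k - \<Lambda> t0) < r" for k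
   using DH(5)[OF model_H[OF t]] theta_Om[of k] that by (simp add: \<Omega>_def)
  show "N (\<Lambda> t + \<Theta> k - (\<Lambda> t + \<Theta> k')) \<le> N (k - k') / 2"
   if k: "k \<in> H" and k': "k' \<in> H" and "N (k - \<Lambda> t0) < r" "N (k' - \<Lambda> t0) < r" for k k'
  proof -
   have "N (\<Theta> k - \<Theta> k') \<le> \<eta> * N (k - k')" using theta_Lip that by (simp add: \<Omega>_def)
   also have "\<dots> \<le> 1 / 2 * N (k - k')" using eta DH(2)[OF DH(6)[OF k k']] by (intro mult_right_mono) auto
   finally show ?thesis by simp
  qed
  have O0: "\<Lambda> t0 \<in> \<Omega>" using model_H[OF t0] r seminormed_zero[OF sH] by (simp add: \<Omega>_def)
  have "N ((\<Lambda> t - \<Lambda> t0) + \<Theta> (\<Lambda> t0)) \<le> N (\<Lambda> t - \<Lambda> t0) + N (\<Theta> (\<Lambda> t0))"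
   using DH(3)[OF DH(6)[OF model_H[OF t] model_H[OF t0]]] theta_Om[OF O0] by blast
  also have "\<dots> \<le> CL * norm (t - t0) + \<eta>" using model_Lip[OF t t0] theta_Om[OF O0] by linarith
  also have "\<dots> \<le> CL * \<tau> + \<eta>" using t CL by (simp add: dist_norm norm_minus_commute mult_left_mono)
  also have "\<dots> < r / 2" by (rule eta)
  finally show "N (\<Lambda> t + \<Theta> (\<Lambda> t0) - \<Lambda> t0) < r / 2" by (simp add: algebra_simps)
 qed (rule r)
 then show ?thesis by (auto simp: \<Omega>_def)
qed

text \<open>The contraction determines the solution on the circle; a representative has to be
  chosen, and its values elsewhere are arbitrary.\<close>

definition kf :: "'n params \<Rightarrow> complex \<Rightarrow> 'n cpoint" where
 "kf t = (SOME k. k \<in> \<Omega> \<and> N (k - (\<Lambda> t + \<Theta> k)) = 0)"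

lemma kf: assumes "t \<in> ball t0 \<tau>" shows "kf t \<in> \<Omega> \<and> N (kf t - (\<Lambda> t + \<Theta> (kf t))) = 0"
proof -
 have "\<exists>k. k \<in> \<Omega> \<and> N (k - (\<Lambda> t + \<Theta> k)) = 0" using contraction[OF assms] by blast
 from someI_ex[OF this] show ?thesis unfolding kf_def .
qed

lemma fixed_point_on_circle:
 assumes "k \<in> \<Omega>" "\<Lambda> t \<in> H" "N (k - (\<Lambda> t + \<Theta> k)) = 0" "norm \<xi> = 1"
 shows "k \<xi> = \<Lambda> t \<xi> + \<Theta> k \<xi>"
 using holder_null[OF alpha(1) Om_H[OF assms(1)] DH(5)[OF assms(2), of "\<Theta> k"]] theta_Om[OF assms(1)] assms(3,4) by simp

lemma kf_eq: "t \<in> ball t0 \<tau> \<Longrightarrow> norm \<xi> = 1 \<Longrightarrow> kf t \<xi> = \<Lambda> t \<xi> + \<Theta> (kf t) \<xi>"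
 using fixed_point_on_circle[of "kf t" t] kf[of t] model_H[of t] by simp

text \<open>On the circle this is the shifted solution \<open>quad_shift A (kf t)\<close>. Writing
  out the right-hand side of the equation gives a function that is holomorphic in the disc, because
  the two operators depend on \<open>kf t\<close> through its boundary values only.\<close>

definition Ff :: "'n params \<Rightarrow> complex \<Rightarrow> 'n cpoint" where
 "Ff t z = \<Lambda> t z + \<Theta> (kf t) z + qpart A (kf t) z"

lemma Ff_circle: "t \<in> ball t0 \<tau> \<Longrightarrow> norm \<xi> = 1 \<Longrightarrow> Ff t \<xi> = quad_shift A (kf t) \<xi>"
 by (simp add: Ff_def quad_shift_def kf_eq)

lemma Ff_H: assumes "t \<in> ball t0 \<tau>" shows "Ff t \<in> H" "N (Ff t - quad_shift A (kf t)) = 0"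
proof -
 have e: "Ff t \<xi> = quad_shift A (kf t) \<xi>" if "\<xi> \<in> sphere 0 1" for \<xi> using Ff_circle[OF assms] that by simp
 have s: "quad_shift A (kf t) \<in> H" using shift_Om[of "kf t"] kf[OF assms] by simp
 show *: "Ff t \<in> H" using holder_norm_cong(2)[OF e, where \<alpha>=\<alpha>] s by simp
 show "N (Ff t - quad_shift A (kf t)) = 0"
  using holder_null[OF alpha(1) * s] e by simp
qed

lemma kf_C1: "C1_map UNIV norm (ball t0 \<tau>) H N kf"
proof (rule C1_map_fixed_point[OF sH seminorm_complete_holder[OF alpha(1)] model_C1 theta_C1 _ _ _ kf])
 show "\<Omega> \<subseteq> H" by (auto simp: \<Omega>_def)
 show "\<exists>d>0. \<forall>y\<in>H. N (y - x) < d \<longrightarrow> y \<in> \<Omega>" if x: "x \<in> \<Omega>" for x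
 proof (intro exI conjI ballI impI)
  show "0 < r - N (x - \<Lambda> t0)" using x by (simp add: \<Omega>_def)
  fix y assume y: "y \<in> H" "N (y - x) < r - N (x - \<Lambda> t0)"
  then show "y \<in> \<Omega>" using seminormed_triangle[OF sH y(1) Om_H[OF x] model_H[OF t0]] by (simp add: \<Omega>_def)
 qed
 show "N (\<Theta> x - \<Theta> y) \<le> N (x - y) / 2" if "x \<in> \<Omega>" "y \<in> \<Omega>" for x y
 proof -
  have "N (\<Theta> x - \<Theta> y) \<le> \<eta> * N (x - y)" by (rule theta_Lip[OF that])
  also have "\<dots> \<le> 1 / 2 * N (x - y)" using eta DH(2)[OF DH(6)[OF Om_H Om_H, OF that]] by (intro mult_right_mono) auto
  finally show ?thesis by simp
 qed
qed

lemma Ff_C1: "C1_map UNIV norm (ball t0 \<tau>) H N Ff"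
proof (rule C1_map_null_cong[OF sH])
 show "C1_map UNIV norm (ball t0 \<tau>) H N (\<lambda>t. quad_shift A (kf t))"
  by (rule C1_map_compose[OF seminormed_norm sH sH subset_UNIV _ kf_C1 shift_C1]) (use kf in \<open>auto simp: \<Omega>_def\<close>)
qed (use Ff_H in auto)

lemma Ff_holomorphic: assumes t: "t \<in> ball t0 \<tau>" shows "holomorphic_disc (Ff t)"
proof -
 have k: "kf t \<in> \<Omega>" using kf[OF t] by blast
 have s: "quad_shift A (kf t) \<in> H" "quad_shift A (kf t) ` sphere 0 1 \<subseteq> ball 0 R" using shift_Om[OF k] by blast+
 have "(\<lambda>u. stat_map A B \<rho> (quad_shift A (kf t) u)) \<in> H"
  by (rule stat_op_compose(1)[OF alpha rho_pert convex_ball open_ball s])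
 then have 1: "holomorphic_disc (\<Theta> (kf t))" unfolding theta_def by (rule stat_op_holomorphic[OF alpha])
 have 2: "holomorphic_disc (qpart A (kf t))" unfolding qpart_def
  by (rule stat_op_holomorphic[OF alpha qpart_bounds(3)[OF alpha Om_H[OF k]]])
 have 3: "holomorphic_disc (\<Lambda> t)" by (rule model_disc_holomorphic) (use param[OF t] in blast)
 show ?thesis unfolding Ff_def[abs_def] by (rule holomorphic_disc_add[OF holomorphic_disc_add[OF 3 1] 2])
qed

lemma Ff_0: "snd (Ff (a, v, w, y) 0) = v" "Im (fst (Ff (a, v, w, y) 0)) = y"
 by (simp_all add: Ff_def model_disc_0 theta_def qpart_def stat_op_0)

text \<open>Undoing the shift recovers \<open>kf\<close> on the circle, the equation then recovers
  the model disc, and \<open>model_disc_param_dist\<close> with distance 0 identifies the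
  parameters.\<close>

lemma Ff_injective:
 assumes s: "s \<in> ball t0 \<tau>" and t: "t \<in> ball t0 \<tau>" and eq: "\<And>\<xi>. norm \<xi> = 1 \<Longrightarrow> Ff s \<xi> = Ff t \<xi>"
 shows "s = t"
proof -
 have Q: "quad_shift A (kf s) \<xi> = quad_shift A (kf t) \<xi>" if "norm \<xi> = 1" for \<xi>
  using eq[OF that] Ff_circle s t that by simp
 have q: "qpart A (quad_shift A (kf s)) = qpart A (quad_shift A (kf t))" by (rule qpart_cong) (simp add: Q)
 have k: "kf s \<xi> = kf t \<xi>" if "norm \<xi> = 1" for \<xi>
  using quad_shift_inverse(2)[OF that, of "kf s" A] quad_shift_inverse(2)[OF that, of "kf t" A] Q[OF that] q by simp
 have "\<Theta> (kf s) = \<Theta> (kf t)" unfolding theta_def by (rule stat_op_cong) (simp add: Q)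
 then have "\<Lambda> s \<xi> = \<Lambda> t \<xi>" if "norm \<xi> = 1" for \<xi> using kf_eq[OF s that] kf_eq[OF t that] k[OF that] by simp
 then have "norm (s - t) \<le> (6 / norm (fst (snd (snd t)) $ j0) + 3 * real CARD('n) + 1) * 0"
  by (intro model_disc_param_dist) (use param[OF s] param[OF t] in auto)
 then show ?thesis by simp
qed

lemma pert_component:
 assumes h: "h \<in> H" "h ` sphere 0 1 \<subseteq> ball 0 R"
 obtains m where "\<And>i. disc_alg (m i)"
  "\<And>i \<xi>. norm \<xi> = 1 \<Longrightarrow> stat_pert A B \<rho> (h \<xi>) i = snd (stat_op (\<lambda>u. stat_map A B \<rho> (h u)) \<xi>) $ i + cnj (m i \<xi>)"
proof -
 have f: "(\<lambda>u. stat_map A B \<rho> (h u)) \<in> H" by (rule stat_op_compose(1)[OF alpha rho_pert convex_ball open_ball h])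
 have "\<exists>m. disc_alg m \<and> (\<forall>\<xi>. norm \<xi> = 1 \<longrightarrow> stat_pert A B \<rho> (h \<xi>) i = snd (stat_op (\<lambda>u. stat_map A B \<rho> (h u)) \<xi>) $ i + cnj (m \<xi>))" for i
  by (rule stat_op_snd[OF alpha f, of i]) (auto simp: stat_map_def)
 then have "\<forall>i. \<exists>m. disc_alg m \<and> (\<forall>\<xi>. norm \<xi> = 1 \<longrightarrow> stat_pert A B \<rho> (h \<xi>) i = snd (stat_op (\<lambda>u. stat_map A B \<rho> (h u)) \<xi>) $ i + cnj (m \<xi>))" by blast
 from choice[OF this] show ?thesis using that by blast
qed

lemma del_exponent:
 assumes h: "h \<in> H" "h ` sphere 0 1 \<subseteq> ball 0 R"
 obtains k p where "disc_alg k" "\<And>\<xi>. norm \<xi> = 1 \<Longrightarrow> p \<xi> > (0::real)"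
  "\<And>\<xi>. norm \<xi> = 1 \<Longrightarrow> 2 * fst (del \<rho> (h \<xi>)) = of_real (p \<xi>) * exp (k \<xi>)"
  "continuous_on (sphere 0 1) (\<lambda>\<xi>. fst (del \<rho> (h \<xi>)))"
proof -
 have u: "(\<lambda>\<xi>. 2 * fst (del \<rho> (h \<xi>))) \<in> \<H> \<alpha>"
  by (rule holder_compose(1)[OF alpha(1) _ convex_ball h, where k=0 and K=2]) (use rho_del in \<open>simp only: One_nat_def\<close>)
 have u1: "norm (2 * fst (del \<rho> (h \<xi>)) - 1) < 1 / 2" if "norm \<xi> = 1" for \<xi>
 proof -
  have "h \<xi> \<in> ball 0 R" using h(2) that by (simp add: image_subset_iff)
  then show ?thesis using rho_reg by blast
 qed
 have "continuous_on (sphere 0 1) (\<lambda>\<xi>. (1 / 2) * (2 * fst (del \<rho> (h \<xi>))))"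
  by (intro continuous_on_mult continuous_on_const holder_continuous_on[OF alpha(1) u])
 then have c: "continuous_on (sphere 0 1) (\<lambda>\<xi>. fst (del \<rho> (h \<xi>)))" by simp
 show ?thesis
  by (rule exists_conjugate_exponent[OF alpha u u1], assumption) (rule that[OF _ _ _ c])
qed

text \<open>The first component of the equation says that the boundary lies in the hypersurface; the
  others are the hypothesis of \<open>form_imp_stationary\<close>, with the antiholomorphic part of
  the perturbation as remainder.\<close>

lemma Ff_stationary:
 assumes t: "t \<in> ball t0 \<tau>" shows "Ff t \<in> nonconstant_stationary_discs (ball 0 R) \<rho>"
proof -
 obtain a v w y where t': "t = (a, v, w, y)" by (cases t)
 have a: "norm a < 1" and w: "w $ j0 \<noteq> 0" using param[OF t] t' by simp_all
 let ?h = "quad_shift A (kf t)" and ?f = "\<lambda>u. stat_map A B \<rho> (quad_shift A (kf t) u)"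
 have k: "kf t \<in> \<Omega>" using kf[OF t] by blast
 have h: "?h \<in> H" "?h ` sphere 0 1 \<subseteq> ball 0 R" using shift_Om[OF k] by blast+
 have f: "?f \<in> H" by (rule stat_op_compose(1)[OF alpha rho_pert convex_ball open_ball h])
 have q: "(\<lambda>u. qmap A (kf t u)) \<in> H" by (rule qpart_bounds(3)[OF alpha Om_H[OF k]])
 have Fh: "Ff t \<xi> = ?h \<xi>" if "norm \<xi> = 1" for \<xi> by (rule Ff_circle[OF t that])
 have FH: "Ff t \<in> H" by (rule Ff_H[OF t])
 have FR: "Ff t ` sphere 0 1 \<subseteq> ball 0 R"
 proof (rule image_subsetI)
  fix \<xi> :: complex assume "\<xi> \<in> sphere 0 1"
  then show "Ff t \<xi> \<in> ball 0 R" using h(2) Fh[of \<xi>] by (simp add: image_subset_iff)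
 qed
 have snd_F: "snd (Ff t z) $ i = v $ i + w $ i * (z / (1 - a * z)) + snd (stat_op ?f z) $ i" if "norm z \<le> 1" for z i
  by (simp add: Ff_def snd_qpart[OF that] t' model_disc_def theta_def)
 \<comment> \<open>\<open>stat_op\<close> preserves the real part of the first component. Hence the
   real part of the disc is the quadratic form plus \<open>quadric_fun A - \<rho>\<close>, which
   leaves exactly \<rho> = 0.\<close>
 have rho0: "\<rho> (Ff t \<xi>) = 0" if z: "norm \<xi> = 1" for \<xi>
 proof -
  have "Re (fst (Ff t \<xi>)) = Re (fst (?f \<xi>)) + Re (fst (qmap A (kf t \<xi>)))"
   using stat_op_Re[OF alpha f z] stat_op_Re[OF alpha q z]
   by (simp add: Ff_def t' model_disc_def theta_def qpart_def)
  moreover have "qmap A (kf t \<xi>) = qmap A (?h \<xi>)" by (rule qmap_cong) (simp add: snd_quad_shift z)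
  ultimately show ?thesis by (simp add: stat_map_def qmap_def Fh[OF z] quadric_fun_qform)
 qed
 obtain m where m: "\<And>i. disc_alg (m i)"
  "\<And>i \<xi>. norm \<xi> = 1 \<Longrightarrow> stat_pert A B \<rho> (?h \<xi>) i = snd (stat_op ?f \<xi>) $ i + cnj (m i \<xi>)"
  by (rule pert_component[OF h], rule that)
 obtain e p where e: "disc_alg e" "\<And>\<xi>. norm \<xi> = 1 \<Longrightarrow> p \<xi> > (0::real)"
  "\<And>\<xi>. norm \<xi> = 1 \<Longrightarrow> 2 * fst (del \<rho> (Ff t \<xi>)) = of_real (p \<xi>) * exp (e \<xi>)"
  "continuous_on (sphere 0 1) (\<lambda>\<xi>. fst (del \<rho> (Ff t \<xi>)))"
  by (rule del_exponent[OF FH FR], rule that)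
 have "stationary_disc (ball 0 R) \<rho> (Ff t)"
 proof (rule form_imp_stationary[OF AB Ff_holomorphic[OF t] _ _ e(4,1) _ e(3) m(1) a, where v=v and w=w])
  show "Ff t ` sphere 0 1 \<subseteq> zero_hypersurface (ball 0 R) \<rho>"
   using FR rho0 by (simp add: zero_hypersurface_def image_subset_iff)
  show "frechet_derivative \<rho> (at z) \<noteq> (\<lambda>_. 0)" if "z \<in> zero_hypersurface (ball 0 R) \<rho>" for z
   using rho_reg[of z] that by (simp add: zero_hypersurface_def)
  show "p \<xi> \<noteq> 0" if "norm \<xi> = 1" for \<xi> using e(2)[OF that] by simp
  show "snd (Ff t \<xi>) $ i - stat_pert A B \<rho> (Ff t \<xi>) i = v $ i + w $ i * (\<xi> / (1 - a * \<xi>)) - cnj (m i \<xi>)"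
   if "norm \<xi> = 1" for i \<xi> using m(2)[OF that, of i] snd_F[of \<xi> i] that by (simp add: Fh)
 qed
 moreover have "\<not> Ff t constant_on cball 0 1"
 proof
  assume "Ff t constant_on cball 0 1"
  then obtain c where c: "\<And>z. norm z \<le> 1 \<Longrightarrow> Ff t z = c" by (auto simp: constant_on_def)
  \<comment> \<open>For a constant disc the perturbation term is constant on the circle and has no
    positive frequencies. Then \<open>w $ j0 * (z / (1 - a * z))\<close> would have to take the same
    value at 1/2 and 0.\<close>
  have "stat_op ?f = stat_op (\<lambda>_. stat_map A B \<rho> c)" by (rule stat_op_cong) (simp add: c flip: Fh)
  then have s: "snd (stat_op ?f (1 / 2)) $ j0 = 0" "snd (stat_op ?f 0) $ j0 = 0"
   by (simp_all add: stat_op_def cauchy_of_disc_alg[OF disc_alg_const])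
  have "snd (Ff t (1 / 2)) $ j0 = snd (Ff t 0) $ j0" using c[of "1 / 2"] c[of 0] by simp
  then have "w $ j0 * ((1 / 2) / (1 - a * (1 / 2))) = 0" using snd_F[of "1 / 2" j0] snd_F[of 0 j0] s by simp
  moreover have "1 - a * (1 / 2) \<noteq> 0" by (rule one_minus_mult_ne[OF a]) simp
  ultimately show False using w by simp
 qed
 ultimately show ?thesis by (simp add: nonconstant_stationary_discs_def)
qed

text \<open>The converse of \<open>Ff_stationary\<close>: every Hoelder stationary disc satisfies
  the equation with some parameter. That the parameter is near \<open>t0\<close> is a separate
  matter, settled in \<open>capture\<close>.\<close>

lemma stationary_representation:
 assumes st: "stationary_disc (ball 0 R) \<rho> h" and hH: "h \<in> H"
 shows "\<exists>t. norm (fst t) < 1 \<and> (\<forall>z. norm z \<le> 1 \<longrightarrow>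
  h z = \<Lambda> t z + stat_op (\<lambda>u. stat_map A B \<rho> (h u)) z + qpart A h z)"
proof -
 let ?f = "\<lambda>u. stat_map A B \<rho> (h u)"
 have hol: "holomorphic_disc h" and hS: "h ` sphere 0 1 \<subseteq> zero_hypersurface (ball 0 R) \<rho>"
  using st by (simp_all add: stationary_disc_def)
 have hR: "h ` sphere 0 1 \<subseteq> ball 0 R" using hS by (auto simp: zero_hypersurface_def)
 have rho0: "\<rho> (h \<xi>) = 0" if "norm \<xi> = 1" for \<xi> using hS that by (simp add: zero_hypersurface_def image_subset_iff)
 obtain c g where c: "\<And>\<xi>. norm \<xi> = 1 \<Longrightarrow> c \<xi> \<noteq> (0::real)" and g: "holomorphic_disc g"
  and gc: "\<And>\<xi>. norm \<xi> = 1 \<Longrightarrow> g \<xi> = (\<xi> * of_real (c \<xi>) * fst (del \<rho> (h \<xi>)), (\<xi> * of_real (c \<xi>)) *s snd (del \<rho> (h \<xi>)))"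
  by (rule stationary_discE[OF st], rule that)
 have f: "?f \<in> H" by (rule stat_op_compose(1)[OF alpha rho_pert convex_ball open_ball hH hR])
 have q: "(\<lambda>u. qmap A (h u)) \<in> H" by (rule qpart_bounds(3)[OF alpha hH])
 obtain m where m: "\<And>i. disc_alg (m i)"
  "\<And>i \<xi>. norm \<xi> = 1 \<Longrightarrow> stat_pert A B \<rho> (h \<xi>) i = snd (stat_op ?f \<xi>) $ i + cnj (m i \<xi>)"
  by (rule pert_component[OF hH hR], rule that)
 obtain e p where e: "disc_alg e" "\<And>\<xi>. norm \<xi> = 1 \<Longrightarrow> p \<xi> > (0::real)"
  "\<And>\<xi>. norm \<xi> = 1 \<Longrightarrow> 2 * fst (del \<rho> (h \<xi>)) = of_real (p \<xi>) * exp (e \<xi>)"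
  by (rule del_exponent[OF hH hR], rule that)
 have f1: "disc_alg (\<lambda>z. snd (stat_op ?f z) $ i)" for i
  using stat_op_holomorphic[OF alpha f] by (simp add: holomorphic_disc_iff)
 have p0: "p \<xi> \<noteq> 0" if "norm \<xi> = 1" for \<xi> using e(2)[OF that] by simp
 obtain a v w where a: "norm a < 1"
  and vw: "\<And>z i. norm z \<le> 1 \<Longrightarrow> snd (h z) $ i = v $ i + w $ i * (z / (1 - a * z)) + snd (stat_op ?f z) $ i"
  by (rule stationary_imp_form[OF AB hol c g gc e(1) p0 e(3) f1 m(1) m(2)], assumption+) (rule that)
 define y where "y = Im (fst (h 0))"
 have "fst (h z) = \<i> * y + fst (stat_op (\<lambda>u. ?f u + qmap A (h u)) z)" if z: "norm z \<le> 1" for z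
  unfolding y_def
 proof (rule stat_op_fst_unique[OF alpha _ _ _ z])
  show "(\<lambda>u. ?f u + qmap A (h u)) \<in> H" using DH(5)[OF f q] by (simp add: plus_fun_def)
  show "disc_alg (\<lambda>z. fst (h z))" using hol by (simp add: holomorphic_disc_iff)
  show "Re (fst (h \<xi>)) = Re (fst (?f \<xi> + qmap A (h \<xi>)))" if "norm \<xi> = 1" for \<xi>
   using rho0[OF that] by (simp add: stat_map_def qmap_def quadric_fun_qform)
 qed
 then have "fst (h z) = \<i> * y + fst (stat_op ?f z) + fst (qpart A h z)" if "norm z \<le> 1" for z
  using stat_op_add[OF alpha f q that] that by (simp add: qpart_def add.assoc)
 then have "h z = \<Lambda> (a, v, w, y) z + stat_op ?f z + qpart A h z" if "norm z \<le> 1" for z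
  using vw[OF that] that snd_qpart[OF that, of A h]
  by (simp add: prod_eq_iff model_disc_def vec_eq_iff)
 then show ?thesis using a by (intro exI[of _ "(a, v, w, y)"]) simp
qed

text \<open>On the circle the model disc of h is k - \<Theta> k and thus within
  \<open>N (k - \<Lambda> t0) + \<eta>\<close> of the one of \<open>t0\<close>; reading off
  parameters puts t into the ball. Then k and \<open>kf t\<close> solve the same contraction
  equation and agree on the circle.\<close>

lemma capture:
 assumes st: "stationary_disc (ball 0 R) \<rho> h" and hH: "h \<in> H" and k: "h - qpart A h \<in> \<Omega>"
  and small: "(6 / norm (fst (snd (snd t0)) $ j0) + 3 * real CARD('n) + 1) * (N ((h - qpart A h) - \<Lambda> t0) + \<eta>) < \<tau>"
 shows "\<exists>t\<in>ball t0 \<tau>. \<forall>\<xi>\<in>sphere 0 1. Ff t \<xi> = h \<xi>"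
proof -
 define k where "k = h - qpart A h"
 have kO: "k \<in> \<Omega>" using k by (simp add: k_def)
 have Qk: "quad_shift A k = h" unfolding k_def by (rule quad_shift_inverse)
 have Tk: "\<Theta> k = stat_op (\<lambda>u. stat_map A B \<rho> (h u))" by (simp add: theta_def Qk)
 obtain t where t1: "norm (fst t) < 1"
  and rep: "\<And>z. norm z \<le> 1 \<Longrightarrow> h z = \<Lambda> t z + stat_op (\<lambda>u. stat_map A B \<rho> (h u)) z + qpart A h z"
  using stationary_representation[OF st hH] by (elim exE conjE) (rule that, auto)
 have ke: "k \<xi> = \<Lambda> t \<xi> + \<Theta> k \<xi>" if "norm \<xi> = 1" for \<xi>
  using rep[of \<xi>] that unfolding Tk by (simp add: k_def)
 have T: "\<Theta> k \<in> H" "N (\<Theta> k) \<le> \<eta>" using theta_Om[OF kO] by blast+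
 have "norm (t - t0) \<le> (6 / norm (fst (snd (snd t0)) $ j0) + 3 * real CARD('n) + 1) * (N (k - \<Lambda> t0) + \<eta>)"
 proof (rule model_disc_param_dist[OF t1])
  fix \<xi> :: complex assume z: "norm \<xi> = 1"
  have "norm (\<Lambda> t \<xi> - \<Lambda> t0 \<xi>) = norm ((k \<xi> - \<Lambda> t0 \<xi>) - \<Theta> k \<xi>)" using ke[OF z] by (simp add: algebra_simps)
  also have "\<dots> \<le> norm (k \<xi> - \<Lambda> t0 \<xi>) + norm (\<Theta> k \<xi>)" by (rule norm_triangle_ineq4)
  also have "\<dots> \<le> N (k - \<Lambda> t0) + \<eta>"
   using holderD(2)[OF alpha(1) DH(6)[OF Om_H[OF kO] model_H[OF t0]], of \<xi>] holderD(2)[OF alpha(1) T(1), of \<xi>] T(2) z by simp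
  finally show "norm (\<Lambda> t \<xi> - \<Lambda> t0 \<xi>) \<le> N (k - \<Lambda> t0) + \<eta>" .
 qed (use param[OF t0] in auto)
 also have "\<dots> < \<tau>" using small by (simp add: k_def)
 finally have t: "t \<in> ball t0 \<tau>" by (simp add: dist_norm norm_minus_commute)
 have kt: "kf t \<in> \<Omega>" using kf[OF t] by blast
 have d: "(k - kf t) \<xi> = (\<Theta> k - \<Theta> (kf t)) \<xi>" if "\<xi> \<in> sphere 0 1" for \<xi> using ke[of \<xi>] kf_eq[OF t, of \<xi>] that by simp
 have "N (k - kf t) = N (\<Theta> k - \<Theta> (kf t))" by (rule holder_norm_cong(1)[OF d])
 also have "\<dots> \<le> \<eta> * N (k - kf t)" by (rule theta_Lip[OF kO kt])
 also have "\<dots> \<le> 1 / 2 * N (k - kf t)" using eta DH(2)[OF DH(6)[OF Om_H[OF kO] Om_H[OF kt]]] by (intro mult_right_mono) auto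
 finally have "N (k - kf t) = 0" using DH(2)[OF DH(6)[OF Om_H[OF kO] Om_H[OF kt]]] by simp
 then have "k \<xi> = kf t \<xi>" if "norm \<xi> = 1" for \<xi> using holder_null[OF alpha(1) Om_H[OF kO] Om_H[OF kt]] that by simp
 then have "quad_shift A k \<xi> = quad_shift A (kf t) \<xi>" if "norm \<xi> = 1" for \<xi> using quad_shift_cong that by blast
 then have "\<forall>\<xi>\<in>sphere 0 1. Ff t \<xi> = h \<xi>" using Ff_circle[OF t] by (simp add: Qk)
 then show ?thesis using t by blast
qed

end

subsection \<open>Discs with a fixed centre\<close>

lemma disc_deriv_cong:
 assumes "\<And>z. norm z < 1 \<Longrightarrow> f z = g z" shows "disc_deriv f 0 = disc_deriv (g :: complex \<Rightarrow> 'n::finite cpoint) 0"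
proof -
 have ev: "\<forall>\<^sub>F z in nhds 0. f z = g z"
  using assms by (intro eventually_nhds_in_open[of "ball 0 1", THEN eventually_mono]) auto
 have "deriv (\<lambda>z. fst (f z)) 0 = deriv (\<lambda>z. fst (g z)) 0"
  by (rule deriv_cong_ev[OF eventually_mono[OF ev] refl]) simp
 moreover have "deriv (\<lambda>z. snd (f z) $ j) 0 = deriv (\<lambda>z. snd (g z) $ j) 0" for j
  by (rule deriv_cong_ev[OF eventually_mono[OF ev] refl]) simp
 ultimately show ?thesis by (simp add: disc_deriv_def)
qed

lemma holomorphic_disc_differentiable:
 assumes "holomorphic_disc f"
 shows "(\<lambda>z. fst (f z)) field_differentiable (at 0)" "(\<lambda>z. snd (f z) $ j) field_differentiable (at 0)"
 using assms unfolding holomorphic_disc_def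
 by (auto intro!: holomorphic_on_imp_differentiable_at[where s="ball 0 1"])

lemma disc_deriv_add:
 fixes f g :: "complex \<Rightarrow> 'n::finite cpoint"
 assumes "holomorphic_disc f" "holomorphic_disc g"
 shows "disc_deriv (\<lambda>z. f z + g z) 0 = disc_deriv f 0 + disc_deriv g 0"
 using holomorphic_disc_differentiable[OF assms(1)] holomorphic_disc_differentiable[OF assms(2)]
 by (simp add: disc_deriv_def prod_eq_iff vec_eq_iff)

lemma disc_deriv_scaleR:
 fixes f :: "complex \<Rightarrow> 'n::finite cpoint"
 assumes "holomorphic_disc f" shows "disc_deriv (\<lambda>z. c *\<^sub>R f z) 0 = c *\<^sub>R disc_deriv f 0"
 using holomorphic_disc_differentiable[OF assms]
 by (simp add: disc_deriv_def prod_eq_iff vec_eq_iff scaleR_conv_of_real)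

text \<open>These are the bounds which \<open>local_diffeo_criterion\<close> asks of the linear
  extensions of the centre and of the derivative at the centre.\<close>

lemma norm_vcauchy_le:
 fixes g :: "complex \<Rightarrow> 'n::finite cpoint"
 assumes \<alpha>: "0 < \<alpha>" "\<alpha> < 1" and g: "g \<in> \<H> \<alpha>"
 shows "norm (vcauchy g 0) \<le> (1 + real CARD('n)) * \<N> \<alpha> g"
  and "norm (disc_deriv (vcauchy g) 0) \<le> (1 + real CARD('n)) * (2 * ((1 + real CARD('n)) * (1 + 2 * cauchy_const \<alpha>))) * \<N> \<alpha> g"
proof -
 let ?N = "\<N> \<alpha> g" and ?n = "real CARD('n)"
 note gf = holder_fst[OF \<alpha>(1) g] and gs = holder_snd[OF \<alpha>(1) g]
 have cc: "0 \<le> 1 + 2 * cauchy_const \<alpha>" using cauchy_const_nonneg[OF \<alpha>] by simp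
 have sum: "norm x + (\<Sum>j\<in>(UNIV::'n set). norm (y j)) \<le> (1 + ?n) * B" if "norm x \<le> B" "\<And>j. norm (y j) \<le> B" for x :: complex and y :: "'n \<Rightarrow> complex" and B
 proof -
  have "(\<Sum>j\<in>(UNIV::'n set). norm (y j)) \<le> (\<Sum>j\<in>(UNIV::'n set). B)" by (intro sum_mono that)
  then show ?thesis using that(1) by (simp add: distrib_right)
 qed
 have "norm (cauchy (\<lambda>u. fst (g u)) 0) \<le> ?N" using norm_cauchy_0_holder[OF \<alpha>(1) gf(1)] gf(2) by linarith
 moreover have "norm (cauchy (\<lambda>u. snd (g u) $ j) 0) \<le> ?N" for j using norm_cauchy_0_holder[OF \<alpha>(1) gs(1)] gs(2)[of j] by (meson order_trans)
 ultimately show "norm (vcauchy g 0) \<le> (1 + ?n) * ?N"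
  by (intro order_trans[OF norm_cpoint_le sum]) (simp_all add: vcauchy_def)
 have "norm (vcauchy g \<xi>) \<le> (1 + ?n) * ((1 + 2 * cauchy_const \<alpha>) * ?N)" if z: "norm \<xi> = 1" for \<xi>
 proof -
  have b: "norm (cauchy f \<xi>) \<le> (1 + 2 * cauchy_const \<alpha>) * ?N" if "f \<in> \<H> \<alpha>" "\<N> \<alpha> f \<le> ?N" for f
   using holderD(2)[OF \<alpha>(1) cauchy_holder(1)[OF \<alpha> that(1)], of \<xi>] cauchy_holder(2)[OF \<alpha> that(1)] mult_left_mono[OF that(2) cc] z by simp
  show ?thesis
   by (intro order_trans[OF norm_cpoint_le sum]) (simp_all add: vcauchy_def b gf gs)
 qed
 from holomorphic_disc_at_0_bound(2)[OF vcauchy_holomorphic_disc[OF \<alpha> g] this]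
 show "norm (disc_deriv (vcauchy g) 0) \<le> (1 + ?n) * (2 * ((1 + ?n) * (1 + 2 * cauchy_const \<alpha>))) * ?N"
  by (simp add: mult_ac)
qed

lemma Re_complex_of_real_mult: "Re (complex_of_real r * z) = r * Re z"
 by simp

lemma Re_cayley: "Re ((1 + b) * cnj (1 - b)) = 1 - (norm b)\<^sup>2"
 unfolding cmod_power2 by (simp add: algebra_simps power2_eq_square)

lemma qform_cscale: "qform A (0, \<chi> j. w $ j * c) (0, \<chi> j. w $ j * c) = (norm c)\<^sup>2 * qform A (0, w) (0, w)"
proof -
 have "cnj (w $ i * c) * A $ i $ j * (w $ j * c) = of_real ((norm c)\<^sup>2) * (cnj (w $ i) * A $ i $ j * w $ j)" for i j
  using complex_norm_square[of c] by (simp add: mult_ac)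
 then have "(\<Sum>i\<in>UNIV. \<Sum>j\<in>UNIV. cnj (w $ i * c) * A $ i $ j * (w $ j * c)) = of_real ((norm c)\<^sup>2) * (\<Sum>i\<in>UNIV. \<Sum>j\<in>UNIV. cnj (w $ i) * A $ i $ j * w $ j)"
  by (simp only: sum_distrib_left)
 then show ?thesis unfolding qform_def snd_conv vec_lambda_beta by (simp only: Re_complex_of_real_mult)
qed

text \<open>The real part of the first component at 0 of the quadric's disc with parameters
  \<open>a\<close> and \<open>w\<close> and \<open>v = 0\<close>, see
  \<open>Gm_values\<close>.\<close>

definition centre_value :: "complex ^ 'n ^ 'n \<Rightarrow> complex \<Rightarrow> complex ^ 'n::finite \<Rightarrow> real" where
 "centre_value A a w = qform A (0, w) (0, w) / (1 - (norm a)\<^sup>2)"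

text \<open>On the circle |\<xi> / (1 - a \<xi>)|^2 is the real part of (1 + a \<xi>) / (1 - a
  \<xi>) divided by 1 - |a|^2, so the holomorphic completion of the quadratic term is
  explicit.\<close>

lemma fst_qpart_model:
 fixes A :: "complex ^ 'n::finite ^ 'n"
 assumes \<alpha>: "0 < \<alpha>" "\<alpha> < 1" and a: "norm a < 1" and mH: "(model_disc (a, 0, w, y) :: complex \<Rightarrow> 'n cpoint) \<in> \<H> \<alpha>" and z: "norm z \<le> 1"
 shows "fst (qpart A (model_disc (a, 0, w, y)) z) = of_real (centre_value A a w) * ((1 + a * z) / (1 - a * z))"
proof -
 define g where "g z = of_real (centre_value A a w) * ((1 + a * z) / (1 - a * z))" for z
 have dg: "disc_alg g" unfolding g_def[abs_def]
  by (auto intro!: disc_alg_add disc_alg_mult disc_alg_divide disc_alg_diff simp: one_minus_mult_ne[OF a, simplified])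
 have "g z = \<i> * Im (g 0) + fst (stat_op (\<lambda>u. qmap A (model_disc (a, 0, w, y) u)) z)"
 proof (rule stat_op_fst_unique[OF \<alpha> qpart_bounds(3)[OF \<alpha> mH] dg _ z])
  fix \<xi> :: complex assume 1: "norm \<xi> = 1"
  have ne: "1 - a * \<xi> \<noteq> 0" using one_minus_mult_ne[OF a, of \<xi>] 1 by simp
  have a2: "1 - (norm a)\<^sup>2 \<noteq> 0" using a abs_square_less_1[of "norm a"] by simp
  have "Re ((1 + a * \<xi>) / (1 - a * \<xi>)) = Re ((1 + a * \<xi>) * cnj (1 - a * \<xi>)) / (norm (1 - a * \<xi>))\<^sup>2"
   by (subst complex_div_cnj) simp
  also have "Re ((1 + a * \<xi>) * cnj (1 - a * \<xi>)) = 1 - (norm (a * \<xi>))\<^sup>2" by (rule Re_cayley)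
  also have "norm (a * \<xi>) = norm a" using 1 by (simp add: norm_mult)
  finally have re: "Re ((1 + a * \<xi>) / (1 - a * \<xi>)) = (1 - (norm a)\<^sup>2) / (norm (1 - a * \<xi>))\<^sup>2" .
  have "Re (g \<xi>) = centre_value A a w * Re ((1 + a * \<xi>) / (1 - a * \<xi>))" by (simp only: g_def Re_complex_of_real_mult)
  also have "\<dots> = (norm (\<xi> / (1 - a * \<xi>)))\<^sup>2 * qform A (0, w) (0, w)"
   using 1 a2 by (simp add: re centre_value_def norm_divide power_divide)
  also have "\<dots> = qform A (0, \<chi> j. w $ j * (\<xi> / (1 - a * \<xi>))) (0, \<chi> j. w $ j * (\<xi> / (1 - a * \<xi>)))" by (rule qform_cscale[symmetric])
  also have "\<dots> = Re (fst (qmap A (model_disc (a, 0, w, y) \<xi>)))" by (simp add: qmap_def qform_def model_disc_def)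
  finally show "Re (g \<xi>) = Re (fst (qmap A (model_disc (a, 0, w, y) \<xi>)))" .
 qed
 then show ?thesis by (simp add: g_def qpart_def)
qed

definition qbil :: "complex ^ 'n ^ 'n \<Rightarrow> 'n::finite cpoint \<Rightarrow> 'n cpoint \<Rightarrow> 'n cpoint" where
 "qbil A x y = (of_real (qform A x y), 0)"

lemma bounded_bilinear_qbil: "bounded_bilinear (qbil A)"
proof -
 note q = bounded_bilinear_qform[of A]
 have "bilinear (qbil A)" unfolding bilinear_def linear_iff
  by (auto simp: qbil_def bounded_bilinear.add_left[OF q] bounded_bilinear.add_right[OF q]
    bounded_bilinear.scaleR_left[OF q] bounded_bilinear.scaleR_right[OF q] scaleR_conv_of_real)
 then show ?thesis by (simp add: bilinear_conv_bounded_bilinear)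
qed

definition qbil_const :: "complex ^ 'n ^ 'n \<Rightarrow> real" where
 "qbil_const A = (SOME K. 0 \<le> K \<and> (\<forall>x y. norm (qbil A x y :: 'n::finite cpoint) \<le> norm x * norm y * K))"

lemma qbil_const: "0 \<le> qbil_const A" "norm (qbil A x y) \<le> qbil_const A * norm x * norm y"
proof -
 have "0 \<le> qbil_const A \<and> (\<forall>x y. norm (qbil A x y) \<le> norm x * norm y * qbil_const A)" unfolding qbil_const_def
  by (rule someI_ex[OF bounded_bilinear.nonneg_bounded[OF bounded_bilinear_qbil]])
 then have q: "0 \<le> qbil_const A" "norm (qbil A x y) \<le> norm x * norm y * qbil_const A" by blast+
 show "0 \<le> qbil_const A" by (rule q)
 show "norm (qbil A x y) \<le> qbil_const A * norm x * norm y" using q(2) by (simp only: mult_ac)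
qed

text \<open>The difference of two squares, valid because the real form of a hermitian matrix is
  symmetric.\<close>

lemma qmap_diff:
 assumes "hermitian_matrix A" shows "qmap A x - qmap A y = qbil A (x + y) (x - y)"
proof -
 note q = bounded_bilinear_qbil[of A]
 have "qbil A x y = qbil A y x" by (simp add: qbil_def qform_commute[OF assms, of x y])
 then have "qbil A (x + y) (x - y) = qbil A x x - qbil A y y"
  by (simp add: bounded_bilinear.add_left[OF q] bounded_bilinear.diff_right[OF q])
 then show ?thesis by (simp add: qbil_def qmap_def)
qed

text \<open>From (a - a') x = (a x - a' x') - a' (x - x') and the lower bound for |x|.\<close>

lemma parameter_recovery_derivative:
 fixes a a' :: complex
 assumes \<kappa>: "0 < \<kappa>" "\<kappa> \<le> \<bar>x\<bar>" and a': "norm a' \<le> 1"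
 shows "norm (a - a') \<le> (1 / \<kappa>) * (norm (2 * a * of_real x - 2 * a' * of_real x') + \<bar>x - x'\<bar>)"
proof -
 have e: "(a * of_real x - a' * of_real x') - a' * of_real (x - x') = (a - a') * of_real x" by (simp add: algebra_simps)
 have "norm (a - a') * \<bar>x\<bar> = norm ((a * of_real x - a' * of_real x') - a' * of_real (x - x'))"
  unfolding e by (simp only: norm_mult norm_of_real)
 also have "\<dots> \<le> norm (a * of_real x - a' * of_real x') + norm a' * \<bar>x - x'\<bar>"
  using norm_triangle_ineq4[of "a * of_real x - a' * of_real x'" "a' * of_real (x - x')"] by (simp only: norm_mult norm_of_real)
 also have "norm a' * \<bar>x - x'\<bar> \<le> 1 * \<bar>x - x'\<bar>" using a' by (intro mult_right_mono) auto
 also have "norm (a * of_real x - a' * of_real x') \<le> norm (2 * a * of_real x - 2 * a' * of_real x')"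
 proof -
  have "2 * a * of_real x - 2 * a' * of_real x' = 2 * (a * of_real x - a' * of_real x')" by (simp add: algebra_simps)
  then have "norm (2 * a * of_real x - 2 * a' * of_real x') = 2 * norm (a * of_real x - a' * of_real x')"
   by (simp only: norm_mult norm_numeral)
  then show ?thesis using norm_ge_zero[of "a * of_real x - a' * of_real x'"] by linarith
 qed
 finally have "norm (a - a') * \<bar>x\<bar> \<le> norm (2 * a * of_real x - 2 * a' * of_real x') + \<bar>x - x'\<bar>" by simp
 moreover have "norm (a - a') * \<kappa> \<le> norm (a - a') * \<bar>x\<bar>" using \<kappa> by (intro mult_left_mono) auto
 ultimately show ?thesis using \<kappa> by (simp add: field_simps)
qed

text \<open>The Cayley transform is inverted by a = (e - x) / (e + x). The denominator is 2 x / (1 -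
  a), of modulus at least |x| as |1 - a| is at most 2, so the inversion is stable even if a comes
  close to 1.\<close>

lemma parameter_recovery_boundary:
 fixes a a' :: complex
 assumes \<kappa>: "0 < \<kappa>" "\<kappa> \<le> \<bar>x\<bar>" and a: "norm a < 1" and a': "norm a' < 1"
  and e: "e = of_real x * ((1 + a) / (1 - a))" "e' = of_real x' * ((1 + a') / (1 - a'))"
 shows "norm (a - a') \<le> (2 / \<kappa>) * (norm (e - e') + \<bar>x - x'\<bar>)"
proof -
 have ne: "1 - a \<noteq> 0" "1 - a' \<noteq> 0" using a a' by auto
 have 1: "a * (of_real x + e) = e - of_real x" "a' * (of_real x' + e') = e' - of_real x'"
  using ne by (simp_all add: e field_simps)
 have "(a - a') * (of_real x + e) = ((e - e') - of_real (x - x')) - a' * (of_real (x - x') + (e - e'))"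
 proof -
  have "(a - a') * (of_real x + e) = a * (of_real x + e) - a' * (of_real x' + e') - a' * (of_real (x - x') + (e - e'))"
   by (simp add: algebra_simps)
  then show ?thesis unfolding 1 by (simp add: algebra_simps)
 qed
 then have "norm (a - a') * norm (of_real x + e) = norm (((e - e') - of_real (x - x')) - a' * (of_real (x - x') + (e - e')))"
  by (simp only: norm_mult[symmetric])
 also have "\<dots> \<le> norm ((e - e') - of_real (x - x')) + norm (a' * (of_real (x - x') + (e - e')))" by (rule norm_triangle_ineq4)
 also have "norm ((e - e') - of_real (x - x')) \<le> norm (e - e') + \<bar>x - x'\<bar>"
  using norm_triangle_ineq4[of "e - e'" "of_real (x - x')"] by (simp only: norm_of_real)
 also have "norm (a' * (of_real (x - x') + (e - e'))) \<le> 1 * (\<bar>x - x'\<bar> + norm (e - e'))"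
 proof -
  have "norm (of_real (x - x') + (e - e')) \<le> \<bar>x - x'\<bar> + norm (e - e')"
   using norm_triangle_ineq[of "of_real (x - x')" "e - e'"] by (simp only: norm_of_real)
  then show ?thesis unfolding norm_mult by (intro mult_mono) (use a' in simp_all)
 qed
 finally have u: "norm (a - a') * norm (of_real x + e) \<le> 2 * (norm (e - e') + \<bar>x - x'\<bar>)" by simp
 have "(of_real x + e) * (1 - a) = 2 * of_real x" using ne by (simp add: e field_simps)
 then have "norm ((of_real x + e) * (1 - a)) = norm (2 * complex_of_real x)" by (rule arg_cong)
 then have "norm (of_real x + e) * norm (1 - a) = 2 * \<bar>x\<bar>" by (simp only: norm_mult norm_of_real norm_numeral)
 moreover have "norm (1 - a) \<le> 2" using norm_triangle_ineq4[of 1 a] a by simp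
 ultimately have "2 * \<bar>x\<bar> \<le> norm (of_real x + e) * 2" using mult_left_mono[of "norm (1 - a)" 2 "norm (of_real x + e)"] by simp
 then have "\<kappa> \<le> norm (of_real x + e)" using \<kappa> by simp
 then have "norm (a - a') * \<kappa> \<le> norm (a - a') * norm (of_real x + e)" by (intro mult_left_mono) auto
 then have "norm (a - a') * \<kappa> \<le> 2 * (norm (e - e') + \<bar>x - x'\<bar>)" using u by simp
 then show ?thesis using \<kappa> by (simp add: field_simps)
qed

context stationary_family
begin

definition "M = N (\<Lambda> t0) + r"
text \<open>The first term accounts for the difference of the perturbations themselves, the bracket
  for their effect through the quadratic part, split as a product; all of them carry one factor
  \<eta>, which is kept outside.\<close>

definition "C3 = 2 * CL + stat_op_const \<alpha> TYPE('n) * (qbil_const A * (2 * M) * (2 * CL) + qbil_const A * (3 * CL))"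

lemma Om_M: assumes k: "k \<in> \<Omega>" shows "N k \<le> M"
 using DH(3)[OF DH(6)[OF Om_H[OF k] model_H[OF t0]] model_H[OF t0]] k by (simp add: \<Omega>_def M_def)

lemma model_M: assumes t: "t \<in> ball t0 \<tau>" shows "N (\<Lambda> t) \<le> M"
proof -
 have "N (\<Lambda> t - \<Lambda> t0) \<le> CL * norm (t - t0)" by (rule model_Lip[OF t t0])
 also have "\<dots> \<le> CL * \<tau>" using t CL by (simp add: dist_norm norm_minus_commute mult_left_mono)
 finally have "N (\<Lambda> t - \<Lambda> t0) \<le> r" using eta r by linarith
 then show ?thesis using DH(3)[OF DH(6)[OF model_H[OF t] model_H[OF t0]] model_H[OF t0]] by (simp add: M_def)
qed

lemma M_nonneg: "0 \<le> M" using DH(2)[OF model_H[OF t0]] model_M[OF t0] by linarith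

lemma kf_Lip: assumes s: "s \<in> ball t0 \<tau>" and t: "t \<in> ball t0 \<tau>"
 shows "N (kf s - kf t) \<le> 2 * CL * norm (s - t)" "N (\<Theta> (kf s) - \<Theta> (kf t)) \<le> \<eta> * (2 * CL * norm (s - t))"
proof -
 have k: "kf s \<in> \<Omega>" "kf t \<in> \<Omega>" using kf s t by blast+
 have T: "\<Theta> (kf s) \<in> H" "\<Theta> (kf t) \<in> H" using theta_Om k by blast+
 have d: "(kf s - kf t) \<xi> = ((\<Lambda> s - \<Lambda> t) + (\<Theta> (kf s) - \<Theta> (kf t))) \<xi>" if "\<xi> \<in> sphere 0 1" for \<xi>
  using kf_eq[OF s, of \<xi>] kf_eq[OF t, of \<xi>] that by simp
 have L: "N (\<Theta> (kf s) - \<Theta> (kf t)) \<le> \<eta> * N (kf s - kf t)" by (rule theta_Lip[OF k])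
 have n: "0 \<le> N (kf s - kf t)" by (rule DH(2)[OF DH(6)[OF Om_H[OF k(1)] Om_H[OF k(2)]]])
 have "N (kf s - kf t) = N ((\<Lambda> s - \<Lambda> t) + (\<Theta> (kf s) - \<Theta> (kf t)))" by (rule holder_norm_cong(1)[OF d])
 also have "\<dots> \<le> N (\<Lambda> s - \<Lambda> t) + N (\<Theta> (kf s) - \<Theta> (kf t))" by (rule DH(3)[OF DH(6)[OF model_H[OF s] model_H[OF t]] DH(6)[OF T]])
 also have "\<dots> \<le> CL * norm (s - t) + \<eta> * N (kf s - kf t)" using model_Lip[OF s t] L by linarith
 also have "\<eta> * N (kf s - kf t) \<le> 1 / 2 * N (kf s - kf t)" using eta n by (intro mult_right_mono) auto
 finally show *: "N (kf s - kf t) \<le> 2 * CL * norm (s - t)" by simp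
 show "N (\<Theta> (kf s) - \<Theta> (kf t)) \<le> \<eta> * (2 * CL * norm (s - t))" using L mult_left_mono[OF * eta(1)] by linarith
qed

text \<open>\<open>Ff\<close> with the perturbation dropped: the explicit disc of the quadric with
  parameter t.\<close>

definition Gm :: "'n params \<Rightarrow> complex \<Rightarrow> 'n cpoint" where
 "Gm t z = \<Lambda> t z + qpart A (\<Lambda> t) z"

lemma Gm_holomorphic: assumes t: "t \<in> ball t0 \<tau>" shows "holomorphic_disc (Gm t)"
proof -
 have 2: "holomorphic_disc (qpart A (\<Lambda> t))" unfolding qpart_def
  by (rule stat_op_holomorphic[OF alpha qpart_bounds(3)[OF alpha model_H[OF t]]])
 have 3: "holomorphic_disc (\<Lambda> t)" by (rule model_disc_holomorphic) (use param[OF t] in blast)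
 show ?thesis unfolding Gm_def[abs_def] by (rule holomorphic_disc_add[OF 3 2])
qed

text \<open>It is not enough that the perturbed family is close to the explicit one; lower bounds
  survive if the difference has a small Lipschitz constant in t. The difference is \<Theta> plus the
  operator applied to the bilinear form of \<open>kf + \<Lambda>\<close> and \<Theta>, by
  \<open>qmap_diff\<close>, and the product rule gives a factor \<eta> in every term.\<close>

lemma Ff_minus_Gm_Lip:
 assumes s: "s \<in> ball t0 \<tau>" and t: "t \<in> ball t0 \<tau>" and z: "norm \<xi> = 1"
 shows "norm ((Ff s \<xi> - Gm s \<xi>) - (Ff t \<xi> - Gm t \<xi>)) \<le> C3 * \<eta> * norm (s - t)"
proof -
 define P where "P t u = qbil A ((kf t + \<Lambda> t) u) (\<Theta> (kf t) u)" for t u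
 let ?K = "qbil_const A" and ?S = "stat_op_const \<alpha> TYPE('n)" and ?d = "norm (s - t)"
 note bb = bounded_bilinear_qbil[of A]
 note mult = holder_mult[OF alpha(1) _ _ bb qbil_const]
 have facts: "kf t \<in> H" "\<Lambda> t \<in> H" "\<Theta> (kf t) \<in> H" "N (kf t) \<le> M" "N (\<Lambda> t) \<le> M" "N (\<Theta> (kf t)) \<le> \<eta>" "kf t + \<Lambda> t \<in> H" "N (kf t + \<Lambda> t) \<le> 2 * M" "P t \<in> H"
  if t: "t \<in> ball t0 \<tau>" for t
 proof -
  have k: "kf t \<in> \<Omega>" using kf[OF t] by blast
  show 1: "kf t \<in> H" "\<Lambda> t \<in> H" "\<Theta> (kf t) \<in> H" "N (kf t) \<le> M" "N (\<Lambda> t) \<le> M" "N (\<Theta> (kf t)) \<le> \<eta>"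
   using Om_H[OF k] model_H[OF t] theta_Om[OF k] Om_M[OF k] model_M[OF t] by blast+
  show 2: "kf t + \<Lambda> t \<in> H" by (rule DH(5)[OF 1(1,2)])
  show "N (kf t + \<Lambda> t) \<le> 2 * M" using DH(3)[OF 1(1,2)] 1(4,5) by linarith
  show "P t \<in> H" unfolding P_def[abs_def] by (rule mult(1)[OF 2 1(3)])
 qed
 note Fs = facts[OF s] and Ft = facts[OF t]
 have e: "Ff t \<xi> - Gm t \<xi> = \<Theta> (kf t) \<xi> + stat_op (P t) \<xi>" if t: "t \<in> ball t0 \<tau>" for t
 proof -
  note F = facts[OF t]
  have "stat_op (P t) = stat_op ((\<lambda>u. qmap A (kf t u)) - (\<lambda>u. qmap A (\<Lambda> t u)))"
   by (rule stat_op_cong) (simp add: P_def qmap_diff[OF herm] kf_eq[OF t])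
  then have "stat_op (P t) \<xi> = stat_op ((\<lambda>u. qmap A (kf t u)) - (\<lambda>u. qmap A (\<Lambda> t u))) \<xi>" by simp
  also have "\<dots> = qpart A (kf t) \<xi> - qpart A (\<Lambda> t) \<xi>"
   unfolding qpart_def by (rule stat_op_diff[OF alpha qpart_bounds(3)[OF alpha F(1)] qpart_bounds(3)[OF alpha F(2)]]) (simp add: z)
  finally show ?thesis by (simp add: Ff_def Gm_def)
 qed
 define P1 where "P1 u = qbil A ((kf s + \<Lambda> s) u) ((\<Theta> (kf s) - \<Theta> (kf t)) u)" for u
 define P2 where "P2 u = qbil A (((kf s - kf t) + (\<Lambda> s - \<Lambda> t)) u) (\<Theta> (kf t) u)" for u
 have Pd: "P s - P t = P1 + P2"
  by (simp add: fun_eq_iff P_def P1_def P2_def bounded_bilinear.add_left[OF bb] bounded_bilinear.diff_left[OF bb] bounded_bilinear.diff_right[OF bb])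
 have Th: "\<Theta> (kf s) - \<Theta> (kf t) \<in> H" by (rule DH(6)[OF Fs(3) Ft(3)])
 have kd: "kf s - kf t \<in> H" "\<Lambda> s - \<Lambda> t \<in> H" by (rule DH(6)[OF Fs(1) Ft(1)], rule DH(6)[OF Fs(2) Ft(2)])
 have P1: "P1 \<in> H" "N P1 \<le> ?K * (2 * M) * (\<eta> * (2 * CL * ?d))"
 proof -
  show "P1 \<in> H" unfolding P1_def[abs_def] by (rule mult(1)[OF Fs(7) Th])
  have "N P1 \<le> ?K * N (kf s + \<Lambda> s) * N (\<Theta> (kf s) - \<Theta> (kf t))" unfolding P1_def[abs_def] by (rule mult(2)[OF Fs(7) Th])
  also have "\<dots> \<le> ?K * (2 * M) * (\<eta> * (2 * CL * ?d))"
   using Fs(8) kf_Lip(2)[OF s t] qbil_const(1)[of A] M_nonneg DH(2)[OF Th] by (intro mult_mono mult_left_mono) auto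
  finally show "N P1 \<le> ?K * (2 * M) * (\<eta> * (2 * CL * ?d))" .
 qed
 have P2: "P2 \<in> H" "N P2 \<le> ?K * (3 * CL * ?d) * \<eta>"
 proof -
  have h: "(kf s - kf t) + (\<Lambda> s - \<Lambda> t) \<in> H" by (rule DH(5)[OF kd])
  show "P2 \<in> H" unfolding P2_def[abs_def] by (rule mult(1)[OF h Ft(3)])
  have "N ((kf s - kf t) + (\<Lambda> s - \<Lambda> t)) \<le> 3 * CL * ?d"
   using DH(3)[OF kd] kf_Lip(1)[OF s t] model_Lip[OF s t] by linarith
  moreover have "N P2 \<le> ?K * N ((kf s - kf t) + (\<Lambda> s - \<Lambda> t)) * N (\<Theta> (kf t))" unfolding P2_def[abs_def] by (rule mult(2)[OF h Ft(3)])
  moreover have "?K * N ((kf s - kf t) + (\<Lambda> s - \<Lambda> t)) * N (\<Theta> (kf t)) \<le> ?K * (3 * CL * ?d) * \<eta>"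
   using calculation(1) Ft(6) qbil_const(1)[of A] CL DH(2)[OF Ft(3)] by (intro mult_mono mult_left_mono) auto
  ultimately show "N P2 \<le> ?K * (3 * CL * ?d) * \<eta>" by linarith
 qed
 have PP: "P s - P t \<in> H" by (rule DH(6)[OF Fs(9) Ft(9)])
 have "N (P s - P t) \<le> ?K * (2 * M) * (\<eta> * (2 * CL * ?d)) + ?K * (3 * CL * ?d) * \<eta>"
  using DH(3)[OF P1(1) P2(1)] P1(2) P2(2) by (simp add: Pd)
 then have "?S * N (P s - P t) \<le> ?S * (?K * (2 * M) * (\<eta> * (2 * CL * ?d)) + ?K * (3 * CL * ?d) * \<eta>)"
  by (rule mult_left_mono) (rule stat_op_const_nonneg[OF alpha])
 then have b2: "norm (stat_op (P s - P t) \<xi>) \<le> ?S * (?K * (2 * M) * (\<eta> * (2 * CL * ?d)) + ?K * (3 * CL * ?d) * \<eta>)"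
  using holderD(2)[OF alpha(1) stat_op_holder(1)[OF alpha PP], of \<xi>] stat_op_holder(2)[OF alpha PP] z by simp
 have b1: "norm ((\<Theta> (kf s) - \<Theta> (kf t)) \<xi>) \<le> \<eta> * (2 * CL * ?d)"
  using holderD(2)[OF alpha(1) Th, of \<xi>] kf_Lip(2)[OF s t] z by simp
 have "(Ff s \<xi> - Gm s \<xi>) - (Ff t \<xi> - Gm t \<xi>) = (\<Theta> (kf s) - \<Theta> (kf t)) \<xi> + stat_op (P s - P t) \<xi>"
  using stat_op_diff[OF alpha Fs(9) Ft(9), of \<xi>] z by (simp add: e[OF s] e[OF t])
 then have "norm ((Ff s \<xi> - Gm s \<xi>) - (Ff t \<xi> - Gm t \<xi>)) \<le> norm ((\<Theta> (kf s) - \<Theta> (kf t)) \<xi>) + norm (stat_op (P s - P t) \<xi>)"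
  by (simp only: norm_triangle_ineq)
 also have "\<dots> \<le> \<eta> * (2 * CL * ?d) + ?S * (?K * (2 * M) * (\<eta> * (2 * CL * ?d)) + ?K * (3 * CL * ?d) * \<eta>)" using b1 b2 by (rule add_mono)
 also have "\<dots> = C3 * \<eta> * ?d" unfolding C3_def by (simp only: algebra_simps)
 finally show ?thesis .
qed

text \<open>\<open>\<phi>\<close> is evaluation at a point or the derivative at the centre.\<close>

lemma Ff_functional_lower_bound:
 fixes \<phi> :: "(complex \<Rightarrow> 'n cpoint) \<Rightarrow> 'n cpoint"
 assumes s: "s \<in> ball t0 \<tau>" and t: "t \<in> ball t0 \<tau>"
  and add: "\<And>f g. holomorphic_disc f \<Longrightarrow> holomorphic_disc g \<Longrightarrow> \<phi> (\<lambda>z. f z + g z) = \<phi> f + \<phi> g"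
  and bd: "\<And>f B. holomorphic_disc f \<Longrightarrow> (\<And>\<xi>. norm \<xi> = 1 \<Longrightarrow> norm (f \<xi>) \<le> B) \<Longrightarrow> norm (\<phi> f) \<le> C * B"
 shows "norm (\<phi> (Gm s) - \<phi> (Gm t)) \<le> norm (\<phi> (Ff s) - \<phi> (Ff t)) + C * (C3 * \<eta> * norm (s - t))"
proof -
 note hol = Ff_holomorphic[OF s] Ff_holomorphic[OF t] Gm_holomorphic[OF s] Gm_holomorphic[OF t]
 define D where "D z = (Ff s z - Gm s z) - (Ff t z - Gm t z)" for z
 have D: "holomorphic_disc D" unfolding D_def[abs_def] by (intro holomorphic_disc_diff hol)
 have "(\<lambda>z. Ff s z + Gm t z) = (\<lambda>z. (Ff t z + Gm s z) + D z)" by (simp add: D_def fun_eq_iff)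
 then have "\<phi> (\<lambda>z. Ff s z + Gm t z) = \<phi> (\<lambda>z. (Ff t z + Gm s z) + D z)" by simp
 then have "\<phi> (Ff s) + \<phi> (Gm t) = \<phi> (Ff t) + \<phi> (Gm s) + \<phi> D"
  by (simp add: add[OF hol(1,4)] add[OF hol(2,3)] add[OF holomorphic_disc_add[OF hol(2,3)] D])
 then have "\<phi> (Gm s) - \<phi> (Gm t) = (\<phi> (Ff s) - \<phi> (Ff t)) - \<phi> D" by (simp add: algebra_simps)
 moreover have "norm (\<phi> D) \<le> C * (C3 * \<eta> * norm (s - t))" by (rule bd[OF D]) (simp add: D_def Ff_minus_Gm_Lip[OF s t])
 ultimately show ?thesis using norm_triangle_ineq4[of "\<phi> (Ff s) - \<phi> (Ff t)" "\<phi> D"] by simp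
qed

lemma Gm_values:
 assumes t: "(a, 0, w, y) \<in> ball t0 \<tau>"
 shows "Gm (a, 0, w, y) 0 = (\<i> * of_real y + of_real (centre_value A a w), 0)"
  and "Gm (a, 0, w, y) 1 = (\<i> * of_real y + of_real (centre_value A a w) * ((1 + a) / (1 - a)), \<chi> j. w $ j * (1 / (1 - a)))"
  and "disc_deriv (Gm (a, 0, w, y)) 0 = (2 * a * of_real (centre_value A a w), w)"
proof -
 have a: "norm a < 1" using param[OF t] by simp
 define e :: "complex \<Rightarrow> 'n cpoint" where
  "e z = (\<i> * of_real y + of_real (centre_value A a w) * ((1 + a * z) / (1 - a * z)), \<chi> j. w $ j * (z / (1 - a * z)))" for z
 have G: "Gm (a, 0, w, y) z = e z" if "norm z \<le> 1" for z
  using fst_qpart_model[OF alpha a model_H[OF t] that] snd_qpart[OF that, of A "\<Lambda> (a, 0, w, y)"]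
  by (simp add: Gm_def e_def prod_eq_iff model_disc_def vec_eq_iff)
 show "Gm (a, 0, w, y) 0 = (\<i> * of_real y + of_real (centre_value A a w), 0)"
  using G[of 0] by (simp add: e_def vec_eq_iff)
 show "Gm (a, 0, w, y) 1 = (\<i> * of_real y + of_real (centre_value A a w) * ((1 + a) / (1 - a)), \<chi> j. w $ j * (1 / (1 - a)))"
  using G[of 1] by (simp add: e_def)
 have "((\<lambda>z. \<i> * of_real y + of_real (centre_value A a w) * ((1 + a * z) / (1 - a * z))) has_field_derivative 2 * a * of_real (centre_value A a w)) (at 0)"
  by (auto intro!: derivative_eq_intros)
 moreover have "((\<lambda>z. w $ j * (z / (1 - a * z))) has_field_derivative w $ j) (at 0)" for j
  by (auto intro!: derivative_eq_intros)
 moreover have "disc_deriv (Gm (a, 0, w, y)) 0 = disc_deriv e 0" by (rule disc_deriv_cong) (simp add: G)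
 ultimately show "disc_deriv (Gm (a, 0, w, y)) 0 = (2 * a * of_real (centre_value A a w), w)"
  by (simp add: disc_deriv_def e_def DERIV_imp_deriv vec_eq_iff)
qed

text \<open>The centre gives x = \<open>centre_value\<close>, then the first component of the
  functional gives \<open>a\<close>, and the vector part gives \<open>w\<close>. For the derivative
  it is \<open>w\<close> itself; at the boundary point 1 it is w / (1 - a), whose size
  \<open>W\<close> enters because \<open>w\<close> is found only after \<open>a\<close>.\<close>

lemma Gm_lower_bound:
 assumes s: "(a, 0, w, y) \<in> ball t0 \<tau>" and t: "(a', 0, w', y) \<in> ball t0 \<tau>"
  and \<kappa>: "0 < \<kappa>" "\<kappa> \<le> \<bar>centre_value A a w\<bar>" and W: "0 \<le> W" "norm w' \<le> W * norm (1 - a')"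
 shows "norm ((a, w) - (a', w')) \<le> ((1 + W) * (2 / \<kappa>) + 2) *
   (norm (Gm (a, 0, w, y) 0 - Gm (a', 0, w', y) 0) + norm (Gm (a, 0, w, y) 1 - Gm (a', 0, w', y) 1))"
  and "norm ((a, w) - (a', w')) \<le> ((1 + W) * (2 / \<kappa>) + 2) *
   (norm (Gm (a, 0, w, y) 0 - Gm (a', 0, w', y) 0) + norm (disc_deriv (Gm (a, 0, w, y)) 0 - disc_deriv (Gm (a', 0, w', y)) 0))"
proof -
 define x where "x = centre_value A a w"
 define x' where "x' = centre_value A a' w'"
 define b where "b = norm (Gm (a, 0, w, y) 0 - Gm (a', 0, w', y) 0)"
 have a: "norm a < 1" "norm a' < 1" using param[OF s] param[OF t] by simp_all
 have b: "\<bar>x - x'\<bar> \<le> b"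
  by (simp add: b_def Gm_values(1)[OF s] Gm_values(1)[OF t] x_def x'_def flip: of_real_diff)
 have d: "norm ((a, w) - (a', w')) \<le> norm (a - a') + norm (w - w')" by (simp add: norm_Pair_le)
 show "norm ((a, w) - (a', w')) \<le> ((1 + W) * (2 / \<kappa>) + 2) * (norm (Gm (a, 0, w, y) 0 - Gm (a', 0, w', y) 0) +
   norm (disc_deriv (Gm (a, 0, w, y)) 0 - disc_deriv (Gm (a', 0, w', y)) 0))"
 proof -
  define p where "p = norm (disc_deriv (Gm (a, 0, w, y)) 0 - disc_deriv (Gm (a', 0, w', y)) 0)"
  have p: "p = norm (2 * a * of_real x - 2 * a' * of_real x', w - w')"
   by (simp add: p_def Gm_values(3)[OF s] Gm_values(3)[OF t] x_def x'_def)
  have p1: "norm (2 * a * of_real x - 2 * a' * of_real x') \<le> p" "norm (w - w') \<le> p"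
   unfolding p by (rule norm_fst_le, rule norm_snd_le)
  have "norm (a - a') \<le> (1 / \<kappa>) * (norm (2 * a * of_real x - 2 * a' * of_real x') + \<bar>x - x'\<bar>)"
   by (rule parameter_recovery_derivative) (use \<kappa> a in \<open>simp_all add: x_def\<close>)
  also have "\<dots> \<le> ((1 + W) * (2 / \<kappa>)) * (b + p)"
  proof (rule mult_mono)
   show "1 / \<kappa> \<le> (1 + W) * (2 / \<kappa>)" using \<kappa>(1) W(1) by (simp add: field_simps)
  qed (use p1 b \<kappa>(1) W(1) in auto)
  finally have "norm (a - a') \<le> ((1 + W) * (2 / \<kappa>)) * (b + p)" .
  moreover have "0 \<le> b" "0 \<le> p" by (simp_all add: b_def p_def)
  moreover have "norm (w - w') \<le> 2 * (b + p)" using p1(2) \<open>0 \<le> b\<close> \<open>0 \<le> p\<close> by simp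
  ultimately have "norm ((a, w) - (a', w')) \<le> ((1 + W) * (2 / \<kappa>)) * (b + p) + 2 * (b + p)" using order_trans[OF d add_mono] by blast
  then show ?thesis by (simp only: b_def p_def distrib_right)
 qed
 define p where "p = norm (Gm (a, 0, w, y) 1 - Gm (a', 0, w', y) 1)"
 define e where "e = of_real x * ((1 + a) / (1 - a))"
 define e' where "e' = of_real x' * ((1 + a') / (1 - a'))"
 define \<omega> :: "complex ^ 'n" where "\<omega> = (\<chi> j. w $ j * (1 / (1 - a)))"
 define \<omega>' :: "complex ^ 'n" where "\<omega>' = (\<chi> j. w' $ j * (1 / (1 - a')))"
 have ne: "1 - a \<noteq> 0" "1 - a' \<noteq> 0" using a by auto
 have p: "p = norm (e - e', \<omega> - \<omega>')"
  by (simp add: p_def Gm_values(2)[OF s] Gm_values(2)[OF t] e_def e'_def \<omega>_def \<omega>'_def x_def x'_def)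
 have p1: "norm (e - e') \<le> p" "norm (\<omega> - \<omega>') \<le> p" unfolding p by (rule norm_fst_le, rule norm_snd_le)
 have "norm (a - a') \<le> (2 / \<kappa>) * (norm (e - e') + \<bar>x - x'\<bar>)"
  by (rule parameter_recovery_boundary) (use \<kappa> a in \<open>simp_all add: x_def e_def e'_def\<close>)
 also have "\<dots> \<le> (2 / \<kappa>) * (b + p)" using p1(1) b \<kappa>(1) by (intro mult_left_mono) auto
 finally have aa: "norm (a - a') \<le> (2 / \<kappa>) * (b + p)" .
 have "norm \<omega>' = norm w' / norm (1 - a')" unfolding \<omega>'_def norm_vec_cmult by (simp add: norm_divide)
 also have "\<dots> \<le> W" using W(2) ne(2) by (simp add: divide_le_eq)
 finally have om: "norm \<omega>' \<le> W" .
 have om_w: "w $ j = \<omega> $ j * (1 - a)" "w' $ j = \<omega>' $ j * (1 - a')" for j using ne by (simp_all add: \<omega>_def \<omega>'_def)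
 have "(w - w') $ j = ((\<chi> j. (\<omega> - \<omega>') $ j * (1 - a)) - (\<chi> j. \<omega>' $ j * (a - a'))) $ j" for j
  by (simp add: om_w) (simp add: algebra_simps)
 then have "w - w' = (\<chi> j. (\<omega> - \<omega>') $ j * (1 - a)) - (\<chi> j. \<omega>' $ j * (a - a'))" unfolding vec_eq_iff by blast
 then have "norm (w - w') \<le> norm (\<chi> j. (\<omega> - \<omega>') $ j * (1 - a)) + norm (\<chi> j. \<omega>' $ j * (a - a'))" by (simp only: norm_triangle_ineq4)
 also have "\<dots> = norm (\<omega> - \<omega>') * norm (1 - a) + norm \<omega>' * norm (a - a')" by (simp only: norm_vec_cmult)
 also have "\<dots> \<le> p * 2 + W * ((2 / \<kappa>) * (b + p))"
 proof (intro add_mono mult_mono)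
  show "norm (1 - a) \<le> 2" using norm_triangle_ineq4[of 1 a] a by simp
 qed (use p1(2) om aa W(1) in \<open>auto simp: p_def\<close>)
 finally have ww: "norm (w - w') \<le> p * 2 + W * ((2 / \<kappa>) * (b + p))" .
 have "0 \<le> b" by (simp add: b_def)
 then have "p * 2 \<le> 2 * (b + p)" by simp
 from order_trans[OF d add_mono[OF aa order_trans[OF ww add_right_mono[OF this]]]]
 have "norm ((a, w) - (a', w')) \<le> (2 / \<kappa>) * (b + p) + (2 * (b + p) + W * ((2 / \<kappa>) * (b + p)))" .
 also have "\<dots> = ((1 + W) * (2 / \<kappa>) + 2) * (b + p)" by (simp only: algebra_simps)
 finally show "norm ((a, w) - (a', w')) \<le> ((1 + W) * (2 / \<kappa>) + 2) *
   (norm (Gm (a, 0, w, y) 0 - Gm (a', 0, w', y) 0) + norm (Gm (a, 0, w, y) 1 - Gm (a', 0, w', y) 1))"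
  by (simp only: b_def p_def)
qed

text \<open>Half of the lower bound for the explicit family is sacrificed to the perturbation. The
  centre is kept as the function \<beta> of the criterion, so the real equation it imposes on
  \<open>(a, w)\<close> never has to be solved.\<close>

lemma centred_local_diffeo:
 assumes \<kappa>: "0 < \<kappa>" and W: "0 \<le> W"
  and bd: "\<And>a v w y. (a, v, w, y) \<in> ball t0 \<tau> \<Longrightarrow> \<kappa> \<le> \<bar>centre_value A a w\<bar> \<and> norm w \<le> W * norm (1 - a)"
  and small: "((1 + W) * (2 / \<kappa>) + 2) * ((1 + real CARD('n)) * 3 * C3 * \<eta>) \<le> 1 / 2"
 shows "local_diffeo_onto_image H N {h \<in> Ff ` ball t0 \<tau>. h 0 = (p0, 0)} (\<lambda>h. h 1)"
  and "local_diffeo_onto_image H N {h \<in> Ff ` ball t0 \<tau>. h 0 = (p0, 0)} (\<lambda>h. disc_deriv h 0)"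
proof -
 let ?n = "real CARD('n)"
 define y0 where "y0 = Im p0"
 \<comment> \<open>A disc of the family centred at \<open>(p0, 0)\<close> has v = 0 and y = Im p0 by
   \<open>Ff_0\<close>, so only \<open>(a, w)\<close> remain as parameters.\<close>
 define \<iota> :: "complex \<times> (complex ^ 'n) \<Rightarrow> 'n params" where
  "\<iota> e = (fst e, 0, snd e, y0)" for e
 define U where "U = \<iota> -` ball t0 \<tau>"
 define F where "F e = Ff (\<iota> e)" for e
 have i_cont: "continuous_on UNIV \<iota>" unfolding \<iota>_def[abs_def] by (intro continuous_intros)
 have U: "open U" unfolding U_def by (rule open_vimage[OF open_ball i_cont])
 have iU: "\<iota> e \<in> ball t0 \<tau>" if "e \<in> U" for e using that by (simp add: U_def)
 have i_C1: "C1_map UNIV norm U UNIV norm \<iota>"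
 proof -
  define l :: "complex \<times> (complex ^ 'n) \<Rightarrow> 'n params" where "l e = (fst e, 0, snd e, 0)" for e
  have "C1_map UNIV norm U UNIV norm (\<lambda>e. l e + (0, 0, 0, y0))"
  proof (rule C1_map_linear_add[OF seminormed_norm seminormed_norm subset_UNIV C1_map_const[OF seminormed_norm seminormed_norm subset_UNIV UNIV_I]])
   show "norm (l e) \<le> 1 * norm e" for e by (simp add: l_def norm_prod_def)
  qed (simp_all add: l_def)
  then show ?thesis by (simp add: l_def \<iota>_def[abs_def])
 qed
 have F_C1: "C1_map UNIV norm U H N F" unfolding F_def[abs_def]
  by (rule C1_map_compose[OF seminormed_norm seminormed_norm sH subset_UNIV subset_UNIV i_C1 Ff_C1]) (rule iU)
 have hol: "holomorphic_disc (F e)" if "e \<in> U" for e unfolding F_def by (rule Ff_holomorphic[OF iU[OF that]])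
 have S: "{h \<in> Ff ` ball t0 \<tau>. h 0 = (p0, 0)} = {h \<in> F ` U. h 0 = (p0, 0)}"
 proof (intro equalityI subsetI)
  fix h assume "h \<in> {h \<in> Ff ` ball t0 \<tau>. h 0 = (p0, 0)}"
  then obtain a v w y where t: "(a, v, w, y) \<in> ball t0 \<tau>" "h = Ff (a, v, w, y)" "h 0 = (p0, 0)" by auto
  then have "v = 0" "y = y0" using Ff_0[of a v w y] by (simp_all add: y0_def)
  then have i: "(a, v, w, y) = \<iota> (a, w)" by (simp add: \<iota>_def)
  then have "(a, w) \<in> U" using t(1) by (simp add: U_def)
  moreover have "h = F (a, w)" using t(2) i by (simp add: F_def)
  ultimately show "h \<in> {h \<in> F ` U. h 0 = (p0, 0)}" using t(3) by blast
 next
  fix h assume "h \<in> {h \<in> F ` U. h 0 = (p0, 0)}"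
  then show "h \<in> {h \<in> Ff ` ball t0 \<tau>. h 0 = (p0, 0)}" using iU by (auto simp: F_def)
 qed
 define c1 where "c1 = (1 + W) * (2 / \<kappa>) + 2"
 have c1: "0 < c1" using \<kappa> W by (simp add: c1_def add_nonneg_pos)
 \<comment> \<open>The factor 3 in the smallness condition is 1 for the centre plus 2 for the
   functional; the perturbation then costs at most half of \<open>norm (s - t)\<close>, whence the
   constant \<open>1 / (2 * c1)\<close>.\<close>
 have finish: "1 / (2 * c1) * norm (s - t) \<le> norm (F s 0 - F t 0) + norm (\<phi> (F s) - \<phi> (F t))"
  if s: "s \<in> U" and t: "t \<in> U" and g: "norm (s - t) \<le> c1 * (norm (Gm (\<iota> s) 0 - Gm (\<iota> t) 0) + norm (\<phi> (Gm (\<iota> s)) - \<phi> (Gm (\<iota> t))))"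
   and p: "norm (\<phi> (Gm (\<iota> s)) - \<phi> (Gm (\<iota> t))) \<le> norm (\<phi> (F s) - \<phi> (F t)) + ((1 + ?n) * 2) * (C3 * \<eta> * norm (\<iota> s - \<iota> t))"
  for s t and \<phi> :: "(complex \<Rightarrow> 'n cpoint) \<Rightarrow> 'n cpoint"
 proof -
  have i: "norm (\<iota> s - \<iota> t) = norm (s - t)" by (simp add: \<iota>_def norm_prod_def)
  have 0: "norm (Gm (\<iota> s) 0 - Gm (\<iota> t) 0) \<le> norm (F s 0 - F t 0) + (1 + ?n) * (C3 * \<eta> * norm (\<iota> s - \<iota> t))"
   unfolding F_def
   by (rule Ff_functional_lower_bound[OF iU[OF s] iU[OF t], where \<phi>="\<lambda>h. h 0"]) (simp_all add: holomorphic_disc_at_0_bound(1))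
  define q where "q = norm (F s 0 - F t 0) + norm (\<phi> (F s) - \<phi> (F t))"
  have "norm (Gm (\<iota> s) 0 - Gm (\<iota> t) 0) + norm (\<phi> (Gm (\<iota> s)) - \<phi> (Gm (\<iota> t))) \<le> q + ((1 + ?n) * 3 * C3 * \<eta>) * norm (s - t)"
   using 0 p unfolding i q_def by (simp add: algebra_simps)
  from order_trans[OF g mult_left_mono[OF this less_imp_le[OF c1]]]
  have "norm (s - t) \<le> c1 * q + (c1 * ((1 + ?n) * 3 * C3 * \<eta>)) * norm (s - t)" by (simp add: algebra_simps)
  also have "\<dots> \<le> c1 * q + 1 / 2 * norm (s - t)" using small by (intro add_left_mono mult_right_mono) (simp_all add: c1_def)
  finally have "norm (s - t) \<le> 2 * c1 * q" by simp
  then show ?thesis using c1 by (simp add: q_def field_simps)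
 qed
 have G: "\<kappa> \<le> \<bar>centre_value A (fst e) (snd e)\<bar>" "norm (snd e) \<le> W * norm (1 - fst e)" if "e \<in> U" for e
  using bd[of "fst e" 0 "snd e" y0] iU[OF that] by (simp_all add: \<iota>_def)
 have low1: "1 / (2 * c1) * norm (s - t) \<le> norm (F s 0 - F t 0) + norm (F s 1 - F t 1)" if s: "s \<in> U" and t: "t \<in> U" for s t
 proof (rule finish[OF s t, where \<phi>="\<lambda>h. h 1"])
  show "norm (s - t) \<le> c1 * (norm (Gm (\<iota> s) 0 - Gm (\<iota> t) 0) + norm (Gm (\<iota> s) 1 - Gm (\<iota> t) 1))"
   using Gm_lower_bound(1)[of "fst s" "snd s" y0 "fst t" "snd t" \<kappa> W] iU[OF s] iU[OF t] G[OF s] G[OF t] \<kappa> W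
   by (simp add: \<iota>_def c1_def)
  show "norm (Gm (\<iota> s) 1 - Gm (\<iota> t) 1) \<le> norm (F s 1 - F t 1) + ((1 + ?n) * 2) * (C3 * \<eta> * norm (\<iota> s - \<iota> t))"
   unfolding F_def
  proof (rule Ff_functional_lower_bound[OF iU[OF s] iU[OF t], where \<phi>="\<lambda>h. h 1"])
   fix f :: "complex \<Rightarrow> 'n cpoint" and B assume f: "\<And>\<xi>. norm \<xi> = 1 \<Longrightarrow> norm (f \<xi>) \<le> B"
   have "norm (f 1) \<le> B" by (rule f) simp
   also have "B \<le> ((1 + ?n) * 2) * B" using order_trans[OF norm_ge_zero \<open>norm (f 1) \<le> B\<close>] by (simp add: algebra_simps)
   finally show "norm (f 1) \<le> ((1 + ?n) * 2) * B" .
  qed simp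
 qed
 have low2: "1 / (2 * c1) * norm (s - t) \<le> norm (F s 0 - F t 0) + norm (disc_deriv (F s) 0 - disc_deriv (F t) 0)" if s: "s \<in> U" and t: "t \<in> U" for s t
 proof (rule finish[OF s t, where \<phi>="\<lambda>h. disc_deriv h 0"])
  show "norm (s - t) \<le> c1 * (norm (Gm (\<iota> s) 0 - Gm (\<iota> t) 0) + norm (disc_deriv (Gm (\<iota> s)) 0 - disc_deriv (Gm (\<iota> t)) 0))"
   using Gm_lower_bound(2)[of "fst s" "snd s" y0 "fst t" "snd t" \<kappa> W] iU[OF s] iU[OF t] G[OF s] G[OF t] \<kappa> W
   by (simp add: \<iota>_def c1_def)
  show "norm (disc_deriv (Gm (\<iota> s)) 0 - disc_deriv (Gm (\<iota> t)) 0) \<le>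
    norm (disc_deriv (F s) 0 - disc_deriv (F t) 0) + ((1 + ?n) * 2) * (C3 * \<eta> * norm (\<iota> s - \<iota> t))"
   unfolding F_def
  proof (rule Ff_functional_lower_bound[OF iU[OF s] iU[OF t], where \<phi>="\<lambda>h. disc_deriv h 0"])
   fix f :: "complex \<Rightarrow> 'n cpoint" and B assume f: "holomorphic_disc f" "\<And>\<xi>. norm \<xi> = 1 \<Longrightarrow> norm (f \<xi>) \<le> B"
   show "norm (disc_deriv f 0) \<le> ((1 + ?n) * 2) * B" using holomorphic_disc_at_0_bound(2)[OF f] by (simp only: mult.assoc)
  qed (rule disc_deriv_add)
 qed
 have c: "0 < 1 / (2 * c1)" using c1 by simp
 have Badd: "vcauchy (f + g) 0 = vcauchy f 0 + vcauchy g 0" if "f \<in> H" "g \<in> H" for f g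
  by (rule vcauchy_linear(1)[OF alpha that]) simp
 have Bscale: "vcauchy (k *\<^sub>R f) 0 = k *\<^sub>R vcauchy f 0" if "f \<in> H" for f k
  by (rule vcauchy_linear(2)[OF alpha that that]) simp
 have Beq: "vcauchy (F e) 0 = F e 0" if "e \<in> U" for e by (rule vcauchy_of_holomorphic_disc[OF hol[OF that]]) simp
 have h1: "norm (f 1) \<le> 1 * N f" if "f \<in> H" for f using holderD(2)[OF alpha(1) that, of 1] by simp
 show "local_diffeo_onto_image H N {h \<in> Ff ` ball t0 \<tau>. h 0 = (p0, 0)} (\<lambda>h. h 1)"
  unfolding S
  by (rule local_diffeo_criterion[where B="\<lambda>h. vcauchy h 0" and \<beta>="\<lambda>h. h 0" and \<Phi>="\<lambda>h. h 1" and \<phi>="\<lambda>h. h 1",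
     OF sH U F_C1 Badd Bscale norm_vcauchy_le(1)[OF alpha] Beq _ _ h1 _ c low1])
    (simp_all add: scaleR_fun_def)
 have Padd: "disc_deriv (vcauchy (f + g)) 0 = disc_deriv (vcauchy f) 0 + disc_deriv (vcauchy g) 0" if f: "f \<in> H" and g: "g \<in> H" for f g
 proof -
  have "disc_deriv (vcauchy (f + g)) 0 = disc_deriv (\<lambda>z. vcauchy f z + vcauchy g z) 0"
   by (rule disc_deriv_cong) (simp add: vcauchy_linear(1)[OF alpha f g])
  then show ?thesis by (simp add: disc_deriv_add[OF vcauchy_holomorphic_disc[OF alpha f] vcauchy_holomorphic_disc[OF alpha g]])
 qed
 have Pscale: "disc_deriv (vcauchy (k *\<^sub>R f)) 0 = k *\<^sub>R disc_deriv (vcauchy f) 0" if f: "f \<in> H" for f k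
 proof -
  have "disc_deriv (vcauchy (k *\<^sub>R f)) 0 = disc_deriv (\<lambda>z. k *\<^sub>R vcauchy f z) 0"
   by (rule disc_deriv_cong) (simp add: vcauchy_linear(2)[OF alpha f f])
  then show ?thesis by (simp add: disc_deriv_scaleR[OF vcauchy_holomorphic_disc[OF alpha f]])
 qed
 have Peq: "disc_deriv (vcauchy (F e)) 0 = disc_deriv (F e) 0" if "e \<in> U" for e
  by (rule disc_deriv_cong) (simp add: vcauchy_of_holomorphic_disc[OF hol[OF that]])
 show "local_diffeo_onto_image H N {h \<in> Ff ` ball t0 \<tau>. h 0 = (p0, 0)} (\<lambda>h. disc_deriv h 0)"
  unfolding S
  by (rule local_diffeo_criterion[where B="\<lambda>h. vcauchy h 0" and \<beta>="\<lambda>h. h 0" and \<Phi>="\<lambda>h. disc_deriv (vcauchy h) 0" and \<phi>="\<lambda>h. disc_deriv h 0",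
     OF sH U F_C1 Badd Bscale norm_vcauchy_le(1)[OF alpha] Beq Padd Pscale norm_vcauchy_le(2)[OF alpha] Peq c low2])
qed

end

subsection \<open>Choice of the neighbourhoods\<close>

lemma stat_pert_quadric:
 assumes "hermitian_matrix A" shows "stat_pert A B (quadric_fun A) z i = 0"
 by (simp add: stat_pert_def stat_err_def del_quadric[OF assms])

text \<open>The given disc is merely continuous up to the circle. For the quadric the perturbation
  vanishes, so \<open>stationary_imp_form\<close> applies without Hoelder regularity and its
  explicit form yields the regularity afterwards.\<close>

lemma quadric_disc_representation:
 fixes A B :: "complex ^ 'n::finite ^ 'n" and h :: "complex \<Rightarrow> 'n cpoint"
 assumes \<alpha>: "0 < \<alpha>" "\<alpha> < 1" and herm: "hermitian_matrix A" and AB: "A ** B = mat 1"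
  and st: "stationary_disc UNIV (quadric_fun A) h" and h0: "h 0 = (p0, 0)"
 obtains a w where "norm a < 1" "(model_disc (a, 0, w, Im p0) :: complex \<Rightarrow> 'n cpoint) \<in> \<H> \<alpha>"
  "\<And>z. norm z \<le> 1 \<Longrightarrow> h z = quad_shift A (model_disc (a, 0, w, Im p0)) z" "Re p0 = centre_value A a w"
proof -
 have hol: "holomorphic_disc h" and hS: "h ` sphere 0 1 \<subseteq> zero_hypersurface UNIV (quadric_fun A)"
  using st by (simp_all add: stationary_disc_def)
 obtain c g where c: "\<And>\<xi>. norm \<xi> = 1 \<Longrightarrow> c \<xi> \<noteq> (0::real)" and g: "holomorphic_disc g"
  and gc: "\<And>\<xi>. norm \<xi> = 1 \<Longrightarrow> g \<xi> = (\<xi> * of_real (c \<xi>) * fst (del (quadric_fun A) (h \<xi>)), (\<xi> * of_real (c \<xi>)) *s snd (del (quadric_fun A) (h \<xi>)))"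
  by (rule stationary_discE[OF st], rule that)
 \<comment> \<open>For the quadric \<open>2 * fst (del \<rho> h)\<close> is identically 1, so
   exponent 0, factor 1 and zero perturbation fit the hypotheses.\<close>
 obtain a v w where a: "norm a < 1"
  and vw: "\<And>z i. norm z \<le> 1 \<Longrightarrow> snd (h z) $ i = v $ i + w $ i * (z / (1 - a * z)) + 0"
  by (rule stationary_imp_form[OF AB hol c g gc, where k="\<lambda>_. 0" and p="\<lambda>_. 1" and ?f1.0="\<lambda>_ _. 0" and ?f2.0="\<lambda>_ _. 0"])
    (simp_all add: del_quadric[OF herm] stat_pert_quadric[OF herm])
 have v: "v = 0" using vw[of 0] h0 by (simp add: vec_eq_iff)
 let ?m = "model_disc (a, 0, w, Im p0) :: complex \<Rightarrow> 'n cpoint"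
 have mH: "?m \<in> \<H> \<alpha>"
 proof -
  have "(1 + norm a) / 2 < 1" using a by simp
  from model_disc_C1[OF \<alpha>(1) less_imp_le[OF \<alpha>(2)] this, of "norm (a, 0 :: complex ^ 'n, w, Im p0) + 1"]
  have "(model_disc :: _ \<Rightarrow> complex \<Rightarrow> 'n cpoint) ` {t. norm (fst t) < (1 + norm a) / 2 \<and> norm t < norm (a, 0 :: complex ^ 'n, w, Im p0) + 1} \<subseteq> \<H> \<alpha>"
   unfolding C1_map_def by blast
  then show ?thesis by (rule subsetD) (use a in \<open>auto intro!: imageI\<close>)
 qed
 have sn: "snd (h z) = snd (?m z)" if "norm z \<le> 1" for z using vw[OF that] v by (simp add: vec_eq_iff model_disc_def)
 have "fst (h z) = \<i> * Im (fst (h 0)) + fst (stat_op (\<lambda>u. qmap A (?m u)) z)" if z: "norm z \<le> 1" for z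
 proof (rule stat_op_fst_unique[OF \<alpha> qpart_bounds(3)[OF \<alpha> mH] _ _ z])
  show "disc_alg (\<lambda>z. fst (h z))" using hol by (simp add: holomorphic_disc_iff)
  fix \<xi> :: complex assume 1: "norm \<xi> = 1"
  have "quadric_fun A (h \<xi>) = 0" using hS 1 by (simp add: zero_hypersurface_def image_subset_iff)
  moreover have "qmap A (h \<xi>) = qmap A (?m \<xi>)" by (rule qmap_cong) (simp add: sn 1)
  ultimately show "Re (fst (h \<xi>)) = Re (fst (qmap A (?m \<xi>)))" by (simp add: quadric_fun_qform qmap_def)
 qed
 then have rep: "h z = quad_shift A ?m z" if "norm z \<le> 1" for z
  using that sn[OF that] snd_qpart[OF that, of A ?m] h0
  by (simp add: prod_eq_iff quad_shift_def model_disc_def qpart_def)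
 have "p0 = \<i> * Im p0 + of_real (centre_value A a w)"
  using rep[of 0] h0 fst_qpart_model[OF \<alpha> a mH, of 0] by (simp add: quad_shift_def model_disc_def prod_eq_iff)
 then have "Re p0 = Re (\<i> * Im p0 + of_real (centre_value A a w))" by (rule arg_cong)
 then have "Re p0 = centre_value A a w" by simp
 then show ?thesis using that a mH rep by blast
qed

text \<open>The margin \<sigma> between the boundary of the initial disc and the sphere of radius R
  is what the shifted discs may move while staying where \<rho> is controlled.\<close>

lemma quad_shift_domain:
 fixes A :: "complex ^ 'n::finite ^ 'n" and k0 :: "complex \<Rightarrow> 'n cpoint"
 assumes \<alpha>: "0 < \<alpha>" "\<alpha> < 1" and k0: "k0 \<in> \<H> \<alpha>" and im: "\<And>\<xi>. norm \<xi> = 1 \<Longrightarrow> norm (quad_shift A k0 \<xi>) + \<sigma> \<le> R"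
  and \<sigma>: "0 < \<sigma>"
 shows "\<exists>r>0. \<exists>C\<ge>0. \<exists>M\<ge>0.
  (\<forall>k \<in> {k \<in> \<H> \<alpha>. \<N> \<alpha> (k - k0) < r}. quad_shift A k \<in> \<H> \<alpha> \<and>
   quad_shift A k ` sphere 0 1 \<subseteq> ball 0 R \<and> \<N> \<alpha> (quad_shift A k) \<le> M) \<and>
  (\<forall>k \<in> {k \<in> \<H> \<alpha>. \<N> \<alpha> (k - k0) < r}. \<forall>k' \<in> {k \<in> \<H> \<alpha>. \<N> \<alpha> (k - k0) < r}.
   \<N> \<alpha> (quad_shift A k - quad_shift A k') \<le> C * \<N> \<alpha> (k - k')) \<and>
  C1_map (\<H> \<alpha>) (\<N> \<alpha>) {k \<in> \<H> \<alpha>. \<N> \<alpha> (k - k0) < r} (\<H> \<alpha>) (\<N> \<alpha>) (quad_shift A)"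
proof -
 let ?H = "\<H> \<alpha> :: (complex \<Rightarrow> 'n cpoint) set" and ?N = "\<N> \<alpha> :: (complex \<Rightarrow> 'n cpoint) \<Rightarrow> real"
 note sH = seminormed_holder[OF \<alpha>(1), where 'b="'n cpoint"]
 note DH = seminormedD[OF sH]
 obtain Cq where Cq: "0 \<le> Cq" "\<forall>k\<in>?H. \<forall>k'\<in>?H. ?N k < ?N k0 + 1 \<longrightarrow> ?N k' < ?N k0 + 1 \<longrightarrow>
  ?N (qpart A k - qpart A k') \<le> Cq * ?N (k - k')" using qpart_bounds(1)[OF \<alpha>] by blast
 define C where "C = 1 + Cq"
 have C: "0 < C" using Cq(1) by (simp add: C_def)
 \<comment> \<open>The 1 stays within the ball on which \<open>qpart\<close> has Lipschitz constant
   \<open>Cq\<close>; the quotient makes shifted discs move by less than \<sigma>.\<close>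
 define r where "r = min 1 (\<sigma> / C)"
 define \<Omega> where "\<Omega> = {k \<in> ?H. ?N (k - k0) < r}"
 have r: "0 < r" "r \<le> 1" "C * r \<le> \<sigma>" using \<sigma> C by (simp_all add: r_def min_def field_simps)
 have OH: "k \<in> ?H" and O1: "?N k < ?N k0 + 1" if "k \<in> \<Omega>" for k
 proof -
  show k: "k \<in> ?H" using that by (simp add: \<Omega>_def)
  show "?N k < ?N k0 + 1" using DH(3)[OF DH(6)[OF k k0] k0] that r by (simp add: \<Omega>_def)
 qed
 have O0: "k0 \<in> \<Omega>" using k0 r seminormed_zero[OF sH] by (simp add: \<Omega>_def)
 have QH: "quad_shift A k \<in> ?H" if "k \<in> \<Omega>" for k
  unfolding quad_shift_def by (rule DH(5)[OF OH[OF that] qpart_bounds(2)[OF \<alpha> OH[OF that]]])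
 have Lip: "?N (quad_shift A k - quad_shift A k') \<le> C * ?N (k - k')" if k: "k \<in> \<Omega>" and k': "k' \<in> \<Omega>" for k k'
 proof -
  have "quad_shift A k - quad_shift A k' = (k - k') + (qpart A k - qpart A k')" by (simp add: quad_shift_def)
  moreover have "?N ((k - k') + (qpart A k - qpart A k')) \<le> ?N (k - k') + ?N (qpart A k - qpart A k')"
   by (intro DH(3) DH(6) OH k k' qpart_bounds(2)[OF \<alpha>])
  moreover have "?N (qpart A k - qpart A k') \<le> Cq * ?N (k - k')" using Cq(2) OH O1 k k' by blast
  ultimately show ?thesis by (simp add: C_def distrib_right)
 qed
 have near: "?N (quad_shift A k - quad_shift A k0) < \<sigma>" if k: "k \<in> \<Omega>" for k
 proof -
  have "?N (quad_shift A k - quad_shift A k0) \<le> C * ?N (k - k0)" by (rule Lip[OF k O0])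
  also have "\<dots> < C * r" using k C by (simp add: \<Omega>_def)
  finally show ?thesis using r by simp
 qed
 have imk: "quad_shift A k ` sphere 0 1 \<subseteq> ball 0 R" if k: "k \<in> \<Omega>" for k
 proof (rule image_subsetI)
  fix \<xi> :: complex assume z: "\<xi> \<in> sphere 0 1"
  have "norm (quad_shift A k \<xi>) \<le> norm (quad_shift A k0 \<xi>) + norm ((quad_shift A k - quad_shift A k0) \<xi>)"
   using norm_triangle_ineq[of "quad_shift A k0 \<xi>" "(quad_shift A k - quad_shift A k0) \<xi>"] by simp
  also have "\<dots> < norm (quad_shift A k0 \<xi>) + \<sigma>"
   using holderD(2)[OF \<alpha>(1) DH(6)[OF QH[OF k] QH[OF O0]] z] near[OF k] by simp
  also have "\<dots> \<le> R" using im z by simp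
  finally show "quad_shift A k \<xi> \<in> ball 0 R" by simp
 qed
 have NQ: "?N (quad_shift A k) \<le> ?N (quad_shift A k0) + \<sigma>" if k: "k \<in> \<Omega>" for k
  using DH(3)[OF DH(6)[OF QH[OF k] QH[OF O0]] QH[OF O0]] near[OF k] by simp
 have OmH: "\<Omega> \<subseteq> ?H" using OH by blast
 have "C1_map ?H ?N \<Omega> ?H ?N (\<lambda>k. k + qpart A k)"
 proof (rule C1_map_linear_add[OF sH sH OmH, where K=1])
  show "C1_map ?H ?N \<Omega> ?H ?N (qpart A)" by (rule qpart_bounds(4)[OF \<alpha>, of _ "?N k0 + 1"]) (use OH O1 in blast)
 qed auto
 then have C1: "C1_map ?H ?N \<Omega> ?H ?N (quad_shift A)" by (simp only: quad_shift_def[abs_def])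
 have M: "0 \<le> ?N (quad_shift A k0) + \<sigma>" using DH(2)[OF QH[OF O0]] \<sigma> by simp
 show ?thesis
  by (rule exI[of _ r], rule conjI[OF r(1)], rule exI[of _ C], rule conjI[OF less_imp_le[OF C]], rule exI, rule conjI[OF M])
    (fold \<Omega>_def, use QH imk NQ Lip C1 in blast)
qed

text \<open>Both bounds are proportional to the size \<open>K\<close> of \<open>stat_map\<close>,
  which is proportional to the distance from \<rho> to the quadric; this is the source of all
  smallness.\<close>

lemma theta_bounds:
 fixes A B :: "complex ^ 'n::finite ^ 'n"
 assumes \<alpha>: "0 < \<alpha>" "\<alpha> < 1" and OmH: "\<Omega> \<subseteq> \<H> \<alpha>"
  and Q': "\<forall>k\<in>\<Omega>. quad_shift A k \<in> \<H> \<alpha> \<and> quad_shift A k ` sphere 0 1 \<subseteq> ball 0 R \<and> \<N> \<alpha> (quad_shift A k) \<le> M"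
  and Lip': "\<forall>k\<in>\<Omega>. \<forall>k'\<in>\<Omega>. \<N> \<alpha> (quad_shift A k - quad_shift A k') \<le> C * \<N> \<alpha> (k - k')"
  and C1: "C1_map (\<H> \<alpha>) (\<N> \<alpha>) \<Omega> (\<H> \<alpha>) (\<N> \<alpha>) (quad_shift A)"
  and M: "0 \<le> M" and K: "0 \<le> K" "Ck_bounded 2 K (stat_map A B \<rho>) (ball 0 R)"
 shows "k \<in> \<Omega> \<Longrightarrow> theta A B \<rho> k \<in> \<H> \<alpha> \<and>
   \<N> \<alpha> (theta A B \<rho> k) \<le> stat_op_const \<alpha> TYPE('n) * (1 + real DIM('n cpoint) * M) * K"
  and "k \<in> \<Omega> \<Longrightarrow> k' \<in> \<Omega> \<Longrightarrow> \<N> \<alpha> (theta A B \<rho> k - theta A B \<rho> k') \<le>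
   stat_op_const \<alpha> TYPE('n) * (2 * real DIM('n cpoint) + (real DIM('n cpoint))\<^sup>2 * M) * C * K * \<N> \<alpha> (k - k')"
  and "C1_map (\<H> \<alpha>) (\<N> \<alpha>) \<Omega> (\<H> \<alpha>) (\<N> \<alpha>) (theta A B \<rho>)"
proof -
 let ?S = "stat_op_const \<alpha> TYPE('n)" and ?D = "real DIM('n cpoint)"
 note sH = seminormed_holder[OF \<alpha>(1), where 'b="'n cpoint"]
 note so = stat_op_compose[OF \<alpha> K(2) convex_ball open_ball]
 note Q = bspec[OF Q'] and Lip = bspec[OF bspec[OF Lip']]
 have S: "0 \<le> ?S" by (rule stat_op_const_nonneg[OF \<alpha>])
 show "theta A B \<rho> k \<in> \<H> \<alpha> \<and> \<N> \<alpha> (theta A B \<rho> k) \<le> ?S * (1 + ?D * M) * K" if k: "k \<in> \<Omega>"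
 proof
  have q: "quad_shift A k \<in> \<H> \<alpha>" "quad_shift A k ` sphere 0 1 \<subseteq> ball 0 R" "\<N> \<alpha> (quad_shift A k) \<le> M"
   using Q[OF k] by simp_all
  show "theta A B \<rho> k \<in> \<H> \<alpha>" unfolding theta_def using so(2)[OF q(1,2)] by simp
  have "\<N> \<alpha> (theta A B \<rho> k) \<le> ?S * (K + ?D * K * \<N> \<alpha> (quad_shift A k))"
   unfolding theta_def using so(2)[OF q(1,2)] by simp
  also have "\<dots> \<le> ?S * (K + ?D * K * M)" using q(3) S K(1) by (intro mult_left_mono add_left_mono) auto
  also have "\<dots> = ?S * (1 + ?D * M) * K" by (simp only: algebra_simps)
  finally show "\<N> \<alpha> (theta A B \<rho> k) \<le> ?S * (1 + ?D * M) * K" .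
 qed
 show "\<N> \<alpha> (theta A B \<rho> k - theta A B \<rho> k') \<le> ?S * (2 * ?D + ?D\<^sup>2 * M) * C * K * \<N> \<alpha> (k - k')"
  if k: "k \<in> \<Omega>" and k': "k' \<in> \<Omega>"
 proof -
  have "\<N> \<alpha> (theta A B \<rho> k - theta A B \<rho> k') \<le> ?S * ((2 * ?D + ?D\<^sup>2 * M) * K * \<N> \<alpha> (quad_shift A k - quad_shift A k'))"
   unfolding theta_def using so(3)[of "quad_shift A k" "quad_shift A k'" M] Q[OF k] Q[OF k'] by simp
  also have "\<dots> \<le> ?S * ((2 * ?D + ?D\<^sup>2 * M) * K * (C * \<N> \<alpha> (k - k')))"
   using Lip[OF k k'] S K(1) M by (intro mult_left_mono) auto
  also have "\<dots> = ?S * (2 * ?D + ?D\<^sup>2 * M) * C * K * \<N> \<alpha> (k - k')" by (simp only: mult_ac)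
  finally show ?thesis .
 qed
 show "C1_map (\<H> \<alpha>) (\<N> \<alpha>) \<Omega> (\<H> \<alpha>) (\<N> \<alpha>) (theta A B \<rho>)"
  unfolding theta_def[abs_def] by (rule C1_map_compose[OF sH sH sH OmH _ C1 so(4)]) (use Q in auto)
qed

text \<open>The inverse substitution is Lipschitz near the initial disc, which translates closeness
  of discs to closeness of solutions of the contraction equation.\<close>

lemma unshift_near:
 fixes A :: "complex ^ 'n::finite ^ 'n" and k0 :: "complex \<Rightarrow> 'n cpoint"
 assumes \<alpha>: "0 < \<alpha>" "\<alpha> < 1" and k0: "k0 \<in> \<H> \<alpha>"
 shows "\<exists>C\<ge>0. \<forall>h\<in>\<H> \<alpha>. \<N> \<alpha> (h - quad_shift A k0) < 1 \<longrightarrow>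
  \<N> \<alpha> ((h - qpart A h) - k0) \<le> C * \<N> \<alpha> (h - quad_shift A k0)"
proof -
 let ?H = "\<H> \<alpha> :: (complex \<Rightarrow> 'n cpoint) set" and ?N = "\<N> \<alpha> :: (complex \<Rightarrow> 'n cpoint) \<Rightarrow> real"
 let ?g = "quad_shift A k0"
 note sH = seminormed_holder[OF \<alpha>(1), where 'b="'n cpoint"]
 note DH = seminormedD[OF sH]
 have g: "?g \<in> ?H" unfolding quad_shift_def by (rule DH(5)[OF k0 qpart_bounds(2)[OF \<alpha> k0]])
 obtain Cq where Cq: "0 \<le> Cq" "\<forall>k\<in>?H. \<forall>k'\<in>?H. ?N k < ?N ?g + 1 \<longrightarrow> ?N k' < ?N ?g + 1 \<longrightarrow>
  ?N (qpart A k - qpart A k') \<le> Cq * ?N (k - k')" using qpart_bounds(1)[OF \<alpha>] by blast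
 have "?N ((h - qpart A h) - k0) \<le> (1 + Cq) * ?N (h - ?g)" if h: "h \<in> ?H" "?N (h - ?g) < 1" for h
 proof -
  have n: "?N h < ?N ?g + 1" using DH(3)[OF DH(6)[OF h(1) g] g] h(2) by simp
  have d: "((h - qpart A h) - k0) \<xi> = ((h - ?g) - (qpart A h - qpart A ?g)) \<xi>" if "\<xi> \<in> sphere 0 1" for \<xi>
   using quad_shift_inverse(2)[of \<xi> k0 A] that by simp
  have "?N ((h - qpart A h) - k0) = ?N ((h - ?g) - (qpart A h - qpart A ?g))" by (rule holder_norm_cong(1)[OF d])
  also have "\<dots> \<le> ?N (h - ?g) + ?N (qpart A h - qpart A ?g)"
   by (intro seminormed_diff_le[OF sH] DH(6) h(1) g qpart_bounds(2)[OF \<alpha>])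
  also have "?N (qpart A h - qpart A ?g) \<le> Cq * ?N (h - ?g)" using Cq(2)[rule_format, OF h(1) g n] by simp
  finally show ?thesis by (simp only: distrib_right mult_1)
 qed
 then show ?thesis using Cq(1) by (intro exI[of _ "1 + Cq"]) simp
qed

lemma parameter_neighbourhood:
 fixes A :: "complex ^ 'n::finite ^ 'n" and w0 v0 :: "complex ^ 'n" and y0 :: real
 assumes a0: "norm a0 < r1" "r1 < 1" and w0: "w0 $ j0 \<noteq> 0" and x: "\<kappa> < \<bar>centre_value A a0 w0\<bar>"
  and t0: "t0 = (a0, v0, w0, y0)" and M: "norm t0 < M"
 shows "\<exists>\<tau>>0. \<forall>a v w y. (a, v, w, y) \<in> ball t0 \<tau> \<longrightarrow>
  norm a < r1 \<and> norm (a, v, w, y) < M \<and> w $ j0 \<noteq> 0 \<and> \<kappa> \<le> \<bar>centre_value A a w\<bar>"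
proof -
 have eq: "\<kappa> < \<bar>centre_value A a w\<bar> \<longleftrightarrow> \<kappa> * (1 - (norm a)\<^sup>2) < \<bar>qform A (0, w) (0, w)\<bar>" if "norm a < r1" for a w
 proof -
  have "0 < 1 - (norm a)\<^sup>2" using that a0 abs_square_less_1[of "norm a"] by simp
  then show ?thesis by (simp add: centre_value_def pos_less_divide_eq)
 qed
 define O1 where "O1 = {t :: 'n params. norm (fst t) < r1}"
 define O2 where "O2 = {t :: 'n params. norm t < M}"
 define O3 where "O3 = {t :: 'n params. fst (snd (snd t)) $ j0 \<noteq> 0}"
 \<comment> \<open>The inequality for \<open>centre_value\<close> with the denominator cleared, so
   that both sides are continuous on the whole parameter space.\<close>
 define O4 where "O4 = {t :: 'n params.
  \<kappa> * (1 - (norm (fst t))\<^sup>2) < \<bar>qform A (0, fst (snd (snd t))) (0, fst (snd (snd t)))\<bar>}"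
 have "open O1" "open O2" "open O3" unfolding O1_def O2_def O3_def
  by (intro open_Collect_less open_Collect_neq continuous_intros)+
 moreover have "open O4" unfolding O4_def
  by (intro open_Collect_less continuous_intros bounded_bilinear.continuous_on[OF bounded_bilinear_qform])
 ultimately have "open (O1 \<inter> O2 \<inter> O3 \<inter> O4)" by (intro open_Int)
 moreover have "t0 \<in> O1 \<inter> O2 \<inter> O3 \<inter> O4"
  using a0 w0 M eq[OF a0(1), of w0] x by (simp add: O1_def O2_def O3_def O4_def t0)
 ultimately obtain \<tau> where \<tau>: "0 < \<tau>" "ball t0 \<tau> \<subseteq> O1 \<inter> O2 \<inter> O3 \<inter> O4" using open_contains_ball by blast
 show ?thesis
 proof (intro exI[of _ \<tau>] conjI allI impI \<tau>(1))
  fix a v w y assume "(a, v, w, y) \<in> ball t0 \<tau>"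
  then have "(a, v, w, y) \<in> O1 \<inter> O2 \<inter> O3 \<inter> O4" using \<tau>(2) by (rule subsetD[rotated])
  then have t: "norm a < r1" "norm (a, v, w, y) < M" "w $ j0 \<noteq> 0" "\<kappa> * (1 - (norm a)\<^sup>2) < \<bar>qform A (0, w) (0, w)\<bar>"
   by (simp_all add: O1_def O2_def O3_def O4_def)
  show "norm a < r1" "norm (a, v, w, y) < M" "w $ j0 \<noteq> 0" using t by simp_all
  show "\<kappa> \<le> \<bar>centre_value A a w\<bar>" using eq[OF t(1), of w] t(4) by simp
 qed
qed

text \<open>Stated for all x \<le> e, so that the minimum of several such thresholds satisfies all
  requirements at once.\<close>

lemma exists_small_factor:
 assumes "0 \<le> c" "0 < d" shows "\<exists>e>0. \<forall>x\<le>e. c * x < (d::real)"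
proof (intro exI[of _ "d / (c + 1)"] conjI allI impI)
 show "0 < d / (c + 1)" using assms by simp
 fix x assume "x \<le> d / (c + 1)"
 then have "c * x \<le> c * (d / (c + 1))" using assms by (intro mult_left_mono) auto
 also have "\<dots> < d" using assms by (simp add: field_simps)
 finally show "c * x < d" .
qed

theorem theorem1:
  fixes A :: "complex ^ 'n::finite ^ 'n"
    and p\<^sub>0 :: complex
    and h\<^sub>0 :: "complex \<Rightarrow> 'n cpoint"
    and \<alpha> R :: real
  assumes "hermitian_matrix A" and "invertible A"
    and "0 < \<alpha>" and "\<alpha> < 1"
    and "(p\<^sub>0, 0) \<notin> zero_hypersurface UNIV (quadric_fun A)"
    and "stationary_disc UNIV (quadric_fun A) h\<^sub>0" and "h\<^sub>0 0 = (p\<^sub>0, 0)"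
    and "h\<^sub>0 ` cball 0 1 \<subseteq> ball 0 R"
    and "CARD('m::finite) = 4 * CARD('n) + 3"
  shows "\<exists>\<epsilon>>0. \<exists>\<delta>>0. \<forall>\<rho>\<in>Ck_ball 3 (ball 0 R) (quadric_fun A) \<epsilon>.
    \<exists>(U :: (real ^ 'm) set) (F :: real ^ 'm \<Rightarrow> complex \<Rightarrow> 'n cpoint).
      open U \<and> 0 \<in> U \<and>
      C1_map UNIV norm U (holder_space \<alpha>) (holder_norm \<alpha>) F \<and>
      (\<forall>s\<in>U. \<forall>t\<in>U. (\<forall>\<zeta>\<in>sphere 0 1. F s \<zeta> = F t \<zeta>) \<longrightarrow> s = t) \<and>
      F ` U \<subseteq> nonconstant_stationary_discs (ball 0 R) \<rho> \<and>
      (\<forall>h \<in> nonconstant_stationary_discs (ball 0 R) \<rho> \<inter> holder_ball \<alpha> h\<^sub>0 \<delta>.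
         \<exists>t\<in>U. \<forall>\<zeta>\<in>sphere 0 1. F t \<zeta> = h \<zeta>) \<and>
      local_diffeo_onto_image (holder_space \<alpha>) (holder_norm \<alpha>)
        {h \<in> F ` U. h 0 = (p\<^sub>0, 0)} (\<lambda>h. h 1) \<and>
      local_diffeo_onto_image (holder_space \<alpha>) (holder_norm \<alpha>)
        {h \<in> F ` U. h 0 = (p\<^sub>0, 0)} (\<lambda>h. disc_deriv h 0)"
proof -
 let ?H = "\<H> \<alpha> :: (complex \<Rightarrow> 'n cpoint) set" and ?N = "\<N> \<alpha> :: (complex \<Rightarrow> 'n cpoint) \<Rightarrow> real"
 let ?n = "real CARD('n)" and ?D = "real DIM('n cpoint)" and ?S = "stat_op_const \<alpha> TYPE('n)"
 let ?r = "quadric_fun A"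
 note herm = assms(1) and \<alpha> = assms(3,4)
 note sH = seminormed_holder[OF \<alpha>(1), where 'b="'n cpoint"]
 note DH = seminormedD[OF sH]
 obtain B where AB: "A ** B = mat 1" using assms(2) by (auto simp: invertible_def)
 obtain a0 w0 where a0: "norm a0 < 1" and m0: "(model_disc (a0, 0, w0, Im p\<^sub>0) :: complex \<Rightarrow> 'n cpoint) \<in> ?H"
  and h0: "\<And>z. norm z \<le> 1 \<Longrightarrow> h\<^sub>0 z = quad_shift A (model_disc (a0, 0, w0, Im p\<^sub>0)) z" and x0: "Re p\<^sub>0 = centre_value A a0 w0"
  by (rule quadric_disc_representation[OF \<alpha> herm AB assms(6,7)], rule that)
 define t0 where "t0 = (a0, 0 :: complex ^ 'n, w0, Im p\<^sub>0)"
 define k0 where "k0 = (model_disc t0 :: complex \<Rightarrow> 'n cpoint)"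
 have k0H: "k0 \<in> ?H" using m0 by (simp add: k0_def t0_def)
 \<comment> \<open>The only use of the centre lying off the quadric: it makes the quadratic form of
   \<open>w0\<close> nonzero, hence \<open>w0\<close> itself, and it bounds
   \<open>centre_value\<close> away from 0 near \<open>t0\<close>.\<close>
 have "Re p\<^sub>0 \<noteq> 0" using assms(5) by (simp add: zero_hypersurface_def quadric_fun_def)
 then have x0': "centre_value A a0 w0 \<noteq> 0" using x0 by simp
 then have "w0 \<noteq> 0" by (auto simp: centre_value_def qform_def)
 then obtain j0 where j0: "w0 $ j0 \<noteq> 0" by (auto simp: vec_eq_iff)
 define \<kappa> where "\<kappa> = \<bar>centre_value A a0 w0\<bar> / 2"
 have \<kappa>: "0 < \<kappa>" "\<kappa> < \<bar>centre_value A a0 w0\<bar>" using x0' by (simp_all add: \<kappa>_def)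
 define r1 where "r1 = (1 + norm a0) / 2"
 have r1: "norm a0 < r1" "r1 < 1" using a0 by (simp_all add: r1_def)
 define M1 where "M1 = norm t0 + 1"
 have M1: "norm t0 < M1" "0 \<le> M1" by (simp_all add: M1_def)
 obtain CL where CL: "0 \<le> CL"
  and mC1: "C1_map UNIV norm {t. norm (fst t) < r1 \<and> norm t < M1} ?H ?N (model_disc :: _ \<Rightarrow> complex \<Rightarrow> 'n cpoint)"
  and mLip: "\<forall>s t. norm (fst s) < r1 \<longrightarrow> norm s < M1 \<longrightarrow> norm (fst t) < r1 \<longrightarrow> norm t < M1 \<longrightarrow>
   ?N (model_disc s - model_disc t) \<le> CL * norm (s - t)"
  using model_disc_C1[OF \<alpha>(1) less_imp_le[OF \<alpha>(2)] r1(2), of M1] by (elim exE conjE) (rule that, assumption+)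
 obtain \<tau>0 where \<tau>0: "0 < \<tau>0" "\<forall>a v w y. (a, v, w, y) \<in> ball t0 \<tau>0 \<longrightarrow>
  norm a < r1 \<and> norm (a, v, w, y) < M1 \<and> w $ j0 \<noteq> 0 \<and> \<kappa> \<le> \<bar>centre_value A a w\<bar>"
  using parameter_neighbourhood[OF r1 j0 \<kappa>(2) t0_def M1(1)] by (elim exE conjE) (rule that)
 have "\<exists>\<xi>\<in>sphere 0 1. \<forall>z\<in>sphere 0 1. norm (h\<^sub>0 z) \<le> norm (h\<^sub>0 \<xi>)"
 proof (rule continuous_attains_sup)
  have "continuous_on (cball 0 1) h\<^sub>0" using assms(6) by (simp add: stationary_disc_def holomorphic_disc_def)
  then show "continuous_on (sphere 0 1) (\<lambda>z. norm (h\<^sub>0 z))"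
   by (intro continuous_on_norm) (rule continuous_on_subset, auto)
 qed auto
 then obtain \<xi> where \<xi>: "norm \<xi> = 1" "\<And>z. norm z = 1 \<Longrightarrow> norm (h\<^sub>0 z) \<le> norm (h\<^sub>0 \<xi>)" by auto
 \<comment> \<open>Compactness of the circle turns the inclusion of the disc in the open ball into a
   positive margin.\<close>
 define \<sigma> where "\<sigma> = R - norm (h\<^sub>0 \<xi>)"
 have "h\<^sub>0 \<xi> \<in> ball 0 R" using assms(8) \<xi>(1) by (simp add: image_subset_iff)
 then have \<sigma>: "0 < \<sigma>" by (simp add: \<sigma>_def)
 have h0k: "quad_shift A k0 z = h\<^sub>0 z" if "norm z \<le> 1" for z using h0[OF that] by (simp add: k0_def t0_def)
 have im: "norm (quad_shift A k0 z) + \<sigma> \<le> R" if "norm z = 1" for z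
  using \<xi>(2)[OF that] h0k[of z] that by (simp add: \<sigma>_def)
 obtain r CQ M3 where r: "0 < r" and CQ: "0 \<le> CQ" and M3: "0 \<le> M3"
  and QOm: "\<forall>k \<in> {k \<in> ?H. ?N (k - k0) < r}. quad_shift A k \<in> ?H \<and> quad_shift A k ` sphere 0 1 \<subseteq> ball 0 R \<and> ?N (quad_shift A k) \<le> M3"
  and QLip: "\<forall>k \<in> {k \<in> ?H. ?N (k - k0) < r}. \<forall>k' \<in> {k \<in> ?H. ?N (k - k0) < r}.
   ?N (quad_shift A k - quad_shift A k') \<le> CQ * ?N (k - k')"
  and QC1: "C1_map ?H ?N {k \<in> ?H. ?N (k - k0) < r} ?H ?N (quad_shift A)"
 proof -
  have "\<exists>r>0. \<exists>C\<ge>0. \<exists>M\<ge>0.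
   (\<forall>k \<in> {k \<in> ?H. ?N (k - k0) < r}. quad_shift A k \<in> ?H \<and> quad_shift A k ` sphere 0 1 \<subseteq> ball 0 R \<and> ?N (quad_shift A k) \<le> M) \<and>
   (\<forall>k \<in> {k \<in> ?H. ?N (k - k0) < r}. \<forall>k' \<in> {k \<in> ?H. ?N (k - k0) < r}.
    ?N (quad_shift A k - quad_shift A k') \<le> C * ?N (k - k')) \<and>
   C1_map ?H ?N {k \<in> ?H. ?N (k - k0) < r} ?H ?N (quad_shift A)"
   by (rule quad_shift_domain[OF \<alpha> k0H im \<sigma>])
  then show thesis by (elim exE conjE) (rule that, assumption+)
 qed
 obtain C where C: "0 \<le> C" and small: "\<forall>\<epsilon> \<rho>. 0 < \<epsilon> \<longrightarrow> \<epsilon> \<le> 1 / 8 \<longrightarrow> \<rho> \<in> Ck_ball 3 (ball 0 R) ?r \<epsilon> \<longrightarrow>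
  Ck_bounded 2 (C * \<epsilon>) (stat_map A B \<rho>) (ball 0 R) \<and>
  Ck_bounded 1 2 (\<lambda>z. 2 * fst (del \<rho> z)) (ball 0 R) \<and>
  (\<forall>z\<in>ball 0 R. norm (2 * fst (del \<rho> z) - 1) \<le> 2 * \<epsilon> \<and> \<D> \<rho> (at z) \<noteq> (\<lambda>_. 0))"
  using stat_map_small[OF herm, where B=B and R=R] by (elim exE conjE) (rule that)
 obtain Ch where Ch: "0 \<le> Ch" "\<forall>h\<in>?H. ?N (h - quad_shift A k0) < 1 \<longrightarrow>
  ?N ((h - qpart A h) - k0) \<le> Ch * ?N (h - quad_shift A k0)"
  using unshift_near[OF \<alpha> k0H, where A=A] by (elim exE conjE) (rule that)
 \<comment> \<open>A quarter of r here and the eighth in the choice of \<eta> add up to less than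
   the \<open>r / 2\<close> required for the contraction.\<close>
 obtain \<tau>1 where \<tau>1: "0 < \<tau>1" "\<forall>x\<le>\<tau>1. CL * x < r / 4" using exists_small_factor[OF CL, of "r / 4"] r by auto
 define \<tau> where "\<tau> = min \<tau>0 \<tau>1"
 have \<tau>: "0 < \<tau>" "CL * \<tau> < r / 4" using \<tau>0(1) \<tau>1 by (simp_all add: \<tau>_def)
 have tball: "norm a < r1" "norm (a, v, w, y) < M1" "w $ j0 \<noteq> 0" "\<kappa> \<le> \<bar>centre_value A a w\<bar>"
  if "(a, v, w, y) \<in> ball t0 \<tau>" for a v w y
 proof -
  have "(a, v, w, y) \<in> ball t0 \<tau>0" using that by (simp add: \<tau>_def)
  then show "norm a < r1" "norm (a, v, w, y) < M1" "w $ j0 \<noteq> 0" "\<kappa> \<le> \<bar>centre_value A a w\<bar>"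
   using \<tau>0(2)[rule_format, of a v w y] by simp_all
 qed
 have tsub: "ball t0 \<tau> \<subseteq> {t. norm (fst t) < r1 \<and> norm t < M1}" using tball by auto
 \<comment> \<open>On the parameter ball w is bounded by \<open>M1\<close>, and |1 - a| is at least
   1 - \<open>r1\<close>.\<close>
 define W where "W = M1 / (1 - r1)"
 have W: "0 \<le> W" using M1(2) r1(2) by (simp add: W_def)
 have Wb: "norm w \<le> W * norm (1 - a)" if t: "(a, v, w, y) \<in> ball t0 \<tau>" for a v w y
 proof -
  have "norm w \<le> norm (a, v, w, y)"
   using norm_snd_le[of "(v, w, y)" a] norm_snd_le[of "(w, y)" v] norm_fst_le[of w y] by linarith
  also have "\<dots> \<le> M1" using tball(2)[OF t] by simp
  also have "M1 = W * (1 - r1)" using r1(2) by (simp add: W_def)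
  also have "\<dots> \<le> W * norm (1 - a)" using norm_triangle_ineq2[of 1 a] tball(1)[OF t] W by (intro mult_left_mono) auto
  finally show ?thesis .
 qed
 define c1 where "c1 = (1 + W) * (2 / \<kappa>) + 2"
 \<comment> \<open>The constant \<open>C3\<close> of the locale written out in advance: \<eta> and
   \<epsilon> must be chosen before \<rho>, and the locale can be entered only afterwards.\<close>
 define C4 where "C4 = 2 * CL + ?S * (qbil_const A * (2 * (?N k0 + r)) * (2 * CL) + qbil_const A * (3 * CL))"
 \<comment> \<open>The constant of \<open>model_disc_param_dist\<close> at \<open>t0\<close>, as it
   appears in \<open>capture\<close>.\<close>
 define Cw where "Cw = 6 / norm (w0 $ j0) + 3 * ?n + 1"
 have S: "0 \<le> ?S" by (rule stat_op_const_nonneg[OF \<alpha>])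
 have c1: "0 \<le> c1" using \<kappa> W by (simp add: c1_def)
 have C4: "0 \<le> C4" unfolding C4_def using CL S qbil_const(1)[of A] DH(2)[OF k0H] r
  by (intro add_nonneg_nonneg mult_nonneg_nonneg) auto
 have Cw: "0 \<le> Cw" by (simp add: Cw_def add_nonneg_nonneg)
 obtain e1 where e1: "0 < e1" "\<forall>x\<le>e1. Cw * x < \<tau> / 2" using exists_small_factor[OF Cw, of "\<tau> / 2"] \<tau> by auto
 have "0 \<le> c1 * ((1 + ?n) * 3 * C4)" using c1 C4 by simp
 then obtain e2 where e2: "0 < e2" "\<forall>x\<le>e2. (c1 * ((1 + ?n) * 3 * C4)) * x < 1 / 2" using exists_small_factor[of _ "1 / 2"] by auto
 \<comment> \<open>In turn: contraction, invariance of the ball, capture of nearby discs, and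
   survival of the lower bounds for the local diffeomorphisms.\<close>
 define \<eta> where "\<eta> = min (min (1 / 2) (r / 8)) (min e1 e2)"
 have \<eta>: "0 < \<eta>" "\<eta> \<le> 1 / 2" "\<eta> \<le> r / 8" "\<eta> \<le> e1" "\<eta> \<le> e2" using r e1(1) e2(1) by (simp_all add: \<eta>_def)
 have \<eta>w: "Cw * \<eta> < \<tau> / 2" using e1(2) \<eta>(4) by blast
 \<comment> \<open>The sum of the two constants of \<open>theta_bounds\<close>, so that one
   smallness condition on \<epsilon> bounds size and Lipschitz constant together.\<close>
 define T where "T = ?S * (1 + ?D * M3) * C + ?S * (2 * ?D + ?D\<^sup>2 * M3) * CQ * C"
 have T12: "0 \<le> ?S * (1 + ?D * M3) * C" "0 \<le> ?S * (2 * ?D + ?D\<^sup>2 * M3) * CQ * C"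
  using S M3 C CQ by (intro mult_nonneg_nonneg add_nonneg_nonneg; simp)+
 obtain e3 where e3: "0 < e3" "\<forall>x\<le>e3. T * x < \<eta>" using exists_small_factor[of T \<eta>] T12 \<eta>(1) by (auto simp: T_def)
 define \<epsilon> where "\<epsilon> = min (1 / 8) e3"
 have \<epsilon>: "0 < \<epsilon>" "\<epsilon> \<le> 1 / 8" "T * \<epsilon> < \<eta>" using e3 by (simp_all add: \<epsilon>_def)
 obtain d1 where d1: "0 < d1" "\<forall>x\<le>d1. Ch * x < r" using exists_small_factor[OF Ch(1) r] by blast
 have "0 \<le> Cw * Ch" using Cw Ch(1) by simp
 then obtain d2 where d2: "0 < d2" "\<forall>x\<le>d2. (Cw * Ch) * x < \<tau> / 2" using exists_small_factor[of _ "\<tau> / 2"] \<tau> by auto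
 \<comment> \<open>A disc this close to the initial one is unshifted into \<Omega>, and its
   parameter lands in the ball: the disc and the perturbation each contribute less than
   \<open>\<tau> / 2\<close>.\<close>
 define \<delta> where "\<delta> = min 1 (min d1 d2)"
 have \<delta>: "0 < \<delta>" "\<delta> \<le> 1" "\<delta> \<le> d1" "\<delta> \<le> d2" using d1(1) d2(1) by (simp_all add: \<delta>_def)
 \<comment> \<open>A linear isometry: the parameters have real dimension 2 + 2n + 2n + 1 = 4n + 3.
   The parameter domain becomes the preimage of the ball, shifted so that 0 corresponds to
   \<open>t0\<close>.\<close>
 obtain f :: "real ^ 'm \<Rightarrow> 'n params" and g where f: "linear f" "linear g" "\<And>x. norm (f x) = norm x" and fg: "\<And>x. g (f x) = x" "\<And>y. f (g y) = y"
 proof (rule isomorphisms_UNIV_UNIV)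
  show "DIM(real ^ 'm) = DIM('n params)" using assms(9) by simp
 qed (rule that, assumption+)
 show ?thesis
 proof (rule exI[of _ \<epsilon>], rule conjI[OF \<epsilon>(1)], rule exI[of _ \<delta>], rule conjI[OF \<delta>(1)], rule ballI, goal_cases)
  case \<rho>: (1 \<rho>)
  note sm = small[rule_format, OF \<epsilon>(1,2) \<rho>]
  have K: "0 \<le> C * \<epsilon>" "Ck_bounded 2 (C * \<epsilon>) (stat_map A B \<rho>) (ball 0 R)" using sm C \<epsilon>(1) by simp_all
  have OmH: "{k \<in> ?H. ?N (k - k0) < r} \<subseteq> ?H" by blast
  note th = theta_bounds[OF \<alpha> OmH QOm QLip QC1 M3 K]
  have T\<epsilon>: "?S * (1 + ?D * M3) * (C * \<epsilon>) \<le> \<eta>" "?S * (2 * ?D + ?D\<^sup>2 * M3) * CQ * (C * \<epsilon>) \<le> \<eta>"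
  proof -
   have "T * \<epsilon> = (?S * (1 + ?D * M3) * C) * \<epsilon> + (?S * (2 * ?D + ?D\<^sup>2 * M3) * CQ * C) * \<epsilon>" by (simp only: T_def distrib_right)
   moreover have "0 \<le> (?S * (1 + ?D * M3) * C) * \<epsilon>" "0 \<le> (?S * (2 * ?D + ?D\<^sup>2 * M3) * CQ * C) * \<epsilon>"
    using T12 \<epsilon>(1) by simp_all
   ultimately have "(?S * (1 + ?D * M3) * C) * \<epsilon> \<le> \<eta>" "(?S * (2 * ?D + ?D\<^sup>2 * M3) * CQ * C) * \<epsilon> \<le> \<eta>" using \<epsilon>(3) by linarith+
   then show "?S * (1 + ?D * M3) * (C * \<epsilon>) \<le> \<eta>" "?S * (2 * ?D + ?D\<^sup>2 * M3) * CQ * (C * \<epsilon>) \<le> \<eta>" by (simp_all only: mult.assoc)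
  qed
  interpret stationary_family \<alpha> R A B \<rho> t0 j0 \<tau> r CL \<eta> "C * \<epsilon>" "{k \<in> ?H. ?N (k - model_disc t0) < r}"
  proof (unfold_locales, fold k0_def)
   show "norm (fst t) < 1 \<and> fst (snd (snd t)) $ j0 \<noteq> 0" if "t \<in> ball t0 \<tau>" for t
    using tball[of "fst t" "fst (snd t)" "fst (snd (snd t))" "snd (snd (snd t))"] that r1(2) by simp
   show "?N (model_disc s - model_disc t) \<le> CL * norm (s - t)" if "s \<in> ball t0 \<tau>" "t \<in> ball t0 \<tau>" for s t
    using mLip[rule_format, of s t] subsetD[OF tsub that(1)] subsetD[OF tsub that(2)] by simp
   show "theta A B \<rho> k \<in> ?H \<and> ?N (theta A B \<rho> k) \<le> \<eta>" if "k \<in> {k \<in> ?H. ?N (k - k0) < r}" for k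
    using th(1)[OF that] T\<epsilon>(1) by simp
   show "?N (theta A B \<rho> k - theta A B \<rho> k') \<le> \<eta> * ?N (k - k')"
    if k: "k \<in> {k \<in> ?H. ?N (k - k0) < r}" and k': "k' \<in> {k \<in> ?H. ?N (k - k0) < r}" for k k'
   proof -
    have "k - k' \<in> ?H" using k k' by (intro DH(6)) simp_all
    then have "0 \<le> ?N (k - k')" by (rule DH(2))
    from order_trans[OF th(2)[OF k k'] mult_right_mono[OF T\<epsilon>(2) this]] show ?thesis .
   qed
   show "norm (2 * fst (del \<rho> z) - 1) < 1 / 2 \<and> \<D> \<rho> (at z) \<noteq> (\<lambda>_. 0)" if "z \<in> ball 0 R" for z
   proof -
    have "norm (2 * fst (del \<rho> z) - 1) \<le> 2 * \<epsilon>" "frechet_derivative \<rho> (at z) \<noteq> (\<lambda>_. 0)" using sm that by blast+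
    then show ?thesis using \<epsilon>(2) by simp
   qed
   show "CL * \<tau> + \<eta> < r / 2" using \<tau>(2) \<eta>(3) r by simp
   show "quad_shift A k \<in> ?H \<and> quad_shift A k ` sphere 0 1 \<subseteq> ball 0 R" if "k \<in> {k \<in> ?H. ?N (k - k0) < r}" for k
    using QOm[rule_format, OF that] by simp
  qed (use \<alpha> herm AB \<tau>(1) r CL \<eta> C1_map_subset[OF mC1 tsub] QC1 th(3) K(2) sm in \<open>simp_all\<close>)
  define U where "U = {x. t0 + f x \<in> ball t0 \<tau>}"
  define F where "F x = Ff (t0 + f x)" for x
  have fU: "t0 + f x \<in> ball t0 \<tau>" if "x \<in> U" for x using that by (simp add: U_def)
  have image: "F ` U = Ff ` ball t0 \<tau>"
  proof (intro equalityI subsetI)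
   fix h assume "h \<in> Ff ` ball t0 \<tau>"
   then obtain t where t: "t \<in> ball t0 \<tau>" "h = Ff t" by blast
   then have "g (t - t0) \<in> U" "h = F (g (t - t0))" by (simp_all add: U_def F_def fg)
   then show "h \<in> F ` U" by blast
  qed (use fU in \<open>auto simp: F_def\<close>)
  have "continuous_on UNIV (\<lambda>x. t0 + f x)"
   by (intro continuous_on_add continuous_on_const linear_continuous_on linear_conv_bounded_linear[THEN iffD1] f)
  then have U: "open U" unfolding U_def using open_vimage[OF open_ball, of "\<lambda>x. t0 + f x" t0 \<tau>] by (simp add: vimage_def)
  have f0: "f 0 = 0" by (rule linear_0[OF f(1)])
  have "C1_map UNIV norm U UNIV norm (\<lambda>x. f x + t0)"
   by (rule C1_map_linear_add[OF seminormed_norm seminormed_norm subset_UNIV C1_map_const[OF seminormed_norm seminormed_norm subset_UNIV UNIV_I], where K=1])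
     (simp_all add: f(3) linear_add[OF f(1)] linear_scale[OF f(1)])
  then have "C1_map UNIV norm U UNIV norm (\<lambda>x. t0 + f x)" by (simp only: add.commute)
  then have FC1: "C1_map UNIV norm U ?H ?N F" unfolding F_def[abs_def]
   by (rule C1_map_compose[OF seminormed_norm seminormed_norm sH subset_UNIV subset_UNIV _ Ff_C1]) (rule fU)
  have inj: "s = t" if "s \<in> U" "t \<in> U" "\<forall>\<xi>\<in>sphere 0 1. F s \<xi> = F t \<xi>" for s t
  proof -
   have "Ff (t0 + f s) z = Ff (t0 + f t) z" if "norm z = 1" for z
    using bspec[OF \<open>\<forall>\<xi>\<in>sphere 0 1. F s \<xi> = F t \<xi>\<close>, of z] that by (simp only: F_def mem_sphere_0)
   then have "t0 + f s = t0 + f t" by (rule Ff_injective[OF fU[OF that(1)] fU[OF that(2)]])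
   then have "g (f s) = g (f t)" by simp
   then show ?thesis by (simp only: fg)
  qed
  have capt: "\<exists>t\<in>U. \<forall>\<xi>\<in>sphere 0 1. F t \<xi> = h \<xi>"
   if h: "h \<in> nonconstant_stationary_discs (ball 0 R) \<rho> \<inter> holder_ball \<alpha> h\<^sub>0 \<delta>" for h
  proof -
   have st: "stationary_disc (ball 0 R) \<rho> h" and hH: "h \<in> ?H" and hd: "?N (h - h\<^sub>0) < \<delta>"
    using h by (simp_all add: nonconstant_stationary_discs_def holder_ball_def)
   have eq: "(h - h\<^sub>0) z = (h - quad_shift A k0) z" if "z \<in> sphere 0 1" for z using h0k[of z] that by simp
   have "?N (h - h\<^sub>0) = ?N (h - quad_shift A k0)" by (rule holder_norm_cong(1)[OF eq])
   then have hd': "?N (h - quad_shift A k0) < \<delta>" using hd by simp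
   then have "?N ((h - qpart A h) - k0) \<le> Ch * ?N (h - quad_shift A k0)" using Ch(2)[rule_format, OF hH] \<delta>(2) by simp
   also have "\<dots> \<le> Ch * \<delta>" using hd' Ch(1) by (intro mult_left_mono) auto
   finally have near: "?N ((h - qpart A h) - k0) \<le> Ch * \<delta>" .
   have "Ch * \<delta> < r" using d1(2) \<delta>(3) by blast
   then have Om: "h - qpart A h \<in> {k \<in> ?H. ?N (k - model_disc t0) < r}"
    using near DH(6)[OF hH qpart_bounds(2)[OF \<alpha> hH]] by (simp add: k0_def)
   have "Cw * (?N ((h - qpart A h) - model_disc t0) + \<eta>) \<le> Cw * (Ch * \<delta> + \<eta>)"
    using near Cw by (intro mult_left_mono add_right_mono) (simp_all add: k0_def)
   also have "\<dots> = (Cw * Ch) * \<delta> + Cw * \<eta>" by (simp only: distrib_left mult.assoc)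
   also have "\<dots> < \<tau> / 2 + \<tau> / 2" using d2(2) \<delta>(4) \<eta>w by (intro add_strict_mono) blast+
   finally have "Cw * (?N ((h - qpart A h) - model_disc t0) + \<eta>) < \<tau>" by simp
   then have "\<exists>t\<in>ball t0 \<tau>. \<forall>\<xi>\<in>sphere 0 1. Ff t \<xi> = h \<xi>"
    by (intro capture[OF st hH Om]) (simp add: Cw_def t0_def)
   then obtain t where t: "t \<in> ball t0 \<tau>" "\<forall>\<xi>\<in>sphere 0 1. Ff t \<xi> = h \<xi>" by blast
   then have "g (t - t0) \<in> U" "F (g (t - t0)) = Ff t" by (simp_all add: U_def F_def fg)
   then show ?thesis using t(2) by (intro bexI[of _ "g (t - t0)"]) simp_all
  qed
  have "(c1 * ((1 + ?n) * 3 * C4)) * \<eta> < 1 / 2" using e2(2) \<eta>(5) by blast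
  moreover have "stationary_family.C3 \<alpha> A t0 r CL = C4" by (simp add: C4_def C3_def M_def k0_def)
  ultimately have smallC: "((1 + W) * (2 / \<kappa>) + 2) * ((1 + ?n) * 3 * stationary_family.C3 \<alpha> A t0 r CL * \<eta>) \<le> 1 / 2"
   by (simp add: c1_def mult.assoc)
  have bd: "\<kappa> \<le> \<bar>centre_value A a w\<bar> \<and> norm w \<le> W * norm (1 - a)" if "(a, v, w, y) \<in> ball t0 \<tau>" for a v w y
   using tball(4)[OF that] Wb[OF that] by simp
  have ld: "local_diffeo_onto_image ?H ?N {h \<in> F ` U. h 0 = (p\<^sub>0, 0)} (\<lambda>h. h 1)"
   "local_diffeo_onto_image ?H ?N {h \<in> F ` U. h 0 = (p\<^sub>0, 0)} (\<lambda>h. disc_deriv h 0)"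
   unfolding image by (rule centred_local_diffeo[OF \<kappa>(1) W bd smallC], assumption)+
  show ?case
  proof (intro exI conjI ballI impI)
   show "0 \<in> U" using \<tau>(1) by (simp add: U_def f0)
   show "F ` U \<subseteq> nonconstant_stationary_discs (ball 0 R) \<rho>" unfolding image using Ff_stationary by blast
  qed (rule U FC1 inj capt ld; assumption)+
 qed
qed

end
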